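(* Let $D$ be a random variable supported on the nonnegative integers with $0<E[D(D-2)]<\infty$, and let $\mathcal G=(G_n)_{n\ge 1}$ be sampled from the configuration model with independent $D$-distributed degrees (with an extra vertex $\mathfrak b$ attached to vertex $1$). Let $a=\frac{E[D^2]}{E[D]}-1$ and $\Lambda=2a-1-2\sqrt{a^2-a}$. Consider chase-escape with rate $\lambda>0$ on $G_n$, and let $\mathcal R_n$ be the set of vertices that are ever red. (i) There is a finite constant $C=C(\Lambda)$, independent of $\lambda$, such that for every $\lambda\le\Lambda$, $$\sup_{n\ge 1}\mathbf E_\lambda[|\mathcal R_n|]<C .$$ (ii) If $\lambda>\Lambda$, then $$\lim_{n\to\infty}\mathbf E_\lambda[|\mathcal R_n|]=\infty .$$ Moreover, if instead $E[D^2]=\infty$ and $E[D]<\infty$, then the result continues to hold with $\Lambda=0$; that is, $\lim_{n\to\infty}\mathbf E_\lambda[|\mathcal R_n|]=\infty$ for every $\lambda>0$.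
   Context: Graphs. Let $D_1,D_2,\dots$ be independent copies of $D$. The random multigraph $G_n$ has vertex set $\{\mathfrak b,1,\dots,n\}$ and is built as follows: vertex $i\in\{1,\dots,n\}$ receives $D_i$ half-edges ($\mathfrak b$ receives none); if $\sum_{i=1}^n D_i$ is odd, one extra half-edge is added to vertex $n$; a perfect matching of all half-edges is chosen uniformly at random, and each matched pair becomes an edge (self-loops and multiple edges are allowed). In addition a single edge is placed between $\mathfrak b$ and $1$. Chase-escape with rate $\lambda>0$ on $G_n$. Each vertex is in one of the states $r$ (red), $b$ (blue), $w$ (white). Initially vertex $1$ is red, $\mathfrak b$ is blue, and all other vertices are white. Along each edge, a pair of adjacent vertices in states $(r,w)$ becomes $(r,r)$ according to a rate-$\lambda$ Poisson process, and a pair of adjacent vertices in states $(b,r)$ becomes $(b,b)$ according to a rate-$1$ Poisson process, all Poisson processes being independent. $\mathcal R_n$ is the set of vertices of $G_n$ that are red at some time. $\mathbf E_\lambda$ denotes expectation with respect to the joint probability measure of the degrees, the matching and the chase-escape dynamics. *)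

theory Defs
  imports "HOL-Probability.Probability" "HOL-Library.Disjoint_Sets"
begin

section \<open>Chase-escape on a finite multigraph\<close>

text \<open>Every edge has its own identity, so multiple edges are allowed; a self-loop is an edge whose
  set of endpoints is a singleton.\<close>

record ('v, 'e) multigraph =
  verts :: "'v set"
  edges :: "'e set"
  ends :: "'e \<Rightarrow> 'v set"

datatype color = Red | Blue | White

text \<open>Each edge carries two independent Poisson processes: Spread (rate \<open>lam\<close>), at whose points
  (red, white) becomes (red, red), and Chase (rate 1), at whose points (blue, red) becomes
  (blue, blue).\<close>

datatype clock = Spread | Chase

primrec rate :: "real \<Rightarrow> clock \<Rightarrow> real" where
  "rate lam Spread = lam"
| "rate lam Chase = 1"

primrec attacker :: "clock \<Rightarrow> color" where
  "attacker Spread = Red"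
| "attacker Chase = Blue"

primrec prey :: "clock \<Rightarrow> color" where
  "prey Spread = White"
| "prey Chase = Red"

text \<open>A Poisson process of rate \<open>r\<close> is realized by its i.i.d. exponential interarrival times:
  \<open>\<omega> (e, c, k)\<close> is the \<open>k\<close>-th interarrival time of clock \<open>c\<close> of edge \<open>e\<close>.\<close>

definition clock_space ::
  "('v, 'e) multigraph \<Rightarrow> real \<Rightarrow> ('e \<times> clock \<times> nat \<Rightarrow> real) measure" where
  "clock_space G lam = PiM (edges G \<times> UNIV \<times> UNIV)
     (\<lambda>(e, c, k). density lborel (\<lambda>x. ennreal (exponential_density (rate lam c) x)))"

definition arrival :: "('e \<times> clock \<times> nat \<Rightarrow> real) \<Rightarrow> 'e \<times> clock \<Rightarrow> nat \<Rightarrow> real" where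
  "arrival \<omega> = (\<lambda>(e, c) k. \<Sum>j\<le>k. \<omega> (e, c, j))"

definition next_arrival :: "('e \<times> clock \<times> nat \<Rightarrow> real) \<Rightarrow> real \<Rightarrow> 'e \<times> clock \<Rightarrow> real" where
  "next_arrival \<omega> t ec = arrival \<omega> ec (LEAST k. t < arrival \<omega> ec k)"

definition active :: "('v, 'e) multigraph \<Rightarrow> ('v \<Rightarrow> color) \<Rightarrow> ('e \<times> clock) set" where
  "active G \<sigma> = {(e, c). e \<in> edges G \<and>
     (\<exists>u v. ends G e = {u, v} \<and> \<sigma> u = attacker c \<and> \<sigma> v = prey c)}"

definition fire :: "('v, 'e) multigraph \<Rightarrow> 'e \<times> clock \<Rightarrow> ('v \<Rightarrow> color) \<Rightarrow> 'v \<Rightarrow> color" where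
  "fire G = (\<lambda>(e, c) \<sigma> v. if v \<in> ends G e then attacker c else \<sigma> v)"

text \<open>From coloring \<open>\<sigma>\<close> at time \<open>t\<close>, the next change of color happens at the first point after \<open>t\<close>
  of the clocks that are active for \<open>\<sigma>\<close>; points of inactive clocks have no effect. Almost surely
  no two clocks ring at the same time, so how \<open>arg_min_on\<close> breaks ties is irrelevant. The process
  is absorbed when no clock is active.\<close>

definition chase_escape_step ::
  "('v, 'e) multigraph \<Rightarrow> ('e \<times> clock \<times> nat \<Rightarrow> real) \<Rightarrow> real \<times> ('v \<Rightarrow> color) \<Rightarrow> real \<times> ('v \<Rightarrow> color)"
where
  "chase_escape_step G \<omega> = (\<lambda>(t, \<sigma>).
     if active G \<sigma> = {} then (t, \<sigma>)
     else let ec = arg_min_on (next_arrival \<omega> t) (active G \<sigma>)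
          in (next_arrival \<omega> t ec, fire G ec \<sigma>))"

text \<open>The time of the \<open>m\<close>-th change of color, and the coloring from that time until the next change
  (from time 0 if \<open>m = 0\<close>).\<close>

definition chase_escape ::
  "('v, 'e) multigraph \<Rightarrow> ('e \<times> clock \<times> nat \<Rightarrow> real) \<Rightarrow> ('v \<Rightarrow> color) \<Rightarrow> nat \<Rightarrow> real \<times> ('v \<Rightarrow> color)"
where
  "chase_escape G \<omega> \<sigma>\<^sub>0 m = (chase_escape_step G \<omega> ^^ m) (0, \<sigma>\<^sub>0)"

definition ever_red ::
  "('v, 'e) multigraph \<Rightarrow> ('e \<times> clock \<times> nat \<Rightarrow> real) \<Rightarrow> ('v \<Rightarrow> color) \<Rightarrow> 'v set" where
  "ever_red G \<omega> \<sigma>\<^sub>0 = {v \<in> verts G. \<exists>m. snd (chase_escape G \<omega> \<sigma>\<^sub>0 m) v = Red}"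


section \<open>The configuration model\<close>

text \<open>The vertex \<open>\<bb>\<close> is encoded as 0. The \<open>j\<close>-th half-edge at vertex \<open>i\<close> is the pair \<open>(i, j)\<close>.\<close>

type_synonym half_edge = "nat \<times> nat"

text \<open>Vertex \<open>n\<close> receives an extra half-edge if the degrees have an odd sum.\<close>

definition half_edge_count :: "nat \<Rightarrow> (nat \<Rightarrow> nat) \<Rightarrow> nat \<Rightarrow> nat" where
  "half_edge_count n d i = d i + (if i = n \<and> odd (\<Sum>k=1..n. d k) then 1 else 0)"

definition half_edges :: "nat \<Rightarrow> (nat \<Rightarrow> nat) \<Rightarrow> half_edge set" where
  "half_edges n d = (SIGMA i:{1..n}. {..<half_edge_count n d i})"

definition perfect_matchings :: "'h set \<Rightarrow> 'h set set set" where
  "perfect_matchings H = {P. partition_on H P \<and> (\<forall>e\<in>P. card e = 2)}"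

datatype edge = Matched "half_edge set" | Chaser_Edge

primrec endpoints :: "edge \<Rightarrow> nat set" where
  "endpoints (Matched h) = fst ` h"
| "endpoints Chaser_Edge = {0, 1}"

definition config_graph :: "nat \<Rightarrow> half_edge set set \<Rightarrow> (nat, edge) multigraph" where
  "config_graph n P =
     \<lparr>verts = {0..n}, edges = insert Chaser_Edge (Matched ` P), ends = endpoints\<rparr>"

text \<open>The law of \<open>G\<^sub>n\<close> when the degrees are independent with law \<open>D\<close>.\<close>

definition config_model :: "nat pmf \<Rightarrow> nat \<Rightarrow> (nat, edge) multigraph pmf" where
  "config_model D n = do {
     d \<leftarrow> Pi_pmf {1..n} 0 (\<lambda>_. D);
     P \<leftarrow> pmf_of_set (perfect_matchings (half_edges n d));
     return_pmf (config_graph n P)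
   }"

definition init_coloring :: "nat \<Rightarrow> color" where
  "init_coloring v = (if v = 0 then Blue else if v = 1 then Red else White)"

text \<open>The expectation of \<open>|\<R>\<^sub>n|\<close> under the joint law of the graph and of the Poisson processes, which
  given the graph are independent processes on its edges.\<close>

definition expected_ever_red :: "nat pmf \<Rightarrow> real \<Rightarrow> nat \<Rightarrow> ennreal" where
  "expected_ever_red D lam n =
     (\<integral>\<^sup>+G. (\<integral>\<^sup>+\<omega>. of_nat (card (ever_red G \<omega> init_coloring)) \<partial>clock_space G lam)
        \<partial>measure_pmf (config_model D n))"


section \<open>The critical rate\<close>

definition mean_excess_degree :: "nat pmf \<Rightarrow> real" where
  "mean_excess_degree D =
     measure_pmf.expectation D (\<lambda>k. (real k)\<^sup>2) / measure_pmf.expectation D real - 1"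

definition critical_rate :: "nat pmf \<Rightarrow> real" where
  "critical_rate D = (let a = mean_excess_degree D in 2 * a - 1 - 2 * sqrt (a\<^sup>2 - a))"

end

theory Submission
  imports Defs
begin

text \<open>
  On a tree, a vertex at distance \<open>k\<close> from the root is reached with the probability \<open>escape_prob p k 1\<close>
  that red makes \<open>k\<close> steps along the path before blue catches up, where \<open>p = lam / (1 + lam)\<close>; by a
  gambler's ruin computation it is of exponential order \<open>(4 * p * (1 - p)) ^ k\<close> if \<open>p \<le> 1 / 2\<close>.
  The configuration model has about \<open>a ^ k\<close> paths of length \<open>k\<close> from the root, where \<open>a\<close> is the mean
  excess degree, and \<open>critical_rate D\<close> is the rate at which \<open>4 * a * p * (1 - p) = 1\<close>.

  Upper bound: on every finite multigraph, the sum of the escape probabilities over all self-avoiding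
  white continuations of red vertices is controlled by a supermartingale, so the expected size is at
  most \<open>1\<close> plus the sum over \<open>k\<close> of the expected number of self-avoiding paths of length \<open>k\<close> times
  \<open>escape_prob p k 1\<close>. A factor of at most \<open>a\<close> per step, uniformly in \<open>n\<close>, comes from removing the
  vertices of a path one at a time: the weight of the last vertex and the total number of half-edges
  are positively associated. At the critical rate the resulting series still converges.

  Lower bound: for fixed \<open>k\<close>, with high probability exploring a bounded number of edges from the root
  meets no cycle, and then all the paths of length \<open>k\<close> through vertices of bounded degree are followed
  by chase-escape as on a tree. The limit inferior of the expected size is thus at least of order
  \<open>\<alpha> ^ k * escape_prob p k 1\<close> for some \<open>\<alpha>\<close> with \<open>4 * \<alpha> * p * (1 - p) > 1\<close>, which is unbounded in \<open>k\<close>.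
\<close>

section \<open>Memorylessness of a Poisson clock\<close>

text \<open>\<open>ever_red\<close> does not depend on times, so the process is replaced by its
  embedded jump chain, and all later estimates are drift estimates for functions of a coloring. In a
  general graph blue may take short cuts and different paths may merge; both only lower the count,
  which is why the length of a shortest red path (\<open>gap\<close>) yields a supermartingale. From
  below, a whole family of paths is followed at once, and the chain is stopped when the reached set
  outgrows the family; so tree-likeness is needed only for explorations of bounded size. The random
  total of half-edges in the denominators is correlated with the path weights: association handles
  it from above, Jensen's inequality from below. The parity correction at vertex \<open>n\<close>
  spoils the product form; it costs a constant factor from above and is avoided from below by paths
  that miss \<open>n\<close>. A bound in terms of \<Lambda> alone is possible because a = (1 +
  \<Lambda>)^2 / (4 \<Lambda>) and E[D] \<le> a + 1. Truncating the degrees treats finite and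
  infinite second moments alike: \<alpha> is any positive number below E[D(D-1)] / E[D].\<close>

definition exp_law :: "real \<Rightarrow> real measure" where
  "exp_law r = density lborel (\<lambda>x. ennreal (exponential_density r x))"

definition seq_law :: "real \<Rightarrow> (nat \<Rightarrow> real) measure" where
  "seq_law r = PiM UNIV (\<lambda>_. exp_law r)"

definition renewals :: "real \<Rightarrow> (nat \<Rightarrow> real) \<Rightarrow> nat" where
  "renewals s w = (LEAST k. s < (\<Sum>j\<le>k. w j))"

text \<open>The interarrival times seen by an observer who starts watching the clock at time \<open>s\<close>.\<close>

definition restart :: "real \<Rightarrow> (nat \<Rightarrow> real) \<Rightarrow> nat \<Rightarrow> real" where
  "restart s w = (\<lambda>i. if i = 0 then (\<Sum>j\<le>renewals s w. w j) - s else w (renewals s w + i))"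

text \<open>The almost sure regularity of a clock. Without divergence of the partial sums the
  \<open>LEAST\<close> in \<open>renewals\<close> could be junk.\<close>

definition proper :: "(nat \<Rightarrow> real) \<Rightarrow> bool" where
  "proper w \<longleftrightarrow> (\<forall>j. 0 < w j) \<and> (\<forall>s. \<exists>k. s < (\<Sum>j\<le>k. w j))"

lemma sets_exp_law [measurable_cong, simp]: "sets (exp_law r) = sets borel"
  by (simp add: exp_law_def)

lemma space_exp_law [simp]: "space (exp_law r) = UNIV"
  by (simp add: exp_law_def)

lemma prob_space_exp_law: "0 < r \<Longrightarrow> prob_space (exp_law r)"
  unfolding exp_law_def by (rule prob_space_exponential_density)

lemma sets_seq_law [measurable_cong, simp]: "sets (seq_law r) = sets (PiM UNIV (\<lambda>_. borel))"
  unfolding seq_law_def by (rule sets_PiM_cong) auto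

lemma space_seq_law [simp]: "space (seq_law r) = UNIV"
  by (simp add: seq_law_def space_PiM)

lemma prob_space_seq_law: "0 < r \<Longrightarrow> prob_space (seq_law r)"
  unfolding seq_law_def by (intro prob_space_PiM prob_space_exp_law)

lemma nn_integral_exp_law:
  assumes [measurable]: "f \<in> borel_measurable borel"
  shows "(\<integral>\<^sup>+x. f x \<partial>exp_law r) = (\<integral>\<^sup>+x. ennreal (exponential_density r x) * f x \<partial>lborel)"
  unfolding exp_law_def by (subst nn_integral_density) auto

lemma emeasure_exp_law_gt:
  assumes "0 < r" "0 \<le> s"
  shows "emeasure (exp_law r) {s<..} = ennreal (exp (- r * s))"
proof -
  interpret prob_space "exp_law r" by (rule prob_space_exp_law) fact
  have D: "distributed (exp_law r) lborel (\<lambda>x. x) (exponential_density r)"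
    unfolding distributed_def exp_law_def by (auto simp: distr_id2)
  have "prob {x\<in>space (exp_law r). s < x} = exp (- s * r)"
    using exponential_distributedD_gt[OF D assms(2,1)] by simp
  then show ?thesis
    by (auto simp: emeasure_eq_measure greaterThan_def mult.commute)
qed

lemma AE_exp_law_pos: "AE x in exp_law r. 0 < x"
proof -
  have "AE x in lborel. x \<noteq> (0::real)"
    by (rule AE_lborel_singleton)
  then have "AE x in lborel. 0 < ennreal (exponential_density r x) \<longrightarrow> 0 < x"
    by eventually_elim (auto simp: exponential_density_def)
  then show ?thesis
    unfolding exp_law_def by (subst AE_density) auto
qed

lemma emeasure_exp_law_le:
  assumes "0 < r" "0 \<le> s"
  shows "emeasure (exp_law r) {..s} = ennreal (1 - exp (- r * s))"
proof -
  interpret prob_space "exp_law r" by (rule prob_space_exp_law) fact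
  have "prob (space (exp_law r) - {s<..}) = 1 - prob {s<..}"
    by (rule prob_compl) auto
  moreover have "space (exp_law r) - {s<..} = {..s}" by auto
  moreover have "prob {s<..} = exp (- r * s)"
    using emeasure_exp_law_gt[OF assms] by (simp add: emeasure_eq_measure)
  ultimately show ?thesis by (simp add: emeasure_eq_measure)
qed

lemma AE_seq_law_large:
  assumes "0 < r" "0 \<le> s"
  shows "AE w in seq_law r. \<exists>j. s < w j"
proof -
  interpret P: product_prob_space "\<lambda>_::nat. exp_law r" UNIV
    by (simp add: product_prob_space_def product_prob_space_axioms_def product_sigma_finite_def
        prob_space_exp_law assms prob_space_imp_sigma_finite)
  let ?B = "{w \<in> space (seq_law r). \<forall>j. w j \<le> s}"
  define q where "q = 1 - exp (- r * s)"
  have q: "0 \<le> q" "q < 1" using assms by (auto simp: q_def)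
  have B: "?B \<in> sets (seq_law r)"
    by measurable
  have le: "emeasure (seq_law r) ?B \<le> ennreal (q ^ n)" for n
  proof -
    have "emeasure (seq_law r) ?B \<le> emeasure (seq_law r) {w\<in>space (seq_law r). \<forall>j\<in>{..<n}. w j \<in> {..s}}"
    proof (rule emeasure_mono)
      show "{w\<in>space (seq_law r). \<forall>j\<in>{..<n}. w j \<in> {..s}} \<in> sets (seq_law r)"
        by measurable
    qed auto
    also have "\<dots> = (\<Prod>j\<in>{..<n}. emeasure (exp_law r) {..s})"
      unfolding seq_law_def by (subst P.emeasure_PiM_Collect) auto
    also have "\<dots> = ennreal (q ^ n)"
      using assms q by (simp add: emeasure_exp_law_le q_def ennreal_power)
    finally show ?thesis .
  qed
  have "(\<lambda>n. ennreal (q ^ n)) \<longlonglongrightarrow> ennreal 0"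
    using q by (intro tendsto_ennrealI LIMSEQ_power_zero) auto
  then have "emeasure (seq_law r) ?B \<le> ennreal 0"
    by (rule LIMSEQ_le_const) (use le in auto)
  then have "AE w in seq_law r. w \<notin> ?B"
    by (intro AE_not_in null_setsI B) simp
  then show ?thesis
    by (auto elim!: eventually_mono simp: not_le)
qed

lemma AE_proper:
  assumes "0 < r"
  shows "AE w in seq_law r. proper w"
proof -
  have pos: "AE w in seq_law r. \<forall>j. 0 < w j"
    unfolding AE_all_countable seq_law_def
    by (intro allI AE_PiM_component prob_space_exp_law assms AE_exp_law_pos) auto
  \<comment> \<open>Single interarrival times are already unbounded, so the partial sums
    are.\<close>
  have "AE w in seq_law r. \<forall>N::nat. \<exists>j. real N < w j"
    unfolding AE_all_countable using AE_seq_law_large[OF assms] by auto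
  with pos show ?thesis
  proof eventually_elim
    case (elim w)
    have "\<exists>k. s < (\<Sum>j\<le>k. w j)" for s
    proof -
      obtain N where N: "s < real N" using reals_Archimedean2 by blast
      obtain j where "real N < w j" using elim by blast
      also have "w j \<le> (\<Sum>i\<le>j. w i)"
        using elim by (intro member_le_sum) (auto intro: less_imp_le)
      finally show ?thesis using N by (intro exI[of _ j]) linarith
    qed
    with elim show ?case by (auto simp: proper_def)
  qed
qed

section \<open>Measurability, and conditioning on the first interarrival time\<close>

lemma measurable_renewals [measurable]:
  "(\<lambda>(s, w). renewals s w) \<in> borel \<Otimes>\<^sub>M PiM UNIV (\<lambda>_. borel) \<rightarrow>\<^sub>M count_space UNIV"
  unfolding renewals_def case_prod_beta by measurable

lemma measurable_restart [measurable]: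
  "(\<lambda>(s, w). restart s w) \<in> borel \<Otimes>\<^sub>M PiM UNIV (\<lambda>_. borel) \<rightarrow>\<^sub>M PiM UNIV (\<lambda>_. borel)"
proof (rule measurable_PiM_single')
  fix i :: nat
  have [measurable]: "(\<lambda>x. renewals (fst x) (snd x)) \<in> borel \<Otimes>\<^sub>M PiM UNIV (\<lambda>_. borel) \<rightarrow>\<^sub>M count_space UNIV"
    using measurable_renewals by (simp add: case_prod_beta)
  have "(\<lambda>x. if i = 0 then (\<Sum>j\<le>renewals (fst x) (snd x). snd x j) - fst x
        else snd x (renewals (fst x) (snd x) + i)) \<in> borel_measurable (borel \<Otimes>\<^sub>M PiM UNIV (\<lambda>_. borel))"
    (is "?f \<in> _")
  proof -
    have 1: "(\<lambda>x. (\<lambda>k x. (\<Sum>j\<le>k. snd x j)) (renewals (fst x) (snd x)) x)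
       \<in> borel_measurable (borel \<Otimes>\<^sub>M PiM UNIV (\<lambda>_::nat. borel :: real measure))"
      by (rule measurable_compose_countable) measurable
    have 2: "(\<lambda>x. (\<lambda>k x. snd x (k + i)) (renewals (fst x) (snd x)) x)
       \<in> borel_measurable (borel \<Otimes>\<^sub>M PiM UNIV (\<lambda>_::nat. borel :: real measure))"
      by (rule measurable_compose_countable) measurable
    show ?thesis using 1 2 by (cases "i = 0") auto
  qed
  then show "(\<lambda>x. (case x of (s, w) \<Rightarrow> restart s w) i) \<in> borel_measurable (borel \<Otimes>\<^sub>M PiM UNIV (\<lambda>_. borel))"
    by (simp add: restart_def case_prod_beta cong: if_cong)
qed (auto simp: space_pair_measure space_PiM)

lemma sum_case_nat: "(\<Sum>j\<le>Suc k. case_nat x w j) = x + (\<Sum>j\<le>k. w j)"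
  by (simp add: sum.atMost_Suc_shift del: sum.atMost_Suc)

lemma restart_case_nat_less:
  assumes "s < x" shows "restart s (case_nat x w) = case_nat (x - s) w"
proof -
  have "renewals s (case_nat x w) = 0"
    unfolding renewals_def by (rule Least_equality) (use assms in auto)
  then show ?thesis by (auto simp: restart_def fun_eq_iff split: nat.split)
qed

text \<open>A ring up to time \<open>s\<close> drops out and the remaining clock is watched from
  \<open>s - x\<close> on. Together with the case \<open>s < x\<close> this is the renewal
  decomposition at the first ring.\<close>

lemma restart_case_nat_ge:
  assumes "x \<le> s" "proper w" shows "restart s (case_nat x w) = restart (s - x) w"
proof -
  obtain k where k: "s - x < (\<Sum>j\<le>k. w j)" using assms by (auto simp: proper_def)
  have "(LEAST k. s < (\<Sum>j\<le>k. case_nat x w j)) = Suc (LEAST k. s < (\<Sum>j\<le>Suc k. case_nat x w j))"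
    by (rule Least_Suc[of _ "Suc k"]) (use assms k in \<open>auto simp: sum_case_nat simp del: sum.atMost_Suc\<close>)
  then have "renewals s (case_nat x w) = Suc (renewals (s - x) w)"
    unfolding renewals_def by (simp add: sum_case_nat algebra_simps del: sum.atMost_Suc)
  then show ?thesis
    by (auto simp: restart_def fun_eq_iff sum_case_nat simp del: sum.atMost_Suc)
qed

lemma nn_integral_seq_law:
  assumes r: "0 < r" and [measurable]: "F \<in> borel_measurable (PiM UNIV (\<lambda>_. borel))"
  shows "(\<integral>\<^sup>+w. F w \<partial>seq_law r) = (\<integral>\<^sup>+x. (\<integral>\<^sup>+w. F (case_nat x w) \<partial>seq_law r) \<partial>exp_law r)"
proof -
  interpret sequence_space "exp_law r"
    by (simp add: sequence_space_def product_prob_space_def product_prob_space_axioms_def product_sigma_finite_def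
        prob_space_exp_law r prob_space_imp_sigma_finite)
  interpret pp: pair_prob_space "exp_law r" "seq_law r"
    by (simp add: pair_prob_space_def pair_sigma_finite_def prob_space_exp_law prob_space_seq_law r prob_space_imp_sigma_finite)
  have "(\<integral>\<^sup>+w. F w \<partial>seq_law r) = (\<integral>\<^sup>+w. F w \<partial>distr (exp_law r \<Otimes>\<^sub>M seq_law r) (seq_law r) (\<lambda>(s, \<omega>). case_nat s \<omega>))"
    using PiM_iter unfolding seq_law_def by simp
  also have "\<dots> = (\<integral>\<^sup>+z. F (case_nat (fst z) (snd z)) \<partial>(exp_law r \<Otimes>\<^sub>M seq_law r))"
    by (subst nn_integral_distr) (auto simp: case_prod_beta)
  also have "\<dots> = (\<integral>\<^sup>+x. (\<integral>\<^sup>+w. F (case_nat x w) \<partial>seq_law r) \<partial>exp_law r)"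
    by (subst pp.M2.nn_integral_fst[symmetric]) auto
  finally show ?thesis .
qed

lemma exp_law_memoryless:
  assumes r: "0 < r" and s: "0 \<le> s" and [measurable]: "f \<in> borel_measurable borel"
  shows "(\<integral>\<^sup>+x. indicator {s<..} x * f (x - s) \<partial>exp_law r) = ennreal (exp (- r * s)) * (\<integral>\<^sup>+x. f x \<partial>exp_law r)"
proof -
  have "(\<integral>\<^sup>+x. indicator {s<..} x * f (x - s) \<partial>exp_law r)
     = (\<integral>\<^sup>+x. ennreal (exponential_density r x) * (indicator {s<..} x * f (x - s)) \<partial>lborel)"
    by (rule nn_integral_exp_law) measurable
  also have "\<dots> = (\<integral>\<^sup>+x. ennreal (exponential_density r (s + x)) * (indicator {s<..} (s + x) * f x) \<partial>lborel)"
    by (subst nn_integral_real_affine[where c=1 and t=s]) auto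
  also have "\<dots> = (\<integral>\<^sup>+x. ennreal (exp (- r * s)) * (ennreal (exponential_density r x) * f x) \<partial>lborel)"
  proof (rule nn_integral_cong_AE)
    \<comment> \<open>The two sides can differ at \<open>x = 0\<close>, where the density is
      positive but the indicator vanishes.\<close>
    have "AE x in lborel. x \<noteq> (0::real)" by (rule AE_lborel_singleton)
    then show "AE x in lborel. ennreal (exponential_density r (s + x)) * (indicator {s<..} (s + x) * f x) =
      ennreal (exp (- r * s)) * (ennreal (exponential_density r x) * f x)"
    proof eventually_elim
      case (elim x)
      show ?case
      proof (cases "x > 0")
        case True
        have "exponential_density r (s + x) = exp (- r * s) * exponential_density r x"
          using True s by (simp add: exponential_density_def exp_add[symmetric] algebra_simps)
        then show ?thesis using True s
          by (simp add: ennreal_mult' mult.assoc)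
      next
        case False
        with elim show ?thesis by (auto simp: exponential_density_def)
      qed
    qed
  qed
  also have "\<dots> = ennreal (exp (- r * s)) * (\<integral>\<^sup>+x. f x \<partial>exp_law r)"
    by (subst nn_integral_cmult) (auto simp: nn_integral_exp_law)
  finally show ?thesis .
qed

text \<open>If there is no ring up to \<open>s\<close>, restarting changes only the first
  interarrival time, so memorylessness of one exponential variable suffices.\<close>

lemma seq_law_memoryless:
  assumes r: "0 < r" and s: "0 \<le> s" and [measurable]: "F \<in> borel_measurable (PiM UNIV (\<lambda>_. borel))"
  shows "(\<integral>\<^sup>+w. indicator {s<..} (w 0) * F (restart s w) \<partial>seq_law r) = ennreal (exp (- r * s)) * (\<integral>\<^sup>+w. F w \<partial>seq_law r)"
proof -
  interpret prob_space "seq_law r" by (rule prob_space_seq_law) fact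
  have "(\<integral>\<^sup>+w. indicator {s<..} (w 0) * F (restart s w) \<partial>seq_law r)
      = (\<integral>\<^sup>+x. (\<integral>\<^sup>+w. indicator {s<..} x * F (restart s (case_nat x w)) \<partial>seq_law r) \<partial>exp_law r)"
    by (subst nn_integral_seq_law[OF r]) auto
  also have "\<dots> = (\<integral>\<^sup>+x. indicator {s<..} x * (\<integral>\<^sup>+w. F (case_nat (x - s) w) \<partial>seq_law r) \<partial>exp_law r)"
    by (intro nn_integral_cong) (auto simp: restart_case_nat_less indicator_def)
  also have "\<dots> = ennreal (exp (- r * s)) * (\<integral>\<^sup>+x. (\<integral>\<^sup>+w. F (case_nat x w) \<partial>seq_law r) \<partial>exp_law r)"
    by (rule exp_law_memoryless[OF r s]) measurable
  finally show ?thesis by (simp add: nn_integral_seq_law[OF r, symmetric])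
qed

text \<open>Renewal argument that avoids the law of the number of rings: conditioning on the first
  ring \<open>x\<close> leads either to the memoryless case or to the same question for
  \<open>s - x\<close>. Only an inequality is proved, because \<open>prob_space_eqI_le\<close> turns
  it into an equality of laws.\<close>

lemma restart_law_le:
  assumes r: "0 < r" and s: "0 \<le> s" and A: "A \<in> sets (seq_law r)"
  shows "(\<integral>\<^sup>+w. indicator A (restart s w) \<partial>seq_law r) \<le> emeasure (seq_law r) A"
proof -
  interpret S: prob_space "seq_law r" by (rule prob_space_seq_law) fact
  interpret E: prob_space "exp_law r" by (rule prob_space_exp_law) fact
  have [measurable]: "A \<in> sets (PiM UNIV (\<lambda>_. borel))" using A by simp
  define g where "g = (\<lambda>s. \<integral>\<^sup>+w. indicator A (restart s w) \<partial>seq_law r)"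
  define I where "I = S.prob A"
  define q where "q = 1 - exp (- r * s)"
  have q: "0 \<le> q" "q < 1" using assms by (auto simp: q_def)
  have I0: "0 \<le> I" by (simp add: I_def)
  have rec: "g t \<le> ennreal (exp (- r * t)) * ennreal I + (\<integral>\<^sup>+x. indicator {..t} x * g (t - x) \<partial>exp_law r)"
    if t: "0 \<le> t" for t
  proof -
    have gm: "g \<in> borel_measurable borel" unfolding g_def by measurable
    have "g t = (\<integral>\<^sup>+x. (\<integral>\<^sup>+w. indicator A (restart t (case_nat x w)) \<partial>seq_law r) \<partial>exp_law r)"
      unfolding g_def by (rule nn_integral_seq_law[OF r]) measurable
    also have "\<dots> \<le> (\<integral>\<^sup>+x. indicator {t<..} x * (\<integral>\<^sup>+w. indicator A (case_nat (x - t) w) \<partial>seq_law r)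
        + indicator {..t} x * g (t - x) \<partial>exp_law r)"
    proof (rule nn_integral_mono)
      fix x :: real
      show "(\<integral>\<^sup>+w. indicator A (restart t (case_nat x w)) \<partial>seq_law r) \<le>
         indicator {t<..} x * (\<integral>\<^sup>+w. indicator A (case_nat (x - t) w) \<partial>seq_law r) + indicator {..t} x * g (t - x)"
      proof (cases "t < x")
        case True then show ?thesis by (simp add: restart_case_nat_less)
      next
        case False
        have "(\<integral>\<^sup>+w. indicator A (restart t (case_nat x w)) \<partial>seq_law r) = g (t - x)"
          unfolding g_def using AE_proper[OF r]
          by (intro nn_integral_cong_AE, eventually_elim) (use False in \<open>simp add: restart_case_nat_ge\<close>)
        then show ?thesis using False by simp
      qed
    qed
    also have "\<dots> = (\<integral>\<^sup>+x. indicator {t<..} x * (\<integral>\<^sup>+w. indicator A (case_nat (x - t) w) \<partial>seq_law r) \<partial>exp_law r)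
        + (\<integral>\<^sup>+x. indicator {..t} x * g (t - x) \<partial>exp_law r)"
    proof (rule nn_integral_add)
      have "(\<lambda>x. g (t - x)) \<in> borel_measurable borel"
        by (rule measurable_compose[OF _ gm]) measurable
      then show "(\<lambda>x. indicator {..t} x * g (t - x)) \<in> borel_measurable (exp_law r)"
        by measurable
    qed measurable
    also have "(\<integral>\<^sup>+x. indicator {t<..} x * (\<integral>\<^sup>+w. indicator A (case_nat (x - t) w) \<partial>seq_law r) \<partial>exp_law r)
       = ennreal (exp (- r * t)) * (\<integral>\<^sup>+x. (\<integral>\<^sup>+w. indicator A (case_nat x w) \<partial>seq_law r) \<partial>exp_law r)"
      by (rule exp_law_memoryless[OF r t]) measurable
    also have "(\<integral>\<^sup>+x. (\<integral>\<^sup>+w. indicator A (case_nat x w) \<partial>seq_law r) \<partial>exp_law r) = (\<integral>\<^sup>+w. indicator A w \<partial>seq_law r)"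
      by (rule nn_integral_seq_law[OF r, symmetric]) measurable
    also have "\<dots> = ennreal I" using A by (simp add: I_def S.emeasure_eq_measure)
    finally show ?thesis .
  qed
  \<comment> \<open>The trivial bound 1 improves by the factor \<open>q\<close>, the probability of
    a ring up to \<open>s\<close>, with each use of the recursion. All \<open>t \<le> s\<close> are
    treated together, as the recursion moves from \<open>t\<close> to \<open>t - x\<close>.\<close>
  have "g t \<le> ennreal (I + q ^ n)" if "0 \<le> t" "t \<le> s" for n t
    using that
  proof (induction n arbitrary: t)
    case 0
    have "g t \<le> (\<integral>\<^sup>+w. 1 \<partial>seq_law r)" unfolding g_def by (intro nn_integral_mono) (auto simp: indicator_def)
    also have "\<dots> = 1" using S.emeasure_space_1 by simp
    also have "\<dots> \<le> ennreal (I + q ^ 0)" using I0 by simp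
    finally show ?case .
  next
    case (Suc n)
    let ?e = "exp (- r * t)"
    have "g t \<le> ennreal ?e * ennreal I + (\<integral>\<^sup>+x. indicator {..t} x * g (t - x) \<partial>exp_law r)"
      by (rule rec) fact
    also have "(\<integral>\<^sup>+x. indicator {..t} x * g (t - x) \<partial>exp_law r) \<le> (\<integral>\<^sup>+x. ennreal (I + q ^ n) * indicator {..t} x \<partial>exp_law r)"
      using AE_exp_law_pos
      by (intro nn_integral_mono_AE, eventually_elim) (use Suc in \<open>auto simp: indicator_def\<close>)
    also have "\<dots> = ennreal (I + q ^ n) * ennreal (1 - ?e)"
      by (subst nn_integral_cmult_indicator) (use r Suc in \<open>auto simp: emeasure_exp_law_le\<close>)
    also have "ennreal ?e * ennreal I + ennreal (I + q ^ n) * ennreal (1 - ?e)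
        = ennreal (?e * I + (I + q ^ n) * (1 - ?e))"
      using r Suc I0 q by (simp add: ennreal_mult'[symmetric] ennreal_plus[symmetric] del: ennreal_plus)
    also have "\<dots> \<le> ennreal (I + q ^ Suc n)"
    proof (rule ennreal_leI)
      have "1 - ?e \<le> q" using Suc r by (simp add: q_def)
      then have "q ^ n * (1 - ?e) \<le> q ^ n * q" using q by (intro mult_left_mono) auto
      then show "?e * I + (I + q ^ n) * (1 - ?e) \<le> I + q ^ Suc n"
        by (simp add: algebra_simps)
    qed
    finally show ?case by (simp add: add_left_mono)
  qed
  from this[OF s order_refl] have le: "g s \<le> ennreal (I + q ^ n)" for n .
  have "(\<lambda>n. ennreal (I + q ^ n)) \<longlonglongrightarrow> ennreal (I + 0)"
    using q by (intro tendsto_ennrealI tendsto_add tendsto_const LIMSEQ_power_zero) auto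
  then have "g s \<le> ennreal (I + 0)"
    by (rule LIMSEQ_le_const) (use le in auto)
  then show ?thesis by (simp add: g_def I_def S.emeasure_eq_measure)
qed

text \<open>The inequality for the complement of a set is the reverse inequality for the
  set.\<close>

lemma prob_space_eqI_le:
  assumes "prob_space M" "prob_space N" "sets M = sets N"
    and le: "\<And>A. A \<in> sets N \<Longrightarrow> emeasure M A \<le> emeasure N A"
  shows "M = N"
proof (rule measure_eqI)
  interpret M: prob_space M by fact
  interpret N: prob_space N by fact
  have sp: "space M = space N" using assms(3) by (rule sets_eq_imp_space_eq)
  fix A assume A: "A \<in> sets M"
  have "M.prob (space M - A) \<le> N.prob (space N - A)"
    using le[of "space N - A"] A assms(3) sp by (simp add: M.emeasure_eq_measure N.emeasure_eq_measure)
  then have "N.prob A \<le> M.prob A"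
    using A assms(3) by (simp add: M.prob_compl N.prob_compl)
  moreover have "M.prob A \<le> N.prob A"
    using le[of A] A assms(3) by (simp add: M.emeasure_eq_measure N.emeasure_eq_measure)
  ultimately show "emeasure M A = emeasure N A"
    by (simp add: M.emeasure_eq_measure N.emeasure_eq_measure)
qed fact

lemma restart_law:
  assumes r: "0 < r" and s: "0 \<le> s"
  shows "distr (seq_law r) (seq_law r) (restart s) = seq_law r"
proof (rule prob_space_eqI_le)
  have m: "restart s \<in> seq_law r \<rightarrow>\<^sub>M seq_law r" by measurable
  show "prob_space (distr (seq_law r) (seq_law r) (restart s))"
    using m by (intro prob_space.prob_space_distr prob_space_seq_law r)
  show "prob_space (seq_law r)" by (rule prob_space_seq_law) fact
  fix A assume A: "A \<in> sets (seq_law r)"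
  have "emeasure (distr (seq_law r) (seq_law r) (restart s)) A
      = (\<integral>\<^sup>+w. indicator A w \<partial>distr (seq_law r) (seq_law r) (restart s))"
    using A by simp
  also have "\<dots> = (\<integral>\<^sup>+w. indicator A (restart s w) \<partial>seq_law r)"
    using m A by (intro nn_integral_distr) auto
  also have "\<dots> \<le> emeasure (seq_law r) A" by (rule restart_law_le[OF r s A])
  finally show "emeasure (distr (seq_law r) (seq_law r) (restart s)) A \<le> emeasure (seq_law r) A" .
qed simp

lemma nn_integral_restart:
  assumes "0 < r" "0 \<le> s" and [measurable]: "F \<in> borel_measurable (PiM UNIV (\<lambda>_. borel))"
  shows "(\<integral>\<^sup>+w. F (restart s w) \<partial>seq_law r) = (\<integral>\<^sup>+w. F w \<partial>seq_law r)"
proof -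
  have "(\<integral>\<^sup>+w. F w \<partial>seq_law r) = (\<integral>\<^sup>+w. F w \<partial>distr (seq_law r) (seq_law r) (restart s))"
    using assms by (simp add: restart_law)
  also have "\<dots> = (\<integral>\<^sup>+w. F (restart s w) \<partial>seq_law r)"
    by (rule nn_integral_distr) measurable
  finally show ?thesis by simp
qed

section \<open>The first point of finitely many clocks\<close>

definition clocks_law :: "'c set \<Rightarrow> ('c \<Rightarrow> real) \<Rightarrow> ('c \<Rightarrow> nat \<Rightarrow> real) measure" where
  "clocks_law C \<rho> = PiM C (\<lambda>c. seq_law (\<rho> c))"

definition restart_all :: "'c set \<Rightarrow> real \<Rightarrow> ('c \<Rightarrow> nat \<Rightarrow> real) \<Rightarrow> 'c \<Rightarrow> nat \<Rightarrow> real" where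
  "restart_all C s w = (\<lambda>c\<in>C. restart s (w c))"

lemma sets_clocks_law [measurable_cong, simp]:
  "sets (clocks_law C \<rho>) = sets (PiM C (\<lambda>_. PiM UNIV (\<lambda>_. borel)))"
  unfolding clocks_law_def by (rule sets_PiM_cong) auto

lemma space_clocks_law: "space (clocks_law C \<rho>) = (\<Pi>\<^sub>E c\<in>C. UNIV)"
  by (simp add: clocks_law_def space_PiM)

lemma prob_space_clocks_law: "(\<And>c. 0 < \<rho> c) \<Longrightarrow> prob_space (clocks_law C \<rho>)"
  unfolding clocks_law_def by (intro prob_space_PiM prob_space_seq_law)

lemma measurable_restart_all [measurable]:
  "(\<lambda>(s, w). restart_all C s w) \<in> borel \<Otimes>\<^sub>M PiM C (\<lambda>_. PiM UNIV (\<lambda>_. borel)) \<rightarrow>\<^sub>M PiM C (\<lambda>_. PiM UNIV (\<lambda>_. borel))"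
  unfolding restart_all_def case_prod_beta by (rule measurable_restrict) measurable

lemma space_PiM_real_seq: "space (PiM UNIV (\<lambda>_::nat. borel :: real measure)) = UNIV"
  by (simp add: space_PiM)

lemma measurable_first_interarrival:
  "d \<in> C \<Longrightarrow> (\<lambda>w. w d 0) \<in> borel_measurable (PiM C (\<lambda>_. PiM UNIV (\<lambda>_::nat. borel::real measure)))"
  by (rule measurable_compose[where f = "\<lambda>w. w d" and N = "PiM UNIV (\<lambda>_. borel)"])
     (auto intro: measurable_component_singleton)

lemma restart_all_insert:
  "c \<notin> C \<Longrightarrow> restart_all (insert c C) s (x(c := y)) = (restart_all C s x)(c := restart s y)"
  by (auto simp: restart_all_def fun_eq_iff restrict_def)

lemma nn_integral_clocks_insert:
  assumes "finite C" "c \<notin> C" "\<And>c. 0 < \<rho> c"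
    and [measurable]: "F \<in> borel_measurable (PiM (insert c C) (\<lambda>_. PiM UNIV (\<lambda>_. borel)))"
  shows "(\<integral>\<^sup>+w. F w \<partial>clocks_law (insert c C) \<rho>) = (\<integral>\<^sup>+y. (\<integral>\<^sup>+x. F (x(c := y)) \<partial>clocks_law C \<rho>) \<partial>seq_law (\<rho> c))"
proof -
  interpret product_sigma_finite "\<lambda>c. seq_law (\<rho> c)"
    by (simp add: product_sigma_finite_def prob_space_seq_law assms prob_space_imp_sigma_finite)
  have eq: "sets (PiM (insert c C) (\<lambda>c. seq_law (\<rho> c))) = sets (PiM (insert c C) (\<lambda>_. PiM UNIV (\<lambda>_. borel)))"
    by (rule sets_PiM_cong) auto
  show ?thesis
    unfolding clocks_law_def
    by (rule product_nn_integral_insert_rev) (use assms in \<open>auto simp: measurable_cong_sets[OF eq refl]\<close>)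
qed

lemma measurable_upd [measurable]:
  "(\<lambda>(y, x). x(c := y)) \<in> PiM UNIV (\<lambda>_. borel) \<Otimes>\<^sub>M PiM C (\<lambda>_. PiM UNIV (\<lambda>_. borel))
     \<rightarrow>\<^sub>M PiM (insert c C) (\<lambda>_. PiM UNIV (\<lambda>_. borel))"
proof -
  have "(\<lambda>(y, x). x(c := y)) = (\<lambda>(f, y). f(c := y)) \<circ> (\<lambda>(y, x). (x, y))"
    by auto
  then show ?thesis
    using measurable_comp[OF measurable_pair_swap' measurable_add_dim[of c C "\<lambda>_. PiM UNIV (\<lambda>_. borel)"]]
    by simp
qed

lemma measurable_upd_const [measurable]:
  "(\<lambda>x. x(c := v)) \<in> PiM C (\<lambda>_. PiM UNIV (\<lambda>_. borel))
     \<rightarrow>\<^sub>M PiM (insert c C) (\<lambda>_. PiM UNIV (\<lambda>_::nat. borel::real measure))"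
  by (rule measurable_compose[OF _ measurable_upd, where f="\<lambda>x. (v, x)", simplified],
      rule measurable_Pair) (auto simp: space_PiM_real_seq)

text \<open>Clocks in \<open>A\<close> contribute the factor from \<open>seq_law_memoryless\<close>.
  The others may have rung any number of times up to \<open>s\<close> and are covered by
  \<open>nn_integral_restart\<close>; they correspond to clocks that keep running while
  inactive.\<close>

lemma clocks_memoryless:
  assumes "finite C" "A \<subseteq> C" and s: "0 \<le> s" and \<rho>: "\<And>c. 0 < \<rho> c"
    and "F \<in> borel_measurable (PiM C (\<lambda>_. PiM UNIV (\<lambda>_. borel)))"
  shows "(\<integral>\<^sup>+w. (\<Prod>c\<in>A. indicator {s<..} (w c 0)) * F (restart_all C s w) \<partial>clocks_law C \<rho>)
     = ennreal (exp (- (\<Sum>c\<in>A. \<rho> c) * s)) * (\<integral>\<^sup>+w. F w \<partial>clocks_law C \<rho>)"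
  using assms(1,2,5)
proof (induction C arbitrary: A F rule: finite_induct)
  case empty
  then have A: "A = {}" by auto
  have "(\<integral>\<^sup>+w. F (restart_all {} s w) \<partial>clocks_law {} \<rho>) = (\<integral>\<^sup>+w. F w \<partial>clocks_law {} \<rho>)"
  proof (rule nn_integral_cong)
    fix w assume "w \<in> space (clocks_law {} \<rho>)"
    then have "w = (\<lambda>_. undefined)" by (auto simp: space_clocks_law)
    moreover have "restart_all {} s w = (\<lambda>_. undefined)" by (auto simp: restart_all_def)
    ultimately show "F (restart_all {} s w) = F w" by simp
  qed
  then show ?case by (simp add: A del: nn_integral_const)
next
  case (insert c C A F)
  note [measurable] = insert.prems(2)
  define A' where "A' = A - {c}"
  have A': "A' \<subseteq> C" "c \<notin> A'" "finite A'" using insert by (auto simp: A'_def finite_subset)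
  interpret P: prob_space "clocks_law C \<rho>" by (rule prob_space_clocks_law) fact
  let ?e = "ennreal (exp (- (\<Sum>c\<in>A'. \<rho> c) * s))"
  let ?i = "\<lambda>y. if c \<in> A then indicator {s<..} (y 0) else (1::ennreal)"
  have fin: "finite A" using insert by (auto intro: finite_subset)
  have AA': "(\<Prod>d\<in>A. indicator {s<..} ((x(c := y)) d 0)) = ?i y * (\<Prod>d\<in>A'. indicator {s<..} (x d 0) :: ennreal)" for x y
  proof (cases "c \<in> A")
    case True
    then have *: "A = insert c A'" by (auto simp: A'_def)
    show ?thesis unfolding * using A' by (auto intro!: prod.cong arg_cong2[where f="(*)"])
  next
    case False
    then have *: "A = A'" by (auto simp: A'_def)
    show ?thesis using False A' unfolding * by (auto intro!: prod.cong)
  qed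
  have "(\<integral>\<^sup>+w. (\<Prod>c\<in>A. indicator {s<..} (w c 0)) * F (restart_all (insert c C) s w) \<partial>clocks_law (insert c C) \<rho>)
     = (\<integral>\<^sup>+y. (\<integral>\<^sup>+x. (\<Prod>d\<in>A. indicator {s<..} ((x(c := y)) d 0)) * F (restart_all (insert c C) s (x(c := y)))
          \<partial>clocks_law C \<rho>) \<partial>seq_law (\<rho> c))"
  proof (rule nn_integral_clocks_insert[OF insert.hyps \<rho>])
    have [measurable]: "(\<lambda>w. w d 0) \<in> borel_measurable (PiM (insert c C) (\<lambda>_. PiM UNIV (\<lambda>_::nat. borel::real measure)))" if "d \<in> A" for d
      using that insert.prems(1) by (intro measurable_first_interarrival) auto
    show "(\<lambda>w. (\<Prod>c\<in>A. indicator {s<..} (w c 0)) * F (restart_all (insert c C) s w))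
      \<in> borel_measurable (PiM (insert c C) (\<lambda>_. PiM UNIV (\<lambda>_. borel)))"
      by measurable
  qed
  also have "\<dots> = (\<integral>\<^sup>+y. ?i y * (\<integral>\<^sup>+x. (\<Prod>d\<in>A'. indicator {s<..} (x d 0)) *
        F ((restart_all C s x)(c := restart s y)) \<partial>clocks_law C \<rho>) \<partial>seq_law (\<rho> c))"
  proof (rule nn_integral_cong)
    fix y :: "nat \<Rightarrow> real"
    have [measurable]: "(\<lambda>w. w d 0) \<in> borel_measurable (PiM C (\<lambda>_. PiM UNIV (\<lambda>_::nat. borel::real measure)))" if "d \<in> A'" for d
      using that A' by (intro measurable_first_interarrival) auto
    show "(\<integral>\<^sup>+x. (\<Prod>d\<in>A. indicator {s<..} ((x(c := y)) d 0)) * F (restart_all (insert c C) s (x(c := y)))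
          \<partial>clocks_law C \<rho>) = ?i y * (\<integral>\<^sup>+x. (\<Prod>d\<in>A'. indicator {s<..} (x d 0)) *
        F ((restart_all C s x)(c := restart s y)) \<partial>clocks_law C \<rho>)"
      unfolding AA' restart_all_insert[OF insert.hyps(2)] mult.assoc
    proof (rule nn_integral_cmult)
      have "(\<lambda>x. F ((restart_all C s x)(c := restart s y))) \<in> borel_measurable (PiM C (\<lambda>_. PiM UNIV (\<lambda>_. borel)))"
        by (rule measurable_compose[OF measurable_compose[OF _ measurable_upd_const] insert.prems(2)]) measurable
      then show "(\<lambda>x. (\<Prod>d\<in>A'. indicator {s<..} (x d 0)) * F ((restart_all C s x)(c := restart s y)))
         \<in> borel_measurable (clocks_law C \<rho>)"
        by measurable
    qed
  qed
  also have "\<dots> = (\<integral>\<^sup>+y. ?i y * (?e * (\<integral>\<^sup>+x. F (x(c := restart s y)) \<partial>clocks_law C \<rho>)) \<partial>seq_law (\<rho> c))"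
  proof (rule nn_integral_cong)
    fix y :: "nat \<Rightarrow> real"
    have "(\<lambda>x. F (x(c := restart s y))) \<in> borel_measurable (PiM C (\<lambda>_. PiM UNIV (\<lambda>_. borel)))"
      by (rule measurable_compose[OF measurable_upd_const insert.prems(2)])
    from insert.IH[OF A'(1) this]
    show "?i y * (\<integral>\<^sup>+x. (\<Prod>d\<in>A'. indicator {s<..} (x d 0)) * F ((restart_all C s x)(c := restart s y)) \<partial>clocks_law C \<rho>)
      = ?i y * (?e * (\<integral>\<^sup>+x. F (x(c := restart s y)) \<partial>clocks_law C \<rho>))" by (simp add: fun_upd_def)
  qed
  also have "\<dots> = ?e * (\<integral>\<^sup>+y. ?i y * (\<integral>\<^sup>+x. F (x(c := restart s y)) \<partial>clocks_law C \<rho>) \<partial>seq_law (\<rho> c))"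
    by (subst nn_integral_cmult[symmetric]) (auto simp: mult_ac intro!: P.borel_measurable_nn_integral)
  also have "(\<integral>\<^sup>+y. ?i y * (\<integral>\<^sup>+x. F (x(c := restart s y)) \<partial>clocks_law C \<rho>) \<partial>seq_law (\<rho> c))
     = (if c \<in> A then ennreal (exp (- \<rho> c * s)) else 1) * (\<integral>\<^sup>+y. (\<integral>\<^sup>+x. F (x(c := y)) \<partial>clocks_law C \<rho>) \<partial>seq_law (\<rho> c))"
  proof -
    have [measurable]: "(\<lambda>y. \<integral>\<^sup>+x. F (x(c := y)) \<partial>clocks_law C \<rho>) \<in> borel_measurable (PiM UNIV (\<lambda>_. borel))"
      by (rule P.borel_measurable_nn_integral) measurable
    show ?thesis
      using seq_law_memoryless[OF \<rho>[of c] s, of "\<lambda>y. \<integral>\<^sup>+x. F (x(c := y)) \<partial>clocks_law C \<rho>"]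
        nn_integral_restart[OF \<rho>[of c] s, of "\<lambda>y. \<integral>\<^sup>+x. F (x(c := y)) \<partial>clocks_law C \<rho>"]
      by auto
  qed
  also have "(\<integral>\<^sup>+y. (\<integral>\<^sup>+x. F (x(c := y)) \<partial>clocks_law C \<rho>) \<partial>seq_law (\<rho> c)) = (\<integral>\<^sup>+w. F w \<partial>clocks_law (insert c C) \<rho>)"
    by (rule nn_integral_clocks_insert[OF insert.hyps \<rho>, symmetric]) measurable
  also have "?e * ((if c \<in> A then ennreal (exp (- \<rho> c * s)) else 1) * (\<integral>\<^sup>+w. F w \<partial>clocks_law (insert c C) \<rho>))
     = ennreal (exp (- (\<Sum>c\<in>A. \<rho> c) * s)) * (\<integral>\<^sup>+w. F w \<partial>clocks_law (insert c C) \<rho>)"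
  proof (cases "c \<in> A")
    case True
    then have "(\<Sum>c\<in>A. \<rho> c) = \<rho> c + (\<Sum>c\<in>A'. \<rho> c)" unfolding A'_def using fin by (rule sum.remove[rotated])
    then have "exp (- (\<Sum>c\<in>A. \<rho> c) * s) = exp (- (\<Sum>c\<in>A'. \<rho> c) * s) * exp (- \<rho> c * s)"
      by (simp add: exp_add[symmetric] algebra_simps)
    then show ?thesis using True by (simp add: ennreal_mult' mult.assoc)
  next
    case False
    then have "A = A'" by (auto simp: A'_def)
    with False show ?thesis by simp
  qed
  finally show ?case .
qed

text \<open>Compares first points only, since the clocks are always looked at from time 0, after a
  restart. Strictness makes the events for different \<open>c\<close> disjoint.\<close>

definition strict_min :: "'c set \<Rightarrow> 'c \<Rightarrow> ('c \<Rightarrow> nat \<Rightarrow> real) \<Rightarrow> bool" where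
  "strict_min A c w \<longleftrightarrow> (\<forall>d\<in>A - {c}. w c 0 < w d 0)"

lemma measurable_indicator_strict_min:
  assumes "finite A" "A \<subseteq> C" "c \<in> A"
  shows "(\<lambda>w. indicator {w. strict_min A c w} w :: ennreal) \<in> borel_measurable (PiM C (\<lambda>_. PiM UNIV (\<lambda>_. borel)))"
proof -
  have "{w \<in> space (PiM C (\<lambda>_. PiM UNIV (\<lambda>_::nat. borel :: real measure))). \<forall>d\<in>A - {c}. w c 0 < w d 0}
     \<in> sets (PiM C (\<lambda>_. PiM UNIV (\<lambda>_. borel)))"
    using assms
    by (intro sets.sets_Collect_finite_All borel_measurable_less measurable_first_interarrival) auto
  then show ?thesis
    by (intro borel_measurable_indicator') (simp add: strict_min_def)
qed

lemma measurable_laplace: "(\<lambda>x. ennreal (exp (- R * x))) \<in> borel_measurable (exp_law r)"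
  by measurable

text \<open>The product of the density and the exponential is a multiple of the density of rate
  \<open>r + R\<close>. The value is the probability that a clock of rate \<open>r\<close> rings
  before an independent one of rate \<open>R\<close>.\<close>

lemma exp_law_laplace:
  assumes "0 < r" "0 \<le> R"
  shows "(\<integral>\<^sup>+x. ennreal (exp (- R * x)) \<partial>exp_law r) = ennreal (r / (r + R))"
proof -
  interpret prob_space "exp_law (r + R)" by (rule prob_space_exp_law) (use assms in simp)
  have "(\<integral>\<^sup>+x. ennreal (exp (- R * x)) \<partial>exp_law r)
     = (\<integral>\<^sup>+x. ennreal (exponential_density r x) * ennreal (exp (- R * x)) \<partial>lborel)"
    by (rule nn_integral_exp_law) measurable
  also have "\<dots> = (\<integral>\<^sup>+x. ennreal (r / (r + R)) * (ennreal (exponential_density (r + R) x) * 1) \<partial>lborel)"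
  proof (rule nn_integral_cong)
    fix x :: real
    have "exponential_density r x * exp (- R * x) = r / (r + R) * exponential_density (r + R) x"
    proof -
      have "r * exp (- x * r) * exp (- R * x) = r * exp (- x * (r + R))"
        by (simp add: mult.assoc exp_add[symmetric] algebra_simps)
      also have "\<dots> = r / (r + R) * ((r + R) * exp (- x * (r + R)))"
        using assms by simp
      finally show ?thesis by (auto simp: exponential_density_def)
    qed
    then show "ennreal (exponential_density r x) * ennreal (exp (- R * x)) =
       ennreal (r / (r + R)) * (ennreal (exponential_density (r + R) x) * 1)"
      using assms by (simp add: ennreal_mult'[symmetric])
  qed
  also have "\<dots> = ennreal (r / (r + R)) * (\<integral>\<^sup>+x. 1 \<partial>exp_law (r + R))"
    by (subst nn_integral_cmult) (auto simp: nn_integral_exp_law simp del: nn_integral_const)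
  also have "(\<integral>\<^sup>+x. 1 \<partial>exp_law (r + R)) = 1" using emeasure_space_1 by simp
  finally show ?thesis by simp
qed

text \<open>The strict inequality in \<open>renewals\<close> counts the ring at time
  \<open>w 0\<close> as past, so exactly the tail of the sequence remains.\<close>

lemma restart_self:
  assumes "proper w" shows "restart (w 0) w = (\<lambda>i. w (Suc i))"
proof -
  have "0 < w (Suc 0)" using assms by (auto simp: proper_def)
  then have "renewals (w 0) w = 1"
    unfolding renewals_def
    by (intro Least_equality) (auto simp: numeral_2_eq_2 Suc_le_eq intro!: gr0I)
  then show ?thesis by (auto simp: restart_def fun_eq_iff)
qed

text \<open>Strong Markov property at the first ring: which clock wins is independent of the
  restarted clocks. Given the sequence \<open>y\<close> of clock \<open>c\<close>, the others are
  restarted at the fixed time \<open>y 0\<close> by \<open>clocks_memoryless\<close>; the tail of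
  \<open>y\<close> is independent of \<open>y 0\<close>, and integrating out \<open>y 0\<close>
  gives the winning probability.\<close>

lemma one_step:
  assumes "finite C" "A \<subseteq> C" "c \<in> A" and \<rho>: "\<And>c. 0 < \<rho> c"
    and F[measurable]: "F \<in> borel_measurable (PiM C (\<lambda>_. PiM UNIV (\<lambda>_. borel)))"
  shows "(\<integral>\<^sup>+w. indicator {w. strict_min A c w} w * F (restart_all C (w c 0) w) \<partial>clocks_law C \<rho>)
     = ennreal (\<rho> c / (\<Sum>c\<in>A. \<rho> c)) * (\<integral>\<^sup>+w. F w \<partial>clocks_law C \<rho>)"
proof -
  define C' where "C' = C - {c}"
  define A' where "A' = A - {c}"
  have C: "C = insert c C'" "c \<notin> C'" "finite C'" using assms by (auto simp: C'_def)
  have A': "A' \<subseteq> C'" "finite A'" using assms by (auto simp: C'_def A'_def finite_subset)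
  have fin: "finite A" using assms by (auto intro: finite_subset)
  have sA: "(\<Sum>c\<in>A. \<rho> c) = \<rho> c + (\<Sum>c\<in>A'. \<rho> c)" unfolding A'_def using fin assms(3) by (rule sum.remove)
  interpret P: prob_space "clocks_law C' \<rho>" by (rule prob_space_clocks_law) fact
  let ?R = "\<Sum>c\<in>A'. \<rho> c"
  have R0: "0 \<le> ?R" using \<rho> by (auto intro: sum_nonneg less_imp_le)
  have ind: "indicator {w. strict_min A c w} w = (\<Prod>d\<in>A'. indicator {w c 0<..} (w d 0) :: ennreal)" for w
  proof (cases "strict_min A c w")
    case True
    then have "(\<Prod>d\<in>A'. indicator {w c 0<..} (w d 0) :: ennreal) = (\<Prod>d\<in>A'. 1)"
      by (intro prod.cong) (auto simp: strict_min_def A'_def)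
    with True show ?thesis by simp
  next
    case False
    then obtain d where "d \<in> A'" "\<not> w c 0 < w d 0" by (auto simp: strict_min_def A'_def)
    then have "\<exists>d\<in>A'. indicator {w c 0<..} (w d 0) = (0::ennreal)" by (intro bexI[of _ d]) auto
    then have "(\<Prod>d\<in>A'. indicator {w c 0<..} (w d 0) :: ennreal) = 0"
      using A' by (simp add: prod_zero_iff)
    with False show ?thesis by simp
  qed
  have [measurable]: "(\<lambda>w. w d 0) \<in> borel_measurable (PiM C (\<lambda>_. PiM UNIV (\<lambda>_::nat. borel::real measure)))" if "d \<in> C" for d
    using that by (rule measurable_first_interarrival)
  have [measurable]: "(\<lambda>w. w c 0) \<in> borel_measurable (PiM C (\<lambda>_. PiM UNIV (\<lambda>_::nat. borel::real measure)))"
    using assms(2,3) by (intro measurable_first_interarrival) auto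
  have Fm: "F \<in> borel_measurable (PiM (insert c C') (\<lambda>_. PiM UNIV (\<lambda>_. borel)))" using F C by simp
  define \<Psi> where "\<Psi> = (\<lambda>v. \<integral>\<^sup>+x. F (x(c := v)) \<partial>clocks_law C' \<rho>)"
  have \<Psi>[measurable]: "\<Psi> \<in> borel_measurable (PiM UNIV (\<lambda>_. borel))"
    unfolding \<Psi>_def by (rule P.borel_measurable_nn_integral) (use Fm in measurable)
  have "(\<integral>\<^sup>+w. indicator {w. strict_min A c w} w * F (restart_all C (w c 0) w) \<partial>clocks_law C \<rho>)
     = (\<integral>\<^sup>+w. (\<Prod>d\<in>A'. indicator {w c 0<..} (w d 0)) * F (restart_all C (w c 0) w) \<partial>clocks_law C \<rho>)"
    by (simp add: ind)
  also have "\<dots> = (\<integral>\<^sup>+y. (\<integral>\<^sup>+x. (\<Prod>d\<in>A'. indicator {(x(c:=y)) c 0<..} ((x(c:=y)) d 0)) *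
      F (restart_all C ((x(c:=y)) c 0) (x(c:=y))) \<partial>clocks_law C' \<rho>) \<partial>seq_law (\<rho> c))"
  proof -
    have "(\<lambda>w. (\<Prod>d\<in>A'. indicator {w c 0<..} (w d 0)) * F (restart_all C (w c 0) w))
      \<in> borel_measurable (PiM C (\<lambda>_. PiM UNIV (\<lambda>_. borel)))"
    proof (rule borel_measurable_times_ennreal)
      show "(\<lambda>w. \<Prod>d\<in>A'. indicator {w c 0<..} (w d 0) :: ennreal) \<in> borel_measurable (PiM C (\<lambda>_. PiM UNIV (\<lambda>_::nat. borel :: real measure)))"
        using measurable_indicator_strict_min[OF fin assms(2,3)] by (simp add: ind)
    qed measurable
    then show ?thesis
      using nn_integral_clocks_insert[OF C(3,2) \<rho>, of "\<lambda>w. (\<Prod>d\<in>A'. indicator {w c 0<..} (w d 0)) * F (restart_all C (w c 0) w)"]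
      unfolding C(1)[symmetric] by simp
  qed
  also have "\<dots> = (\<integral>\<^sup>+y. (\<integral>\<^sup>+x. (\<Prod>d\<in>A'. indicator {y 0<..} (x d 0)) *
      F ((restart_all C' (y 0) x)(c := restart (y 0) y)) \<partial>clocks_law C' \<rho>) \<partial>seq_law (\<rho> c))"
    using C(2) A'(1)
    by (intro nn_integral_cong arg_cong2[where f="(*)"] prod.cong refl)
       (auto simp: restart_all_insert C(1))
  also have "\<dots> = (\<integral>\<^sup>+y. ennreal (exp (- ?R * y 0)) * \<Psi> (\<lambda>i. y (Suc i)) \<partial>seq_law (\<rho> c))"
    using AE_proper[OF \<rho>[of c]]
  proof (intro nn_integral_cong_AE, eventually_elim)
    case (elim y)
    have y: "proper y" using elim by simp
    then have "0 \<le> y 0" by (auto simp: proper_def less_imp_le)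
    have "(\<integral>\<^sup>+x. (\<Prod>d\<in>A'. indicator {y 0<..} (x d 0)) * F ((restart_all C' (y 0) x)(c := restart (y 0) y)) \<partial>clocks_law C' \<rho>)
      = ennreal (exp (- ?R * y 0)) * (\<integral>\<^sup>+x. F (x(c := restart (y 0) y)) \<partial>clocks_law C' \<rho>)"
      by (rule clocks_memoryless) (use C A' \<open>0 \<le> y 0\<close> \<rho> in \<open>auto intro: measurable_compose[OF measurable_upd_const Fm]\<close>)
    then show ?case
      by (simp add: \<Psi>_def restart_self[OF y])
  qed
  also have "\<dots> = (\<integral>\<^sup>+x. (\<integral>\<^sup>+v. ennreal (exp (- ?R * x)) * \<Psi> v \<partial>seq_law (\<rho> c)) \<partial>exp_law (\<rho> c))"
  proof (subst nn_integral_seq_law[OF \<rho>])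
    have [measurable]: "(\<lambda>y. \<lambda>i. y (Suc i)) \<in> PiM UNIV (\<lambda>_. borel) \<rightarrow>\<^sub>M PiM UNIV (\<lambda>_::nat. borel :: real measure)"
      by (rule measurable_PiM_single') (auto simp: space_PiM)
    show "(\<lambda>y. ennreal (exp (- ?R * y 0)) * \<Psi> (\<lambda>i. y (Suc i))) \<in> borel_measurable (PiM UNIV (\<lambda>_. borel))"
      by measurable
  qed simp
  also have "\<dots> = (\<integral>\<^sup>+x. ennreal (exp (- ?R * x)) * (\<integral>\<^sup>+v. \<Psi> v \<partial>seq_law (\<rho> c)) \<partial>exp_law (\<rho> c))"
    by (intro nn_integral_cong nn_integral_cmult) measurable
  also have "\<dots> = ennreal (\<rho> c / (\<rho> c + ?R)) * (\<integral>\<^sup>+v. \<Psi> v \<partial>seq_law (\<rho> c))"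
  proof (subst nn_integral_multc)
    show "(\<lambda>x. ennreal (exp (- ?R * x))) \<in> borel_measurable (exp_law (\<rho> c))"
      by (rule measurable_laplace)
  qed (use exp_law_laplace[OF \<rho> R0, of c] in simp)
  also have "(\<integral>\<^sup>+v. \<Psi> v \<partial>seq_law (\<rho> c)) = (\<integral>\<^sup>+w. F w \<partial>clocks_law C \<rho>)"
    unfolding \<Psi>_def C(1) by (rule nn_integral_clocks_insert[OF C(3,2) \<rho> Fm, symmetric])
  finally show ?thesis by (simp add: sA)
qed

section \<open>The jump chain\<close>

lemma sum_restart:
  "(\<Sum>j\<le>k. restart t w j) = (\<Sum>j\<le>renewals t w + k. w j) - t"
proof (induction k)
  case 0 then show ?case by (simp add: restart_def)
next
  case (Suc k) then show ?case by (simp add: restart_def)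
qed

lemma renewals_works: "proper w \<Longrightarrow> t < (\<Sum>j\<le>renewals t w. w j)"
  unfolding renewals_def by (rule LeastI_ex) (auto simp: proper_def)

lemma proper_restart:
  assumes "proper w" "0 \<le> t" shows "proper (restart t w)"
  unfolding proper_def
proof (intro conjI allI)
  fix j show "0 < restart t w j"
    using assms renewals_works[OF assms(1), of t] by (auto simp: restart_def proper_def)
next
  fix s
  let ?N = "renewals t w"
  obtain k where k: "s + t < (\<Sum>j\<le>k. w j)" using assms by (auto simp: proper_def)
  also have "\<dots> \<le> (\<Sum>j\<le>?N + k. w j)"
    using assms by (intro sum_mono2) (auto simp: proper_def less_imp_le)
  finally show "\<exists>k. s < (\<Sum>j\<le>k. restart t w j)"
    by (intro exI[of _ k]) (simp add: sum_restart)
qed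

text \<open>Semigroup property of restarting: watching from \<open>t\<close> on and then waiting for
  \<open>u\<close> finds the same ring as watching from \<open>t + u\<close> on.\<close>

lemma renewals_add:
  assumes w: "proper w" and "0 \<le> t" "0 \<le> u"
  shows "renewals (t + u) w = renewals t w + renewals u (restart t w)"
proof -
  have pr: "proper (restart t w)" by (rule proper_restart) fact+
  let ?K = "renewals t w" and ?k = "renewals u (restart t w)"
  have "u < (\<Sum>j\<le>?k. restart t w j)" by (rule renewals_works[OF pr])
  then have 1: "t + u < (\<Sum>j\<le>?K + ?k. w j)" by (simp add: sum_restart)
  have 2: "?K + ?k \<le> y" if y: "t + u < (\<Sum>j\<le>y. w j)" for y
  proof -
    have "t < (\<Sum>j\<le>y. w j)" using y assms by linarith
    then have "?K \<le> y" unfolding renewals_def by (rule Least_le)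
    then obtain k' where k': "y = ?K + k'" using le_Suc_ex by blast
    then have "u < (\<Sum>j\<le>k'. restart t w j)" using y by (simp add: sum_restart)
    then have "?k \<le> k'" unfolding renewals_def by (rule Least_le)
    then show ?thesis using k' by simp
  qed
  show ?thesis unfolding renewals_def[of "t + u"] by (rule Least_equality) (use 1 2 in auto)
qed

definition next_ring :: "('c \<Rightarrow> nat \<Rightarrow> real) \<Rightarrow> real \<Rightarrow> 'c \<Rightarrow> real" where
  "next_ring w t c = (\<Sum>j\<le>renewals t (w c). w c j)"

definition clocks :: "('v, 'e) multigraph \<Rightarrow> ('e \<times> clock) set" where
  "clocks G = edges G \<times> UNIV"

lemma active_subset: "active G \<sigma> \<subseteq> clocks G"
  by (auto simp: active_def clocks_def)

lemma UNIV_clock: "UNIV = {Spread, Chase}"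
  using clock.exhaust by auto

instance clock :: finite
  by standard (simp add: UNIV_clock)

lemma finite_clocks: "finite (edges G) \<Longrightarrow> finite (clocks G)"
  by (simp add: clocks_def)

definition clocks_step :: "('v, 'e) multigraph \<Rightarrow> ('e \<times> clock \<Rightarrow> nat \<Rightarrow> real) \<Rightarrow> real \<times> ('v \<Rightarrow> color) \<Rightarrow> real \<times> ('v \<Rightarrow> color)"
where
  "clocks_step G w = (\<lambda>(t, \<sigma>).
     if active G \<sigma> = {} then (t, \<sigma>)
     else let ec = arg_min_on (next_ring w t) (active G \<sigma>) in (next_ring w t ec, fire G ec \<sigma>))"

lemma next_ring_restart_all:
  assumes "c \<in> C" "proper (w c)" "0 \<le> t" "0 \<le> u"
  shows "next_ring w (t + u) c = t + next_ring (restart_all C t w) u c"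
  using assms by (simp add: next_ring_def restart_all_def renewals_add sum_restart)

text \<open>\<open>arg_min_on\<close> chooses from the set of minimizers, which depends only on the
  order that \<open>f\<close> induces on \<open>S\<close>; hence even ties are broken alike.\<close>

lemma arg_min_on_cong:
  assumes "\<And>x y. x \<in> S \<Longrightarrow> y \<in> S \<Longrightarrow> f x < f y \<longleftrightarrow> g x < g y"
  shows "arg_min_on f S = arg_min_on g S"
proof -
  have "is_arg_min f (\<lambda>x. x \<in> S) = is_arg_min g (\<lambda>x. x \<in> S)"
    using assms by (auto simp: is_arg_min_def fun_eq_iff)
  then show ?thesis by (simp add: arg_min_on_def arg_min_def)
qed

lemma arg_min_on_in: "finite S \<Longrightarrow> S \<noteq> {} \<Longrightarrow> arg_min_on f S \<in> S" for f :: "'a \<Rightarrow> real"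
  by (simp add: arg_min_if_finite)

text \<open>A step from time \<open>t + u\<close> uses only rings after that time, so it is a step
  of the restarted clocks from time \<open>u\<close>. The second claim keeps the new time
  nonnegative, as the iteration requires.\<close>

lemma clocks_step_shift:
  assumes fin: "finite (edges G)" and w: "\<And>c. c \<in> clocks G \<Longrightarrow> proper (w c)" and t: "0 \<le> t" "0 \<le> u"
  shows "clocks_step G w (t + u, \<sigma>) = (t + fst (clocks_step G (restart_all (clocks G) t w) (u, \<sigma>)),
            snd (clocks_step G (restart_all (clocks G) t w) (u, \<sigma>)))"
    and "0 \<le> fst (clocks_step G (restart_all (clocks G) t w) (u, \<sigma>))"
proof -
  let ?w = "restart_all (clocks G) t w"
  have fa: "finite (active G \<sigma>)" using finite_subset[OF active_subset finite_clocks[OF fin]] .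
  have nx: "next_ring w (t + u) c = t + next_ring ?w u c" if "c \<in> active G \<sigma>" for c
    using that active_subset[of G \<sigma>] by (intro next_ring_restart_all w t) auto
  have am: "arg_min_on (next_ring w (t + u)) (active G \<sigma>) = arg_min_on (next_ring ?w u) (active G \<sigma>)"
    by (rule arg_min_on_cong) (simp add: nx)
  have am_in: "active G \<sigma> \<noteq> {} \<Longrightarrow> arg_min_on (next_ring ?w u) (active G \<sigma>) \<in> active G \<sigma>"
    using fa by (rule arg_min_on_in)
  show "clocks_step G w (t + u, \<sigma>) = (t + fst (clocks_step G ?w (u, \<sigma>)), snd (clocks_step G ?w (u, \<sigma>)))"
    using am_in by (simp add: clocks_step_def Let_def am nx)
  have pos: "0 \<le> next_ring ?w u c" if c: "c \<in> active G \<sigma>" for c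
  proof -
    have "c \<in> clocks G" using c active_subset[of G \<sigma>] by blast
    then have "proper (?w c)" using w[of c] t by (simp add: restart_all_def proper_restart)
    from renewals_works[OF this, of u] t show ?thesis by (simp add: next_ring_def)
  qed
  show "0 \<le> fst (clocks_step G ?w (u, \<sigma>))"
    using am_in pos t by (simp add: clocks_step_def Let_def)
qed

lemma clocks_steps_shift:
  assumes fin: "finite (edges G)" and w: "\<And>c. c \<in> clocks G \<Longrightarrow> proper (w c)" and t: "0 \<le> t" "0 \<le> u"
  shows "snd ((clocks_step G w ^^ m) (t + u, \<sigma>)) = snd ((clocks_step G (restart_all (clocks G) t w) ^^ m) (u, \<sigma>))"
  using t(2)
proof (induction m arbitrary: u \<sigma>)
  case 0 then show ?case by simp
next
  case (Suc m)
  let ?w = "restart_all (clocks G) t w"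
  obtain u' \<sigma>' where r: "clocks_step G ?w (u, \<sigma>) = (u', \<sigma>')" by fastforce
  have "clocks_step G w (t + u, \<sigma>) = (t + u', \<sigma>')" "0 \<le> u'"
    using clocks_step_shift[where w = w and \<sigma> = \<sigma> and G = G, OF fin w t(1) Suc.prems] by (auto simp: r)
  then show ?case using Suc.IH[of u' \<sigma>'] r by (simp add: funpow_swap1)
qed

text \<open>From time 0 the next ring of a proper clock is its first interarrival time, and a strict
  minimum leaves \<open>arg_min_on\<close> no choice.\<close>

lemma clocks_step_first:
  assumes w: "\<And>c. c \<in> clocks G \<Longrightarrow> proper (w c)" and c: "c \<in> active G \<sigma>" and m: "strict_min (active G \<sigma>) c w"
  shows "clocks_step G w (0, \<sigma>) = (w c 0, fire G c \<sigma>)"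
proof -
  have nx: "next_ring w 0 d = w d 0" if "d \<in> active G \<sigma>" for d
  proof -
    have "proper (w d)" using that active_subset[of G \<sigma>] w by blast
    then have "renewals 0 (w d) = 0" unfolding renewals_def by (intro Least_equality) (auto simp: proper_def)
    then show ?thesis by (simp add: next_ring_def)
  qed
  have "is_arg_min (next_ring w 0) (\<lambda>x. x \<in> active G \<sigma>) x \<longleftrightarrow> x = c" for x
  proof
    assume x: "is_arg_min (next_ring w 0) (\<lambda>x. x \<in> active G \<sigma>) x"
    show "x = c"
    proof (rule ccontr)
      assume "x \<noteq> c"
      then have "next_ring w 0 c < next_ring w 0 x" using x c m by (simp add: is_arg_min_def strict_min_def nx)
      then show False using x c unfolding is_arg_min_def by blast
    qed
  next
    assume x: "x = c"
    have "\<not> next_ring w 0 y < next_ring w 0 c" if "y \<in> active G \<sigma>" for y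
    proof (cases "y = c")
      case False
      then have "w c 0 < w y 0" using that m by (simp add: strict_min_def)
      then show ?thesis using that c by (simp add: nx)
    qed simp
    then show "is_arg_min (next_ring w 0) (\<lambda>x. x \<in> active G \<sigma>) x" using x c by (auto simp: is_arg_min_def)
  qed
  then have "arg_min_on (next_ring w 0) (active G \<sigma>) = c" by (simp add: arg_min_on_def arg_min_def)
  then show ?thesis using c nx by (auto simp: clocks_step_def Let_def)
qed

section \<open>The embedded chain of colorings\<close>

definition clock_rate :: "real \<Rightarrow> 'e \<times> clock \<Rightarrow> real" where
  "clock_rate lam ec = rate lam (snd ec)"

lemma clock_rate_pos: "0 < lam \<Longrightarrow> 0 < clock_rate lam ec"
  by (cases "snd ec") (auto simp: clock_rate_def)

text \<open>The transition operator of the embedded chain of colorings.\<close>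

definition jump :: "('v, 'e) multigraph \<Rightarrow> real \<Rightarrow> (('v \<Rightarrow> color) \<Rightarrow> real) \<Rightarrow> ('v \<Rightarrow> color) \<Rightarrow> real" where
  "jump G lam V \<sigma> = (if active G \<sigma> = {} then V \<sigma>
     else (\<Sum>ec\<in>active G \<sigma>. clock_rate lam ec * V (fire G ec \<sigma>)) / (\<Sum>ec\<in>active G \<sigma>. clock_rate lam ec))"

lemma jump_nonneg:
  assumes "0 < lam" "\<And>\<sigma>. 0 \<le> V \<sigma>" shows "0 \<le> jump G lam V \<sigma>"
  unfolding jump_def
  by (simp only: split: if_split)
     (intro conjI impI divide_nonneg_nonneg sum_nonneg mult_nonneg_nonneg assms(2) less_imp_le[OF clock_rate_pos[OF assms(1)]])

lemma jumps_nonneg: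
  assumes "0 < lam" "\<And>\<sigma>. 0 \<le> V \<sigma>" shows "0 \<le> (jump G lam ^^ m) V \<sigma>"
  using assms(2) by (induction m arbitrary: \<sigma>) (auto intro: jump_nonneg[OF assms(1)])

text \<open>By \<open>one_step\<close> for the indicator of a null set, its preimage under the
  restart at the first ring is null. This is needed because the identity carried through the
  induction over the jumps holds only almost everywhere.\<close>

lemma AE_restart_strict:
  assumes "finite C" "A \<subseteq> C" "c \<in> A" and \<rho>: "\<And>c. 0 < \<rho> c" and P: "AE w in clocks_law C \<rho>. P w"
  shows "AE w in clocks_law C \<rho>. strict_min A c w \<longrightarrow> P (restart_all C (w c 0) w)"
proof -
  obtain N where N: "{w\<in>space (clocks_law C \<rho>). \<not> P w} \<subseteq> N" "emeasure (clocks_law C \<rho>) N = 0" "N \<in> sets (clocks_law C \<rho>)"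
    using P by (rule AE_E)
  have [measurable]: "(\<lambda>w. w d 0) \<in> borel_measurable (PiM C (\<lambda>_. PiM UNIV (\<lambda>_::nat. borel::real measure)))" if "d \<in> C" for d
    using that by (rule measurable_first_interarrival)
  have [measurable]: "(\<lambda>w. w c 0) \<in> borel_measurable (PiM C (\<lambda>_. PiM UNIV (\<lambda>_::nat. borel::real measure)))"
    using assms(2,3) by (intro measurable_first_interarrival) auto
  have [measurable]: "N \<in> sets (PiM C (\<lambda>_. PiM UNIV (\<lambda>_. borel)))" using N by simp
  have "(\<integral>\<^sup>+w. indicator {w. strict_min A c w} w * indicator N (restart_all C (w c 0) w) \<partial>clocks_law C \<rho>)
     = ennreal (\<rho> c / (\<Sum>c\<in>A. \<rho> c)) * (\<integral>\<^sup>+w. indicator N w \<partial>clocks_law C \<rho>)"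
    by (rule one_step[OF assms(1-3) \<rho>]) measurable
  also have "\<dots> = 0" using N by simp
  finally have 0: "(\<integral>\<^sup>+w. indicator {w. strict_min A c w} w * indicator N (restart_all C (w c 0) w) \<partial>clocks_law C \<rho>) = 0" .
  have meas: "(\<lambda>w. indicator {w. strict_min A c w} w * indicator N (restart_all C (w c 0) w) :: ennreal) \<in> borel_measurable (clocks_law C \<rho>)"
    using measurable_indicator_strict_min[OF finite_subset[OF assms(2,1)] assms(2,3)] by measurable
  have "AE w in clocks_law C \<rho>. indicator {w. strict_min A c w} w * indicator N (restart_all C (w c 0) w) = (0::ennreal)"
    using 0 by (subst (asm) nn_integral_0_iff_AE[OF meas])
  then show ?thesis
    using AE_space
  proof eventually_elim
    case (elim w)
    have "restart_all C (w c 0) w \<in> space (clocks_law C \<rho>)" by (auto simp: space_clocks_law restart_all_def)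
    with elim N(1) show ?case by (auto simp: indicator_def split: if_splits)
  qed
qed

text \<open>The events are disjoint with probabilities proportional to the rates, and these add up
  to 1; so ties are null.\<close>

lemma ex_strict_min:
  assumes "finite C" "A \<subseteq> C" "A \<noteq> {}" and \<rho>: "\<And>c. 0 < \<rho> c"
  shows "AE w in clocks_law C \<rho>. \<exists>c\<in>A. strict_min A c w"
proof -
  interpret prob_space "clocks_law C \<rho>" by (rule prob_space_clocks_law) fact
  have finA: "finite A" using assms finite_subset by blast
  have pos: "0 < (\<Sum>c\<in>A. \<rho> c)" using finA assms by (intro sum_pos) auto
  let ?B = "{w \<in> space (clocks_law C \<rho>). \<exists>c\<in>A. strict_min A c w}"
  have m[measurable]: "(\<lambda>w. indicator {w. strict_min A c w} w :: ennreal) \<in> borel_measurable (clocks_law C \<rho>)" if "c \<in> A" for c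
    using measurable_indicator_strict_min[OF finA assms(2) that] by simp
  have ind: "indicator ?B w = (\<Sum>c\<in>A. indicator {w. strict_min A c w} w :: ennreal)" if w: "w \<in> space (clocks_law C \<rho>)" for w
  proof (cases "\<exists>c\<in>A. strict_min A c w")
    case True
    then obtain c where c: "c \<in> A" "strict_min A c w" by blast
    have "indicator {w. strict_min A d w} w = (if d = c then 1 else 0 :: ennreal)" if "d \<in> A" for d
      using c that by (auto simp: strict_min_def indicator_def) (metis Diff_iff less_asym singletonD)
    then have "(\<Sum>d\<in>A. indicator {w. strict_min A d w} w :: ennreal) = (\<Sum>d\<in>A. if d = c then 1 else 0)"
      by (intro sum.cong) auto
    then show ?thesis using True c finA w by simp
  next
    case False then show ?thesis by auto
  qed
  have "(\<integral>\<^sup>+w. (\<Sum>c\<in>A. indicator {w. strict_min A c w} w) \<partial>clocks_law C \<rho>)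
     = (\<Sum>c\<in>A. \<integral>\<^sup>+w. indicator {w. strict_min A c w} w * 1 \<partial>clocks_law C \<rho>)"
    by (subst nn_integral_sum) (auto intro: m)
  also have "\<dots> = (\<Sum>c\<in>A. ennreal (\<rho> c / (\<Sum>c\<in>A. \<rho> c)))"
  proof (rule sum.cong[OF refl])
    fix c assume c: "c \<in> A"
    show "(\<integral>\<^sup>+w. indicator {w. strict_min A c w} w * 1 \<partial>clocks_law C \<rho>) = ennreal (\<rho> c / (\<Sum>c\<in>A. \<rho> c))"
      using one_step[where F="\<lambda>_. 1", OF assms(1,2) c \<rho>] emeasure_space_1 by simp
  qed
  also have "\<dots> = ennreal ((\<Sum>c\<in>A. \<rho> c / (\<Sum>c\<in>A. \<rho> c)))"
    using pos \<rho> by (intro sum_ennreal) (simp add: less_imp_le)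
  also have "\<dots> = 1" using pos by (simp add: sum_divide_distrib[symmetric])
  finally have 1: "(\<integral>\<^sup>+w. (\<Sum>c\<in>A. indicator {w. strict_min A c w} w) \<partial>clocks_law C \<rho>) = 1" .
  have "(\<integral>\<^sup>+w. indicator ?B w \<partial>clocks_law C \<rho>) = 1"
    unfolding 1[symmetric] by (rule nn_integral_cong) (rule ind)
  moreover have B: "?B \<in> sets (clocks_law C \<rho>)"
  proof -
    have "(\<lambda>w. \<Sum>c\<in>A. indicator {w. strict_min A c w} w :: ennreal) \<in> borel_measurable (clocks_law C \<rho>)"
      by (rule borel_measurable_sum) (rule m)
    then have "(\<lambda>w. indicator ?B w :: ennreal) \<in> borel_measurable (clocks_law C \<rho>)"
      by (subst measurable_cong[OF ind])
    then have "?B \<inter> space (clocks_law C \<rho>) \<in> sets (clocks_law C \<rho>)"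
      by (simp only: borel_measurable_indicator_iff)
    moreover have "?B \<inter> space (clocks_law C \<rho>) = ?B" by auto
    ultimately show ?thesis by simp
  qed
  ultimately have "emeasure (clocks_law C \<rho>) ?B = 1" by simp
  then have "AE w in clocks_law C \<rho>. w \<in> ?B"
    using AE_in_set_eq_1[OF B] by (simp add: emeasure_eq_measure)
  then show ?thesis by eventually_elim auto
qed

text \<open>Measurability of the coloring in the clocks is bypassed: the induction constructs a
  measurable \<open>H\<close> that agrees with it almost everywhere.\<close>

lemma jump_chain_nested:
  fixes G :: "('v, 'e) multigraph"
  assumes fin: "finite (edges G)" and lam: "0 < lam" and V: "\<And>\<sigma>. 0 \<le> V \<sigma>"
  shows "\<exists>H\<in>borel_measurable (clocks_law (clocks G) (clock_rate lam)).
     (AE w in clocks_law (clocks G) (clock_rate lam). ennreal (V (snd ((clocks_step G w ^^ m) (0, \<sigma>)))) = H w) \<and>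
     (\<integral>\<^sup>+w. H w \<partial>clocks_law (clocks G) (clock_rate lam)) = ennreal ((jump G lam ^^ m) V \<sigma>)"
proof (induction m arbitrary: \<sigma>)
  case 0
  interpret prob_space "clocks_law (clocks G) (clock_rate lam)"
    by (rule prob_space_clocks_law) (rule clock_rate_pos[OF lam])
  show ?case using emeasure_space_1 by (intro bexI[of _ "\<lambda>_. ennreal (V \<sigma>)"]) auto
next
  case (Suc m)
  let ?C = "clocks G" and ?\<rho> = "clock_rate lam :: 'e \<times> clock \<Rightarrow> real" and ?A = "active G \<sigma>"
  let ?N = "clocks_law ?C ?\<rho>"
  show ?case
  proof (cases "?A = {}")
    case True
    then have "clocks_step G w (0, \<sigma>) = (0, \<sigma>)" for w by (simp add: clocks_step_def)
    moreover have "(jump G lam ^^ Suc m) V \<sigma> = (jump G lam ^^ m) V \<sigma>"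
      using True by (simp add: jump_def)
    ultimately show ?thesis using Suc.IH[of \<sigma>] by (simp add: funpow_Suc_right del: funpow.simps)
  next
    case False
    have finC: "finite ?C" by (rule finite_clocks[OF fin])
    have finA: "finite ?A" using finite_subset[OF active_subset finC] .
    note \<rho> = clock_rate_pos[OF lam]
    have pos: "0 < (\<Sum>c\<in>?A. ?\<rho> c)" by (intro sum_pos finA False \<rho>)
    have "\<exists>H. \<forall>c. H c \<in> borel_measurable ?N \<and>
      (AE w in ?N. ennreal (V (snd ((clocks_step G w ^^ m) (0, fire G c \<sigma>)))) = H c w) \<and>
      (\<integral>\<^sup>+w. H c w \<partial>?N) = ennreal ((jump G lam ^^ m) V (fire G c \<sigma>))"
      by (rule choice, rule allI, use Suc.IH in \<open>simp only: Bex_def\<close>)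
    then obtain H where "\<forall>c. H c \<in> borel_measurable ?N \<and>
      (AE w in ?N. ennreal (V (snd ((clocks_step G w ^^ m) (0, fire G c \<sigma>)))) = H c w) \<and>
      (\<integral>\<^sup>+w. H c w \<partial>?N) = ennreal ((jump G lam ^^ m) V (fire G c \<sigma>))" ..
    then have H: "\<And>c. H c \<in> borel_measurable ?N"
      "\<And>c. AE w in ?N. ennreal (V (snd ((clocks_step G w ^^ m) (0, fire G c \<sigma>)))) = H c w"
      "\<And>c. (\<integral>\<^sup>+w. H c w \<partial>?N) = ennreal ((jump G lam ^^ m) V (fire G c \<sigma>))"
      by - (erule allE, elim conjE, assumption)+
    have [measurable]: "H c \<in> borel_measurable (PiM ?C (\<lambda>_. PiM UNIV (\<lambda>_. borel)))" for c
      using H(1)[of c] by simp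
    \<comment> \<open>The first ring selects one of finitely many summands; in each, the induction
      hypothesis is applied to the restarted clocks.\<close>
    define H' where "H' = (\<lambda>w. \<Sum>c\<in>?A. indicator {w. strict_min ?A c w} w * H c (restart_all ?C (w c 0) w))"
    have sm: "(\<lambda>w. indicator {w. strict_min ?A c w} w * H c (restart_all ?C (w c 0) w)) \<in> borel_measurable ?N"
      if "c \<in> ?A" for c
    proof -
      have [measurable]: "(\<lambda>w. w c 0) \<in> borel_measurable (PiM ?C (\<lambda>_. PiM UNIV (\<lambda>_::nat. borel::real measure)))"
        using that active_subset[of G \<sigma>] by (intro measurable_first_interarrival) auto
      show ?thesis
        using measurable_indicator_strict_min[OF finA active_subset that] by measurable
    qed
    have 1: "AE w in ?N. ennreal (V (snd ((clocks_step G w ^^ Suc m) (0, \<sigma>)))) = H' w"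
    proof -
      have pr: "AE w in ?N. \<forall>c\<in>?C. proper (w c)"
        unfolding clocks_law_def
        by (rule AE_finite_allI[OF finC], rule AE_PiM_component[where P=proper])
           (auto intro: prob_space_seq_law AE_proper \<rho>)
      have "AE w in ?N. \<forall>c\<in>?A. strict_min ?A c w \<longrightarrow>
          ennreal (V (snd ((clocks_step G (restart_all ?C (w c 0) w) ^^ m) (0, fire G c \<sigma>)))) = H c (restart_all ?C (w c 0) w)"
        by (rule AE_finite_allI[OF finA])
           (rule AE_restart_strict[OF finC active_subset _ \<rho> H(2)])
      with pr ex_strict_min[OF finC active_subset False \<rho>] show ?thesis
      proof eventually_elim
        case (elim w)
        obtain c where c: "c \<in> ?A" "strict_min ?A c w" using elim by blast
        have cC: "c \<in> ?C" using c active_subset[of G \<sigma>] by blast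
        have prw: "\<And>d. d \<in> ?C \<Longrightarrow> proper (w d)" using elim by blast
        have "0 \<le> w c 0" using prw[OF cC] by (auto simp: proper_def less_imp_le)
        have "clocks_step G w (0, \<sigma>) = (w c 0 + 0, fire G c \<sigma>)" using clocks_step_first[OF prw c] by simp
        then have "snd ((clocks_step G w ^^ Suc m) (0, \<sigma>)) = snd ((clocks_step G (restart_all ?C (w c 0) w) ^^ m) (0, fire G c \<sigma>))"
          using clocks_steps_shift[where w = w and G = G, OF fin prw \<open>0 \<le> w c 0\<close> order_refl, where m = m and \<sigma> = "fire G c \<sigma>"]
          by (simp add: funpow_Suc_right del: funpow.simps)
        then have "ennreal (V (snd ((clocks_step G w ^^ Suc m) (0, \<sigma>)))) = H c (restart_all ?C (w c 0) w)"
          using elim c by metis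
        also have "\<dots> = H' w"
        proof -
          have "\<not> strict_min ?A d w" if "d \<in> ?A" "d \<noteq> c" for d
            using c that by (auto simp: strict_min_def) (metis Diff_iff less_asym singletonD)
          then have "H' w = (\<Sum>d\<in>?A. if d = c then H c (restart_all ?C (w c 0) w) else 0)"
            unfolding H'_def using c by (intro sum.cong) (auto simp: indicator_def)
          then show ?thesis using finA c by simp
        qed
        finally show ?case .
      qed
    qed
    have "(\<integral>\<^sup>+w. H' w \<partial>?N) = (\<Sum>c\<in>?A. \<integral>\<^sup>+w. indicator {w. strict_min ?A c w} w * H c (restart_all ?C (w c 0) w) \<partial>?N)"
      unfolding H'_def by (rule nn_integral_sum) (rule sm)
    also have "\<dots> = (\<Sum>c\<in>?A. ennreal (?\<rho> c / (\<Sum>c\<in>?A. ?\<rho> c) * (jump G lam ^^ m) V (fire G c \<sigma>)))"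
    proof (rule sum.cong[OF refl])
      fix c assume c: "c \<in> ?A"
      have "(\<integral>\<^sup>+w. indicator {w. strict_min ?A c w} w * H c (restart_all ?C (w c 0) w) \<partial>?N)
        = ennreal (?\<rho> c / (\<Sum>c\<in>?A. ?\<rho> c)) * (\<integral>\<^sup>+w. H c w \<partial>?N)"
        by (rule one_step[OF finC active_subset c \<rho>]) measurable
      moreover have "ennreal (?\<rho> c / (\<Sum>c\<in>?A. ?\<rho> c)) * ennreal ((jump G lam ^^ m) V (fire G c \<sigma>))
        = ennreal (?\<rho> c / (\<Sum>c\<in>?A. ?\<rho> c) * (jump G lam ^^ m) V (fire G c \<sigma>))"
        using pos \<rho>[of c] by (intro ennreal_mult'[symmetric] divide_nonneg_nonneg) simp_all
      ultimately show "(\<integral>\<^sup>+w. indicator {w. strict_min ?A c w} w * H c (restart_all ?C (w c 0) w) \<partial>?N)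
        = ennreal (?\<rho> c / (\<Sum>c\<in>?A. ?\<rho> c) * (jump G lam ^^ m) V (fire G c \<sigma>))"
        by (simp only: H(3))
    qed
    also have "\<dots> = ennreal (\<Sum>c\<in>?A. ?\<rho> c / (\<Sum>c\<in>?A. ?\<rho> c) * (jump G lam ^^ m) V (fire G c \<sigma>))"
    proof (rule sum_ennreal)
      fix c
      have "0 \<le> (jump G lam ^^ m) V (fire G c \<sigma>)" by (rule jumps_nonneg[OF lam V])
      then show "0 \<le> ?\<rho> c / (\<Sum>c\<in>?A. ?\<rho> c) * (jump G lam ^^ m) V (fire G c \<sigma>)"
        using pos \<rho>[of c] by (intro mult_nonneg_nonneg divide_nonneg_nonneg) simp_all
    qed
    also have "(\<Sum>c\<in>?A. ?\<rho> c / (\<Sum>c\<in>?A. ?\<rho> c) * (jump G lam ^^ m) V (fire G c \<sigma>)) = (jump G lam ^^ Suc m) V \<sigma>"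
      using False by (simp add: jump_def sum_divide_distrib)
    finally have 2: "(\<integral>\<^sup>+w. H' w \<partial>?N) = ennreal ((jump G lam ^^ Suc m) V \<sigma>)" .
    have "H' \<in> borel_measurable ?N" unfolding H'_def by (rule borel_measurable_sum) (rule sm)
    with 1 2 show ?thesis by blast
  qed
qed

section \<open>From interarrival times indexed by triples to a family of clocks\<close>

definition group_clocks :: "('v, 'e) multigraph \<Rightarrow> ('e \<times> clock \<times> nat \<Rightarrow> real) \<Rightarrow> 'e \<times> clock \<Rightarrow> nat \<Rightarrow> real" where
  "group_clocks G \<omega> = (\<lambda>c\<in>clocks G. \<lambda>k. \<omega> (fst c, snd c, k))"

lemma chase_escape_step_group_clocks:
  fixes G :: "('v, 'e) multigraph"
  assumes fin: "finite (edges G)"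
  shows "chase_escape_step G \<omega> = clocks_step G (group_clocks G \<omega>)"
proof
  fix z :: "real \<times> ('v \<Rightarrow> color)"
  obtain t \<sigma> where z: "z = (t, \<sigma>)" by fastforce
  have nx: "next_arrival \<omega> t c = next_ring (group_clocks G \<omega>) t c" if "c \<in> clocks G" for c
    using that by (cases c) (simp add: next_arrival_def next_ring_def renewals_def arrival_def group_clocks_def)
  have am: "arg_min_on (next_arrival \<omega> t) (active G \<sigma>) = arg_min_on (next_ring (group_clocks G \<omega>) t) (active G \<sigma>)"
    using active_subset[of G \<sigma>] by (intro arg_min_on_cong) (auto simp: nx subset_iff)
  show "chase_escape_step G \<omega> z = clocks_step G (group_clocks G \<omega>) z"
  proof (cases "active G \<sigma> = {}")
    case True then show ?thesis by (simp add: z chase_escape_step_def clocks_step_def)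
  next
    case False
    have "arg_min_on (next_ring (group_clocks G \<omega>) t) (active G \<sigma>) \<in> active G \<sigma>"
      by (rule arg_min_on_in[OF finite_subset[OF active_subset finite_clocks[OF fin]] False])
    then have "arg_min_on (next_ring (group_clocks G \<omega>) t) (active G \<sigma>) \<in> clocks G"
      using active_subset[of G \<sigma>] by blast
    then show ?thesis using False by (simp add: z chase_escape_step_def clocks_step_def Let_def am nx)
  qed
qed

text \<open>Coordinates of a product measure are independent, hence so are disjoint blocks of them;
  the block of one edge and clock is reindexed as a sequence.\<close>

lemma distr_clock_space:
  fixes G :: "('v, 'e) multigraph"
  assumes lam: "0 < lam" and ne: "edges G \<noteq> {}"
  shows "distr (clock_space G lam) (clocks_law (clocks G) (clock_rate lam)) (group_clocks G)
     = clocks_law (clocks G) (clock_rate lam)"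
    and "group_clocks G \<in> clock_space G lam \<rightarrow>\<^sub>M clocks_law (clocks G) (clock_rate lam)"
proof -
  define I where "I = edges G \<times> (UNIV :: clock set) \<times> (UNIV :: nat set)"
  define M where "M = (\<lambda>i :: 'e \<times> clock \<times> nat. exp_law (rate lam (fst (snd i))))"
  have pM: "prob_space (M i)" for i
    unfolding M_def by (intro prob_space_exp_law) (cases "fst (snd i)", auto simp: lam)
  have CS: "clock_space G lam = PiM I M"
    unfolding clock_space_def I_def M_def exp_law_def by (intro PiM_cong) (auto simp: case_prod_beta)
  interpret P: prob_space "PiM I M" by (intro prob_space_PiM pM)
  have I: "I \<noteq> {}" using ne by (auto simp: I_def)
  let ?C = "clocks G"
  let ?K = "\<lambda>c :: 'e \<times> clock. {fst c} \<times> {snd c} \<times> (UNIV :: nat set)"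
  have KI: "?K c \<subseteq> I" if "c \<in> ?C" for c using that by (auto simp: I_def clocks_def)
  have C: "?C \<noteq> {}" using ne by (auto simp: clocks_def)
  have "P.indep_vars M (\<lambda>i \<omega>. \<omega> i) I"
  proof (subst P.indep_vars_iff_distr_eq_PiM'[OF I])
    have "distr (PiM I M) (PiM I M) (\<lambda>x. \<lambda>i\<in>I. x i) = distr (PiM I M) (PiM I M) (\<lambda>x. x)"
      by (intro distr_cong) (auto simp: space_PiM PiE_def extensional_restrict)
    also have "\<dots> = PiM I (\<lambda>i. distr (PiM I M) (M i) (\<lambda>\<omega>. \<omega> i))"
      using distr_PiM_component[of I M, OF pM] by (auto simp: distr_id2 intro!: PiM_cong)
    finally show "distr (PiM I M) (PiM I M) (\<lambda>x. \<lambda>i\<in>I. x i) = PiM I (\<lambda>i. distr (PiM I M) (M i) (\<lambda>\<omega>. \<omega> i))" .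
  qed (auto intro: measurable_component_singleton)
  then have "P.indep_vars (\<lambda>c. PiM (?K c) M) (\<lambda>c \<omega>. restrict (\<lambda>i. \<omega> i) (?K c)) ?C"
    by (rule P.indep_vars_restrict) (use KI in \<open>auto simp: disjoint_family_on_def\<close>)
  then have ind: "P.indep_vars (\<lambda>c. seq_law (clock_rate lam c))
     (\<lambda>c \<omega>. (\<lambda>k. restrict (\<lambda>i. \<omega> i) (?K c) (fst c, snd c, k))) ?C"
  proof (rule P.indep_vars_compose2)
    fix c assume "c \<in> ?C"
    show "(\<lambda>x k. x (fst c, snd c, k)) \<in> PiM (?K c) M \<rightarrow>\<^sub>M seq_law (clock_rate lam c)"
      unfolding seq_law_def
    proof (rule measurable_PiM_single')
      fix k
      have "(\<lambda>x. x (fst c, snd c, k)) \<in> PiM (?K c) M \<rightarrow>\<^sub>M M (fst c, snd c, k)"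
        by (rule measurable_component_singleton) auto
      then show "(\<lambda>x. x (fst c, snd c, k)) \<in> PiM (?K c) M \<rightarrow>\<^sub>M exp_law (clock_rate lam c)"
        by (simp add: M_def clock_rate_def)
    qed (auto simp: space_PiM)
  qed
  then have ind': "P.indep_vars (\<lambda>c. seq_law (clock_rate lam c)) (\<lambda>c \<omega> k. \<omega> (fst c, snd c, k)) ?C"
    by simp
  have rv: "(\<lambda>\<omega> k. \<omega> (fst c, snd c, k)) \<in> PiM I M \<rightarrow>\<^sub>M seq_law (clock_rate lam c)" if "c \<in> ?C" for c
    using ind' that by (auto simp: P.indep_vars_def)
  have comp: "distr (PiM I M) (seq_law (clock_rate lam c)) (\<lambda>\<omega> k. \<omega> (fst c, snd c, k)) = seq_law (clock_rate lam c)"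
    if c: "c \<in> ?C" for c
  proof -
    have "distr (PiM I M) (PiM UNIV (\<lambda>k. M (fst c, snd c, k))) (\<lambda>\<omega>. \<lambda>k\<in>UNIV. \<omega> (fst c, snd c, k))
      = PiM UNIV (\<lambda>k. M (fst c, snd c, k))"
      by (rule distr_PiM_reindex[OF pM]) (use c in \<open>auto simp: inj_on_def I_def clocks_def\<close>)
    then show ?thesis by (simp add: M_def seq_law_def clock_rate_def restrict_UNIV)
  qed
  have eq: "group_clocks G = (\<lambda>\<omega>. \<lambda>c\<in>?C. \<lambda>k. \<omega> (fst c, snd c, k))"
    by (auto simp: group_clocks_def fun_eq_iff)
  have "distr (PiM I M) (PiM ?C (\<lambda>c. seq_law (clock_rate lam c))) (\<lambda>\<omega>. \<lambda>c\<in>?C. \<lambda>k. \<omega> (fst c, snd c, k))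
     = PiM ?C (\<lambda>c. distr (PiM I M) (seq_law (clock_rate lam c)) (\<lambda>\<omega> k. \<omega> (fst c, snd c, k)))"
    by (subst P.indep_vars_iff_distr_eq_PiM'[OF C, symmetric]) (simp_all add: rv ind')
  also have "\<dots> = PiM ?C (\<lambda>c. seq_law (clock_rate lam c))"
    by (intro PiM_cong refl comp)
  finally show "distr (clock_space G lam) (clocks_law ?C (clock_rate lam)) (group_clocks G) = clocks_law ?C (clock_rate lam)"
    unfolding clocks_law_def CS eq .
  show "group_clocks G \<in> clock_space G lam \<rightarrow>\<^sub>M clocks_law ?C (clock_rate lam)"
    unfolding clocks_law_def CS eq using rv by (rule measurable_restrict)
qed

text \<open>\<open>nn_integral_cong_AE\<close> does not ask for measurability, so the functional of
  the coloring may be exchanged for its measurable version inside the integral.\<close>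

theorem nn_integral_chase_escape:
  fixes G :: "('v, 'e) multigraph"
  assumes fin: "finite (edges G)" and ne: "edges G \<noteq> {}" and lam: "0 < lam" and V: "\<And>\<sigma>. 0 \<le> V \<sigma>"
  shows "(\<integral>\<^sup>+\<omega>. ennreal (V (snd (chase_escape G \<omega> \<sigma> m))) \<partial>clock_space G lam) = ennreal ((jump G lam ^^ m) V \<sigma>)"
proof -
  let ?N = "clocks_law (clocks G) (clock_rate lam)"
  obtain H where H: "H \<in> borel_measurable ?N" "AE w in ?N. ennreal (V (snd ((clocks_step G w ^^ m) (0, \<sigma>)))) = H w"
    "(\<integral>\<^sup>+w. H w \<partial>?N) = ennreal ((jump G lam ^^ m) V \<sigma>)"
    using jump_chain_nested[where V=V and G=G and m=m and \<sigma>=\<sigma>, OF fin lam V] by (elim bexE conjE) (rule that)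
  note d = distr_clock_space(1)[OF lam ne] and gm = distr_clock_space(2)[OF lam ne]
  have "AE w in distr (clock_space G lam) ?N (group_clocks G). ennreal (V (snd ((clocks_step G w ^^ m) (0, \<sigma>)))) = H w"
    unfolding d by (rule H(2))
  then have "AE \<omega> in clock_space G lam. ennreal (V (snd ((clocks_step G (group_clocks G \<omega>) ^^ m) (0, \<sigma>)))) = H (group_clocks G \<omega>)"
    by (rule AE_distrD[OF gm])
  then have "(\<integral>\<^sup>+\<omega>. ennreal (V (snd (chase_escape G \<omega> \<sigma> m))) \<partial>clock_space G lam)
     = (\<integral>\<^sup>+\<omega>. H (group_clocks G \<omega>) \<partial>clock_space G lam)"
    by (intro nn_integral_cong_AE) (simp add: chase_escape_def chase_escape_step_group_clocks[OF fin])
  also have "\<dots> = (\<integral>\<^sup>+w. H w \<partial>distr (clock_space G lam) ?N (group_clocks G))"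
    by (rule nn_integral_distr[OF gm, symmetric]) (use H(1) in simp)
  finally show ?thesis by (simp add: d H(3))
qed

section \<open>Chase-escape along a path\<close>

text \<open>The probability that, on a path with \<open>l\<close> red vertices, red makes \<open>k\<close> more steps before it dies
  out, when each event is a step of red with probability \<open>p\<close> and of blue otherwise.\<close>

fun escape_prob :: "real \<Rightarrow> nat \<Rightarrow> nat \<Rightarrow> real" where
  "escape_prob p 0 l = 1"
| "escape_prob p (Suc k) 0 = 0"
| "escape_prob p (Suc k) (Suc l) = p * escape_prob p k (Suc (Suc l)) + (1 - p) * escape_prob p (Suc k) l"

lemma escape_prob_bounds:
  assumes "0 \<le> p" "p \<le> 1"
  shows escape_prob_nonneg: "0 \<le> escape_prob p k l" and escape_prob_le_1: "escape_prob p k l \<le> 1"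
proof -
  have "0 \<le> escape_prob p k l \<and> escape_prob p k l \<le> 1"
    using assms
  proof (induction p k l rule: escape_prob.induct)
    case (3 p k l)
    let ?x = "escape_prob p k (Suc (Suc l))" and ?y = "escape_prob p (Suc k) l"
    have "p * ?x \<le> p * 1" "(1 - p) * ?y \<le> (1 - p) * 1" "0 \<le> p * ?x" "0 \<le> (1 - p) * ?y"
      using 3 by (intro mult_left_mono mult_nonneg_nonneg; simp)+
    then show ?case by simp
  qed auto
  then show "0 \<le> escape_prob p k l" "escape_prob p k l \<le> 1" by auto
qed

lemma escape_prob_Suc_gap:
  assumes p: "0 \<le> p" "p \<le> 1" shows "escape_prob p k l \<le> escape_prob p k (Suc l)"
proof (induction k arbitrary: l)
  case 0 then show ?case by simp
next
  case (Suc k)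
  note IH = Suc.IH
  show ?case
  proof (induction l)
    case 0
    show ?case using escape_prob_nonneg[OF p, where k = "Suc k" and l = "Suc 0"] by (simp del: escape_prob.simps(3))
  next
    case (Suc l)
    then show ?case using IH[of "Suc (Suc l)"] p
      by (auto intro!: add_mono mult_left_mono)
  qed
qed

lemma escape_prob_mono_gap:
  assumes p: "0 \<le> p" "p \<le> 1" and "l \<le> l'" shows "escape_prob p k l \<le> escape_prob p k l'"
  using assms(3) by (rule lift_Suc_mono_le[where f = "escape_prob p k", OF escape_prob_Suc_gap[OF p]])

lemma escape_prob_Suc_steps:
  assumes p: "0 \<le> p" "p \<le> 1" shows "escape_prob p (Suc k) l \<le> escape_prob p k l"
proof (induction k arbitrary: l)
  case 0 then show ?case using escape_prob_le_1[OF p] by simp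
next
  case (Suc k)
  note IH = Suc.IH
  show ?case
  proof (induction l)
    case 0 then show ?case by simp
  next
    case (Suc l)
    then show ?case using IH[of "Suc (Suc l)"] p
      by (simp only: escape_prob.simps) (auto intro!: add_mono mult_left_mono)
  qed
qed

text \<open>A larger \<open>p\<close> moves weight to the step of red, and the state after it is
  better than the one after a step of blue: one step fewer to go and two more red vertices.\<close>

lemma escape_prob_mono_p:
  assumes p: "0 \<le> p" "p \<le> p'" "p' \<le> 1" shows "escape_prob p k l \<le> escape_prob p' k l"
proof (induction k arbitrary: l)
  case 0 then show ?case by simp
next
  case (Suc k)
  note IH = Suc.IH
  have p': "0 \<le> p'" using p by simp
  show ?case
  proof (induction l)
    case 0 then show ?case by simp
  next
    case (Suc l)
    let ?x = "escape_prob p' k (Suc (Suc l))" and ?y = "escape_prob p' (Suc k) l"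
    have "?y \<le> escape_prob p' k l" by (rule escape_prob_Suc_steps) (use p in auto)
    also have "\<dots> \<le> ?x" by (rule escape_prob_mono_gap) (use p in auto)
    finally have "0 \<le> (p' - p) * (?x - ?y)" using p by (intro mult_nonneg_nonneg) auto
    then have "p * ?x + (1 - p) * ?y \<le> p' * ?x + (1 - p') * ?y" by (simp add: algebra_simps)
    moreover have "p * escape_prob p k (Suc (Suc l)) + (1 - p) * escape_prob p (Suc k) l \<le> p * ?x + (1 - p) * ?y"
      using Suc IH[of "Suc (Suc l)"] p by (intro add_mono mult_left_mono) auto
    ultimately show ?case by simp
  qed
qed

section \<open>Counting self-avoiding continuations\<close>

definition hops :: "('v, 'e) multigraph \<Rightarrow> 'v \<Rightarrow> 'v set \<Rightarrow> ('e \<times> 'v) set" where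
  "hops G u W = {(e, w). e \<in> edges G \<and> w \<in> W \<and> ends G e = {u, w}}"

text \<open>Parallel edges are different \<open>hops\<close>, so paths are counted with
  multiplicity. A self-loop at \<open>u\<close> is not a hop as long as \<open>u\<close> is outside
  \<open>W\<close>.\<close>

fun npaths :: "('v, 'e) multigraph \<Rightarrow> nat \<Rightarrow> 'v \<Rightarrow> 'v set \<Rightarrow> nat" where
  "npaths G 0 u W = 1"
| "npaths G (Suc k) u W = (\<Sum>(e, w)\<in>hops G u W. npaths G k w (W - {w}))"

lemma finite_hops: "finite (edges G) \<Longrightarrow> finite W \<Longrightarrow> finite (hops G u W)"
  by (rule finite_subset[of _ "edges G \<times> W"]) (auto simp: hops_def)

lemma hops_mono: "W \<subseteq> W' \<Longrightarrow> hops G u W \<subseteq> hops G u W'"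
  by (auto simp: hops_def)

lemma npaths_mono:
  assumes "finite (edges G)" "finite W'" "W \<subseteq> W'"
  shows "npaths G k u W \<le> npaths G k u W'"
  using assms(2,3)
proof (induction k arbitrary: u W W')
  case 0 then show ?case by simp
next
  case (Suc k)
  have "(\<Sum>(e, w)\<in>hops G u W. npaths G k w (W - {w})) \<le> (\<Sum>(e, w)\<in>hops G u W. npaths G k w (W' - {w}))"
    using Suc by (intro sum_mono) (auto intro!: Suc.IH)
  also have "\<dots> \<le> (\<Sum>(e, w)\<in>hops G u W'. npaths G k w (W' - {w}))"
    using Suc assms(1) by (intro sum_mono2 finite_hops hops_mono) auto
  finally show ?case by simp
qed

lemma npaths_eq_0:
  assumes "finite W" "card W < k" shows "npaths G k u W = 0"
  using assms
proof (induction k arbitrary: u W)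
  case 0 then show ?case by simp
next
  case (Suc k)
  have *: "npaths G k w (W - {w}) = 0" if "(e, w) \<in> hops G u W" for e w
  proof (rule Suc.IH)
    have "w \<in> W" using that by (auto simp: hops_def)
    then have "Suc (card (W - {w})) = card W" by (rule card_Suc_Diff1[OF Suc.prems(1)])
    then show "card (W - {w}) < k" using Suc.prems(2) by linarith
  qed (use Suc in auto)
  have "(\<Sum>(e, w)\<in>hops G u W. npaths G k w (W - {w})) = 0"
    by (intro sum.neutral ballI) (clarsimp simp: *)
  then show ?case by simp
qed

section \<open>Distance from blue along red walks\<close>

text \<open>Walks may repeat vertices; this is harmless, as only the least length matters.\<close>

inductive chased :: "('v, 'e) multigraph \<Rightarrow> ('v \<Rightarrow> color) \<Rightarrow> nat \<Rightarrow> 'v \<Rightarrow> bool" for G \<sigma> where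
  chased_1: "e \<in> edges G \<Longrightarrow> ends G e = {b, u} \<Longrightarrow> \<sigma> b = Blue \<Longrightarrow> \<sigma> u = Red \<Longrightarrow> chased G \<sigma> (Suc 0) u"
| chased_Suc: "chased G \<sigma> l u \<Longrightarrow> e \<in> edges G \<Longrightarrow> ends G e = {u, w} \<Longrightarrow> \<sigma> w = Red \<Longrightarrow> chased G \<sigma> (Suc l) w"

text \<open>The number of red vertices on a shortest red path that ends at \<open>u\<close> and starts next to a blue
  vertex; junk if there is none.\<close>

definition gap :: "('v, 'e) multigraph \<Rightarrow> ('v \<Rightarrow> color) \<Rightarrow> 'v \<Rightarrow> nat" where
  "gap G \<sigma> u = (LEAST l. chased G \<sigma> l u)"

lemma chased_pos: "chased G \<sigma> l u \<Longrightarrow> 0 < l"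
  by (induction rule: chased.induct) auto

lemma gap_le: "chased G \<sigma> l u \<Longrightarrow> gap G \<sigma> u \<le> l"
  unfolding gap_def by (rule Least_le)

lemma chased_gap: "chased G \<sigma> l u \<Longrightarrow> chased G \<sigma> (gap G \<sigma> u) u"
  unfolding gap_def by (rule LeastI)

lemma fire_Spread:
  assumes "ends G e = {u, w}" "\<sigma> u = Red"
  shows "fire G (e, Spread) \<sigma> = \<sigma>(w := Red)"
  using assms by (auto simp: fire_def fun_eq_iff)

lemma fire_Chase:
  assumes "ends G e = {b, u}" "\<sigma> b = Blue"
  shows "fire G (e, Chase) \<sigma> = \<sigma>(u := Blue)"
  using assms by (auto simp: fire_def fun_eq_iff)

lemma active_SpreadE:
  assumes "(e, Spread) \<in> active G \<sigma>"
  obtains u w where "e \<in> edges G" "ends G e = {u, w}" "\<sigma> u = Red" "\<sigma> w = White"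
  using assms by (auto simp: active_def)

lemma active_ChaseE:
  assumes "(e, Chase) \<in> active G \<sigma>"
  obtains b u where "e \<in> edges G" "ends G e = {b, u}" "\<sigma> b = Blue" "\<sigma> u = Red"
  using assms by (auto simp: active_def)

lemma chased_upd_Red:
  assumes "chased G \<sigma> l u" "\<sigma> w = White" shows "chased G (\<sigma>(w := Red)) l u"
  using assms(1)
proof (induction rule: chased.induct)
  case (chased_1 e b u)
  then show ?case using assms(2) by (intro chased.chased_1[of e _ b]) auto
next
  case (chased_Suc l u e w')
  then show ?case using assms(2) by (intro chased.chased_Suc[of _ _ l u e]) auto
qed

text \<open>If the walk passes through \<open>r\<close>, its part after \<open>r\<close> now starts
  next to a blue vertex and is shorter.\<close>

lemma chased_upd_Blue:
  assumes "chased G \<sigma> l u" "u \<noteq> r" "\<sigma> r = Red"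
  shows "\<exists>l'\<le>l. chased G (\<sigma>(r := Blue)) l' u"
  using assms(1,2)
proof (induction rule: chased.induct)
  case (chased_1 e b u)
  then show ?case using assms(3) by (intro exI[of _ "Suc 0"] conjI chased.chased_1[of e _ b]) auto
next
  case (chased_Suc l u e w)
  show ?case
  proof (cases "u = r")
    case True
    then show ?thesis using chased_Suc by (intro exI[of _ "Suc 0"] conjI chased.chased_1[of e _ u]) auto
  next
    case False
    then obtain l' where "l' \<le> l" "chased G (\<sigma>(r := Blue)) l' u" using chased_Suc by blast
    then have "chased G (\<sigma>(r := Blue)) (Suc l') w"
      using chased_Suc.hyps chased_Suc.prems by (intro chased.chased_Suc[of _ _ l' u e]) simp_all
    moreover have "Suc l' \<le> Suc l" using \<open>l' \<le> l\<close> by simp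
    ultimately show ?thesis by blast
  qed
qed

text \<open>The edge is the first one of the walk, from the blue vertex; when it fires, the walk
  loses its first vertex. Extending the walk at its far end leaves this edge unchanged.\<close>

lemma chased_front:
  assumes "chased G \<sigma> l u"
  shows "\<exists>e. (e, Chase) \<in> active G \<sigma> \<and>
    (fire G (e, Chase) \<sigma> u = Blue \<or> (\<exists>l'<l. chased G (fire G (e, Chase) \<sigma>) l' u))"
  using assms
proof (induction rule: chased.induct)
  case (chased_1 e b u)
  then have "(e, Chase) \<in> active G \<sigma>" by (auto simp: active_def)
  moreover have "fire G (e, Chase) \<sigma> u = Blue" using chased_1 by (simp add: fire_Chase)
  ultimately show ?case by blast
next
  case (chased_Suc l u e w)
  then obtain e' where e': "(e', Chase) \<in> active G \<sigma>"
    "fire G (e', Chase) \<sigma> u = Blue \<or> (\<exists>l'<l. chased G (fire G (e', Chase) \<sigma>) l' u)" by blast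
  let ?s = "fire G (e', Chase) \<sigma>"
  obtain b r where br: "e' \<in> edges G" "ends G e' = {b, r}" "\<sigma> b = Blue" "\<sigma> r = Red"
    using e'(1) by (rule active_ChaseE)
  have s: "?s = \<sigma>(r := Blue)" using br by (simp add: fire_Chase)
  show ?case
  proof (cases "w = r")
    case True then show ?thesis using e'(1) s by auto
  next
    case False
    then have w: "?s w = Red" using chased_Suc s by simp
    have "\<exists>l'<Suc l. chased G ?s l' w"
      using e'(2)
    proof
      assume "?s u = Blue"
      then have "chased G ?s (Suc 0) w" using chased_Suc w by (intro chased.chased_1[of e _ u]) auto
      moreover have "0 < l" using chased_pos[OF chased_Suc.hyps(1)] .
      ultimately show ?thesis by auto
    next
      assume "\<exists>l'<l. chased G ?s l' u"
      then obtain l' where "l' < l" "chased G ?s l' u" by blast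
      then show ?thesis using chased_Suc w by (intro exI[of _ "Suc l'"]) (auto intro: chased.chased_Suc[of _ _ l' u e])
    qed
    then show ?thesis using e'(1) by blast
  qed
qed

definition colored :: "('v, 'e) multigraph \<Rightarrow> ('v \<Rightarrow> color) \<Rightarrow> color \<Rightarrow> 'v set" where
  "colored G \<sigma> c = {v \<in> verts G. \<sigma> v = c}"

text \<open>The invariant that makes \<open>gap\<close> meaningful at every red vertex.\<close>

definition all_chased :: "('v, 'e) multigraph \<Rightarrow> ('v \<Rightarrow> color) \<Rightarrow> bool" where
  "all_chased G \<sigma> \<longleftrightarrow> (\<forall>u\<in>colored G \<sigma> Red. \<exists>l. chased G \<sigma> l u)"

lemma all_chased_fire:
  assumes "all_chased G \<sigma>" "c \<in> active G \<sigma>" and ends: "\<And>e. e \<in> edges G \<Longrightarrow> ends G e \<subseteq> verts G"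
  shows "all_chased G (fire G c \<sigma>)"
proof (cases "snd c")
  case Spread
  then obtain e where c: "c = (e, Spread)" by (cases c) auto
  obtain u w where uw: "e \<in> edges G" "ends G e = {u, w}" "\<sigma> u = Red" "\<sigma> w = White"
    using assms(2) unfolding c by (rule active_SpreadE)
  have s: "fire G c \<sigma> = \<sigma>(w := Red)" using uw by (simp add: c fire_Spread)
  show ?thesis unfolding all_chased_def
  proof
    fix x assume x: "x \<in> colored G (fire G c \<sigma>) Red"
    show "\<exists>l. chased G (fire G c \<sigma>) l x"
    proof (cases "x = w")
      case True
      have "u \<in> colored G \<sigma> Red" using uw ends by (auto simp: colored_def)
      then obtain l where "chased G \<sigma> l u" using assms(1) by (auto simp: all_chased_def)
      then have "chased G (\<sigma>(w := Red)) (Suc l) w"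
        using uw by (intro chased_Suc[of _ _ l u e] chased_upd_Red) auto
      then show ?thesis using True s by auto
    next
      case False
      then have "x \<in> colored G \<sigma> Red" using x s by (auto simp: colored_def)
      then obtain l where "chased G \<sigma> l x" using assms(1) by (auto simp: all_chased_def)
      then show ?thesis using chased_upd_Red[of G \<sigma> l x w] uw(4) s by auto
    qed
  qed
next
  case Chase
  then obtain e where c: "c = (e, Chase)" by (cases c) auto
  obtain b r where br: "e \<in> edges G" "ends G e = {b, r}" "\<sigma> b = Blue" "\<sigma> r = Red"
    using assms(2) unfolding c by (rule active_ChaseE)
  have s: "fire G c \<sigma> = \<sigma>(r := Blue)" using br by (simp add: c fire_Chase)
  show ?thesis unfolding all_chased_def
  proof
    fix x assume x: "x \<in> colored G (fire G c \<sigma>) Red"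
    then have "x \<noteq> r" "x \<in> colored G \<sigma> Red" using s by (auto simp: colored_def split: if_splits)
    then obtain l where "chased G \<sigma> l x" using assms(1) by (auto simp: all_chased_def)
    then show "\<exists>l. chased G (fire G c \<sigma>) l x" using chased_upd_Blue[of G \<sigma> l x r] \<open>x \<noteq> r\<close> br(4) s by auto
  qed
qed

section \<open>The upper bound on a finite graph\<close>

lemma chased_gap_all:
  "all_chased G \<sigma> \<Longrightarrow> x \<in> colored G \<sigma> Red \<Longrightarrow> chased G \<sigma> (gap G \<sigma> x) x"
  by (auto simp: all_chased_def intro: chased_gap)

primrec stage :: "color \<Rightarrow> nat" where
  "stage White = 0" | "stage Red = 1" | "stage Blue = 2"

locale finite_multigraph =
  fixes G :: "('v, 'e) multigraph" and lam :: real
  assumes finite_verts: "finite (verts G)" and finite_edges: "finite (edges G)"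
    and ends_subset: "e \<in> edges G \<Longrightarrow> ends G e \<subseteq> verts G" and lam_pos: "0 < lam"
begin

definition p where "p = lam / (1 + lam)"

lemma p_bounds: "0 \<le> p" "p \<le> 1" and one_minus_p: "1 - p = 1 / (1 + lam)"
  using lam_pos by (auto simp: p_def field_simps)

text \<open>An upper bound for the expected number of vertices that are reached along a path from \<open>u\<close> of
  length between 1 and \<open>card (verts G)\<close> into \<open>W\<close>.\<close>

definition reach :: "'v \<Rightarrow> 'v set \<Rightarrow> nat \<Rightarrow> real" where
  "reach u W l = (\<Sum>j=1..card (verts G). real (npaths G j u W) * escape_prob p j l)"

text \<open>A supermartingale whose final value is the number of vertices that were ever not white.\<close>

definition potential :: "('v \<Rightarrow> color) \<Rightarrow> real" where
  "potential \<sigma> = real (card (verts G - colored G \<sigma> White)) +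
     (\<Sum>u\<in>colored G \<sigma> Red. reach u (colored G \<sigma> White) (gap G \<sigma> u))"

lemma finite_colored [simp]: "finite (colored G \<sigma> c)"
  using finite_verts by (simp add: colored_def)

lemma reach_mono:
  assumes "finite W'" "W \<subseteq> W'" "l \<le> l'" shows "reach u W l \<le> reach u W' l'"
  unfolding reach_def using assms npaths_mono[OF finite_edges]
  by (intro sum_mono mult_mono escape_prob_mono_gap escape_prob_nonneg p_bounds) auto

lemma reach_nonneg: "0 \<le> reach u W l"
  unfolding reach_def by (intro sum_nonneg mult_nonneg_nonneg escape_prob_nonneg p_bounds) auto

lemma reach_0: "reach u W 0 = 0"
proof -
  have "escape_prob p j 0 = 0" if "j \<in> {1..card (verts G)}" for j using that by (cases j) auto
  then show ?thesis unfolding reach_def by (intro sum.neutral) simp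
qed

text \<open>Bound for the change of \<open>potential\<close> when red steps to \<open>w\<close> from
  a vertex of gap \<open>l\<close>: paths through \<open>w\<close> have one step fewer to go and one
  more red vertex, and their old contribution is withdrawn. The term \<open>j = 1\<close> counts
  \<open>w\<close> itself.\<close>

definition spread_gain :: "'v \<Rightarrow> 'v set \<Rightarrow> nat \<Rightarrow> real" where
  "spread_gain w W l = (\<Sum>j=1..card (verts G). real (npaths G (j - 1) w (W - {w})) *
     (escape_prob p (j - 1) (Suc l) - escape_prob p j l))"

text \<open>Among the paths from \<open>u\<close> into \<open>W\<close>, those that avoid
  \<open>w\<close> and those that begin with the hop \<open>(e, w)\<close> are disjoint
  families.\<close>

lemma reach_remove:
  assumes "finite W" "(e, w) \<in> hops G u W"
  shows "reach u (W - {w}) l + (\<Sum>j=1..card (verts G). real (npaths G (j - 1) w (W - {w})) * escape_prob p j l) \<le> reach u W l"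
proof -
  have "npaths G j u (W - {w}) + npaths G (j - 1) w (W - {w}) \<le> npaths G j u W" if j: "j \<in> {1..card (verts G)}" for j
  proof -
    obtain k where k: "j = Suc k" using j by (cases j) auto
    have fh: "finite (hops G u W)" by (rule finite_hops[OF finite_edges assms(1)])
    have "npaths G j u (W - {w}) = (\<Sum>(e', w')\<in>hops G u (W - {w}). npaths G k w' (W - {w} - {w'}))"
      by (simp add: k)
    also have "\<dots> \<le> (\<Sum>(e', w')\<in>hops G u (W - {w}). npaths G k w' (W - {w'}))"
      using assms(1) by (intro sum_mono) (auto intro!: npaths_mono finite_edges)
    also have "\<dots> \<le> (\<Sum>(e', w')\<in>hops G u W - {(e, w)}. npaths G k w' (W - {w'}))"
      using fh by (intro sum_mono2) (auto simp: hops_def)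
    finally have "npaths G j u (W - {w}) + npaths G k w (W - {w}) \<le> npaths G k w (W - {w}) +
        (\<Sum>(e', w')\<in>hops G u W - {(e, w)}. npaths G k w' (W - {w'}))" by simp
    also have "\<dots> = npaths G j u W"
      using sum.remove[OF fh assms(2), of "\<lambda>(e, w). npaths G k w (W - {w})"] by (simp add: k)
    finally show ?thesis by (simp add: k)
  qed
  then have "(\<Sum>j=1..card (verts G). real (npaths G j u (W - {w}) + npaths G (j - 1) w (W - {w})) * escape_prob p j l)
    \<le> reach u W l"
    unfolding reach_def by (intro sum_mono mult_right_mono escape_prob_nonneg p_bounds) (simp del: of_nat_add)
  then show ?thesis
    unfolding reach_def by (simp add: sum.distrib distrib_right)
qed

text \<open>The 1 is the path of length 0 at \<open>w\<close>. The shift of the index drops the term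
  of length \<open>card (verts G)\<close>, which vanishes because fewer than that many vertices
  remain.\<close>

lemma reach_new:
  assumes "W \<subseteq> verts G" "w \<in> W"
  shows "1 + reach w (W - {w}) l = (\<Sum>j=1..card (verts G). real (npaths G (j - 1) w (W - {w})) * escape_prob p (j - 1) l)"
proof -
  define J where "J = card (verts G)"
  have fW: "finite W" using assms finite_verts finite_subset by blast
  have "Suc (card (W - {w})) = card W" by (rule card_Suc_Diff1[OF fW assms(2)])
  moreover have "card W \<le> J" unfolding J_def by (rule card_mono[OF finite_verts assms(1)])
  ultimately have J: "card (W - {w}) < J" by linarith
  define h where "h = (\<lambda>j. real (npaths G j w (W - {w})) * escape_prob p j l)"
  have "npaths G J w (W - {w}) = 0" by (rule npaths_eq_0[OF _ J]) (use fW in simp)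
  then have hJ: "h J = 0" by (simp add: h_def)
  have "h 0 + (\<Sum>j=1..J. h j) = (\<Sum>j\<le>J. h j)" by (simp add: sum.atLeast1_atMost_eq sum.atMost_shift)
  also have "\<dots> = (\<Sum>j<J. h j)" using hJ by (simp flip: lessThan_Suc_atMost)
  also have "\<dots> = (\<Sum>j=1..J. h (j - 1))" by (simp add: sum.atLeast1_atMost_eq)
  finally show ?thesis by (simp add: h_def reach_def J_def)
qed

lemma gap_fire_le:
  assumes "all_chased G \<sigma>" "c \<in> active G \<sigma>" "x \<in> colored G \<sigma> Red" "fire G c \<sigma> x = Red"
  shows "gap G (fire G c \<sigma>) x \<le> gap G \<sigma> x"
proof -
  have ch: "chased G \<sigma> (gap G \<sigma> x) x" by (rule chased_gap_all) fact+
  show ?thesis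
  proof (cases "snd c")
    case Spread
    then obtain e where c: "c = (e, Spread)" by (cases c) auto
    obtain u w where uw: "e \<in> edges G" "ends G e = {u, w}" "\<sigma> u = Red" "\<sigma> w = White"
      using assms(2) unfolding c by (rule active_SpreadE)
    then show ?thesis using chased_upd_Red[OF ch uw(4)] by (simp add: c fire_Spread gap_le)
  next
    case Chase
    then obtain e where c: "c = (e, Chase)" by (cases c) auto
    obtain b r where br: "e \<in> edges G" "ends G e = {b, r}" "\<sigma> b = Blue" "\<sigma> r = Red"
      using assms(2) unfolding c by (rule active_ChaseE)
    have s: "fire G c \<sigma> = \<sigma>(r := Blue)" using br by (simp add: c fire_Chase)
    have "x \<noteq> r" using assms(4) by (auto simp: s)
    from chased_upd_Blue[OF ch this br(4)] obtain l' where l': "l' \<le> gap G \<sigma> x" "chased G (\<sigma>(r := Blue)) l' x"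
      by (elim exE conjE) (rule that)
    from gap_le[OF l'(2)] l'(1) show ?thesis unfolding s by (rule order_trans)
  qed
qed

text \<open>When \<open>w\<close> is no longer white, all red vertices may lose paths; only the loss
  at \<open>u\<close> by way of \<open>e\<close> is recorded. There may be a shorter red walk to
  \<open>w\<close> than the one through \<open>u\<close>, so its gap is only bounded by that of
  \<open>u\<close> plus 1, and monotonicity of \<open>reach\<close> does the rest.\<close>

lemma potential_Spread:
  assumes inv: "all_chased G \<sigma>" and u: "u \<in> colored G \<sigma> Red" and h: "(e, w) \<in> hops G u (colored G \<sigma> White)"
  shows "potential (fire G (e, Spread) \<sigma>) - potential \<sigma> \<le> spread_gain w (colored G \<sigma> White) (gap G \<sigma> u)"
proof -
  let ?s = "fire G (e, Spread) \<sigma>" and ?W = "colored G \<sigma> White" and ?R = "colored G \<sigma> Red"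
  have e: "e \<in> edges G" "ends G e = {u, w}" "\<sigma> w = White" "w \<in> verts G" "\<sigma> u = Red"
    using h u by (auto simp: hops_def colored_def)
  have act: "(e, Spread) \<in> active G \<sigma>" using e by (auto simp: active_def)
  have s: "?s = \<sigma>(w := Red)" using e by (simp add: fire_Spread)
  have W: "colored G ?s White = ?W - {w}" using e by (auto simp: s colored_def)
  have R: "colored G ?s Red = insert w ?R" "w \<notin> ?R" using e by (auto simp: s colored_def)
  have N: "verts G - colored G ?s White = insert w (verts G - ?W)" "w \<notin> verts G - ?W"
    unfolding W using e by (auto simp: colored_def)
  have chu: "chased G \<sigma> (gap G \<sigma> u) u" using inv u by (rule chased_gap_all)
  have "chased G ?s (Suc (gap G \<sigma> u)) w"
    unfolding s by (rule chased_Suc[OF chased_upd_Red[OF chu e(3)] e(1,2)]) simp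
  then have gw: "gap G ?s w \<le> Suc (gap G \<sigma> u)" by (rule gap_le)
  have le: "reach x (?W - {w}) (gap G ?s x) \<le> reach x (?W - {w}) (gap G \<sigma> x)" if "x \<in> ?R" for x
  proof (rule reach_mono)
    have "?s x = Red" using that by (auto simp: s colored_def)
    then show "gap G ?s x \<le> gap G \<sigma> x" by (rule gap_fire_le[OF inv act that])
  qed auto
  have le2: "reach x (?W - {w}) (gap G \<sigma> x) \<le> reach x ?W (gap G \<sigma> x)" for x
    by (rule reach_mono) auto
  have "(\<Sum>x\<in>?R. reach x (?W - {w}) (gap G ?s x)) \<le> (\<Sum>x\<in>?R. reach x (?W - {w}) (gap G \<sigma> x))"
    by (intro sum_mono le)
  also have "\<dots> = reach u (?W - {w}) (gap G \<sigma> u) + (\<Sum>x\<in>?R - {u}. reach x (?W - {w}) (gap G \<sigma> x))"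
    by (rule sum.remove) (use u in auto)
  also have "\<dots> \<le> reach u ?W (gap G \<sigma> u) - (\<Sum>j=1..card (verts G). real (npaths G (j - 1) w (?W - {w})) * escape_prob p j (gap G \<sigma> u))
     + (\<Sum>x\<in>?R - {u}. reach x ?W (gap G \<sigma> x))"
    using reach_remove[OF _ h, of "gap G \<sigma> u"] by (intro add_mono sum_mono le2) simp
  also have "\<dots> = (\<Sum>x\<in>?R. reach x ?W (gap G \<sigma> x)) - (\<Sum>j=1..card (verts G). real (npaths G (j - 1) w (?W - {w})) * escape_prob p j (gap G \<sigma> u))"
    using sum.remove[of ?R u "\<lambda>x. reach x ?W (gap G \<sigma> x)"] u by simp
  finally have A: "(\<Sum>x\<in>?R. reach x (?W - {w}) (gap G ?s x)) \<le> \<dots>" .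
  have "1 + reach w (?W - {w}) (gap G ?s w) \<le> 1 + reach w (?W - {w}) (Suc (gap G \<sigma> u))"
    using gw by (intro add_left_mono reach_mono) auto
  also have "\<dots> = (\<Sum>j=1..card (verts G). real (npaths G (j - 1) w (?W - {w})) * escape_prob p (j - 1) (Suc (gap G \<sigma> u)))"
    using e by (intro reach_new) (auto simp: colored_def)
  finally have B: "1 + reach w (?W - {w}) (gap G ?s w) \<le> \<dots>" .
  have "potential ?s = real (card (verts G - ?W)) + 1 + reach w (?W - {w}) (gap G ?s w) + (\<Sum>x\<in>?R. reach x (?W - {w}) (gap G ?s x))"
  proof -
    have cN: "card (verts G - colored G ?s White) = Suc (card (verts G - ?W))"
      unfolding N(1) by (rule card_insert_disjoint) (use N(2) finite_verts in auto)
    have cR: "(\<Sum>x\<in>colored G ?s Red. reach x (colored G ?s White) (gap G ?s x))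
      = reach w (?W - {w}) (gap G ?s w) + (\<Sum>x\<in>?R. reach x (?W - {w}) (gap G ?s x))"
      unfolding R(1) W by (rule sum.insert) (use R(2) in auto)
    show ?thesis unfolding potential_def cN cR by simp
  qed
  then show ?thesis using A B
    by (simp add: potential_def spread_gain_def right_diff_distrib sum_subtractf)
qed

lemma ex_front:
  assumes "all_chased G \<sigma>" "x \<in> colored G \<sigma> Red"
  shows "\<exists>e. (e, Chase) \<in> active G \<sigma> \<and>
    (fire G (e, Chase) \<sigma> x = Red \<longrightarrow> gap G (fire G (e, Chase) \<sigma>) x \<le> gap G \<sigma> x - 1)"
proof -
  have ch: "chased G \<sigma> (gap G \<sigma> x) x" by (rule chased_gap_all) fact+
  obtain e where e: "(e, Chase) \<in> active G \<sigma>"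
    "fire G (e, Chase) \<sigma> x = Blue \<or> (\<exists>l'<gap G \<sigma> x. chased G (fire G (e, Chase) \<sigma>) l' x)"
    using chased_front[OF ch] by blast
  have "fire G (e, Chase) \<sigma> x = Red \<longrightarrow> gap G (fire G (e, Chase) \<sigma>) x \<le> gap G \<sigma> x - 1"
    using e(2)
  proof
    assume "\<exists>l'<gap G \<sigma> x. chased G (fire G (e, Chase) \<sigma>) l' x"
    then obtain l' where "l' < gap G \<sigma> x" "chased G (fire G (e, Chase) \<sigma>) l' x" by blast
    then show ?thesis using gap_le[of G "fire G (e, Chase) \<sigma>" l' x] by linarith
  qed simp
  with e(1) show ?thesis by blast
qed

text \<open>Charges every red vertex to one chase edge that reduces its gap; one such edge of rate 1
  per vertex is what the balance equation calls for.\<close>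

definition front :: "('v \<Rightarrow> color) \<Rightarrow> 'v \<Rightarrow> 'e" where
  "front \<sigma> x = (SOME e. (e, Chase) \<in> active G \<sigma> \<and>
    (fire G (e, Chase) \<sigma> x = Red \<longrightarrow> gap G (fire G (e, Chase) \<sigma>) x \<le> gap G \<sigma> x - 1))"

lemma front:
  assumes "all_chased G \<sigma>" "x \<in> colored G \<sigma> Red"
  shows "(front \<sigma> x, Chase) \<in> active G \<sigma>"
    "fire G (front \<sigma> x, Chase) \<sigma> x = Red \<Longrightarrow> gap G (fire G (front \<sigma> x, Chase) \<sigma>) x \<le> gap G \<sigma> x - 1"
  using someI_ex[OF ex_front[OF assms]] unfolding front_def by auto

text \<open>Only the vertices charged to \<open>e\<close> receive credit; for the others it suffices
  that gaps do not grow. The vertex that turns blue leaves the sum, which is expressed by giving it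
  gap 0, where \<open>reach\<close> vanishes.\<close>

lemma potential_Chase:
  assumes inv: "all_chased G \<sigma>" and act: "(e, Chase) \<in> active G \<sigma>"
  shows "potential (fire G (e, Chase) \<sigma>) - potential \<sigma> \<le>
    (\<Sum>x\<in>{x \<in> colored G \<sigma> Red. front \<sigma> x = e}. reach x (colored G \<sigma> White) (gap G \<sigma> x - 1) - reach x (colored G \<sigma> White) (gap G \<sigma> x))"
proof -
  let ?s = "fire G (e, Chase) \<sigma>" and ?W = "colored G \<sigma> White" and ?R = "colored G \<sigma> Red"
  obtain b r where br: "e \<in> edges G" "ends G e = {b, r}" "\<sigma> b = Blue" "\<sigma> r = Red"
    using act by (rule active_ChaseE)
  have s: "?s = \<sigma>(r := Blue)" using br by (simp add: fire_Chase)
  have W: "colored G ?s White = ?W" using br by (auto simp: s colored_def)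
  have R: "colored G ?s Red = ?R - {r}" by (auto simp: s colored_def)
  have r: "r \<in> ?R" using br ends_subset by (auto simp: colored_def)
  define g where "g = (\<lambda>x. if x = r then 0 else gap G ?s x)"
  have "(\<Sum>x\<in>?R - {r}. reach x ?W (gap G ?s x)) = (\<Sum>x\<in>?R - {r}. reach x ?W (g x))"
    by (intro sum.cong) (auto simp: g_def)
  also have "\<dots> = (\<Sum>x\<in>?R. reach x ?W (g x))"
    using sum.remove[of ?R r "\<lambda>x. reach x ?W (g x)"] r by (simp add: g_def reach_0)
  finally have "potential ?s - potential \<sigma> = (\<Sum>x\<in>?R. reach x ?W (g x) - reach x ?W (gap G \<sigma> x))"
    by (simp add: potential_def W R sum_subtractf)
  also have "\<dots> \<le> (\<Sum>x\<in>?R. if front \<sigma> x = e then reach x ?W (gap G \<sigma> x - 1) - reach x ?W (gap G \<sigma> x) else 0)"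
  proof (rule sum_mono)
    fix x assume x: "x \<in> ?R"
    have "g x \<le> gap G \<sigma> x" using gap_fire_le[OF inv act x] x by (auto simp: g_def s colored_def)
    moreover have "g x \<le> gap G \<sigma> x - 1" if "front \<sigma> x = e"
      using front(2)[OF inv x] x that by (auto simp: g_def s colored_def)
    ultimately show "reach x ?W (g x) - reach x ?W (gap G \<sigma> x) \<le> (if front \<sigma> x = e then reach x ?W (gap G \<sigma> x - 1) - reach x ?W (gap G \<sigma> x) else 0)"
      using reach_mono[of ?W ?W "g x" _ x] by auto
  qed
  also have "\<dots> = (\<Sum>x\<in>{x \<in> ?R. front \<sigma> x = e}. reach x ?W (gap G \<sigma> x - 1) - reach x ?W (gap G \<sigma> x))"
    by (rule sum.inter_filter[symmetric]) simp
  finally show ?thesis .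
qed

text \<open>The recursion of \<open>escape_prob\<close>, multiplied by \<open>1 + lam\<close>:
  harmonicity with respect to the rates \<open>lam\<close> and 1.\<close>

lemma escape_prob_balance:
  assumes "0 < l" "0 < j"
  shows "lam * (escape_prob p (j - 1) (Suc l) - escape_prob p j l) + (escape_prob p j (l - 1) - escape_prob p j l) = 0"
proof -
  obtain k where k: "j = Suc k" using assms by (cases j) auto
  obtain l' where l': "l = Suc l'" using assms by (cases l) auto
  have *: "(1 + lam) * p = lam" "(1 + lam) * (1 - p) = 1"
    using lam_pos by (simp_all add: one_minus_p) (simp add: p_def)
  have "(1 + lam) * escape_prob p j l = ((1 + lam) * p) * escape_prob p k (Suc l) + ((1 + lam) * (1 - p)) * escape_prob p j l'"
    unfolding k l' by (simp add: algebra_simps)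
  then have "(1 + lam) * escape_prob p j l = lam * escape_prob p k (Suc l) + escape_prob p j l'"
    unfolding * by simp
  then show ?thesis by (simp add: k l' algebra_simps)
qed

text \<open>The gains from all spreads out of \<open>u\<close> cancel the loss from the one chase
  edge charged to \<open>u\<close>, separately for each path length.\<close>

lemma sum_spread_gain:
  assumes "finite W" "1 \<le> l"
  shows "lam * (\<Sum>(e, w)\<in>hops G u W. spread_gain w W l) + (reach u W (l - 1) - reach u W l) = 0"
proof -
  obtain l' where l': "l = Suc l'" using assms(2) by (cases l) auto
  have fh: "finite (hops G u W)" by (rule finite_hops[OF finite_edges assms(1)])
  have "(\<Sum>(e, w)\<in>hops G u W. spread_gain w W l)
     = (\<Sum>j=1..card (verts G). \<Sum>(e, w)\<in>hops G u W. real (npaths G (j - 1) w (W - {w})) * (escape_prob p (j - 1) (Suc l) - escape_prob p j l))"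
    unfolding spread_gain_def case_prod_beta by (rule sum.swap)
  also have "\<dots> = (\<Sum>j=1..card (verts G). real (npaths G j u W) * (escape_prob p (j - 1) (Suc l) - escape_prob p j l))"
  proof (rule sum.cong[OF refl])
    fix j assume "j \<in> {1..card (verts G)}"
    then obtain k where k: "j = Suc k" by (cases j) auto
    show "(\<Sum>(e, w)\<in>hops G u W. real (npaths G (j - 1) w (W - {w})) * (escape_prob p (j - 1) (Suc l) - escape_prob p j l))
      = real (npaths G j u W) * (escape_prob p (j - 1) (Suc l) - escape_prob p j l)"
      unfolding k by (simp add: case_prod_beta sum_distrib_right del: escape_prob.simps)
  qed
  finally have "lam * (\<Sum>(e, w)\<in>hops G u W. spread_gain w W l) + (reach u W (l - 1) - reach u W l)
    = (\<Sum>j=1..card (verts G). real (npaths G j u W) * (lam * (escape_prob p (j - 1) (Suc l) - escape_prob p j l) + (escape_prob p j (l - 1) - escape_prob p j l)))"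
    unfolding reach_def by (simp add: sum_distrib_left sum_subtractf[symmetric] sum.distrib[symmetric] algebra_simps)
  also have "\<dots> = 0"
  proof (rule sum.neutral, rule ballI)
    fix j assume "j \<in> {1..card (verts G)}"
    then obtain k where k: "j = Suc k" by (cases j) auto
    have "lam * (escape_prob p (j - 1) (Suc l) - escape_prob p j l) + (escape_prob p j (l - 1) - escape_prob p j l) = 0"
      by (rule escape_prob_balance) (use k l' in auto)
    then show "real (npaths G j u W) * (lam * (escape_prob p (j - 1) (Suc l) - escape_prob p j l) + (escape_prob p j (l - 1) - escape_prob p j l)) = 0"
      by simp
  qed
  finally show ?thesis .
qed

lemma finite_active: "finite (active G \<sigma>)"
  by (rule finite_subset[OF active_subset finite_clocks[OF finite_edges]])

text \<open>Active spread edges correspond to pairs of a red vertex and a hop, and each red vertex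
  is charged to one chase edge, so the drift splits into the sums of \<open>sum_spread_gain\<close>,
  one for each red vertex.\<close>

lemma sum_active_potential:
  assumes inv: "all_chased G \<sigma>"
  shows "(\<Sum>c\<in>active G \<sigma>. clock_rate lam c * (potential (fire G c \<sigma>) - potential \<sigma>)) \<le> 0"
proof -
  let ?W = "colored G \<sigma> White" and ?R = "colored G \<sigma> Red"
  let ?d = "\<lambda>c. potential (fire G c \<sigma>) - potential \<sigma>"
  define S where "S = {e. (e, Spread) \<in> active G \<sigma>}"
  define T where "T = {e. (e, Chase) \<in> active G \<sigma>}"
  have fin: "finite S" "finite T"
    using finite_edges by (auto simp: S_def T_def active_def intro: finite_subset[of _ "edges G"])
  have act: "active G \<sigma> = (\<lambda>e. (e, Spread)) ` S \<union> (\<lambda>e. (e, Chase)) ` T"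
  proof (intro set_eqI)
    fix c :: "'e \<times> clock"
    obtain e k where "c = (e, k)" by fastforce
    then show "c \<in> active G \<sigma> \<longleftrightarrow> c \<in> (\<lambda>e. (e, Spread)) ` S \<union> (\<lambda>e. (e, Chase)) ` T"
      by (cases k) (auto simp: S_def T_def)
  qed
  have "(\<Sum>c\<in>active G \<sigma>. clock_rate lam c * ?d c) = (\<Sum>e\<in>S. lam * ?d (e, Spread)) + (\<Sum>e\<in>T. ?d (e, Chase))"
    unfolding act using fin
    by (subst sum.union_disjoint) (auto simp: sum.reindex inj_on_def clock_rate_def)
  also have "(\<Sum>e\<in>S. lam * ?d (e, Spread)) \<le> (\<Sum>u\<in>?R. lam * (\<Sum>(e, w)\<in>hops G u ?W. spread_gain w ?W (gap G \<sigma> u)))"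
  proof -
    let ?H = "SIGMA u:?R. hops G u ?W"
    \<comment> \<open>An active spread edge has one red and one white endpoint, so its direction is
      read off from the coloring.\<close>
    have "(\<Sum>e\<in>S. lam * ?d (e, Spread)) = (\<Sum>(u, (e, w))\<in>?H. lam * ?d (e, Spread))"
    proof (rule sum.reindex_bij_witness[where i = "\<lambda>(u, (e, w)). e" and
        j = "\<lambda>e. (THE u. u \<in> ends G e \<and> \<sigma> u = Red, (e, THE w. w \<in> ends G e \<and> \<sigma> w = White))"])
      fix e assume "e \<in> S"
      then have "(e, Spread) \<in> active G \<sigma>" by (simp add: S_def)
      then obtain u w where uw: "e \<in> edges G" "ends G e = {u, w}" "\<sigma> u = Red" "\<sigma> w = White"
        by (rule active_SpreadE)
      have 1: "(THE u. u \<in> ends G e \<and> \<sigma> u = Red) = u" "(THE w. w \<in> ends G e \<and> \<sigma> w = White) = w"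
        using uw by (auto intro!: the_equality)
      show "(THE u. u \<in> ends G e \<and> \<sigma> u = Red, (e, THE w. w \<in> ends G e \<and> \<sigma> w = White)) \<in> ?H"
        using uw ends_subset[OF uw(1)] unfolding 1 by (auto simp: hops_def colored_def)
    next
      fix b assume "b \<in> ?H"
      then obtain u e w where b: "b = (u, (e, w))" "u \<in> ?R" "(e, w) \<in> hops G u ?W" by auto
      then have uw: "e \<in> edges G" "ends G e = {u, w}" "\<sigma> u = Red" "\<sigma> w = White" by (auto simp: hops_def colored_def)
      have 1: "(THE u. u \<in> ends G e \<and> \<sigma> u = Red) = u" "(THE w. w \<in> ends G e \<and> \<sigma> w = White) = w"
        using uw by (auto intro!: the_equality)
      show "(THE u. u \<in> ends G (case b of (u, (e, w)) \<Rightarrow> e) \<and> \<sigma> u = Red,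
          (case b of (u, (e, w)) \<Rightarrow> e), THE w. w \<in> ends G (case b of (u, (e, w)) \<Rightarrow> e) \<and> \<sigma> w = White) = b"
        by (simp add: b 1)
      show "(case b of (u, (e, w)) \<Rightarrow> e) \<in> S" using uw by (auto simp: b S_def active_def)
    qed auto
    also have "\<dots> \<le> (\<Sum>(u, (e, w))\<in>?H. lam * spread_gain w ?W (gap G \<sigma> u))"
      using potential_Spread[OF inv] lam_pos by (intro sum_mono) (auto intro!: mult_left_mono)
    also have "\<dots> = (\<Sum>u\<in>?R. \<Sum>(e, w)\<in>hops G u ?W. lam * spread_gain w ?W (gap G \<sigma> u))"
      by (subst sum.Sigma) (auto intro: finite_hops finite_edges)
    finally show ?thesis by (simp add: sum_distrib_left case_prod_beta)
  qed
  also have "(\<Sum>e\<in>T. ?d (e, Chase)) \<le> (\<Sum>e\<in>T. \<Sum>x\<in>{x \<in> ?R. front \<sigma> x = e}. reach x ?W (gap G \<sigma> x - 1) - reach x ?W (gap G \<sigma> x))"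
    by (intro sum_mono potential_Chase inv) (simp add: T_def)
  also have "\<dots> = (\<Sum>x\<in>?R. reach x ?W (gap G \<sigma> x - 1) - reach x ?W (gap G \<sigma> x))"
    by (rule sum.group) (use fin front(1)[OF inv] in \<open>auto simp: T_def\<close>)
  finally have "(\<Sum>c\<in>active G \<sigma>. clock_rate lam c * ?d c) \<le>
    (\<Sum>u\<in>?R. lam * (\<Sum>(e, w)\<in>hops G u ?W. spread_gain w ?W (gap G \<sigma> u)) + (reach u ?W (gap G \<sigma> u - 1) - reach u ?W (gap G \<sigma> u)))"
    by (simp add: sum.distrib)
  also have "\<dots> = 0"
  proof (rule sum.neutral, rule ballI, rule sum_spread_gain)
    fix u assume "u \<in> ?R"
    then have "chased G \<sigma> (gap G \<sigma> u) u" by (rule chased_gap_all[OF inv])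
    then show "1 \<le> gap G \<sigma> u" using chased_pos[of G \<sigma> "gap G \<sigma> u" u] by simp
  qed simp
  finally show ?thesis .
qed

section \<open>From drift to expectations of the chain\<close>

lemma jump_le:
  assumes "(\<Sum>c\<in>active G \<sigma>. clock_rate lam c * (V (fire G c \<sigma>) - x)) \<le> 0" "active G \<sigma> = {} \<Longrightarrow> V \<sigma> \<le> x"
  shows "jump G lam V \<sigma> \<le> x"
proof (cases "active G \<sigma> = {}")
  case True then show ?thesis using assms by (simp add: jump_def)
next
  case False
  have pos: "0 < (\<Sum>c\<in>active G \<sigma>. clock_rate lam c)"
    by (intro sum_pos finite_active False clock_rate_pos lam_pos)
  have "(\<Sum>c\<in>active G \<sigma>. clock_rate lam c * V (fire G c \<sigma>)) \<le> (\<Sum>c\<in>active G \<sigma>. clock_rate lam c) * x"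
    using assms(1) by (simp add: right_diff_distrib sum_subtractf sum_distrib_right)
  then show ?thesis using pos False by (simp add: jump_def field_simps)
qed

lemma jump_ge:
  assumes "0 \<le> (\<Sum>c\<in>active G \<sigma>. clock_rate lam c * (V (fire G c \<sigma>) - x))" "active G \<sigma> = {} \<Longrightarrow> x \<le> V \<sigma>"
  shows "x \<le> jump G lam V \<sigma>"
proof (cases "active G \<sigma> = {}")
  case True then show ?thesis using assms by (simp add: jump_def)
next
  case False
  have pos: "0 < (\<Sum>c\<in>active G \<sigma>. clock_rate lam c)"
    by (intro sum_pos finite_active False clock_rate_pos lam_pos)
  have "(\<Sum>c\<in>active G \<sigma>. clock_rate lam c) * x \<le> (\<Sum>c\<in>active G \<sigma>. clock_rate lam c * V (fire G c \<sigma>))"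
    using assms(1) by (simp add: right_diff_distrib sum_subtractf sum_distrib_right)
  then show ?thesis using pos False by (simp add: jump_def field_simps)
qed

lemma active_fireE:
  assumes "c \<in> active G \<sigma>"
  obtains u v where "u \<in> verts G" "v \<in> verts G" "fst c \<in> edges G" "ends G (fst c) = {u, v}"
    "\<sigma> u = attacker (snd c)" "\<sigma> v = prey (snd c)" "fire G c \<sigma> = \<sigma>(v := attacker (snd c))"
proof -
  obtain e k where c: "c = (e, k)" by fastforce
  then obtain u v where "e \<in> edges G" "ends G e = {u, v}" "\<sigma> u = attacker k" "\<sigma> v = prey k"
    using assms by (auto simp: active_def)
  then show ?thesis using ends_subset[of e] that[of u v]
    by (auto simp: c fire_def fun_eq_iff)
qed

lemma fire_Blue: "c \<in> active G \<sigma> \<Longrightarrow> \<sigma> b = Blue \<Longrightarrow> fire G c \<sigma> b = Blue"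
  by (erule active_fireE, cases "snd c") auto

lemma fire_White: "c \<in> active G \<sigma> \<Longrightarrow> fire G c \<sigma> v = White \<Longrightarrow> \<sigma> v = White"
  by (erule active_fireE, cases "snd c") (auto split: if_splits)

text \<open>The supermartingale property, iterated. The final \<open>- 1\<close> removes
  \<open>b\<close>, which \<open>potential\<close> counts among the vertices that are not
  white.\<close>

lemma jumps_le_potential:
  assumes "all_chased G \<sigma>" "\<sigma> b = Blue" "b \<in> verts G"
  shows "(jump G lam ^^ m) (\<lambda>\<sigma>. real (card (verts G - colored G \<sigma> White - {b}))) \<sigma> \<le> potential \<sigma> - 1"
  using assms(1,2)
proof (induction m arbitrary: \<sigma>)
  case 0
  have "Suc (card (verts G - colored G \<sigma> White - {b})) = card (verts G - colored G \<sigma> White)"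
    using 0 assms(3) finite_verts by (intro card_Suc_Diff1) (auto simp: colored_def)
  moreover have "0 \<le> (\<Sum>u\<in>colored G \<sigma> Red. reach u (colored G \<sigma> White) (gap G \<sigma> u))"
    by (intro sum_nonneg reach_nonneg)
  ultimately show ?case by (simp add: potential_def)
next
  case (Suc m)
  let ?U = "(jump G lam ^^ m) (\<lambda>\<sigma>. real (card (verts G - colored G \<sigma> White - {b})))"
  have "jump G lam ?U \<sigma> \<le> potential \<sigma> - 1"
  proof (rule jump_le)
    have "(\<Sum>c\<in>active G \<sigma>. clock_rate lam c * (?U (fire G c \<sigma>) - (potential \<sigma> - 1)))
      \<le> (\<Sum>c\<in>active G \<sigma>. clock_rate lam c * (potential (fire G c \<sigma>) - potential \<sigma>))"
    proof (intro sum_mono mult_left_mono)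
      fix c assume c: "c \<in> active G \<sigma>"
      have "?U (fire G c \<sigma>) \<le> potential (fire G c \<sigma>) - 1"
        by (rule Suc.IH[OF all_chased_fire[OF Suc.prems(1) c ends_subset] fire_Blue[where b = b, OF c Suc.prems(2)]])
      then show "?U (fire G c \<sigma>) - (potential \<sigma> - 1) \<le> potential (fire G c \<sigma>) - potential \<sigma>" by simp
      show "0 \<le> clock_rate lam c" using clock_rate_pos[OF lam_pos, of c] by simp
    qed
    also have "\<dots> \<le> 0" by (rule sum_active_potential) fact
    finally show "(\<Sum>c\<in>active G \<sigma>. clock_rate lam c * (?U (fire G c \<sigma>) - (potential \<sigma> - 1))) \<le> 0" .
    show "?U \<sigma> \<le> potential \<sigma> - 1" by (rule Suc.IH) fact+
  qed
  then show ?case by simp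
qed

section \<open>Absorption, and the set of vertices that are ever red\<close>

text \<open>Vertices only move from white to red to blue, so every jump raises this number by
  exactly 1, and the number of jumps is bounded.\<close>

definition progress :: "('v \<Rightarrow> color) \<Rightarrow> nat" where
  "progress \<sigma> = (\<Sum>v\<in>verts G. stage (\<sigma> v))"

lemma progress_fire: "c \<in> active G \<sigma> \<Longrightarrow> progress (fire G c \<sigma>) = Suc (progress \<sigma>)"
proof (erule active_fireE)
  fix u v assume v: "v \<in> verts G" "\<sigma> v = prey (snd c)" "fire G c \<sigma> = \<sigma>(v := attacker (snd c))"
  have "(\<Sum>x\<in>verts G - {v}. stage ((\<sigma>(v := attacker (snd c))) x))
    = (\<Sum>x\<in>verts G - {v}. stage (\<sigma> x))"
    by (intro sum.cong) auto
  then show ?thesis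
    unfolding progress_def v(3) using v(2)
    by (subst (1 2) sum.remove[OF finite_verts v(1)]) (cases "snd c", auto)
qed

lemma progress_le: "progress \<sigma> \<le> 2 * card (verts G)"
proof -
  have "progress \<sigma> \<le> (\<Sum>v\<in>verts G. 2)" unfolding progress_def
  proof (rule sum_mono)
    fix v show "stage (\<sigma> v) \<le> 2" by (cases "\<sigma> v") auto
  qed
  then show ?thesis by simp
qed

definition coloring_at :: "('e \<times> clock \<times> nat \<Rightarrow> real) \<Rightarrow> ('v \<Rightarrow> color) \<Rightarrow> nat \<Rightarrow> 'v \<Rightarrow> color" where
  "coloring_at \<omega> \<sigma> m = snd (chase_escape G \<omega> \<sigma> m)"

lemma coloring_at_0: "coloring_at \<omega> \<sigma> 0 = \<sigma>"
  by (simp add: coloring_at_def chase_escape_def)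

lemma coloring_at_absorbed:
  "active G (coloring_at \<omega> \<sigma> m) = {} \<Longrightarrow> coloring_at \<omega> \<sigma> (Suc m) = coloring_at \<omega> \<sigma> m"
  by (simp add: coloring_at_def chase_escape_def chase_escape_step_def case_prod_beta)

lemma coloring_at_fire:
  "active G (coloring_at \<omega> \<sigma> m) \<noteq> {} \<Longrightarrow>
    \<exists>c\<in>active G (coloring_at \<omega> \<sigma> m). coloring_at \<omega> \<sigma> (Suc m) = fire G c (coloring_at \<omega> \<sigma> m)"
  by (intro bexI[OF _ arg_min_on_in[OF finite_active]])
     (simp_all add: coloring_at_def chase_escape_def chase_escape_step_def case_prod_beta Let_def)

lemma coloring_at_progress:
  "active G (coloring_at \<omega> \<sigma> m) = {} \<or> m \<le> progress (coloring_at \<omega> \<sigma> m)"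
proof (induction m)
  case (Suc m)
  show ?case
  proof (cases "active G (coloring_at \<omega> \<sigma> m) = {}")
    case True then show ?thesis by (simp add: coloring_at_absorbed)
  next
    case False
    then obtain c where "c \<in> active G (coloring_at \<omega> \<sigma> m)" "coloring_at \<omega> \<sigma> (Suc m) = fire G c (coloring_at \<omega> \<sigma> m)"
      using coloring_at_fire by blast
    then show ?thesis using Suc False by (simp add: progress_fire)
  qed
qed simp

lemma coloring_at_final:
  assumes "Suc (2 * card (verts G)) \<le> m"
  shows "coloring_at \<omega> \<sigma> m = coloring_at \<omega> \<sigma> (Suc (2 * card (verts G)))"
  using assms
proof (induction m rule: dec_induct)
  case (step m)
  have "active G (coloring_at \<omega> \<sigma> m) = {}"
    using coloring_at_progress[of \<omega> \<sigma> m] progress_le[of "coloring_at \<omega> \<sigma> m"] step by linarith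
  then show ?case using step by (simp add: coloring_at_absorbed)
qed simp

lemma coloring_at_step_cases:
  "coloring_at \<omega> \<sigma> (Suc m) = coloring_at \<omega> \<sigma> m \<or>
   (\<exists>c\<in>active G (coloring_at \<omega> \<sigma> m). coloring_at \<omega> \<sigma> (Suc m) = fire G c (coloring_at \<omega> \<sigma> m))"
  using coloring_at_absorbed coloring_at_fire by blast

lemma coloring_at_White_antimono:
  assumes "m \<le> m'" "coloring_at \<omega> \<sigma> m' v = White" shows "coloring_at \<omega> \<sigma> m v = White"
  using assms
proof (induction m' rule: dec_induct)
  case (step m')
  then show ?case using coloring_at_step_cases[of \<omega> \<sigma> m'] fire_White by metis
qed simp

lemma coloring_at_Blue: "\<sigma> b = Blue \<Longrightarrow> coloring_at \<omega> \<sigma> m b = Blue"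
proof (induction m)
  case (Suc m)
  then show ?case using coloring_at_step_cases[of \<omega> \<sigma> m] fire_Blue by metis
qed (simp add: coloring_at_0)

lemma ever_red_subset:
  assumes "\<sigma> b = Blue" "Suc (2 * card (verts G)) \<le> m"
  shows "ever_red G \<omega> \<sigma> \<subseteq> verts G - colored G (coloring_at \<omega> \<sigma> m) White - {b}"
proof
  fix v assume "v \<in> ever_red G \<omega> \<sigma>"
  then obtain j where v: "v \<in> verts G" "coloring_at \<omega> \<sigma> j v = Red"
    by (auto simp: ever_red_def coloring_at_def)
  have "coloring_at \<omega> \<sigma> m v \<noteq> White"
  proof (cases "j \<le> m")
    case True then show ?thesis using coloring_at_White_antimono[of j m] v by auto
  next
    case False
    then have "coloring_at \<omega> \<sigma> m = coloring_at \<omega> \<sigma> j"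
      using coloring_at_final[of m] coloring_at_final[of j] assms(2) by simp
    then show ?thesis using v by simp
  qed
  moreover have "v \<noteq> b" using coloring_at_Blue[of \<sigma> b \<omega> j] assms(1) v by auto
  ultimately show "v \<in> verts G - colored G (coloring_at \<omega> \<sigma> m) White - {b}"
    using v by (auto simp: colored_def)
qed

text \<open>White never turns blue directly, so a vertex that has left white was red after some
  jump.\<close>

lemma subset_ever_red:
  assumes "\<And>v. \<sigma> v = Blue \<Longrightarrow> v = b"
  shows "verts G - colored G (coloring_at \<omega> \<sigma> m) White - {b} \<subseteq> ever_red G \<omega> \<sigma>"
proof -
  have "coloring_at \<omega> \<sigma> m v = White \<or> (\<exists>j\<le>m. coloring_at \<omega> \<sigma> j v = Red)" if "v \<noteq> b" for v
  proof (induction m)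
    case 0
    then show ?case using assms[of v] that by (cases "\<sigma> v") (auto simp: coloring_at_0)
  next
    case (Suc m)
    show ?case
    proof (cases "coloring_at \<omega> \<sigma> m v = White")
      case False
      then show ?thesis using Suc le_Suc_eq by metis
    next
      case True
      from coloring_at_step_cases[of \<omega> \<sigma> m] show ?thesis
      proof
        assume "coloring_at \<omega> \<sigma> (Suc m) = coloring_at \<omega> \<sigma> m"
        then show ?thesis using True by simp
      next
        assume "\<exists>c\<in>active G (coloring_at \<omega> \<sigma> m). coloring_at \<omega> \<sigma> (Suc m) = fire G c (coloring_at \<omega> \<sigma> m)"
        then obtain c where c: "c \<in> active G (coloring_at \<omega> \<sigma> m)" "coloring_at \<omega> \<sigma> (Suc m) = fire G c (coloring_at \<omega> \<sigma> m)" by blast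
        from c(1) have "fire G c (coloring_at \<omega> \<sigma> m) v \<noteq> Blue"
          by (rule active_fireE, cases "snd c") (use True in auto)
        then have "coloring_at \<omega> \<sigma> (Suc m) v = White \<or> coloring_at \<omega> \<sigma> (Suc m) v = Red"
          using c(2) by (cases "coloring_at \<omega> \<sigma> (Suc m) v") auto
        then show ?thesis by blast
      qed
    qed
  qed
  then show ?thesis by (auto simp: ever_red_def colored_def coloring_at_def)
qed

theorem expected_ever_red_le:
  assumes "edges G \<noteq> {}" "all_chased G \<sigma>" "\<sigma> b = Blue" "b \<in> verts G"
  shows "(\<integral>\<^sup>+\<omega>. of_nat (card (ever_red G \<omega> \<sigma>)) \<partial>clock_space G lam) \<le> ennreal (potential \<sigma> - 1)"
proof -
  let ?m = "Suc (2 * card (verts G))"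
  let ?V = "\<lambda>\<sigma>. real (card (verts G - colored G \<sigma> White - {b}))"
  have "card (ever_red G \<omega> \<sigma>) \<le> card (verts G - colored G (coloring_at \<omega> \<sigma> ?m) White - {b})" for \<omega>
    using finite_verts by (intro card_mono ever_red_subset assms) auto
  then have "(\<integral>\<^sup>+\<omega>. of_nat (card (ever_red G \<omega> \<sigma>)) \<partial>clock_space G lam) \<le>
    (\<integral>\<^sup>+\<omega>. ennreal (?V (snd (chase_escape G \<omega> \<sigma> ?m))) \<partial>clock_space G lam)"
    by (intro nn_integral_mono) (simp add: coloring_at_def ennreal_of_nat_eq_real_of_nat)
  also have "\<dots> = ennreal ((jump G lam ^^ ?m) ?V \<sigma>)"
    by (rule nn_integral_chase_escape[OF finite_edges assms(1) lam_pos]) simp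
  also have "\<dots> \<le> ennreal (potential \<sigma> - 1)"
    by (intro ennreal_leI jumps_le_potential assms)
  finally show ?thesis .
qed

text \<open>Valid for every number \<open>m\<close> of jumps: looking at the chain before its
  absorption can only miss vertices.\<close>

theorem expected_ever_red_ge:
  assumes "edges G \<noteq> {}" "\<And>v. \<sigma> v = Blue \<Longrightarrow> v = b"
  shows "ennreal ((jump G lam ^^ m) (\<lambda>\<sigma>. real (card (verts G - colored G \<sigma> White - {b}))) \<sigma>) \<le>
    (\<integral>\<^sup>+\<omega>. of_nat (card (ever_red G \<omega> \<sigma>)) \<partial>clock_space G lam)"
proof -
  let ?V = "\<lambda>\<sigma>. real (card (verts G - colored G \<sigma> White - {b}))"
  have "card (verts G - colored G (coloring_at \<omega> \<sigma> m) White - {b}) \<le> card (ever_red G \<omega> \<sigma>)" for \<omega>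
    using finite_verts by (intro card_mono subset_ever_red assms) (auto simp: ever_red_def)
  then have "(\<integral>\<^sup>+\<omega>. ennreal (?V (snd (chase_escape G \<omega> \<sigma> m))) \<partial>clock_space G lam)
    \<le> (\<integral>\<^sup>+\<omega>. of_nat (card (ever_red G \<omega> \<sigma>)) \<partial>clock_space G lam)"
    by (intro nn_integral_mono) (simp add: coloring_at_def ennreal_of_nat_eq_real_of_nat)
  moreover have "(\<integral>\<^sup>+\<omega>. ennreal (?V (snd (chase_escape G \<omega> \<sigma> m))) \<partial>clock_space G lam) = ennreal ((jump G lam ^^ m) ?V \<sigma>)"
    by (rule nn_integral_chase_escape[OF finite_edges assms(1) lam_pos]) simp
  ultimately show ?thesis by simp
qed

end

section \<open>The lower bound on a locally tree-like graph\<close>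

text \<open>Both the set of vertices that are no longer white and the set of blue ones, without
  \<open>b\<close>, have this form (unless empty) while chase-escape is being followed. Adding a
  vertex twice is allowed, which makes closure under unions immediate.\<close>

inductive grown :: "('v, 'e) multigraph \<Rightarrow> 'v \<Rightarrow> 'v \<Rightarrow> 'v set \<Rightarrow> bool" for G b r where
  grown_root: "grown G b r {r}"
| grown_insert: "grown G b r X \<Longrightarrow> e \<in> edges G \<Longrightarrow> ends G e = {u, w} \<Longrightarrow> u \<in> X \<Longrightarrow> w \<noteq> b \<Longrightarrow> grown G b r (insert w X)"

text \<open>An edge leaving a set that was grown from \<open>r\<close> cannot close a cycle; only edges to vertices
  outside the set are controlled, so self-loops are irrelevant.\<close>

definition locally_tree :: "('v, 'e) multigraph \<Rightarrow> 'v \<Rightarrow> 'v \<Rightarrow> nat \<Rightarrow> bool" where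
  "locally_tree G b r J \<longleftrightarrow> (\<forall>X v x x' e e'. grown G b r X \<longrightarrow> card X < J \<longrightarrow> v \<notin> X \<longrightarrow> v \<noteq> b \<longrightarrow>
     x \<in> X \<longrightarrow> x' \<in> X \<longrightarrow> e \<in> edges G \<longrightarrow> e' \<in> edges G \<longrightarrow> ends G e = {x, v} \<longrightarrow> ends G e' = {x', v} \<longrightarrow> e = e')"

lemma locally_treeD:
  assumes "locally_tree G b r J" "grown G b r X" "card X < J" "v \<notin> X" "v \<noteq> b" "x \<in> X" "x' \<in> X"
    "e \<in> edges G" "e' \<in> edges G" "ends G e = {x, v}" "ends G e' = {x', v}"
  shows "e = e'"
  using assms unfolding locally_tree_def by blast

lemma root_in_grown: "grown G b r X \<Longrightarrow> r \<in> X"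
  by (induction rule: grown.induct) auto

lemma finite_grown: "grown G b r X \<Longrightarrow> finite X"
  by (induction rule: grown.induct) auto

lemma grown_Un:
  assumes "grown G b r X" "grown G b r Y" shows "grown G b r (X \<union> Y)"
  using assms(2)
proof (induction rule: grown.induct)
  case grown_root
  have "X \<union> {r} = X" using root_in_grown[OF assms(1)] by auto
  then show ?case using assms(1) by simp
next
  case (grown_insert Y e u w)
  have "grown G b r (insert w (X \<union> Y))"
    by (rule grown.grown_insert[OF grown_insert.IH grown_insert.hyps(2,3)]) (use grown_insert in auto)
  then show ?case by simp
qed

section \<open>Self-avoiding paths as lists of hops\<close>

fun paths :: "('v, 'e) multigraph \<Rightarrow> nat \<Rightarrow> 'v \<Rightarrow> 'v set \<Rightarrow> ('e \<times> 'v) list set" where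
  "paths G 0 u W = {[]}"
| "paths G (Suc k) u W = (\<Union>(e, w)\<in>hops G u W. (\<lambda>q. (e, w) # q) ` paths G k w (W - {w}))"

lemma finite_card_paths:
  assumes "finite (edges G)" "finite W"
  shows "finite (paths G k u W) \<and> card (paths G k u W) = npaths G k u W"
  using assms(2)
proof (induction k arbitrary: u W)
  case 0 then show ?case by simp
next
  case (Suc k)
  have fh: "finite (hops G u W)" by (rule finite_hops[OF assms(1) Suc.prems])
  have IH: "finite (paths G k w (W - {w}))" "card (paths G k w (W - {w})) = npaths G k w (W - {w})" for w
    using Suc by auto
  have "card (paths G (Suc k) u W) = (\<Sum>h\<in>hops G u W. card (case h of (e, w) \<Rightarrow> (\<lambda>q. (e, w) # q) ` paths G k w (W - {w})))"
    unfolding paths.simps by (rule card_UN_disjoint[OF fh]) (use IH in auto)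
  also have "\<dots> = npaths G (Suc k) u W"
    by (auto intro!: sum.cong simp: card_image IH(2))
  finally show ?case using fh IH by auto
qed

fun valid_path :: "('v, 'e) multigraph \<Rightarrow> 'v \<Rightarrow> ('e \<times> 'v) list \<Rightarrow> bool" where
  "valid_path G r [] \<longleftrightarrow> True"
| "valid_path G r ((e, w) # q) \<longleftrightarrow> e \<in> edges G \<and> ends G e = {r, w} \<and> valid_path G w q"

lemma paths_valid:
  assumes "q \<in> paths G k u W"
  shows "length q = k \<and> valid_path G u q \<and> snd ` set q \<subseteq> W \<and> distinct (map snd q)"
  using assms
proof (induction k arbitrary: u W q)
  case 0 then show ?case by simp
next
  case (Suc k)
  obtain e w q' where h: "(e, w) \<in> hops G u W" "q' \<in> paths G k w (W - {w})" "q = (e, w) # q'" using Suc.prems by auto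
  from Suc.IH[OF h(2)] show ?case using h(1) by (auto simp: h(3) hops_def)
qed

lemma last_path_vertex: "last (r # map snd q) \<in> insert r (snd ` set q)"
proof -
  have "last (r # map snd q) \<in> set (r # map snd q)" by (rule last_in_set) simp
  then show ?thesis by (simp only: list.set set_map)
qed

lemma nth_notin_take: "distinct xs \<Longrightarrow> j < length xs \<Longrightarrow> xs ! j \<notin> set (take j xs)"
  using id_take_nth_drop[of j xs] by (metis disjoint_iff distinct_append list.set_intros(1))

lemma nth_in_take: "j < length xs \<Longrightarrow> xs ! j \<in> set (take (Suc j) xs)"
  by (simp add: take_Suc_conv_app_nth)

lemma valid_path_append:
  "valid_path G r (q @ q') \<longleftrightarrow> valid_path G r q \<and> valid_path G (last (r # map snd q)) q'"
  by (induction G r q rule: valid_path.induct) auto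

lemma grown_valid_path:
  assumes "valid_path G r q" "b \<notin> snd ` set q" shows "grown G b r (insert r (snd ` set q))"
  using assms
proof (induction q rule: rev_induct)
  case Nil then show ?case by (simp add: grown_root)
next
  case (snoc h q)
  obtain e w where h: "h = (e, w)" by fastforce
  have e: "e \<in> edges G" "ends G e = {last (r # map snd q), w}" and "valid_path G r q"
    using snoc.prems by (auto simp: h valid_path_append)
  then have "grown G b r (insert r (snd ` set q))" using snoc by auto
  then have "grown G b r (insert w (insert r (snd ` set q)))"
    by (rule grown_insert[OF _ e last_path_vertex]) (use snoc.prems in \<open>auto simp: h\<close>)
  then show ?case by (simp add: h insert_commute)
qed

text \<open>The last edges of both paths enter the common endpoint from the union of the two shorter
  paths, which is grown and has fewer than \<open>J\<close> vertices. So these edges agree, hence so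
  do the vertices before the endpoint, and the induction goes on from there.\<close>

lemma valid_path_unique:
  assumes lt: "locally_tree G b r J"
    and "valid_path G r q" "distinct (r # map snd q)" "b \<notin> snd ` set q"
    and "valid_path G r q'" "distinct (r # map snd q')" "b \<notin> snd ` set q'"
    and "length q' = length q" "2 * length q < J" "last (r # map snd q) = last (r # map snd q')"
  shows "q = q'"
  using assms(2-)
proof (induction q arbitrary: q' rule: rev_induct)
  case Nil then show ?case by simp
next
  case (snoc h q q')
  obtain q1 h' where q': "q' = q1 @ [h']" using snoc.prems(7) by (cases q' rule: rev_cases) auto
  obtain e v where h: "h = (e, v)" by fastforce
  obtain e' v' where h': "h' = (e', v')" by fastforce
  have v: "v' = v" using snoc.prems(9) by (simp add: h h' q')
  let ?u = "last (r # map snd q)" and ?u' = "last (r # map snd q1)"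
  have e: "e \<in> edges G" "ends G e = {?u, v}" "e' \<in> edges G" "ends G e' = {?u', v}" "valid_path G r q" "valid_path G r q1"
    using snoc.prems by (auto simp: h h' q' v valid_path_append)
  let ?X = "insert r (snd ` set q)" and ?Y = "insert r (snd ` set q1)"
  have g: "grown G b r (?X \<union> ?Y)"
    using snoc.prems by (intro grown_Un grown_valid_path e) (auto simp: q')
  have "card (?X \<union> ?Y) \<le> card (set (r # map snd q @ map snd q1))" by (intro card_mono) auto
  also have "\<dots> \<le> length (r # map snd q @ map snd q1)" by (rule card_length)
  also have "\<dots> < J" using snoc.prems(7,8) by (simp add: q')
  finally have J: "card (?X \<union> ?Y) < J" .
  have u: "?u \<in> ?X" "?u' \<in> ?Y"
    by (rule last_path_vertex)+
  have nv: "v \<notin> ?X \<union> ?Y" "v \<noteq> b" using snoc.prems by (auto simp: h h' q' v)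
  have "e = e'" by (rule locally_treeD[OF lt g J nv UnI1[OF u(1)] UnI2[OF u(2)] e(1,3,2,4)])
  then have "{?u, v} = {?u', v}" using e by simp
  then have "?u = ?u'" using u nv by (auto simp: doubleton_eq_iff)
  then have "q = q1"
    using snoc.prems e by (intro snoc.IH) (auto simp: q')
  then show ?case using \<open>e = e'\<close> by (simp add: q' h h' v)
qed

section \<open>Colors along one path\<close>

definition pattern :: "('v \<Rightarrow> color) \<Rightarrow> 'v list \<Rightarrow> nat \<Rightarrow> nat \<Rightarrow> bool" where
  "pattern \<sigma> vs i l \<longleftrightarrow> i + l \<le> length vs \<and>
     (\<forall>j<length vs. \<sigma> (vs ! j) = (if j < i then Blue else if j < i + l then Red else White))"

text \<open>Written with counts so that it is defined for every coloring; it is the success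
  probability of the one-path game only if \<open>pattern\<close> holds.\<close>

definition success_prob :: "real \<Rightarrow> ('v \<Rightarrow> color) \<Rightarrow> 'v list \<Rightarrow> real" where
  "success_prob p \<sigma> vs = escape_prob p (card {j. j < length vs \<and> \<sigma> (vs ! j) = White}) (card {j. j < length vs \<and> \<sigma> (vs ! j) = Red})"

lemma success_prob_pattern:
  assumes "pattern \<sigma> vs i l" shows "success_prob p \<sigma> vs = escape_prob p (length vs - (i + l)) l"
proof -
  have *: "\<sigma> (vs ! j) = (if j < i then Blue else if j < i + l then Red else White)" if "j < length vs" for j
    using assms that unfolding pattern_def by blast
  have "{j. j < length vs \<and> \<sigma> (vs ! j) = White} = {i + l..<length vs}"
    using * by (auto split: if_splits)
  moreover have "{j. j < length vs \<and> \<sigma> (vs ! j) = Red} = {i..<i + l}"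
    using * assms by (auto simp: pattern_def split: if_splits)
  ultimately show ?thesis by (simp add: success_prob_def)
qed

lemma pattern_cong:
  assumes "pattern \<sigma> vs i l" "\<And>v. v \<in> set vs \<Longrightarrow> \<sigma>' v = \<sigma> v" shows "pattern \<sigma>' vs i l"
  using assms by (auto simp: pattern_def)

lemma pattern_Spread:
  assumes "pattern \<sigma> vs i l" "distinct vs" "i + l < length vs"
  shows "pattern (\<sigma>(vs ! (i + l) := Red)) vs i (Suc l)"
  using assms by (auto simp: pattern_def nth_eq_iff_index_eq)

lemma pattern_Chase:
  assumes "pattern \<sigma> vs i (Suc l)" "distinct vs"
  shows "pattern (\<sigma>(vs ! i := Blue)) vs (Suc i) l"
  using assms by (auto simp: pattern_def nth_eq_iff_index_eq)

text \<open>\<Gamma> is the family of paths to be followed. The bounds on \<open>J\<close> leave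
  room for the reached set, of at most about twice \<open>card \<Gamma>\<close> vertices, joined
  with one path, and for comparing two paths with each other.\<close>

locale chase_tree = finite_multigraph G lam for G :: "('v, 'e) multigraph" and lam +
  fixes b r :: 'v and e0 :: 'e and J k :: nat and \<Gamma> :: "('e \<times> 'v) list set"
  assumes b: "b \<in> verts G" "b \<noteq> r" and r: "r \<in> verts G"
    and e0: "e0 \<in> edges G" "ends G e0 = {b, r}" "\<And>e. e \<in> edges G \<Longrightarrow> b \<in> ends G e \<Longrightarrow> e = e0"
    and lt: "locally_tree G b r J"
    and \<Gamma>: "finite \<Gamma>" "\<And>q. q \<in> \<Gamma> \<Longrightarrow> valid_path G r q \<and> distinct (r # map snd q) \<and> b \<notin> snd ` set q \<and> length q = k"
    and J: "2 * card \<Gamma> + k + 3 < J" "2 * k < J"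
begin

abbreviation "pv q \<equiv> r # map snd q"

definition X where "X \<sigma> = verts G - colored G \<sigma> White - {b}"
definition Y where "Y \<sigma> = colored G \<sigma> Blue - {b}"

definition inv where
  "inv \<sigma> \<longleftrightarrow> \<sigma> b = Blue \<and> grown G b r (X \<sigma>) \<and> (Y \<sigma> = {} \<or> grown G b r (Y \<sigma>)) \<and> (\<forall>q\<in>\<Gamma>. \<exists>i l. pattern \<sigma> (pv q) i l)"

lemma path_edge:
  assumes "q \<in> \<Gamma>" "j < k"
  shows "fst (q ! j) \<in> edges G" "ends G (fst (q ! j)) = {pv q ! j, pv q ! Suc j}"
    and "grown G b r (set (take (Suc j) (pv q)))" "b \<notin> set (pv q)" "pv q ! j \<in> set (take (Suc j) (pv q))"
proof -
  have q: "valid_path G r q" "b \<notin> snd ` set q" "length q = k" using \<Gamma>(2)[OF assms(1)] by auto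
  have split: "q = take j q @ (q ! j) # drop (Suc j) q" using assms(2) q(3) by (simp add: id_take_nth_drop[symmetric])
  have "valid_path G r (take j q) \<and> valid_path G (last (r # map snd (take j q))) ((q ! j) # drop (Suc j) q)"
    using q(1) by (subst (asm) split) (simp add: valid_path_append del: last.simps)
  moreover have "last (r # map snd (take j q)) = pv q ! j"
  proof -
    have "r # map snd (take j q) = take (Suc j) (pv q)" by (simp add: take_map)
    also have "\<dots> = take j (pv q) @ [pv q ! j]"
      by (rule take_Suc_conv_app_nth) (use assms(2) q(3) in simp)
    finally show ?thesis by (simp only: last_snoc)
  qed
  ultimately have v: "valid_path G r (take j q)" "valid_path G (pv q ! j) ((q ! j) # drop (Suc j) q)" by auto
  obtain e w where ew: "q ! j = (e, w)" by fastforce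
  show "fst (q ! j) \<in> edges G" "ends G (fst (q ! j)) = {pv q ! j, pv q ! Suc j}"
    using v(2) ew assms(2) q(3) by auto
  have "grown G b r (insert r (snd ` set (take j q)))"
    using v(1) q(2) set_take_subset[of j q] by (intro grown_valid_path) auto
  then show "grown G b r (set (take (Suc j) (pv q)))" by (simp add: take_map)
  show "b \<notin> set (pv q)" using q b by auto
  show "pv q ! j \<in> set (take (Suc j) (pv q))"
    by (rule nth_in_take) (use assms(2) q(3) in simp)
qed

lemma path_facts: "q \<in> \<Gamma> \<Longrightarrow> distinct (pv q) \<and> length (pv q) = Suc k"
  using \<Gamma>(2) by auto

text \<open>\<open>Z\<close> together with the initial segment of the path is grown and still small;
  both \<open>e\<close> and the path edge lead from it to the same outside vertex, so they are
  equal.\<close>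

lemma attack_along_path:
  assumes q: "q \<in> \<Gamma>" and Z: "grown G b r Z" "card Z + k + 1 < J" and j: "Suc j \<le> k" "pv q ! Suc j \<notin> Z"
    and e: "e \<in> edges G" "ends G e = {u, pv q ! Suc j}" "u \<in> Z"
  shows "e = fst (q ! j)" "u = pv q ! j"
proof -
  let ?Z = "Z \<union> set (take (Suc j) (pv q))" and ?v = "pv q ! Suc j"
  have jk: "j < k" using j by simp
  note pe = path_edge[OF q jk]
  have g: "grown G b r ?Z" by (rule grown_Un[OF Z(1) pe(3)])
  have "card ?Z \<le> card Z + card (set (take (Suc j) (pv q)))" by (rule card_Un_le)
  also have "card (set (take (Suc j) (pv q))) \<le> length (take (Suc j) (pv q))" by (rule card_length)
  also have "\<dots> \<le> Suc k" using j by simp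
  finally have cJ: "card ?Z < J" using Z(2) by simp
  have d: "distinct (pv q)" "length (pv q) = Suc k" using path_facts[OF q] by auto
  have "?v \<notin> set (take (Suc j) (pv q))"
    by (rule nth_notin_take[OF d(1)]) (use d j in simp)
  then have nv: "?v \<notin> ?Z" using j by simp
  have vb: "?v \<noteq> b" using pe(4) d j nth_mem[of "Suc j" "pv q"] by auto
  show "e = fst (q ! j)"
    by (rule locally_treeD[OF lt g cJ nv vb _ _ e(1) pe(1) e(2) pe(2)]) (use e(3) pe(5) in auto)
  then have "{u, ?v} = {pv q ! j, ?v}" using e(2) pe(2) by simp
  then show "u = pv q ! j" using nv e(3) by (auto simp: doubleton_eq_iff)
qed

text \<open>Were a later vertex of the path hit, red would have come from the vertex before it on
  the path, which is still white.\<close>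

lemma inv_Spread:
  assumes "inv \<sigma>" "e \<in> edges G" "ends G e = {u, w}" "\<sigma> u = Red" "\<sigma> w = White" "card (X \<sigma>) + k + 1 < J" and q: "q \<in> \<Gamma>"
    and pat: "pattern \<sigma> (pv q) i l"
  shows "w \<notin> set (pv q) \<or> (i + l \<le> k \<and> w = pv q ! (i + l))"
proof (rule ccontr)
  assume neg: "\<not> ?thesis"
  have d: "distinct (pv q)" "length (pv q) = Suc k" using path_facts[OF q] by auto
  from neg have "w \<in> set (pv q)" by blast
  then obtain j where "j < length (pv q)" "pv q ! j = w" unfolding in_set_conv_nth by blast
  then have j: "j \<le> k" "w = pv q ! j" using d(2) by simp_all
  have white: "\<not> j < i + l" using pat j assms(5) d by (auto simp: pattern_def split: if_splits)
  with neg j have jl: "i + l < j" by (metis linorder_neqE_nat)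
  then obtain j' where j': "j = Suc j'" by (cases j) auto
  have "u \<in> X \<sigma>" using assms b ends_subset[OF assms(2)] by (auto simp: X_def colored_def inv_def)
  moreover have "w \<notin> X \<sigma>" using assms ends_subset[OF assms(2)] by (auto simp: X_def colored_def)
  ultimately have "u = pv q ! j'"
    using assms j j' by (intro attack_along_path(2)[OF q, of "X \<sigma>"]) (auto simp: inv_def)
  moreover have "\<sigma> (pv q ! j') = White" using pat jl j' j d by (auto simp: pattern_def)
  ultimately show False using assms by simp
qed

lemma Y_subset_X: "Y \<sigma> \<subseteq> X \<sigma>"
  by (auto simp: X_def Y_def colored_def)

lemma finite_X: "finite (X \<sigma>)"
  using finite_verts by (auto simp: X_def)

definition chase_edge where "chase_edge q i = (if i = 0 then e0 else fst (q ! (i - 1)))"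

text \<open>The argument for red, applied to the blue set; \<open>b\<close> is treated apart, since
  its only edge leads to \<open>r\<close>. The edge is identified, and not only the vertex, so that
  at most one clock can harm a given path.\<close>

lemma inv_Chase:
  assumes "inv \<sigma>" "e \<in> edges G" "ends G e = {y, v}" "\<sigma> y = Blue" "\<sigma> v = Red" "card (X \<sigma>) + k + 1 < J" and q: "q \<in> \<Gamma>"
    and pat: "pattern \<sigma> (pv q) i l"
  shows "v \<notin> set (pv q) \<or> (0 < l \<and> v = pv q ! i \<and> e = chase_edge q i)"
proof (cases "v \<in> set (pv q)")
  case True
  have d: "distinct (pv q)" "length (pv q) = Suc k" using path_facts[OF q] by auto
  from True obtain j where "j < length (pv q)" "pv q ! j = v" unfolding in_set_conv_nth by blast
  then have j: "j \<le> k" "v = pv q ! j" using d(2) by simp_all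
  have red: "i \<le> j" "j < i + l" using pat j assms(5) d by (auto simp: pattern_def split: if_splits)
  show ?thesis
  proof (cases "y = b")
    case y: True
    then have "e = e0" using e0(3)[OF assms(2)] assms(3) by simp
    then have "v = r" using assms(3) e0(2) y b by (auto simp: doubleton_eq_iff)
    then have "j = 0" using j d nth_eq_iff_index_eq[OF d(1), of j 0] by simp
    then show ?thesis using red j \<open>e = e0\<close> by (auto simp: chase_edge_def)
  next
    case y: False
    have yY: "y \<in> Y \<sigma>" using assms y ends_subset[OF assms(2)] by (auto simp: Y_def colored_def)
    then have gY: "grown G b r (Y \<sigma>)" using assms(1) by (auto simp: inv_def)
    have vY: "v \<notin> Y \<sigma>" using assms by (auto simp: Y_def colored_def)
    have "v \<noteq> r" using vY root_in_grown[OF gY] by auto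
    then obtain j' where j': "j = Suc j'" using j by (cases j) auto
    have cY: "card (Y \<sigma>) + k + 1 < J" using card_mono[OF finite_X Y_subset_X, of \<sigma>] assms(6) by simp
    have al: "e = fst (q ! j')" "y = pv q ! j'"
      using attack_along_path[OF q gY cY, of j' e y] j j' vY assms(2,3) yY by auto
    have "\<sigma> (pv q ! j') = Blue" using al assms by simp
    then have "j' < i" using pat j' j d by (auto simp: pattern_def split: if_splits)
    then have "j = i" using red j' by simp
    then show ?thesis using al red j j' by (auto simp: chase_edge_def)
  qed
qed simp

text \<open>The second claim measures the progress of the exploration: a spread adds a vertex to
  \<open>X\<close>, a chase adds one to \<open>Y\<close>.\<close>

lemma fire_inv:
  assumes inv: "inv \<sigma>" and c: "c \<in> active G \<sigma>" and J: "card (X \<sigma>) + k + 1 < J"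
  shows "inv (fire G c \<sigma>)"
    and "card (X (fire G c \<sigma>)) + card (Y (fire G c \<sigma>)) = Suc (card (X \<sigma>) + card (Y \<sigma>))"
proof -
  have fY: "finite (Y \<sigma>)" using finite_subset[OF Y_subset_X finite_X] .
  have "inv (fire G c \<sigma>) \<and> card (X (fire G c \<sigma>)) + card (Y (fire G c \<sigma>)) = Suc (card (X \<sigma>) + card (Y \<sigma>))"
  proof (cases "snd c")
    case Spread
    then obtain e where ce: "c = (e, Spread)" by (cases c) auto
    obtain u w where uw: "e \<in> edges G" "ends G e = {u, w}" "\<sigma> u = Red" "\<sigma> w = White"
      using c unfolding ce by (rule active_SpreadE)
    have s: "fire G c \<sigma> = \<sigma>(w := Red)" using uw by (simp add: ce fire_Spread)
    have w: "w \<in> verts G" "w \<noteq> b" using uw inv ends_subset[OF uw(1)] by (auto simp: inv_def)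
    have X: "X (\<sigma>(w := Red)) = insert w (X \<sigma>)" "w \<notin> X \<sigma>" and Y: "Y (\<sigma>(w := Red)) = Y \<sigma>"
      using uw w by (auto simp: X_def Y_def colored_def)
    have "u \<in> X \<sigma>" using uw inv ends_subset[OF uw(1)] by (auto simp: X_def colored_def inv_def)
    then have g: "grown G b r (insert w (X \<sigma>))"
      using inv uw w by (intro grown_insert[of _ _ _ "X \<sigma>" e u]) (auto simp: inv_def)
    have "\<exists>i l. pattern (\<sigma>(w := Red)) (pv q) i l" if q: "q \<in> \<Gamma>" for q
    proof -
      obtain i l where pat: "pattern \<sigma> (pv q) i l" using inv q by (auto simp: inv_def)
      from inv_Spread[OF inv uw J q pat] show ?thesis
      proof
        assume nw: "w \<notin> set (pv q)"
        have "pattern (\<sigma>(w := Red)) (pv q) i l"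
          by (rule pattern_cong[OF pat]) (use nw in \<open>metis fun_upd_other\<close>)
        then show ?thesis by blast
      next
        assume "i + l \<le> k \<and> w = pv q ! (i + l)"
        then show ?thesis using pattern_Spread[OF pat] path_facts[OF q] by (metis le_imp_less_Suc)
      qed
    qed
    then have "inv (\<sigma>(w := Red))" using g inv w by (auto simp: inv_def X Y)
    then show ?thesis using X(2) finite_X[of \<sigma>] by (simp add: s X(1) Y)
  next
    case Chase
    then obtain e where ce: "c = (e, Chase)" by (cases c) auto
    obtain y v where yv: "e \<in> edges G" "ends G e = {y, v}" "\<sigma> y = Blue" "\<sigma> v = Red"
      using c unfolding ce by (rule active_ChaseE)
    have s: "fire G c \<sigma> = \<sigma>(v := Blue)" using yv by (simp add: ce fire_Chase)
    have v: "v \<in> verts G" "v \<noteq> b" using yv inv ends_subset[OF yv(1)] by (auto simp: inv_def)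
    have Y: "Y (\<sigma>(v := Blue)) = insert v (Y \<sigma>)" "v \<notin> Y \<sigma>" and X: "X (\<sigma>(v := Blue)) = X \<sigma>"
      using yv v by (auto simp: X_def Y_def colored_def)
    have g: "grown G b r (insert v (Y \<sigma>))"
    proof (cases "y = b")
      case True
      then have "e = e0" using e0(3)[OF yv(1)] yv(2) by simp
      then have "v = r" using yv(2) e0(2) True b by (auto simp: doubleton_eq_iff)
      then have "Y \<sigma> = {}" using inv Y(2) root_in_grown[of G b r "Y \<sigma>"] by (auto simp: inv_def)
      then show ?thesis using \<open>v = r\<close> by (simp add: grown_root)
    next
      case False
      then have y: "y \<in> Y \<sigma>" using yv ends_subset[OF yv(1)] by (auto simp: Y_def colored_def)
      then have "grown G b r (Y \<sigma>)" using inv by (auto simp: inv_def)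
      then show ?thesis using yv(1,2) y v(2) by (rule grown_insert)
    qed
    have "\<exists>i l. pattern (\<sigma>(v := Blue)) (pv q) i l" if q: "q \<in> \<Gamma>" for q
    proof -
      obtain i l where pat: "pattern \<sigma> (pv q) i l" using inv q by (auto simp: inv_def)
      from inv_Chase[OF inv yv J q pat] show ?thesis
      proof
        assume nv: "v \<notin> set (pv q)"
        have "pattern (\<sigma>(v := Blue)) (pv q) i l"
          by (rule pattern_cong[OF pat]) (use nv in \<open>metis fun_upd_other\<close>)
        then show ?thesis by blast
      next
        assume v: "0 < l \<and> v = pv q ! i \<and> e = chase_edge q i"
        then obtain l' where "l = Suc l'" by (cases l) auto
        then show ?thesis using pattern_Chase[of \<sigma> "pv q" i l'] pat v path_facts[OF q] by metis
      qed
    qed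
    then have "inv (\<sigma>(v := Blue))" using g inv v by (auto simp: inv_def X Y(1))
    then show ?thesis using Y(2) fY by (simp add: s X Y(1))
  qed
  then show "inv (fire G c \<sigma>)" "card (X (fire G c \<sigma>)) + card (Y (fire G c \<sigma>)) = Suc (card (X \<sigma>) + card (Y \<sigma>))"
    by auto
qed

text \<open>Off the path nothing matters. One active spread clock of rate \<open>lam\<close> surely
  advances red, and at most one chase clock of rate 1 helps blue, so the drift is at least the
  expression that vanishes by \<open>escape_prob_balance\<close>.\<close>

lemma success_prob_drift:
  assumes inv: "inv \<sigma>" and J: "card (X \<sigma>) + k + 1 < J" and q: "q \<in> \<Gamma>"
  shows "0 \<le> (\<Sum>c\<in>active G \<sigma>. clock_rate lam c * (success_prob p (fire G c \<sigma>) (pv q) - success_prob p \<sigma> (pv q)))"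
proof -
  obtain i l where pat: "pattern \<sigma> (pv q) i l" using inv q by (auto simp: inv_def)
  note d = path_facts[OF q]
  define w where "w = Suc k - (i + l)"
  have il: "i + l \<le> Suc k" using pat d by (simp add: pattern_def)
  have sp: "success_prob p \<sigma> (pv q) = escape_prob p w l"
    using success_prob_pattern[OF pat, of p] d by (simp add: w_def)
  let ?f = "\<lambda>c. success_prob p (fire G c \<sigma>) (pv q) - success_prob p \<sigma> (pv q)"
  have Spread: "?f (e, Spread) = 0 \<or> 0 < w \<and> ?f (e, Spread) = escape_prob p (w - 1) (Suc l) - escape_prob p w l"
    if act: "(e, Spread) \<in> active G \<sigma>" for e
  proof -
    obtain u x where uw: "e \<in> edges G" "ends G e = {u, x}" "\<sigma> u = Red" "\<sigma> x = White"
      using act by (rule active_SpreadE)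
    have s: "fire G (e, Spread) \<sigma> = \<sigma>(x := Red)" using uw by (simp add: fire_Spread)
    from inv_Spread[OF inv uw J q pat] show ?thesis
    proof
      assume nx: "x \<notin> set (pv q)"
      have "pattern (\<sigma>(x := Red)) (pv q) i l"
        by (rule pattern_cong[OF pat]) (use nx in \<open>metis fun_upd_other\<close>)
      then show ?thesis using success_prob_pattern[of "\<sigma>(x := Red)" "pv q" i l p] d by (simp add: s sp w_def)
    next
      assume x: "i + l \<le> k \<and> x = pv q ! (i + l)"
      then have "pattern (\<sigma>(x := Red)) (pv q) i (Suc l)" using pattern_Spread[OF pat] d by (metis le_imp_less_Suc)
      then have "success_prob p (\<sigma>(x := Red)) (pv q) = escape_prob p (w - 1) (Suc l)"
        using success_prob_pattern[of "\<sigma>(x := Red)" "pv q" i "Suc l" p] d by (simp add: w_def)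
      moreover have "0 < w" using x by (simp add: w_def)
      ultimately show ?thesis by (simp add: s sp)
    qed
  qed
  have Chase: "?f (e, Chase) = 0 \<or> (0 < l \<and> e = chase_edge q i \<and> ?f (e, Chase) = escape_prob p w (l - 1) - escape_prob p w l)"
    if act: "(e, Chase) \<in> active G \<sigma>" for e
  proof -
    obtain y v where yv: "e \<in> edges G" "ends G e = {y, v}" "\<sigma> y = Blue" "\<sigma> v = Red"
      using act by (rule active_ChaseE)
    have s: "fire G (e, Chase) \<sigma> = \<sigma>(v := Blue)" using yv by (simp add: fire_Chase)
    from inv_Chase[OF inv yv J q pat] show ?thesis
    proof
      assume nv: "v \<notin> set (pv q)"
      have "pattern (\<sigma>(v := Blue)) (pv q) i l"
        by (rule pattern_cong[OF pat]) (use nv in \<open>metis fun_upd_other\<close>)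
      then show ?thesis using success_prob_pattern[of "\<sigma>(v := Blue)" "pv q" i l p] d by (simp add: s sp w_def)
    next
      assume v: "0 < l \<and> v = pv q ! i \<and> e = chase_edge q i"
      then obtain l' where l': "l = Suc l'" by (cases l) auto
      then have "pattern (\<sigma>(v := Blue)) (pv q) (Suc i) l'" using pattern_Chase[of \<sigma> "pv q" i l'] pat v d by metis
      then have "success_prob p (\<sigma>(v := Blue)) (pv q) = escape_prob p w (l - 1)"
        using success_prob_pattern[of "\<sigma>(v := Blue)" "pv q" "Suc i" l' p] d l' by (simp add: w_def)
      then have "?f (e, Chase) = escape_prob p w (l - 1) - escape_prob p w l" by (simp only: s sp)
      then show ?thesis using v by blast
    qed
  qed
  let ?c1 = "(fst (q ! (i + l - 1)), Spread)" and ?c2 = "(chase_edge q i, Chase)"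
  have up: "0 \<le> escape_prob p (w - 1) (Suc l) - escape_prob p w l"
  proof (cases w)
    case 0 then show ?thesis by simp
  next
    case (Suc w')
    have "escape_prob p (Suc w') l \<le> escape_prob p w' l" by (rule escape_prob_Suc_steps[OF p_bounds])
    also have "\<dots> \<le> escape_prob p w' (Suc l)" by (rule escape_prob_Suc_gap[OF p_bounds])
    finally show ?thesis using Suc by simp
  qed
  have down: "0 \<le> escape_prob p w l - escape_prob p w (l - 1)"
    using escape_prob_mono_gap[OF p_bounds, of "l - 1" l w] by simp
  have f_Spread: "0 \<le> ?f (e, Spread)" if "(e, Spread) \<in> active G \<sigma>" for e
    using Spread[OF that] up by auto
  show ?thesis
  proof (cases "l = 0 \<or> w = 0")
    case True
    \<comment> \<open>Without a red vertex on the path, or without a white one, no event lowers the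
      success probability.\<close>
    have "0 \<le> ?f c" if "c \<in> active G \<sigma>" for c
    proof (cases "snd c")
      case Spread': Spread
      then show ?thesis using that f_Spread by (cases c) auto
    next
      case Chase': Chase
      then show ?thesis using that Chase[of "fst c"] True by (cases c) auto
    qed
    then show ?thesis
      by (intro sum_nonneg mult_nonneg_nonneg less_imp_le[OF clock_rate_pos[OF lam_pos]])
  next
    case False
    then have lw: "0 < l" "0 < w" by auto
    define j where "j = i + l - 1"
    have j: "i + l = Suc j" "j < k" using lw by (auto simp: j_def w_def)
    have c1: "?c1 \<in> active G \<sigma>"
    proof -
      have "\<sigma> (pv q ! j) = Red" "\<sigma> (pv q ! Suc j) = White"
        using pat j lw d by (auto simp: pattern_def)
      then show ?thesis using path_edge(1,2)[OF q j(2)] by (auto simp: active_def j_def)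
    qed
    have fc1: "?f ?c1 = escape_prob p (w - 1) (Suc l) - escape_prob p w l"
    proof -
      have wh: "\<sigma> (pv q ! j) = Red" "\<sigma> (pv q ! Suc j) = White"
        using pat j lw d by (auto simp: pattern_def)
      have s: "fire G ?c1 \<sigma> = \<sigma>(pv q ! (i + l) := Red)"
        using path_edge(2)[OF q j(2)] wh by (simp add: fire_Spread j j_def[symmetric] del: nth_Cons_Suc)
      have "pattern (\<sigma>(pv q ! (i + l) := Red)) (pv q) i (Suc l)"
        using pattern_Spread[OF pat] d j by simp
      from success_prob_pattern[OF this, of p] show ?thesis using d by (simp only: s sp) (simp add: w_def)
    qed
    \<comment> \<open>A minorant of the summands: the gain is credited to the clock
      \<open>?c1\<close> alone, the loss is confined to \<open>?c2\<close>, which need not be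
      active.\<close>
    let ?h = "\<lambda>c. if c = ?c1 then lam * (escape_prob p (w - 1) (Suc l) - escape_prob p w l)
      else if c = ?c2 then escape_prob p w (l - 1) - escape_prob p w l else 0"
    have "?h c \<le> clock_rate lam c * ?f c" if c: "c \<in> active G \<sigma>" for c
    proof (cases "snd c")
      case S: Spread
      then obtain e where ce: "c = (e, Spread)" by (cases c) auto
      then show ?thesis using f_Spread[of e] c fc1 lam_pos by (auto simp: clock_rate_def)
    next
      case C: Chase
      then obtain e where ce: "c = (e, Chase)" by (cases c) auto
      then show ?thesis using Chase[of e] c down by (auto simp: clock_rate_def)
    qed
    then have "(\<Sum>c\<in>active G \<sigma>. ?h c) \<le> (\<Sum>c\<in>active G \<sigma>. clock_rate lam c * ?f c)" by (rule sum_mono)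
    moreover have "0 \<le> (\<Sum>c\<in>active G \<sigma>. ?h c)"
    proof -
      have "(\<Sum>c\<in>active G \<sigma>. ?h c) = ?h ?c1 + (\<Sum>c\<in>active G \<sigma> - {?c1}. ?h c)"
        by (rule sum.remove[OF finite_active c1])
      also have "(\<Sum>c\<in>active G \<sigma> - {?c1}. ?h c) = (\<Sum>c\<in>active G \<sigma> - {?c1}. if c = ?c2 then escape_prob p w (l - 1) - escape_prob p w l else 0)"
        by (rule sum.cong) auto
      finally have "(\<Sum>c\<in>active G \<sigma>. ?h c) = ?h ?c1 +
        (\<Sum>c\<in>active G \<sigma> - {?c1}. if c = ?c2 then escape_prob p w (l - 1) - escape_prob p w l else 0)" .
      moreover have "escape_prob p w (l - 1) - escape_prob p w l \<le>
        (\<Sum>c\<in>active G \<sigma> - {?c1}. if c = ?c2 then escape_prob p w (l - 1) - escape_prob p w l else 0)"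
        using down finite_active[of \<sigma>] by (simp add: sum.delta)
      moreover have "?h ?c1 = lam * (escape_prob p (w - 1) (Suc l) - escape_prob p w l)" by simp
      moreover have "lam * (escape_prob p (w - 1) (Suc l) - escape_prob p w l) + (escape_prob p w (l - 1) - escape_prob p w l) = 0"
        by (rule escape_prob_balance[OF lw])
      ultimately show ?thesis by linarith
    qed
    ultimately show ?thesis by simp
  qed
qed

definition val where "val \<sigma> = (\<Sum>q\<in>\<Gamma>. success_prob p \<sigma> (pv q))"

lemma val_le: "val \<sigma> \<le> real (card \<Gamma>)"
proof -
  have "val \<sigma> \<le> (\<Sum>q\<in>\<Gamma>. 1)" unfolding val_def success_prob_def
    by (intro sum_mono escape_prob_le_1 p_bounds)
  then show ?thesis by simp
qed

text \<open>After absorption no red vertex of a path is followed by a white one, so a path whose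
  last vertex is white has success probability 0. Different paths end at different vertices, by
  \<open>valid_path_unique\<close>.\<close>

lemma val_absorbed:
  assumes "inv \<sigma>" "active G \<sigma> = {}" shows "val \<sigma> \<le> real (card (X \<sigma>))"
proof -
  let ?D = "{q \<in> \<Gamma>. \<sigma> (pv q ! k) \<noteq> White}"
  have "success_prob p \<sigma> (pv q) \<le> (if \<sigma> (pv q ! k) \<noteq> White then 1 else 0)" if q: "q \<in> \<Gamma>" for q
  proof (cases "\<sigma> (pv q ! k) = White")
    case False
    then show ?thesis using escape_prob_le_1[OF p_bounds] by (simp add: success_prob_def)
  next
    case True
    obtain i l where pat: "pattern \<sigma> (pv q) i l" using assms(1) q by (auto simp: inv_def)
    note d = path_facts[OF q]
    have il: "i + l \<le> k" using True pat d by (auto simp: pattern_def split: if_splits)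
    have "l = 0"
    proof (rule ccontr)
      assume "l \<noteq> 0"
      then obtain j where j: "i + l = Suc j" by (cases "i + l") auto
      then have jk: "j < k" using il by simp
      have "\<sigma> (pv q ! j) = Red" "\<sigma> (pv q ! Suc j) = White"
        using pat j jk \<open>l \<noteq> 0\<close> d by (auto simp: pattern_def)
      then have "(fst (q ! j), Spread) \<in> active G \<sigma>" using path_edge(1,2)[OF q jk] by (auto simp: active_def)
      then show False using assms(2) by simp
    qed
    moreover obtain w where "Suc k - (i + l) = Suc w" using il by (metis Suc_diff_le)
    ultimately show ?thesis using success_prob_pattern[OF pat, of p] d True by simp
  qed
  then have "val \<sigma> \<le> (\<Sum>q\<in>\<Gamma>. if \<sigma> (pv q ! k) \<noteq> White then 1 else 0)" unfolding val_def by (rule sum_mono)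
  also have "\<dots> = real (card ?D)" using \<Gamma>(1) by (simp add: sum.If_cases Int_def)
  also have "card ?D \<le> card (X \<sigma>)"
  proof (rule card_inj_on_le[where f = "\<lambda>q. pv q ! k"])
    show "inj_on (\<lambda>q. pv q ! k) ?D"
    proof (rule inj_onI)
      fix q q' assume q: "q \<in> ?D" "q' \<in> ?D" "pv q ! k = pv q' ! k"
      have "last (pv q) = pv q ! (length (pv q) - 1)" "last (pv q') = pv q' ! (length (pv q') - 1)"
        by (rule last_conv_nth, simp)+
      then have "last (pv q) = pv q ! k" "last (pv q') = pv q' ! k"
        using path_facts[of q] path_facts[of q'] q by (simp_all del: last.simps)
      then show "q = q'" using q \<Gamma>(2)[of q] \<Gamma>(2)[of q'] J(2)
        by (intro valid_path_unique[OF lt]) (simp_all del: last.simps)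
    qed
    show "(\<lambda>q. pv q ! k) ` ?D \<subseteq> X \<sigma>"
    proof
      fix v assume "v \<in> (\<lambda>q. pv q ! k) ` ?D"
      then obtain q where q: "q \<in> \<Gamma>" "\<sigma> (pv q ! k) \<noteq> White" "v = pv q ! k" by auto
      have "v \<in> verts G"
      proof (cases k)
        case 0 then show ?thesis using q r by simp
      next
        case (Suc k')
        then show ?thesis using path_edge(1,2)[OF q(1), of k'] ends_subset q(3) by auto
      qed
      moreover have "v \<noteq> b"
      proof -
        have "v \<in> set (pv q)" using q path_facts[of q] by (metis lessI nth_mem)
        then show ?thesis using \<Gamma>(2)[OF q(1)] b by auto
      qed
      ultimately show "v \<in> X \<sigma>" using q by (auto simp: X_def colored_def)
    qed
    show "finite (X \<sigma>)" by (rule finite_X)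
  qed
  finally show ?thesis by simp
qed

text \<open>The chain is run until \<open>X\<close> and \<open>Y\<close> together have
  \<open>2 * card \<Gamma> + 1\<close> elements. By then \<open>X\<close>, which contains
  \<open>Y\<close>, has more than \<open>card \<Gamma>\<close> elements and exceeds the trivial
  bound on \<open>val\<close>; before that, the exploration is small enough for
  \<open>fire_inv\<close>. Absorption at an earlier time is covered by
  \<open>val_absorbed\<close>.\<close>

lemma val_le_jumps:
  assumes "inv \<sigma>" "card (X \<sigma>) + card (Y \<sigma>) + m = 2 * card \<Gamma> + 1"
  shows "val \<sigma> \<le> (jump G lam ^^ m) (\<lambda>\<sigma>. real (card (X \<sigma>))) \<sigma>"
  using assms
proof (induction m arbitrary: \<sigma>)
  case 0
  have "card (Y \<sigma>) \<le> card (X \<sigma>)" by (rule card_mono[OF finite_X Y_subset_X])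
  then have "card \<Gamma> \<le> card (X \<sigma>)" using 0 by simp
  then show ?case using val_le[of \<sigma>] by simp
next
  case (Suc m)
  let ?U = "(jump G lam ^^ m) (\<lambda>\<sigma>. real (card (X \<sigma>)))"
  have cJ: "card (X \<sigma>) + k + 1 < J" using Suc.prems(2) J by simp
  have "val \<sigma> \<le> jump G lam ?U \<sigma>"
  proof (rule jump_ge)
    have "0 \<le> (\<Sum>q\<in>\<Gamma>. \<Sum>c\<in>active G \<sigma>. clock_rate lam c * (success_prob p (fire G c \<sigma>) (pv q) - success_prob p \<sigma> (pv q)))"
      by (intro sum_nonneg success_prob_drift Suc.prems(1) cJ)
    also have "\<dots> = (\<Sum>c\<in>active G \<sigma>. clock_rate lam c * (val (fire G c \<sigma>) - val \<sigma>))"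
      unfolding val_def by (subst sum.swap) (simp add: sum_distrib_left sum_subtractf right_diff_distrib)
    also have "\<dots> \<le> (\<Sum>c\<in>active G \<sigma>. clock_rate lam c * (?U (fire G c \<sigma>) - val \<sigma>))"
    proof (intro sum_mono mult_left_mono diff_right_mono)
      fix c assume c: "c \<in> active G \<sigma>"
      show "val (fire G c \<sigma>) \<le> ?U (fire G c \<sigma>)"
        by (rule Suc.IH) (use fire_inv[OF Suc.prems(1) c cJ] Suc.prems(2) in auto)
      show "0 \<le> clock_rate lam c" using clock_rate_pos[OF lam_pos, of c] by simp
    qed
    finally show "0 \<le> (\<Sum>c\<in>active G \<sigma>. clock_rate lam c * (?U (fire G c \<sigma>) - val \<sigma>))" .
    assume a: "active G \<sigma> = {}"
    have "?U \<sigma> = real (card (X \<sigma>))"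
      by (induction m) (simp_all add: jump_def a)
    then show "val \<sigma> \<le> ?U \<sigma>" using val_absorbed[OF Suc.prems(1) a] by simp
  qed
  then show ?case by simp
qed

theorem expected_ever_red_ge_paths:
  assumes \<sigma>: "\<sigma> b = Blue" "\<sigma> r = Red" "\<And>v. v \<noteq> b \<Longrightarrow> v \<noteq> r \<Longrightarrow> \<sigma> v = White"
  shows "ennreal (real (card \<Gamma>) * escape_prob p k 1) \<le> (\<integral>\<^sup>+\<omega>. of_nat (card (ever_red G \<omega> \<sigma>)) \<partial>clock_space G lam)"
proof -
  have X: "X \<sigma> = {r}" using \<sigma> r b by (auto simp: X_def colored_def)
  have "\<sigma> v = Blue \<Longrightarrow> v = b" for v using \<sigma>(2) \<sigma>(3)[of v] by (cases "v = r") auto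
  then have Y: "Y \<sigma> = {}" by (auto simp: Y_def colored_def)
  have pat: "pattern \<sigma> (pv q) 0 1" if "q \<in> \<Gamma>" for q
  proof -
    have "\<sigma> (pv q ! j) = White" if j: "j < length (pv q)" "0 < j" for j
    proof (rule \<sigma>(3))
      have "pv q ! j \<in> set (pv q)" using j by simp
      then show "pv q ! j \<noteq> b" using \<Gamma>(2)[OF \<open>q \<in> \<Gamma>\<close>] b by auto
      show "pv q ! j \<noteq> r" using nth_eq_iff_index_eq[of "pv q" j 0] \<Gamma>(2)[OF \<open>q \<in> \<Gamma>\<close>] j by auto
    qed
    then show ?thesis using \<sigma>(2) by (auto simp: pattern_def simp del: nth_Cons_Suc)
  qed
  have inv: "inv \<sigma>" using \<sigma> pat by (auto simp: inv_def X Y grown_root)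
  have "val \<sigma> = (\<Sum>q\<in>\<Gamma>. escape_prob p k 1)"
    unfolding val_def using success_prob_pattern[OF pat, of _ p] path_facts by (intro sum.cong) auto
  then have "real (card \<Gamma>) * escape_prob p k 1 = val \<sigma>" by simp
  also have "\<dots> \<le> (jump G lam ^^ (2 * card \<Gamma>)) (\<lambda>\<sigma>. real (card (X \<sigma>))) \<sigma>"
    by (rule val_le_jumps[OF inv]) (simp add: X Y)
  finally have "ennreal (real (card \<Gamma>) * escape_prob p k 1) \<le> ennreal ((jump G lam ^^ (2 * card \<Gamma>)) (\<lambda>\<sigma>. real (card (X \<sigma>))) \<sigma>)"
    by (rule ennreal_leI)
  also have "\<dots> \<le> (\<integral>\<^sup>+\<omega>. of_nat (card (ever_red G \<omega> \<sigma>)) \<partial>clock_space G lam)"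
    unfolding X_def
    by (rule expected_ever_red_ge) (use e0(1) \<open>\<And>v. \<sigma> v = Blue \<Longrightarrow> v = b\<close> in auto)
  finally show ?thesis .
qed

end

section \<open>Uniform perfect matchings\<close>

text \<open>The double factorial (n - 1)!! for even n, and 0 for odd n.\<close>

fun num_matchings :: "nat \<Rightarrow> nat" where
  "num_matchings 0 = 1"
| "num_matchings (Suc 0) = 0"
| "num_matchings (Suc (Suc n)) = Suc n * num_matchings n"

lemma finite_perfect_matchings: "finite H \<Longrightarrow> finite (perfect_matchings H)"
  by (rule finite_subset[of _ "Pow (Pow H)"]) (auto simp: perfect_matchings_def partition_on_def)

lemma perfect_matchings_remove:
  assumes "h \<in> H" "h' \<in> H" "h \<noteq> h'"
  shows "bij_betw (insert {h, h'}) (perfect_matchings (H - {h, h'})) {P \<in> perfect_matchings H. {h, h'} \<in> P}"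
proof (rule bij_betw_byWitness[where f' = "\<lambda>P. P - {{h, h'}}"])
  have nin: "{h, h'} \<notin> P" if "P \<in> perfect_matchings (H - {h, h'})" for P
    using that by (auto simp: perfect_matchings_def partition_on_def)
  show "\<forall>P\<in>perfect_matchings (H - {h, h'}). insert {h, h'} P - {{h, h'}} = P"
    using nin by auto
  show "\<forall>P\<in>{P \<in> perfect_matchings H. {h, h'} \<in> P}. insert {h, h'} (P - {{h, h'}}) = P" by auto
  show "insert {h, h'} ` perfect_matchings (H - {h, h'}) \<subseteq> {P \<in> perfect_matchings H. {h, h'} \<in> P}"
  proof
    fix Q assume "Q \<in> insert {h, h'} ` perfect_matchings (H - {h, h'})"
    then obtain P where P: "P \<in> perfect_matchings (H - {h, h'})" "Q = insert {h, h'} P" by auto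
    have "\<Union>P = H - {h, h'}" "disjoint P" "{} \<notin> P" "\<forall>e\<in>P. card e = 2"
      using P by (auto simp: perfect_matchings_def partition_on_def)
    then have "partition_on H Q"
      using assms unfolding partition_on_def P(2) by (auto simp: disjoint_def)
    then show "Q \<in> {P \<in> perfect_matchings H. {h, h'} \<in> P}"
      using P assms by (auto simp: perfect_matchings_def)
  qed
  show "(\<lambda>P. P - {{h, h'}}) ` {P \<in> perfect_matchings H. {h, h'} \<in> P} \<subseteq> perfect_matchings (H - {h, h'})"
  proof
    fix Q assume "Q \<in> (\<lambda>P. P - {{h, h'}}) ` {P \<in> perfect_matchings H. {h, h'} \<in> P}"
    then obtain P where P: "P \<in> perfect_matchings H" "{h, h'} \<in> P" "Q = P - {{h, h'}}" by auto
    have P': "\<Union>P = H" "disjoint P" "{} \<notin> P" "\<forall>e\<in>P. card e = 2"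
      using P by (auto simp: perfect_matchings_def partition_on_def)
    have "\<Union>Q = H - {h, h'}"
    proof
      show "\<Union>Q \<subseteq> H - {h, h'}"
      proof
        fix x assume "x \<in> \<Union>Q"
        then obtain e where e: "e \<in> P" "e \<noteq> {h, h'}" "x \<in> e" by (auto simp: P(3))
        then have "e \<inter> {h, h'} = {}" using P'(2) P(2) by (auto simp: disjoint_def)
        then show "x \<in> H - {h, h'}" using e P'(1) by auto
      qed
      show "H - {h, h'} \<subseteq> \<Union>Q" using P'(1) by (auto simp: P(3))
    qed
    then show "Q \<in> perfect_matchings (H - {h, h'})"
      using P' by (auto simp: perfect_matchings_def partition_on_def P(3) disjoint_def)
  qed
qed

lemma sum_perfect_matchings_edge:
  assumes "h \<in> H" "h' \<in> H" "h \<noteq> h'"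
  shows "(\<Sum>P\<in>{P \<in> perfect_matchings H. {h, h'} \<in> P}. f P) = (\<Sum>P\<in>perfect_matchings (H - {h, h'}). f (insert {h, h'} P))"
  using sum.reindex_bij_betw[OF perfect_matchings_remove[OF assms], of f] by simp

lemma card_perfect_matchings_edge:
  assumes "h \<in> H" "h' \<in> H" "h \<noteq> h'"
  shows "card {P \<in> perfect_matchings H. {h, h'} \<in> P \<and> Q P} = card {P \<in> perfect_matchings (H - {h, h'}). Q (insert {h, h'} P)}"
proof -
  have "bij_betw (insert {h, h'}) {P \<in> perfect_matchings (H - {h, h'}). Q (insert {h, h'} P)} {P \<in> perfect_matchings H. {h, h'} \<in> P \<and> Q P}"
  proof -
    have *: "bij_betw (insert {h, h'}) (perfect_matchings (H - {h, h'})) {P \<in> perfect_matchings H. {h, h'} \<in> P}"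
      by (rule perfect_matchings_remove[OF assms])
    have "insert {h, h'} ` {P \<in> perfect_matchings (H - {h, h'}). Q (insert {h, h'} P)} = {P \<in> perfect_matchings H. {h, h'} \<in> P \<and> Q P}"
    proof -
      have "{P \<in> perfect_matchings H. {h, h'} \<in> P \<and> Q P} = {P \<in> {P \<in> perfect_matchings H. {h, h'} \<in> P}. Q P}" by simp
      also have "\<dots> = {P \<in> insert {h, h'} ` perfect_matchings (H - {h, h'}). Q P}"
        unfolding bij_betw_imp_surj_on[OF *] ..
      also have "\<dots> = insert {h, h'} ` {P \<in> perfect_matchings (H - {h, h'}). Q (insert {h, h'} P)}"
        by (auto simp: image_iff)
      finally show ?thesis by (rule sym)
    qed
    from bij_betw_subset[OF * _ this] show ?thesis by blast
  qed
  from bij_betw_same_card[OF this] show ?thesis by (rule sym)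
qed

lemma perfect_matching_partner:
  assumes "P \<in> perfect_matchings H" "h \<in> H"
  shows "\<exists>!h'. h' \<in> H - {h} \<and> {h, h'} \<in> P"
proof -
  have P': "\<Union>P = H" "disjoint P" "\<forall>e\<in>P. card e = 2"
    using assms by (auto simp: perfect_matchings_def partition_on_def)
  obtain e where e: "e \<in> P" "h \<in> e" using P'(1) assms(2) by auto
  then obtain h' where h': "e = {h, h'}" "h' \<noteq> h"
    using P'(3) by (metis card_2_iff doubleton_eq_iff insertE singletonD)
  show ?thesis
  proof (rule ex1I[of _ h'])
    show "h' \<in> H - {h} \<and> {h, h'} \<in> P" using e h' P'(1) by auto
    fix g assume g: "g \<in> H - {h} \<and> {h, g} \<in> P"
    have "{h, g} = {h, h'}"
    proof (rule ccontr)
      assume "{h, g} \<noteq> {h, h'}"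
      then have "{h, g} \<inter> {h, h'} = {}" using P'(2)[unfolded disjoint_def, rule_format, of "{h, g}" "{h, h'}"] g e(1) h'(1) by simp
      then show False by simp
    qed
    then show "g = h'" using g by (auto simp: doubleton_eq_iff)
  qed
qed

text \<open>Matchings are classified by the partner of one fixed element.\<close>

lemma card_perfect_matchings: "finite H \<Longrightarrow> card (perfect_matchings H) = num_matchings (card H)"
proof (induction "card H" arbitrary: H rule: less_induct)
  case less
  show ?case
  proof (cases "H = {}")
    case True
    then have "perfect_matchings H = {{}}" by (auto simp: perfect_matchings_def partition_on_def)
    then show ?thesis using True by simp
  next
    case False
    then obtain h where h: "h \<in> H" by auto
    then obtain n where n: "card H = Suc n" using less.prems by (metis card_Suc_Diff1)
    have "perfect_matchings H = (\<Union>h'\<in>H - {h}. {P \<in> perfect_matchings H. {h, h'} \<in> P})"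
      using perfect_matching_partner[OF _ h] by blast
    then have "card (perfect_matchings H) = card (\<Union>h'\<in>H - {h}. {P \<in> perfect_matchings H. {h, h'} \<in> P})" by simp
    also have "\<dots> = (\<Sum>h'\<in>H - {h}. card {P \<in> perfect_matchings H. {h, h'} \<in> P})"
    proof (rule card_UN_disjoint)
      show "\<forall>i\<in>H - {h}. \<forall>j\<in>H - {h}. i \<noteq> j \<longrightarrow> {P \<in> perfect_matchings H. {h, i} \<in> P} \<inter> {P \<in> perfect_matchings H. {h, j} \<in> P} = {}"
        using perfect_matching_partner[OF _ h] by blast
    qed (use less.prems finite_perfect_matchings[OF less.prems] in auto)
    also have "\<dots> = (\<Sum>h'\<in>H - {h}. num_matchings (card H - 2))"
    proof (rule sum.cong[OF refl])
      fix h' assume h': "h' \<in> H - {h}"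
      have c: "card (H - {h, h'}) = card H - 2" using h h' less.prems by (subst card_Diff_subset) auto
      have "card {P \<in> perfect_matchings H. {h, h'} \<in> P} = card (perfect_matchings (H - {h, h'}))"
        using bij_betw_same_card[OF perfect_matchings_remove[of h H h']] h h' by auto
      also have "\<dots> = num_matchings (card (H - {h, h'}))"
        by (rule less.hyps) (use c n less.prems in auto)
      finally show "card {P \<in> perfect_matchings H. {h, h'} \<in> P} = num_matchings (card H - 2)" using c by simp
    qed
    also have "\<dots> = n * num_matchings (card H - 2)" using h less.prems n by simp
    also have "\<dots> = num_matchings (card H)" by (cases n) (simp_all add: n)
    finally show ?thesis .
  qed
qed

lemma num_matchings_pos: "even n \<Longrightarrow> 0 < num_matchings n"
  by (induction n rule: num_matchings.induct) auto

lemma num_matchings_rec: "2 \<le> n \<Longrightarrow> num_matchings n = (n - 1) * num_matchings (n - 2)"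
  by (cases n rule: num_matchings.cases) auto

section \<open>Paths in a uniform matching\<close>

text \<open>A path into \<open>W\<close> uses only edges that meet \<open>W\<close>; so the edge
  through which a vertex was entered can be deleted once both of its endpoints are outside
  \<open>W\<close>.\<close>

lemma npaths_cong:
  assumes "\<And>e. ends G e \<inter> W \<noteq> {} \<Longrightarrow> e \<in> edges G \<longleftrightarrow> e \<in> edges G'" "ends G = ends G'"
  shows "npaths G k u W = npaths G' k u W"
  using assms(1)
proof (induction k arbitrary: u W)
  case 0 then show ?case by simp
next
  case (Suc k)
  have h: "hops G u W = hops G' u W" using Suc.prems assms(2) by (auto simp: hops_def)
  have "npaths G k w (W - {w}) = npaths G' k w (W - {w})" for w
    by (rule Suc.IH) (use Suc.prems in auto)
  then show ?case by (simp add: h)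
qed

text \<open>As \<open>u\<close> is outside \<open>W\<close>, the two half-edges of a hop are told
  apart by their vertices, so hops correspond to ordered matched pairs.\<close>

lemma hops_config_graph:
  assumes "P \<in> perfect_matchings H" "u \<notin> W" "0 \<notin> W" "u \<noteq> 0"
  shows "bij_betw (\<lambda>(h, h'). (Matched {h, h'}, fst h')) {(h, h'). h \<in> H \<and> h' \<in> H \<and> fst h = u \<and> fst h' \<in> W \<and> {h, h'} \<in> P}
     (hops (config_graph n P) u W)"
  unfolding bij_betw_def
proof
  have P': "\<Union>P = H" "\<forall>e\<in>P. card e = 2"
    using assms by (auto simp: perfect_matchings_def partition_on_def)
  show "inj_on (\<lambda>(h, h'). (Matched {h, h'}, fst h')) {(h, h'). h \<in> H \<and> h' \<in> H \<and> fst h = u \<and> fst h' \<in> W \<and> {h, h'} \<in> P}"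
    using assms(2) by (auto simp: inj_on_def doubleton_eq_iff)
  show "(\<lambda>(h, h'). (Matched {h, h'}, fst h')) ` {(h, h'). h \<in> H \<and> h' \<in> H \<and> fst h = u \<and> fst h' \<in> W \<and> {h, h'} \<in> P}
    = hops (config_graph n P) u W"
  proof
    show "(\<lambda>(h, h'). (Matched {h, h'}, fst h')) ` {(h, h'). h \<in> H \<and> h' \<in> H \<and> fst h = u \<and> fst h' \<in> W \<and> {h, h'} \<in> P}
      \<subseteq> hops (config_graph n P) u W"
      by (auto simp: hops_def config_graph_def)
    show "hops (config_graph n P) u W \<subseteq> (\<lambda>(h, h'). (Matched {h, h'}, fst h')) `
      {(h, h'). h \<in> H \<and> h' \<in> H \<and> fst h = u \<and> fst h' \<in> W \<and> {h, h'} \<in> P}"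
    proof
      fix z assume z: "z \<in> hops (config_graph n P) u W"
      obtain e w where ew: "z = (e, w)" by fastforce
      have e: "e \<in> insert Chaser_Edge (Matched ` P)" "w \<in> W" "endpoints e = {u, w}"
        using z by (auto simp: ew hops_def config_graph_def)
      have "e \<noteq> Chaser_Edge" using e assms by (auto simp: doubleton_eq_iff)
      then obtain q where q: "e = Matched q" "q \<in> P" using e by auto
      then obtain g g' where g: "q = {g, g'}" "g \<noteq> g'" using P'(2) by (metis card_2_iff)
      have "g \<in> H" "g' \<in> H" using g q P'(1) by auto
      moreover have "fst g = u \<and> fst g' = w \<or> fst g' = u \<and> fst g = w"
        using e(3) q g by (auto simp: doubleton_eq_iff)
      ultimately obtain h h' where h: "h \<in> H" "h' \<in> H" "fst h = u" "fst h' = w" "q = {h, h'}"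
        using g(1) by (metis insert_commute)
      show "z \<in> (\<lambda>(h, h'). (Matched {h, h'}, fst h')) `
        {(h, h'). h \<in> H \<and> h' \<in> H \<and> fst h = u \<and> fst h' \<in> W \<and> {h, h'} \<in> P}"
        by (rule image_eqI[of _ _ "(h, h')"]) (use h q e(2) ew in auto)
    qed
  qed
qed

text \<open>The expected number of paths of length \<open>k\<close> into \<open>W\<close> from a vertex with \<open>c\<close> unmatched half-edges,
  when \<open>L\<close> half-edges are matched uniformly, \<open>d w\<close> of them at \<open>w\<close>.\<close>

fun mean_paths :: "(nat \<Rightarrow> nat) \<Rightarrow> nat \<Rightarrow> nat \<Rightarrow> nat \<Rightarrow> nat set \<Rightarrow> real" where
  "mean_paths d 0 c L W = 1"
| "mean_paths d (Suc k) c L W = (\<Sum>w\<in>W. real c * real (d w) / real (L - 1) * mean_paths d k (d w - 1) (L - 2) (W - {w}))"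

text \<open>Exposing one matched pair leaves a uniform matching of the other half-edges, in which
  the vertex just entered has one half-edge fewer; this is the recursion of
  \<open>mean_paths\<close>.\<close>

lemma sum_npaths_matchings:
  assumes "finite H" "even (card H)" "u \<notin> W" "0 \<notin> W" "u \<noteq> 0" "finite W"
    "\<And>w. w \<in> W \<Longrightarrow> card {h \<in> H. fst h = w} = d w" "card {h \<in> H. fst h = u} = c"
  shows "(\<Sum>P\<in>perfect_matchings H. real (npaths (config_graph n P) k u W)) = real (num_matchings (card H)) * mean_paths d k c (card H) W"
  using assms
proof (induction k arbitrary: H u W c)
  case 0
  then show ?case by (simp add: card_perfect_matchings)
next
  case (Suc k)
  let ?Hu = "{h \<in> H. fst h = u}" and ?HW = "{h \<in> H. fst h \<in> W}" and ?N = "real (num_matchings (card H - 2))"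
  have fin: "finite ?Hu" "finite ?HW" "finite (perfect_matchings H)"
    using Suc.prems finite_perfect_matchings by auto
  have "(\<Sum>P\<in>perfect_matchings H. real (npaths (config_graph n P) (Suc k) u W))
    = (\<Sum>P\<in>perfect_matchings H. \<Sum>(h, h')\<in>?Hu \<times> ?HW. if {h, h'} \<in> P then real (npaths (config_graph n P) k (fst h') (W - {fst h'})) else 0)"
  proof (rule sum.cong[OF refl])
    fix P assume P: "P \<in> perfect_matchings H"
    let ?S = "{(h, h'). h \<in> H \<and> h' \<in> H \<and> fst h = u \<and> fst h' \<in> W \<and> {h, h'} \<in> P}"
    have "real (npaths (config_graph n P) (Suc k) u W) = (\<Sum>(e, w)\<in>hops (config_graph n P) u W. real (npaths (config_graph n P) k w (W - {w})))"
      by (simp add: case_prod_beta)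
    also have "\<dots> = (\<Sum>(h, h')\<in>?S. real (npaths (config_graph n P) k (fst h') (W - {fst h'})))"
      using sum.reindex_bij_betw[OF hops_config_graph[OF P Suc.prems(3-5)], of "\<lambda>(e, w). real (npaths (config_graph n P) k w (W - {w}))" n]
      by (simp add: case_prod_beta)
    also have "?S = {z \<in> ?Hu \<times> ?HW. (case z of (h, h') \<Rightarrow> {h, h'} \<in> P)}" by auto
    also have "(\<Sum>(h, h')\<in>{z \<in> ?Hu \<times> ?HW. (case z of (h, h') \<Rightarrow> {h, h'} \<in> P)}. real (npaths (config_graph n P) k (fst h') (W - {fst h'})))
      = (\<Sum>z\<in>?Hu \<times> ?HW. if (case z of (h, h') \<Rightarrow> {h, h'} \<in> P) then (case z of (h, h') \<Rightarrow> real (npaths (config_graph n P) k (fst h') (W - {fst h'}))) else 0)"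
      by (rule sum.inter_filter) (use fin in auto)
    finally show "real (npaths (config_graph n P) (Suc k) u W) =
      (\<Sum>(h, h')\<in>?Hu \<times> ?HW. if {h, h'} \<in> P then real (npaths (config_graph n P) k (fst h') (W - {fst h'})) else 0)"
      by (simp add: case_prod_beta cong: if_cong)
  qed
  also have "\<dots> = (\<Sum>(h, h')\<in>?Hu \<times> ?HW. \<Sum>P\<in>perfect_matchings H. if {h, h'} \<in> P then real (npaths (config_graph n P) k (fst h') (W - {fst h'})) else 0)"
    by (subst sum.swap) (simp add: case_prod_beta)
  also have "\<dots> = (\<Sum>(h, h')\<in>?Hu \<times> ?HW. ?N * mean_paths d k (d (fst h') - 1) (card H - 2) (W - {fst h'}))"
  proof (rule sum.cong[OF refl])
    fix z assume z: "z \<in> ?Hu \<times> ?HW"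
    obtain h h' where hh: "z = (h, h')" by (rule prod.exhaust)
    have h: "h \<in> H" "fst h = u" "h' \<in> H" "fst h' \<in> W" using z by (auto simp: hh)
    let ?w = "fst h'" and ?H = "H - {h, h'}"
    have ne: "h \<noteq> h'" and w0: "fst h' \<noteq> 0" using h Suc.prems(3,4) by metis+
    have c: "card ?H = card H - 2" using h ne Suc.prems(1) by (subst card_Diff_subset) auto
    have "(\<Sum>P\<in>perfect_matchings H. if {h, h'} \<in> P then real (npaths (config_graph n P) k ?w (W - {?w})) else 0)
      = (\<Sum>P\<in>{P \<in> perfect_matchings H. {h, h'} \<in> P}. real (npaths (config_graph n P) k ?w (W - {?w})))"
      by (rule sum.inter_filter[symmetric]) (rule fin)
    also have "\<dots> = (\<Sum>P\<in>perfect_matchings ?H. real (npaths (config_graph n (insert {h, h'} P)) k ?w (W - {?w})))"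
      by (rule sum_perfect_matchings_edge) (use h ne in auto)
    also have "\<dots> = (\<Sum>P\<in>perfect_matchings ?H. real (npaths (config_graph n P) k ?w (W - {?w})))"
    proof (rule sum.cong[OF refl], rule arg_cong[where f = real], rule npaths_cong)
      fix P e
      show "ends (config_graph n (insert {h, h'} P)) = ends (config_graph n P)" by (simp add: config_graph_def)
      assume "ends (config_graph n (insert {h, h'} P)) e \<inter> (W - {?w}) \<noteq> {}"
      then have "e \<noteq> Matched {h, h'}" using h Suc.prems(3) by (auto simp: config_graph_def)
      then show "e \<in> edges (config_graph n (insert {h, h'} P)) \<longleftrightarrow> e \<in> edges (config_graph n P)"
        by (auto simp: config_graph_def)
    qed
    also have "\<dots> = real (num_matchings (card ?H)) * mean_paths d k (d ?w - 1) (card ?H) (W - {?w})"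
    proof (rule Suc.IH)
      show "even (card ?H)" using c Suc.prems(2) by simp
      show "card {g \<in> ?H. fst g = ?w} = d ?w - 1"
      proof -
        have "{g \<in> ?H. fst g = ?w} = {g \<in> H. fst g = ?w} - {h'}" using h Suc.prems(3) by auto
        then show ?thesis using Suc.prems(7)[OF h(4)] h Suc.prems(1) by (simp add: card_Diff_singleton)
      qed
      fix x assume x: "x \<in> W - {?w}"
      have "{g \<in> ?H. fst g = x} = {g \<in> H. fst g = x}" using h x Suc.prems(3) by auto
      then show "card {g \<in> ?H. fst g = x} = d x" using Suc.prems(7)[of x] x by simp
    qed (use Suc.prems h w0 in auto)
    finally show "(case z of (h, h') \<Rightarrow> \<Sum>P\<in>perfect_matchings H. if {h, h'} \<in> P then real (npaths (config_graph n P) k (fst h') (W - {fst h'})) else 0)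
      = (case z of (h, h') \<Rightarrow> ?N * mean_paths d k (d (fst h') - 1) (card H - 2) (W - {fst h'}))"
      by (simp only: hh prod.case c)
  qed
  also have "\<dots> = real c * (\<Sum>h'\<in>?HW. ?N * mean_paths d k (d (fst h') - 1) (card H - 2) (W - {fst h'}))"
    using Suc.prems(8) by (simp add: sum.cartesian_product[symmetric])
  also have "(\<Sum>h'\<in>?HW. ?N * mean_paths d k (d (fst h') - 1) (card H - 2) (W - {fst h'}))
    = (\<Sum>w\<in>W. \<Sum>h'\<in>{h' \<in> ?HW. fst h' = w}. ?N * mean_paths d k (d (fst h') - 1) (card H - 2) (W - {fst h'}))"
    by (rule sum.group[symmetric]) (use fin Suc.prems in auto)
  also have "\<dots> = (\<Sum>w\<in>W. real (d w) * (?N * mean_paths d k (d w - 1) (card H - 2) (W - {w})))"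
  proof (rule sum.cong[OF refl])
    fix w assume w: "w \<in> W"
    have "{h' \<in> ?HW. fst h' = w} = {h \<in> H. fst h = w}" using w by auto
    then show "(\<Sum>h'\<in>{h' \<in> ?HW. fst h' = w}. ?N * mean_paths d k (d (fst h') - 1) (card H - 2) (W - {fst h'}))
      = real (d w) * (?N * mean_paths d k (d w - 1) (card H - 2) (W - {w}))"
      using Suc.prems(7)[OF w] by simp
  qed
  also have "real c * \<dots> = real (num_matchings (card H)) * mean_paths d (Suc k) c (card H) W"
  proof (cases "c = 0 \<or> (\<forall>w\<in>W. d w = 0)")
    case True then show ?thesis by auto
  next
    case False
    then obtain w where w: "w \<in> W" "d w \<noteq> 0" "c \<noteq> 0" by auto
    \<comment> \<open>Otherwise both sides vanish. Here \<open>u\<close> and \<open>w\<close> carry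
      different half-edges, which gives \<open>2 \<le> card H\<close> for the recursion of
      \<open>num_matchings\<close>.\<close>
    have "card ?Hu + card {h \<in> H. fst h = w} = card (?Hu \<union> {h \<in> H. fst h = w})"
      using w Suc.prems(1,3) by (intro card_Un_disjoint[symmetric]) auto
    also have "\<dots> \<le> card H" using Suc.prems(1) by (intro card_mono) auto
    finally have "2 \<le> card H" using Suc.prems(7)[OF w(1)] Suc.prems(8) w by simp
    then show ?thesis
      by (simp add: num_matchings_rec[of "card H"] sum_distrib_left mult_ac)
  qed
  finally show ?case .
qed

section \<open>The expected number of paths from above\<close>

definition dlists :: "nat \<Rightarrow> 'a set \<Rightarrow> 'a list set" where
  "dlists k W = {ws. length ws = k \<and> distinct ws \<and> set ws \<subseteq> W}"

lemma finite_dlists: "finite W \<Longrightarrow> finite (dlists k W)"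
  by (rule finite_subset[OF _ finite_lists_length_eq[of W k]]) (auto simp: dlists_def)

lemma dlists_0 [simp]: "dlists 0 W = {[]}"
  by (auto simp: dlists_def)

lemma sum_dlists_Cons:
  assumes "finite W"
  shows "(\<Sum>ws\<in>dlists (Suc k) W. f ws) = (\<Sum>w\<in>W. \<Sum>ws\<in>dlists k (W - {w}). f (w # ws))"
proof -
  have "(\<Sum>ws\<in>dlists (Suc k) W. f ws) = (\<Sum>(w, ws)\<in>(SIGMA w:W. dlists k (W - {w})). f (w # ws))"
    by (rule sum.reindex_bij_witness[where i = "\<lambda>(w, ws). w # ws" and j = "\<lambda>ws. (hd ws, tl ws)"])
       (auto simp: dlists_def length_Suc_conv)
  then show ?thesis using assms by (simp add: sum.Sigma finite_dlists)
qed

lemma sum_dlists_snoc: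
  assumes "finite W"
  shows "(\<Sum>ws\<in>dlists (Suc k) W. f ws) = (\<Sum>ws\<in>dlists k W. \<Sum>w\<in>W - set ws. f (ws @ [w]))"
proof -
  have "(\<Sum>ws\<in>dlists (Suc k) W. f ws) = (\<Sum>(ws, w)\<in>(SIGMA ws:dlists k W. W - set ws). f (ws @ [w]))"
    by (rule sum.reindex_bij_witness[where i = "\<lambda>(ws, w). ws @ [w]" and j = "\<lambda>ws. (butlast ws, last ws)"])
       (auto simp: dlists_def length_Suc_conv_rev)
  then show ?thesis using assms by (simp add: sum.Sigma finite_dlists)
qed

lemma dlists_empty: "finite W \<Longrightarrow> card W < k \<Longrightarrow> dlists k W = {}"
proof -
  assume W: "finite W" "card W < k"
  have "length ws \<le> card W" if "distinct ws" "set ws \<subseteq> W" for ws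
    using card_mono[OF W(1) that(2)] distinct_card[OF that(1)] by simp
  then show ?thesis using W(2) by (fastforce simp: dlists_def)
qed

text \<open>At each inner vertex of a path there are \<open>d w\<close> choices for the half-edge of
  arrival and \<open>d w - 1\<close> for that of departure.\<close>

definition steps_weight :: "(nat \<Rightarrow> nat) \<Rightarrow> nat list \<Rightarrow> nat" where
  "steps_weight d ws = (\<Prod>w\<leftarrow>ws. d w * (d w - 1))"

text \<open>Every half-edge is matched to at most one vertex, so the last step of a path costs nothing.\<close>

lemma mean_paths_le:
  assumes "finite W" "c + sum d W \<le> L"
  shows "mean_paths d (Suc k) c L W \<le>
    (\<Sum>ws\<in>dlists k W. real c * real (steps_weight d ws) / (\<Prod>i<k. real (L - (2 * i + 1))))"
  using assms
proof (induction k arbitrary: c L W)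
  case 0
  have "(\<Sum>w\<in>W. real c * real (d w) / real (L - 1)) \<le> real c"
  proof (cases "c = 0")
    case False
    have "(\<Sum>w\<in>W. real c * real (d w) / real (L - 1)) = real c * (real (sum d W) / real (L - 1))"
      by (simp add: sum_distrib_left sum_divide_distrib)
    also have "real (sum d W) / real (L - 1) \<le> 1"
    proof -
      define M where "M = L - 1"
      have "sum d W \<le> M" using 0 False by (simp add: M_def)
      then show ?thesis unfolding M_def[symmetric] by (cases "M = 0") (simp_all add: divide_le_eq_1 del: of_nat_sum)
    qed
    finally show ?thesis by (simp add: mult_left_mono)
  qed simp
  then show ?case by (simp add: steps_weight_def)
next
  case (Suc k)
  show ?case
  proof (cases "c = 0")
    case True then show ?thesis by (simp add: sum_nonneg)
  next
    case False
    have "mean_paths d (Suc (Suc k)) c L W = (\<Sum>w\<in>W. real c * real (d w) / real (L - 1) * mean_paths d (Suc k) (d w - 1) (L - 2) (W - {w}))"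
      by simp
    also have "\<dots> \<le> (\<Sum>w\<in>W. real c * real (d w) / real (L - 1) * (\<Sum>ws\<in>dlists k (W - {w}).
        real (d w - 1) * real (steps_weight d ws) / (\<Prod>i<k. real (L - 2 - (2 * i + 1)))))"
    proof (rule sum_mono)
      fix w assume w: "w \<in> W"
      show "real c * real (d w) / real (L - 1) * mean_paths d (Suc k) (d w - 1) (L - 2) (W - {w})
        \<le> real c * real (d w) / real (L - 1) * (\<Sum>ws\<in>dlists k (W - {w}).
        real (d w - 1) * real (steps_weight d ws) / (\<Prod>i<k. real (L - 2 - (2 * i + 1))))"
      proof (cases "d w = 0")
        case dw: False
        have "sum d W = d w + sum d (W - {w})" using w Suc.prems(1) by (simp add: sum.remove)
        then have "d w - 1 + sum d (W - {w}) \<le> L - 2" using Suc.prems(2) False dw by linarith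
        then show ?thesis using Suc.prems(1) by (intro mult_left_mono Suc.IH) auto
      qed simp
    qed
    also have "\<dots> = (\<Sum>w\<in>W. \<Sum>ws\<in>dlists k (W - {w}).
        real c * real (steps_weight d (w # ws)) / (\<Prod>i<Suc k. real (L - (2 * i + 1))))"
    proof (intro sum.cong refl)
      fix w
      have eq: "(\<Prod>i<Suc k. real (L - (2 * i + 1))) = real (L - 1) * (\<Prod>i<k. real (L - 2 - (2 * i + 1)))"
        by (subst prod.lessThan_Suc_shift) (simp add: algebra_simps)
      show "real c * real (d w) / real (L - 1) * (\<Sum>ws\<in>dlists k (W - {w}).
        real (d w - 1) * real (steps_weight d ws) / (\<Prod>i<k. real (L - 2 - (2 * i + 1)))) =
        (\<Sum>ws\<in>dlists k (W - {w}). real c * real (steps_weight d (w # ws)) / (\<Prod>i<Suc k. real (L - (2 * i + 1))))"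
        unfolding sum_distrib_left eq by (intro sum.cong refl) (simp add: steps_weight_def)
    qed
    also have "\<dots> = (\<Sum>ws\<in>dlists (Suc k) W. real c * real (steps_weight d ws) / (\<Prod>i<Suc k. real (L - (2 * i + 1))))"
      by (rule sum_dlists_Cons[symmetric]) fact
    finally show ?thesis .
  qed
qed

section \<open>Averaging over the degrees\<close>

lemma expectation_coordinate:
  assumes "finite I" "v \<in> I"
  shows "(\<integral>\<^sup>+d. f (d v) \<partial>Pi_pmf I z (\<lambda>_. D)) = (\<integral>\<^sup>+k. f k \<partial>D)"
  using nn_integral_map_pmf[of "\<lambda>d. d v" "Pi_pmf I z (\<lambda>_. D)" f] Pi_pmf_component[of I v z "\<lambda>_. D"] assms by simp

text \<open>Replacing one coordinate by an independent copy preserves the law, so one degree can be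
  integrated out while the others stay fixed.\<close>

lemma Pi_pmf_resample:
  fixes f :: "('a \<Rightarrow> 'b) \<Rightarrow> ennreal"
  assumes "finite I" "v \<in> I"
  shows "(\<integral>\<^sup>+d. f d \<partial>Pi_pmf I z p) = (\<integral>\<^sup>+d. (\<integral>\<^sup>+x. f (d(v := x)) \<partial>p v) \<partial>Pi_pmf I z p)"
proof -
  have I: "I = insert v (I - {v})" using assms by auto
  have *: "Pi_pmf I z p = do {g \<leftarrow> Pi_pmf (I - {v}) z p; y \<leftarrow> p v; return_pmf (g(v := y))}"
    by (subst I, subst Pi_pmf_insert') (use assms in \<open>auto simp: bind_commute_pmf[of "p v"]\<close>)
  show ?thesis unfolding * by simp
qed

text \<open>Chebyshev's association inequality under the size-biased law of \<open>D\<close>: compare \<open>G k\<close> with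
  \<open>G t\<close>, where \<open>t\<close> is the threshold at which \<open>k - 1 - a\<close> changes sign.\<close>

lemma size_biased_association:
  fixes D :: "nat pmf" and G :: "nat \<Rightarrow> ennreal"
  assumes a: "0 \<le> a" "(\<integral>\<^sup>+k. of_nat (k * (k - 1)) \<partial>D) = ennreal a * (\<integral>\<^sup>+k. of_nat k \<partial>D)"
    and fin: "(\<integral>\<^sup>+k. of_nat k \<partial>D) < \<infinity>" and G: "antimono G" "\<And>k. 1 \<le> k \<Longrightarrow> G k < \<top>"
  shows "(\<integral>\<^sup>+k. of_nat (k * (k - 1)) * G k \<partial>D) \<le> ennreal a * (\<integral>\<^sup>+k. of_nat k * G k \<partial>D)"
proof -
  \<comment> \<open>The least natural number above \<open>a\<close>: \<open>k - 1 \<le> a\<close>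
    for \<open>k \<le> t\<close>, and \<open>k - 1 \<ge> a\<close> beyond. It is positive, so
    \<open>G t\<close> is finite.\<close>
  define t where "t = Suc (nat \<lfloor>a\<rfloor>)"
  let ?m1 = "\<integral>\<^sup>+k. of_nat k \<partial>D"
  \<comment> \<open>This is k (k - 1 - a) (G k - G t) \<le> 0, with the negative terms moved to the
    other side to avoid subtraction in \<open>ennreal\<close>.\<close>
  have pw: "of_nat (k * (k - 1)) * G k + ennreal a * of_nat k * G t \<le> ennreal a * (of_nat k * G k) + of_nat (k * (k - 1)) * G t" for k
  proof -
    have ak: "ennreal a * of_nat k = ennreal (a * real k)"
      using a(1) by (simp add: ennreal_of_nat_eq_real_of_nat ennreal_mult')
    have kk: "of_nat (k * (k - 1)) = ennreal (real (k * (k - 1)))" by (simp only: ennreal_of_nat_eq_real_of_nat)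
    show ?thesis
    proof (cases "k \<le> t")
      case True
      have "real (k - 1) \<le> a" using True a(1) by (auto simp: t_def) linarith
      then have "real k * real (k - 1) \<le> real k * a" by (intro mult_left_mono) auto
      then have "of_nat (k * (k - 1)) \<le> ennreal a * of_nat k"
        unfolding ak kk by (intro ennreal_leI) (simp add: mult.commute)
      then obtain \<delta> where \<delta>: "ennreal a * of_nat k = of_nat (k * (k - 1)) + \<delta>" unfolding le_iff_add by blast
      have "G t \<le> G k" using True G(1) by (simp add: antimonoD)
      then have "\<delta> * G t \<le> \<delta> * G k" by (rule mult_left_mono) simp
      then show ?thesis unfolding mult.assoc[symmetric] \<delta> distrib_right by (simp add: add_ac add_left_mono)
    next
      case False
      have "a \<le> real (k - 1)" using False a(1) by (auto simp: t_def) linarith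
      then have "real k * a \<le> real k * real (k - 1)" by (intro mult_left_mono) auto
      then have "ennreal a * of_nat k \<le> of_nat (k * (k - 1))"
        unfolding ak kk by (intro ennreal_leI) (simp add: mult.commute)
      then obtain \<delta> where \<delta>: "of_nat (k * (k - 1)) = ennreal a * of_nat k + \<delta>" unfolding le_iff_add by blast
      have "G k \<le> G t" using False G(1) by (simp add: antimonoD)
      then have "\<delta> * G k \<le> \<delta> * G t" by (rule mult_left_mono) simp
      then show ?thesis unfolding mult.assoc[symmetric] \<delta> distrib_right by (simp add: add_ac add_left_mono)
    qed
  qed
  have "(\<integral>\<^sup>+k. of_nat (k * (k - 1)) * G k \<partial>D) + ennreal a * ?m1 * G t
    = (\<integral>\<^sup>+k. of_nat (k * (k - 1)) * G k + ennreal a * of_nat k * G t \<partial>D)"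
    by (simp add: nn_integral_add nn_integral_cmult nn_integral_multc)
  also have "\<dots> \<le> (\<integral>\<^sup>+k. ennreal a * (of_nat k * G k) + of_nat (k * (k - 1)) * G t \<partial>D)"
    by (intro nn_integral_mono pw)
  also have "\<dots> = ennreal a * (\<integral>\<^sup>+k. of_nat k * G k \<partial>D) + ennreal a * ?m1 * G t"
    using a(2) by (simp add: nn_integral_add nn_integral_cmult nn_integral_multc)
  finally have "(\<integral>\<^sup>+k. of_nat (k * (k - 1)) * G k \<partial>D) + ennreal a * ?m1 * G t \<le> ennreal a * (\<integral>\<^sup>+k. of_nat k * G k \<partial>D) + ennreal a * ?m1 * G t" .
  moreover have "ennreal a * ?m1 * G t < \<top>"
    using fin G(2)[of t] by (simp add: ennreal_mult_less_top t_def)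
  ultimately show ?thesis
    using ennreal_add_left_cancel_le[of "ennreal a * ?m1 * G t"] by (auto simp: add.commute less_top)
qed

text \<open>The product of \<open>g L\<close> and the inverses of \<nu>(L) - (s + 2 i) for i < k,
  that is, the denominators of k matching steps as a function of the total degree. \<nu> allows for
  the parity correction, \<open>s\<close> is the initial offset.\<close>

fun matching_weight :: "(nat \<Rightarrow> ennreal) \<Rightarrow> (nat \<Rightarrow> nat) \<Rightarrow> nat \<Rightarrow> nat \<Rightarrow> nat \<Rightarrow> ennreal" where
  "matching_weight g \<nu> s 0 L = g L"
| "matching_weight g \<nu> s (Suc k) L = matching_weight g \<nu> s k L * inverse (of_nat (\<nu> L - (s + 2 * k)))"

text \<open>Holds down to 0, because \<open>inverse 0\<close> is infinite in \<open>ennreal\<close>.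
  The price is that finiteness of the weights has to be tracked separately.\<close>

lemma inverse_of_nat_antimono: "m \<le> n \<Longrightarrow> inverse (of_nat n :: ennreal) \<le> inverse (of_nat m)"
  by (cases "m = 0") (auto simp: ennreal_of_nat_eq_real_of_nat inverse_ennreal intro!: ennreal_leI le_imp_inverse_le)

lemma matching_weight_antimono:
  assumes "antimono g" "mono \<nu>" shows "antimono (matching_weight g \<nu> s k)"
proof (induction k)
  case 0 then show ?case using assms(1) by (auto simp: antimono_def)
next
  case (Suc k)
  show ?case
  proof (rule antimonoI)
    fix L L' :: nat assume "L \<le> L'"
    then show "matching_weight g \<nu> s (Suc k) L' \<le> matching_weight g \<nu> s (Suc k) L"
      using Suc assms(2) by (auto intro!: mult_mono inverse_of_nat_antimono diff_le_mono simp: antimono_def mono_def)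
  qed
qed

lemma matching_weight_finite:
  assumes "\<And>L. 1 \<le> L \<Longrightarrow> g L < \<top>" "\<And>L. L \<le> \<nu> L" "s + 2 * k \<le> L + 1" "1 \<le> L"
  shows "matching_weight g \<nu> s k L < \<top>"
  using assms(3)
proof (induction k)
  case 0 then show ?case using assms by simp
next
  case (Suc k)
  have "\<nu> L - (s + 2 * k) \<noteq> 0" using assms(2)[of L] Suc.prems by auto
  then have "inverse (of_nat (\<nu> L - (s + 2 * k)) :: ennreal) < \<top>"
    by (subst less_top[symmetric]) (simp only: ennreal_inverse_eq_top_iff of_nat_eq_0_iff not_False_eq_True)
  then show ?case using Suc by (simp add: ennreal_mult_less_top)
qed

lemma steps_weight_pos:
  assumes "steps_weight d ws \<noteq> 0" "distinct ws" shows "2 * length ws \<le> sum d (set ws)"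
  using assms by (induction ws) (auto simp: steps_weight_def)

lemma steps_weight_snoc: "steps_weight d (ws @ [w]) = steps_weight d ws * (d w * (d w - 1))"
  by (simp add: steps_weight_def)

lemma steps_weight_upd: "w \<notin> set ws \<Longrightarrow> steps_weight (d(w := x)) ws = steps_weight d ws"
  unfolding steps_weight_def by (rule arg_cong[where f = prod_list]) auto

lemma of_nat_mult_inverse_le:
  assumes "x \<le> y" shows "of_nat x * inverse (of_nat y) \<le> (1 :: ennreal)"
proof (cases "y = 0")
  case True then show ?thesis using assms by simp
next
  case False
  have "of_nat x * inverse (of_nat y) \<le> of_nat y * inverse (of_nat y :: ennreal)"
    using assms by (intro mult_right_mono) auto
  also have "\<dots> = 1"
    using False ennreal_divide_self[of "of_nat y"] of_nat_less_top[of y] by (simp add: divide_ennreal_def)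
  finally show ?thesis .
qed

text \<open>The moment identity says that \<open>a\<close> is the mean of D - 1 under the
  size-biased law of D.\<close>

locale degree_law =
  fixes D :: "nat pmf" and a :: real
  assumes a: "0 \<le> a" "(\<integral>\<^sup>+k. of_nat (k * (k - 1)) \<partial>D) = ennreal a * (\<integral>\<^sup>+k. of_nat k \<partial>D)"
    and fin: "(\<integral>\<^sup>+k. of_nat k \<partial>D) < \<infinity>"
begin

abbreviation "degs I \<equiv> Pi_pmf I 0 (\<lambda>_. D)"

text \<open>Resampling the degree of \<open>w\<close> collects its weight and its share of the total
  degree in one integral over \<open>D\<close>, where the association inequality replaces the factor
  \<open>d w - 1\<close> by \<open>a\<close>.\<close>

lemma peel_vertex:
  fixes K :: "nat \<Rightarrow> ennreal"
  fixes I :: "nat set"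
  assumes I: "finite I" "w \<in> I" and K: "antimono K"
    and Q: "\<And>d x. Q (d(w := x)) = Q d"
    and Kfin: "\<And>d x. Q d \<noteq> 0 \<Longrightarrow> 1 \<le> x \<Longrightarrow> K (x + sum d (I - {w})) < \<top>"
  shows "(\<integral>\<^sup>+d. Q d * of_nat (d w * (d w - 1)) * K (sum d I) \<partial>degs I) \<le> ennreal a * (\<integral>\<^sup>+d. Q d * of_nat (d w) * K (sum d I) \<partial>degs I)"
proof -
  have s: "sum (d(w := x)) I = x + sum d (I - {w})" for d :: "nat \<Rightarrow> nat" and x
    using I by (simp add: sum.remove)
  have "(\<integral>\<^sup>+d. Q d * of_nat (d w * (d w - 1)) * K (sum d I) \<partial>degs I)
    = (\<integral>\<^sup>+d. (\<integral>\<^sup>+x. Q d * (of_nat (x * (x - 1)) * K (x + sum d (I - {w}))) \<partial>D) \<partial>degs I)"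
    by (subst Pi_pmf_resample[OF I]) (simp only: s Q fun_upd_same mult.assoc)
  also have "\<dots> = (\<integral>\<^sup>+d. Q d * (\<integral>\<^sup>+x. of_nat (x * (x - 1)) * K (x + sum d (I - {w})) \<partial>D) \<partial>degs I)"
    by (intro nn_integral_cong nn_integral_cmult) simp
  also have "\<dots> \<le> (\<integral>\<^sup>+d. Q d * (ennreal a * (\<integral>\<^sup>+x. of_nat x * K (x + sum d (I - {w})) \<partial>D)) \<partial>degs I)"
  proof (rule nn_integral_mono)
    fix d
    show "Q d * (\<integral>\<^sup>+x. of_nat (x * (x - 1)) * K (x + sum d (I - {w})) \<partial>D) \<le> Q d * (ennreal a * (\<integral>\<^sup>+x. of_nat x * K (x + sum d (I - {w})) \<partial>D))"
    proof (cases "Q d = 0")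
      case False
      show ?thesis
      proof (intro mult_left_mono size_biased_association a fin)
        show "antimono (\<lambda>x. K (x + sum d (I - {w})))" using K by (auto simp: antimono_def)
      qed (use Kfin False in auto)
    qed simp
  qed
  also have "\<dots> = ennreal a * (\<integral>\<^sup>+d. (\<integral>\<^sup>+x. Q d * (of_nat x * K (x + sum d (I - {w}))) \<partial>D) \<partial>degs I)"
  proof -
    have "(\<integral>\<^sup>+x. Q d * (of_nat x * K (x + sum d (I - {w}))) \<partial>D) = Q d * (\<integral>\<^sup>+x. of_nat x * K (x + sum d (I - {w})) \<partial>D)" for d
      by (rule nn_integral_cmult) simp
    then show ?thesis by (subst nn_integral_cmult[symmetric]) (simp_all only: mult.left_commute, simp)
  qed
  also have "(\<integral>\<^sup>+d. (\<integral>\<^sup>+x. Q d * (of_nat x * K (x + sum d (I - {w}))) \<partial>D) \<partial>degs I) = (\<integral>\<^sup>+d. Q d * of_nat (d w) * K (sum d I) \<partial>degs I)"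
    by (subst (2) Pi_pmf_resample[OF I]) (simp only: s Q fun_upd_same mult.assoc)
  finally show ?thesis .
qed

text \<open>The last vertex is removed first: association turns its weight d w (d w - 1) into a
  times d w, and the sum of \<open>d w\<close> over the free vertices, divided by the last
  denominator, is at most 1. The start of the path is kept general in \<open>q\<close>, which
  depends only on the degrees in \<open>A\<close>.\<close>

lemma peel_path:
  fixes I :: "nat set"
  assumes I: "finite I" "A \<subseteq> I" and g: "antimono g" "\<And>L. 1 \<le> L \<Longrightarrow> g L < \<top>" and \<nu>: "mono \<nu>" "\<And>L. L \<le> \<nu> L"
    and q: "\<And>d w x. w \<notin> A \<Longrightarrow> q (d(w := x)) = q d" "\<And>d. q d \<noteq> 0 \<Longrightarrow> s \<le> sum d A" and s: "1 \<le> s"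
  shows "(\<Sum>ws\<in>dlists k (I - A). \<integral>\<^sup>+d. q d * of_nat (steps_weight d ws) * matching_weight g \<nu> s k (sum d I) \<partial>degs I)
    \<le> ennreal a ^ k * (\<integral>\<^sup>+d. q d * g (sum d I) \<partial>degs I)"
proof (induction k)
  case 0 then show ?case by (simp add: steps_weight_def)
next
  case (Suc k)
  let ?W = "I - A" and ?K = "matching_weight g \<nu> s"
  have fW: "finite ?W" using I by simp
  have finA: "finite A" using I finite_subset by blast
  \<comment> \<open>Where the weight does not vanish, every vertex of \<open>ws\<close> has degree
    at least 2, so \<open>A\<close> and the path account for \<open>s + 2 * k\<close>
    half-edges.\<close>
  have low: "s + 2 * k + sum d (?W - set ws) \<le> sum d I"
    if "q d * of_nat (steps_weight d ws) \<noteq> 0" "ws \<in> dlists k ?W" for d ws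
  proof -
    have "s \<le> sum d A" using that q(2) by auto
    moreover have "2 * k \<le> sum d (set ws)" using that steps_weight_pos[of d ws] by (auto simp: dlists_def)
    moreover have "sum d I = sum d A + sum d (set ws) + sum d (?W - set ws)"
    proof -
      have "sum d I = sum d A + sum d ?W" using I finA by (metis sum.subset_diff add.commute)
      moreover have "sum d ?W = sum d (set ws) + sum d (?W - set ws)"
        using that(2) fW by (metis (no_types, lifting) add.commute dlists_def mem_Collect_eq sum.subset_diff)
      ultimately show ?thesis by simp
    qed
    ultimately show ?thesis by linarith
  qed
  have "(\<Sum>ws\<in>dlists (Suc k) ?W. \<integral>\<^sup>+d. q d * of_nat (steps_weight d ws) * ?K (Suc k) (sum d I) \<partial>degs I)
    = (\<Sum>ws\<in>dlists k ?W. \<Sum>w\<in>?W - set ws. \<integral>\<^sup>+d. q d * of_nat (steps_weight d ws) * of_nat (d w * (d w - 1)) * ?K (Suc k) (sum d I) \<partial>degs I)"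
    by (subst sum_dlists_snoc[OF fW]) (simp only: steps_weight_snoc of_nat_mult mult.assoc)
  also have "\<dots> \<le> (\<Sum>ws\<in>dlists k ?W. \<Sum>w\<in>?W - set ws. ennreal a * (\<integral>\<^sup>+d. q d * of_nat (steps_weight d ws) * of_nat (d w) * ?K (Suc k) (sum d I) \<partial>degs I))"
  proof (intro sum_mono peel_vertex)
    fix ws w d x assume ws: "ws \<in> dlists k ?W" and w: "w \<in> ?W - set ws"
    show "finite I" "w \<in> I" using I w by auto
    show "antimono (?K (Suc k))" by (rule matching_weight_antimono) fact+
    show "q (d(w := x)) * of_nat (steps_weight (d(w := x)) ws) = q d * of_nat (steps_weight d ws)"
      using q(1)[of w d x] w by (simp add: steps_weight_upd)
    assume nz: "q d * of_nat (steps_weight d ws) \<noteq> 0" and x: "1 \<le> x"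
    have "s + 2 * k \<le> sum d (I - {w})"
    proof -
      have "q (d(w := 0)) * of_nat (steps_weight (d(w := 0)) ws) \<noteq> 0"
        using nz q(1)[of w d 0] w by (simp add: steps_weight_upd)
      from low[OF this ws] have "s + 2 * k \<le> sum (d(w := 0)) I" by simp
      also have "\<dots> = sum (d(w := 0)) (I - {w})"
        by (subst sum.remove[of I w]) (use I w in auto)
      also have "\<dots> = sum d (I - {w})" by (rule sum.cong) auto
      finally show ?thesis .
    qed
    then show "?K (Suc k) (x + sum d (I - {w})) < \<top>"
      using x s by (intro matching_weight_finite g(2) \<nu>(2)) auto
  qed
  also have "\<dots> = ennreal a * (\<Sum>ws\<in>dlists k ?W. \<integral>\<^sup>+d. (\<Sum>w\<in>?W - set ws. q d * of_nat (steps_weight d ws) * of_nat (d w) * ?K (Suc k) (sum d I)) \<partial>degs I)"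
    by (simp add: sum_distrib_left[symmetric] nn_integral_sum)
  also have "\<dots> \<le> ennreal a * (\<Sum>ws\<in>dlists k ?W. \<integral>\<^sup>+d. q d * of_nat (steps_weight d ws) * ?K k (sum d I) \<partial>degs I)"
  proof (intro mult_left_mono sum_mono nn_integral_mono)
    fix ws d assume ws: "ws \<in> dlists k ?W"
    let ?Q = "q d * of_nat (steps_weight d ws)"
    have eq: "(\<Sum>w\<in>?W - set ws. ?Q * of_nat (d w) * ?K (Suc k) (sum d I))
      = ?Q * ?K k (sum d I) * (of_nat (sum d (?W - set ws)) * inverse (of_nat (\<nu> (sum d I) - (s + 2 * k))))"
      by (simp add: sum_distrib_left sum_distrib_right mult_ac)
    show "(\<Sum>w\<in>?W - set ws. ?Q * of_nat (d w) * ?K (Suc k) (sum d I)) \<le> ?Q * ?K k (sum d I)"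
    proof (cases "?Q = 0")
      case False
      define x y where "x = sum d (?W - set ws)" and "y = \<nu> (sum d I) - (s + 2 * k)"
      have "x \<le> y" using low[OF False ws] \<nu>(2)[of "sum d I"] by (auto simp: x_def y_def)
      have "of_nat x * inverse (of_nat y) \<le> (1 :: ennreal)"
        using \<open>x \<le> y\<close> by (rule of_nat_mult_inverse_le)
      then have "?Q * ?K k (sum d I) * (of_nat x * inverse (of_nat y)) \<le> ?Q * ?K k (sum d I) * 1"
        by (intro mult_left_mono) auto
      then show ?thesis unfolding eq x_def y_def by simp
    next
      case True
      show ?thesis by (simp only: True mult_zero_left sum.neutral_const order_refl)
    qed
  qed simp
  also have "\<dots> \<le> ennreal a * (ennreal a ^ k * (\<integral>\<^sup>+d. q d * g (sum d I) \<partial>degs I))"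
    by (intro mult_left_mono Suc.IH) simp
  finally show ?case by (simp add: mult.assoc)
qed

text \<open>The degrees of the vertices other than 1 are exchangeable, and their sum is at most the
  total degree. So the expectation is of order 1/n, which will pay for the number of positions that
  vertex \<open>n\<close> can have in a path.\<close>

lemma exchange_last_degree:
  assumes "2 \<le> n"
  shows "of_nat (n - 1) * (\<integral>\<^sup>+d. of_nat (d 1 * d n) * inverse (of_nat (sum d {1..n})) \<partial>degs {1..n}) \<le> (\<integral>\<^sup>+k. of_nat k \<partial>D)"
proof -
  let ?f = "\<lambda>v d. of_nat (d 1 * d v) * inverse (of_nat (sum d {1..n})) :: ennreal"
  have eq: "(\<integral>\<^sup>+d. ?f n d \<partial>degs {1..n}) = (\<integral>\<^sup>+d. ?f v d \<partial>degs {1..n})" if v: "v \<in> {2..n}" for v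
  proof -
    define h where "h = (\<lambda>x. if x = v then n else if x = n then v else x)"
    have h: "bij_betw h {1..n} {1..n}"
      by (rule bij_betw_byWitness[where f' = h]) (use v assms in \<open>auto simp: h_def\<close>)
    have "degs {1..n} = map_pmf (\<lambda>g. g \<circ> h) (degs {1..n})"
      by (rule Pi_pmf_bij_betw[OF _ h]) (use v assms in \<open>auto simp: h_def\<close>)
    then have "(\<integral>\<^sup>+d. ?f n d \<partial>degs {1..n}) = (\<integral>\<^sup>+d. ?f n d \<partial>map_pmf (\<lambda>g. g \<circ> h) (degs {1..n}))" by simp
    also have "\<dots> = (\<integral>\<^sup>+g. ?f n (g \<circ> h) \<partial>degs {1..n})" by simp
    also have "\<dots> = (\<integral>\<^sup>+g. ?f v g \<partial>degs {1..n})"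
    proof (rule nn_integral_cong)
      fix g :: "nat \<Rightarrow> nat"
      have "sum (g \<circ> h) {1..n} = sum g {1..n}" using sum.reindex_bij_betw[OF h, of g] by (simp add: o_def)
      then show "?f n (g \<circ> h) = ?f v g" using v assms by (simp add: h_def)
    qed
    finally show ?thesis .
  qed
  have "of_nat (n - 1) * (\<integral>\<^sup>+d. ?f n d \<partial>degs {1..n}) = (\<Sum>v\<in>{2..n}. \<integral>\<^sup>+d. ?f n d \<partial>degs {1..n})"
    using assms by simp
  also have "\<dots> = (\<Sum>v\<in>{2..n}. \<integral>\<^sup>+d. ?f v d \<partial>degs {1..n})" by (intro sum.cong refl eq)
  also have "\<dots> = (\<integral>\<^sup>+d. (\<Sum>v\<in>{2..n}. ?f v d) \<partial>degs {1..n})" by (rule nn_integral_sum[symmetric]) simp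
  also have "\<dots> \<le> (\<integral>\<^sup>+d. of_nat (d 1) \<partial>degs {1..n})"
  proof (rule nn_integral_mono)
    fix d :: "nat \<Rightarrow> nat"
    have "(\<Sum>v\<in>{2..n}. ?f v d) = of_nat (d 1) * (of_nat (sum d {2..n}) * inverse (of_nat (sum d {1..n})))"
      by (simp add: sum_distrib_left sum_distrib_right mult_ac)
    also have "\<dots> \<le> of_nat (d 1) * 1"
      by (intro mult_left_mono of_nat_mult_inverse_le sum_mono2) auto
    finally show "(\<Sum>v\<in>{2..n}. ?f v d) \<le> of_nat (d 1)" by simp
  qed
  also have "\<dots> = (\<integral>\<^sup>+k. of_nat k \<partial>D)" by (rule expectation_coordinate) (use assms in auto)
  finally show ?thesis .
qed

end

section \<open>The extra half-edge at the last vertex\<close>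

text \<open>A list is determined by its remainder and the position of \<open>x\<close> in it, for
  which there are \<open>Suc j\<close> possibilities.\<close>

lemma sum_remove1_le:
  fixes \<phi> :: "'a list \<Rightarrow> ennreal"
  assumes "finite W"
  shows "(\<Sum>ws\<in>{ws \<in> dlists (Suc j) W. x \<in> set ws}. \<phi> (remove1 x ws)) \<le> of_nat (Suc j) * (\<Sum>ws\<in>dlists j (W - {x}). \<phi> ws)"
proof -
  let ?S = "{ws \<in> dlists (Suc j) W. x \<in> set ws}"
  have fS: "finite ?S" using assms by (simp add: finite_dlists)
  have "(\<Sum>ws\<in>?S. \<phi> (remove1 x ws)) = (\<Sum>vs\<in>dlists j (W - {x}). \<Sum>ws\<in>{ws \<in> ?S. remove1 x ws = vs}. \<phi> (remove1 x ws))"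
  proof (rule sum.group[symmetric])
    show "finite (dlists j (W - {x}))" using assms by (simp add: finite_dlists)
    show "remove1 x ` ?S \<subseteq> dlists j (W - {x})" by (auto simp: dlists_def length_remove1)
  qed (rule fS)
  also have "\<dots> = (\<Sum>vs\<in>dlists j (W - {x}). of_nat (card {ws \<in> ?S. remove1 x ws = vs}) * \<phi> vs)"
    by (intro sum.cong refl) simp
  also have "\<dots> \<le> (\<Sum>vs\<in>dlists j (W - {x}). of_nat (Suc j) * \<phi> vs)"
  proof (intro sum_mono mult_right_mono)
    fix vs assume vs: "vs \<in> dlists j (W - {x})"
    have "{ws \<in> ?S. remove1 x ws = vs} \<subseteq> (\<lambda>i. take i vs @ x # drop i vs) ` {..j}"
    proof
      fix ws assume ws: "ws \<in> {ws \<in> ?S. remove1 x ws = vs}"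
      then obtain xs ys where xy: "ws = xs @ x # ys" "x \<notin> set xs" using split_list_first[of x ws] by auto
      then have "vs = xs @ ys" using ws by (simp add: remove1_append)
      moreover have "length xs \<le> j" using ws xy by (simp add: dlists_def)
      ultimately show "ws \<in> (\<lambda>i. take i vs @ x # drop i vs) ` {..j}"
        using xy by (intro image_eqI[of _ _ "length xs"]) auto
    qed
    then have "card {ws \<in> ?S. remove1 x ws = vs} \<le> card ((\<lambda>i. take i vs @ x # drop i vs) ` {..j})"
      by (intro card_mono) auto
    also have "\<dots> \<le> card {..j}" by (rule card_image_le) simp
    finally show "of_nat (card {ws \<in> ?S. remove1 x ws = vs}) \<le> (of_nat (Suc j) :: ennreal)"
      by (intro of_nat_mono) simp
  qed simp
  finally show ?thesis by (simp add: sum_distrib_left)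
qed

lemma steps_weight_eq_prod: "distinct ws \<Longrightarrow> steps_weight d ws = (\<Prod>w\<in>set ws. d w * (d w - 1))"
  unfolding steps_weight_def by (rule prod.distinct_set_conv_list[symmetric])

text \<open>The extra half-edge changes d n (d n - 1) into (d n + 1) d n, an increase by 2 d
  n.\<close>

lemma steps_weight_half_edge_count:
  assumes "distinct ws"
  shows "steps_weight (half_edge_count n d) ws = steps_weight d ws +
    (if n \<in> set ws \<and> odd (\<Sum>k=1..n. d k) then 2 * d n * steps_weight d (remove1 n ws) else 0)"
proof (cases "n \<in> set ws \<and> odd (\<Sum>k=1..n. d k)")
  case True
  then have ws: "set ws = insert n (set (remove1 n ws))" "n \<notin> set (remove1 n ws)" "distinct (remove1 n ws)"
    using assms by auto
  have eq: "steps_weight f ws = f n * (f n - 1) * steps_weight f (remove1 n ws)" for f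
    unfolding steps_weight_eq_prod[OF assms] steps_weight_eq_prod[OF ws(3)] ws(1) using ws(2) by simp
  have "steps_weight (half_edge_count n d) (remove1 n ws) = steps_weight d (remove1 n ws)"
    unfolding steps_weight_eq_prod[OF ws(3)] using ws(2) by (intro prod.cong refl) (auto simp: half_edge_count_def)
  moreover have "half_edge_count n d n = Suc (d n)" using True by (simp add: half_edge_count_def)
  moreover have "Suc (d n) * d n = d n * (d n - 1) + 2 * d n" by (cases "d n") auto
  ultimately have "steps_weight (half_edge_count n d) ws = (d n * (d n - 1) + 2 * d n) * steps_weight d (remove1 n ws)"
    unfolding eq[of "half_edge_count n d"] by simp
  also have "\<dots> = steps_weight d ws + 2 * d n * steps_weight d (remove1 n ws)"
    unfolding eq[of d] by (simp add: algebra_simps)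
  finally show ?thesis using True by simp
next
  case False
  have "steps_weight (half_edge_count n d) ws = steps_weight d ws"
    unfolding steps_weight_eq_prod[OF assms] using False by (intro prod.cong refl) (auto simp: half_edge_count_def)
  then show ?thesis using False by auto
qed

lemma sum_half_edge_count:
  assumes "1 \<le> n" shows "(\<Sum>i=1..n. half_edge_count n d i) = (\<Sum>i=1..n. d i) + (\<Sum>i=1..n. d i) mod 2"
proof -
  have "(\<Sum>i=1..n. half_edge_count n d i) = (\<Sum>i=1..n. d i) + (\<Sum>i=1..n. if i = n then (if odd (\<Sum>k=1..n. d k) then 1 else 0) else 0)"
    unfolding half_edge_count_def sum.distrib by (intro arg_cong2[where f = "(+)"] sum.cong) auto
  then show ?thesis using assms by (simp add: odd_iff_mod_2_eq_one)
qed

text \<open>For odd \<open>S\<close> the first denominator is S + 1 - 1 = S; it is moved into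
  \<open>g\<close>, and the remaining ones are those with offset 2 and no parity correction.\<close>

lemma matching_weight_odd:
  assumes "odd S"
  shows "matching_weight (\<lambda>_. 1) (\<lambda>S. S + S mod 2) 1 (Suc j) S = matching_weight (\<lambda>L. inverse (of_nat L)) (\<lambda>L. L) 2 j S"
proof (induction j)
  case 0 then show ?case using assms by (simp add: odd_iff_mod_2_eq_one)
next
  case (Suc j)
  have "S + S mod 2 - (1 + 2 * Suc j) = S - (2 + 2 * j)" using assms by (simp add: odd_iff_mod_2_eq_one)
  then show ?case using Suc unfolding matching_weight.simps(2)[of _ _ _ "Suc j"] matching_weight.simps(2)[of _ _ _ j S] by metis
qed

text \<open>An inequality only, since division by 0 is 0 in \<open>real\<close> whereas
  \<open>inverse 0\<close> is infinite in \<open>ennreal\<close>.\<close>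

lemma ennreal_divide_prod_le:
  assumes "finite I"
  shows "ennreal (real x / (\<Prod>i\<in>I. real (y i))) \<le> of_nat x * (\<Prod>i\<in>I. inverse (of_nat (y i)))"
proof (cases "\<exists>i\<in>I. y i = 0")
  case True
  then have "(\<Prod>i\<in>I. real (y i)) = 0" using assms by auto
  then show ?thesis by simp
next
  case False
  have "(\<Prod>i\<in>I. inverse (of_nat (y i)) :: ennreal) = (\<Prod>i\<in>I. ennreal (inverse (real (y i))))"
    using False by (intro prod.cong refl) (simp add: ennreal_of_nat_eq_real_of_nat inverse_ennreal)
  also have "\<dots> = ennreal (inverse (\<Prod>i\<in>I. real (y i)))"
    by (subst prod_ennreal) (auto simp: prod_inversef[symmetric])
  finally show ?thesis
    by (simp add: ennreal_of_nat_eq_real_of_nat ennreal_mult'[symmetric] divide_inverse)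
qed

lemma matching_weight_eq_prod:
  "matching_weight (\<lambda>_. 1) \<nu> s k L = (\<Prod>i<k. inverse (of_nat (\<nu> L - (s + 2 * i))))"
  by (induction k) simp_all

context degree_law
begin

text \<open>The constant is 1 + 2. The paths weighted with the degrees themselves give the 1. The
  extra half-edge contributes a factor 2, at most \<open>k\<close> positions of \<open>n\<close> in
  the path, and by \<open>exchange_last_degree\<close> a mean divided by \<open>n - 1\<close>; since
  a path requires \<open>k \<le> n - 1\<close>, the number of positions cancels.\<close>

theorem expected_mean_paths_le:
  assumes n: "2 \<le> n" and a1: "1 \<le> a"
  shows "(\<integral>\<^sup>+d. ennreal (mean_paths (half_edge_count n d) (Suc k) (half_edge_count n d 1) (\<Sum>i=1..n. half_edge_count n d i) {2..n}) \<partial>degs {1..n})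
    \<le> ennreal (3 * a ^ k) * (\<integral>\<^sup>+k. of_nat k \<partial>D)"
proof -
  let ?S = "\<lambda>d :: nat \<Rightarrow> nat. sum d {1..n}" and ?m = "\<integral>\<^sup>+k. of_nat k \<partial>D"
  let ?\<nu> = "\<lambda>S :: nat. S + S mod 2"
  let ?K = "\<lambda>k. matching_weight (\<lambda>_. 1) ?\<nu> 1 k" and ?K2 = "\<lambda>k. matching_weight (\<lambda>L. inverse (of_nat L)) (\<lambda>L. L) 2 k"
  let ?W = "{2..n}" and ?E = "\<lambda>f. \<integral>\<^sup>+d. f d \<partial>degs {1..n}"
  have mono_\<nu>: "mono ?\<nu>"
  proof (rule incseq_SucI)
    fix S :: nat show "S + S mod 2 \<le> Suc S + Suc S mod 2" by (cases "even S") (auto simp: odd_iff_mod_2_eq_one even_iff_mod_2_eq_zero)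
  qed
  have pw: "ennreal (mean_paths (half_edge_count n d) (Suc k) (half_edge_count n d 1) (\<Sum>i=1..n. half_edge_count n d i) ?W)
    \<le> (\<Sum>ws\<in>dlists k ?W. of_nat (d 1) * of_nat (steps_weight d ws) * ?K k (?S d)) +
       (\<Sum>ws\<in>{ws \<in> dlists k ?W. n \<in> set ws}. of_nat (2 * d 1 * d n) * of_nat (steps_weight d (remove1 n ws)) * ?K2 (k - 1) (?S d))" for d
  proof -
    let ?h = "half_edge_count n d"
    have h1: "?h 1 = d 1" using n by (simp add: half_edge_count_def)
    have L: "(\<Sum>i=1..n. ?h i) = ?\<nu> (?S d)" using n by (intro sum_half_edge_count) simp
    have "?h 1 + sum ?h ?W = (\<Sum>i=1..n. ?h i)"
      using n by (simp add: sum.atLeast_Suc_atMost numeral_2_eq_2)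
    then have "mean_paths ?h (Suc k) (?h 1) (\<Sum>i=1..n. ?h i) ?W \<le>
      (\<Sum>ws\<in>dlists k ?W. real (?h 1) * real (steps_weight ?h ws) / (\<Prod>i<k. real ((\<Sum>i=1..n. ?h i) - (2 * i + 1))))"
      by (intro mean_paths_le) auto
    then have "ennreal (mean_paths ?h (Suc k) (?h 1) (\<Sum>i=1..n. ?h i) ?W) \<le>
      ennreal (\<Sum>ws\<in>dlists k ?W. real (d 1 * steps_weight ?h ws) / (\<Prod>i<k. real (?\<nu> (?S d) - (1 + 2 * i))))"
      unfolding L h1 by (intro ennreal_leI) (simp add: add.commute)
    also have "\<dots> = (\<Sum>ws\<in>dlists k ?W. ennreal (real (d 1 * steps_weight ?h ws) / (\<Prod>i<k. real (?\<nu> (?S d) - (1 + 2 * i)))))"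
      by (rule sum_ennreal[symmetric]) (intro divide_nonneg_nonneg prod_nonneg, auto)
    also have "\<dots> \<le> (\<Sum>ws\<in>dlists k ?W. of_nat (d 1 * steps_weight ?h ws) * ?K k (?S d))"
      unfolding matching_weight_eq_prod by (intro sum_mono ennreal_divide_prod_le) simp
    also have "\<dots> \<le> (\<Sum>ws\<in>dlists k ?W. of_nat (d 1) * of_nat (steps_weight d ws) * ?K k (?S d) +
        (if n \<in> set ws then of_nat (2 * d 1 * d n) * of_nat (steps_weight d (remove1 n ws)) * ?K2 (k - 1) (?S d) else 0))"
    proof (rule sum_mono)
      fix ws assume ws: "ws \<in> dlists k ?W"
      then have di: "distinct ws" "length ws = k" by (auto simp: dlists_def)
      show "of_nat (d 1 * steps_weight ?h ws) * ?K k (?S d) \<le> of_nat (d 1) * of_nat (steps_weight d ws) * ?K k (?S d) +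
        (if n \<in> set ws then of_nat (2 * d 1 * d n) * of_nat (steps_weight d (remove1 n ws)) * ?K2 (k - 1) (?S d) else 0)"
      proof (cases "n \<in> set ws \<and> odd (?S d)")
        case True
        then obtain j where j: "k = Suc j" using di by (cases k) auto
        have "?K k (?S d) = ?K2 (k - 1) (?S d)" using matching_weight_odd[of "?S d" j] True j by simp
        then show ?thesis using True by (simp add: steps_weight_half_edge_count[OF di(1)] distrib_right algebra_simps)
      next
        case False
        then have "steps_weight ?h ws = steps_weight d ws" by (auto simp: steps_weight_half_edge_count[OF di(1)])
        then show ?thesis by simp
      qed
    qed
    also have "\<dots> = (\<Sum>ws\<in>dlists k ?W. of_nat (d 1) * of_nat (steps_weight d ws) * ?K k (?S d)) +
       (\<Sum>ws\<in>{ws \<in> dlists k ?W. n \<in> set ws}. of_nat (2 * d 1 * d n) * of_nat (steps_weight d (remove1 n ws)) * ?K2 (k - 1) (?S d))"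
      by (simp only: sum.distrib sum.inter_filter[OF finite_dlists[OF finite_atLeastAtMost]])
    finally show ?thesis .
  qed
  have A: "(\<Sum>ws\<in>dlists k ({1..n} - {1}). ?E (\<lambda>d. of_nat (d 1) * of_nat (steps_weight d ws) * ?K k (?S d))) \<le> ennreal a ^ k * ?m"
  proof -
    have "(\<Sum>ws\<in>dlists k ({1..n} - {1}). ?E (\<lambda>d. of_nat (d 1) * of_nat (steps_weight d ws) * ?K k (?S d))) \<le> ennreal a ^ k * ?E (\<lambda>d. of_nat (d 1) * 1)"
      by (rule peel_path[where \<nu> = ?\<nu> and s = 1]) (use n mono_\<nu> in \<open>auto simp: antimono_def\<close>)
    then show ?thesis using expectation_coordinate[where I = "{1..n}" and v = 1 and f = of_nat and z = 0 and D = D] n by simp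
  qed
  have B: "(\<Sum>ws\<in>{ws \<in> dlists k ?W. n \<in> set ws}. ?E (\<lambda>d. of_nat (2 * d 1 * d n) * of_nat (steps_weight d (remove1 n ws)) * ?K2 (k - 1) (?S d))) \<le> 2 * ennreal a ^ k * ?m"
  proof (cases "k = 0 \<or> n - 1 < k")
    case True
    then have empty: "{ws \<in> dlists k ?W. n \<in> set ws} = {}" using dlists_empty[of ?W k] by auto
    show ?thesis unfolding empty by simp
  next
    case False
    then obtain j where j: "k = Suc j" by (cases k) auto
    let ?\<phi> = "\<lambda>ws. ?E (\<lambda>d. of_nat (2 * d 1 * d n) * of_nat (steps_weight d ws) * ?K2 j (?S d))"
    have "(\<Sum>ws\<in>{ws \<in> dlists (Suc j) ?W. n \<in> set ws}. ?\<phi> (remove1 n ws)) \<le> of_nat (Suc j) * (\<Sum>ws\<in>dlists j (?W - {n}). ?\<phi> ws)"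
      by (rule sum_remove1_le) simp
    also have "?W - {n} = {1..n} - {1, n}" using n by auto
    also have "(\<Sum>ws\<in>dlists j ({1..n} - {1, n}). ?\<phi> ws) \<le> ennreal a ^ j * ?E (\<lambda>d. of_nat (2 * d 1 * d n) * inverse (of_nat (?S d)))"
    proof (rule peel_path[where \<nu> = "\<lambda>L. L" and s = 2])
      show "antimono (\<lambda>L. inverse (of_nat L :: ennreal))" by (auto simp: antimono_def intro: inverse_of_nat_antimono)
      show "inverse (of_nat L :: ennreal) < \<top>" if "1 \<le> L" for L :: nat
        using that by (subst less_top[symmetric]) (simp only: ennreal_inverse_eq_top_iff of_nat_eq_0_iff)
      fix d :: "nat \<Rightarrow> nat" assume "of_nat (2 * d 1 * d n) \<noteq> (0 :: ennreal)"
      then have "1 \<le> d 1" "1 \<le> d n" by auto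
      then show "2 \<le> sum d {1, n}" using n by simp
    qed (use n in \<open>auto simp: mono_def\<close>)
    also have "?E (\<lambda>d. of_nat (2 * d 1 * d n) * inverse (of_nat (?S d))) = 2 * ?E (\<lambda>d. of_nat (d 1 * d n) * inverse (of_nat (?S d)))"
      by (subst nn_integral_cmult[symmetric]) (auto simp: mult_ac)
    also have "of_nat (Suc j) * (ennreal a ^ j * (2 * ?E (\<lambda>d. of_nat (d 1 * d n) * inverse (of_nat (?S d)))))
      \<le> 2 * ennreal a ^ j * (of_nat (n - 1) * ?E (\<lambda>d. of_nat (d 1 * d n) * inverse (of_nat (?S d))))"
    proof -
      have "(of_nat (Suc j) :: ennreal) \<le> of_nat (n - 1)" using False j by (intro of_nat_mono) simp
      then have "of_nat (Suc j) * (2 * ennreal a ^ j * ?E (\<lambda>d. of_nat (d 1 * d n) * inverse (of_nat (?S d))))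
        \<le> of_nat (n - 1) * (2 * ennreal a ^ j * ?E (\<lambda>d. of_nat (d 1 * d n) * inverse (of_nat (?S d))))" by (rule mult_right_mono) simp
      then show ?thesis by (simp add: mult_ac)
    qed
    also have "\<dots> \<le> 2 * ennreal a ^ j * ?m" by (intro mult_left_mono exchange_last_degree n) simp
    also have "\<dots> \<le> 2 * ennreal a ^ k * ?m"
    proof -
      have "ennreal a ^ j \<le> ennreal a ^ k" using a1 by (intro power_increasing) (auto simp: j)
      then show ?thesis by (intro mult_right_mono mult_left_mono) auto
    qed
    finally show ?thesis by (simp add: j mult_left_mono)
  qed
  have "?E (\<lambda>d. ennreal (mean_paths (half_edge_count n d) (Suc k) (half_edge_count n d 1) (\<Sum>i=1..n. half_edge_count n d i) ?W))
    \<le> ?E (\<lambda>d. (\<Sum>ws\<in>dlists k ?W. of_nat (d 1) * of_nat (steps_weight d ws) * ?K k (?S d)) +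
       (\<Sum>ws\<in>{ws \<in> dlists k ?W. n \<in> set ws}. of_nat (2 * d 1 * d n) * of_nat (steps_weight d (remove1 n ws)) * ?K2 (k - 1) (?S d)))"
    by (intro nn_integral_mono pw)
  also have "\<dots> = (\<Sum>ws\<in>dlists k ?W. ?E (\<lambda>d. of_nat (d 1) * of_nat (steps_weight d ws) * ?K k (?S d))) +
     (\<Sum>ws\<in>{ws \<in> dlists k ?W. n \<in> set ws}. ?E (\<lambda>d. of_nat (2 * d 1 * d n) * of_nat (steps_weight d (remove1 n ws)) * ?K2 (k - 1) (?S d)))"
    by (simp add: nn_integral_add nn_integral_sum)
  also have "\<dots> \<le> ennreal a ^ k * ?m + 2 * ennreal a ^ k * ?m"
  proof (rule add_mono[OF _ B])
    have "?W = {1..n} - {1}" by auto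
    then show "(\<Sum>ws\<in>dlists k ?W. ?E (\<lambda>d. of_nat (d 1) * of_nat (steps_weight d ws) * ?K k (?S d))) \<le> ennreal a ^ k * ?m"
      using A by simp
  qed
  also have "\<dots> = ennreal (3 * a ^ k) * ?m"
  proof -
    have "ennreal (3 * a ^ k) = 3 * ennreal a ^ k" using a(1) by (simp add: ennreal_mult' ennreal_power)
    moreover have "(3 :: ennreal) = 1 + 2" by simp
    ultimately show ?thesis by (simp only: distrib_right mult_1_left)
  qed
  finally show ?thesis .
qed

end

section \<open>The critical rate\<close>

text \<open>The partial sums satisfy a linear recursion with \<open>a * p = 1 / (2 * r)\<close> and
  \<open>1 - p = r / 2\<close>. Its characteristic polynomial (x - r)^2 has a double root, as befits
  criticality, and the inhomogeneous term is matched by the constant \<open>- c\<close>. So the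
  right-hand side solves the recursion exactly, for all \<open>K\<close> at once; the coefficient 2
  makes it nonnegative on the boundary.\<close>

lemma weighted_escape_prob_le:
  fixes a p r c :: real
  assumes p: "0 < p" "p < 1" and crit: "4 * a * p * (1 - p) = 1" and r: "r = 2 * (1 - p)" "1 < r" and c: "c = 1 / (r - 1)\<^sup>2"
  shows "(\<Sum>k=1..K. a ^ k * escape_prob p k l) \<le> c * (2 * r ^ l - 1)"
proof -
  define T where "T = (\<lambda>K l. \<Sum>k=1..K. a ^ k * escape_prob p k l)"
  have c0: "0 \<le> c" and cr: "c * (r - 1)\<^sup>2 = 1" using r by (auto simp: c)
  have "a * p * r = (4 * a * p * (1 - p)) / 2" unfolding r(1) by simp
  then have ap: "a * p * r = 1 / 2" using crit by simp
  have rec: "T (Suc K) (Suc l) = a * p * (1 + T K (Suc (Suc l))) + (1 - p) * T (Suc K) l" for K l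
  proof -
    have "T (Suc K) (Suc l) = (\<Sum>k<Suc K. a ^ Suc k * escape_prob p (Suc k) (Suc l))"
      unfolding T_def by (simp only: One_nat_def sum.atLeast1_atMost_eq)
    also have "\<dots> = a * p * (\<Sum>k<Suc K. a ^ k * escape_prob p k (Suc (Suc l))) + (1 - p) * (\<Sum>k<Suc K. a ^ Suc k * escape_prob p (Suc k) l)"
      by (simp add: sum_distrib_left sum.distrib[symmetric] algebra_simps)
    also have "(\<Sum>k<Suc K. a ^ Suc k * escape_prob p (Suc k) l) = T (Suc K) l"
      unfolding T_def by (simp only: One_nat_def sum.atLeast1_atMost_eq)
    also have "(\<Sum>k<Suc K. a ^ k * escape_prob p k (Suc (Suc l))) = 1 + T K (Suc (Suc l))"
      unfolding T_def One_nat_def sum.atLeast1_atMost_eq by (subst sum.lessThan_Suc_shift) simp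
    finally show ?thesis .
  qed
  have "0 < 4 * a * (p * (1 - p))" using crit by (simp add: algebra_simps)
  moreover have "0 < p * (1 - p)" using p by simp
  ultimately have "0 < 4 * a" by (rule zero_less_mult_pos2)
  then have a0: "0 < a" by simp
  have "T K l \<le> c * (2 * r ^ l - 1)" for K l
  proof (induction K arbitrary: l)
    case 0
    have "1 \<le> r ^ l" using r by (simp add: one_le_power)
    then show ?case using c0 by (simp add: T_def)
  next
    case (Suc K)
    note IH = Suc.IH
    show ?case
    proof (induction l)
      case 0
      have "T (Suc K) 0 = 0" unfolding T_def by (intro sum.neutral ballI) (metis One_nat_def Suc_le_D atLeastAtMost_iff escape_prob.simps(2) mult_zero_right)
      then show ?case using c0 by simp
    next
      case (Suc l)
      have "T (Suc K) (Suc l) \<le> a * p * (1 + c * (2 * r ^ Suc (Suc l) - 1)) + (1 - p) * (c * (2 * r ^ l - 1))"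
        unfolding rec using IH[of "Suc (Suc l)"] Suc a0 p by (intro add_mono mult_left_mono) auto
      also have "\<dots> = c * (2 * r ^ Suc l - 1)"
      proof -
        have rp: "1 - p = r / 2" using r by simp
        have "a * p = a * p * r / r" using r(2) by simp
        then have ap': "a * p = 1 / (2 * r)" unfolding ap by simp
        have "2 * r * (a * p * (1 + c * (2 * r ^ Suc (Suc l) - 1)) + (1 - p) * (c * (2 * r ^ l - 1)))
          = 1 + c * (2 * r ^ Suc (Suc l) - 1) + r * r * (c * (2 * r ^ l - 1))"
          unfolding rp ap' using r by (simp add: field_simps)
        also have "\<dots> = c * (r - 1)\<^sup>2 + c * (2 * r ^ Suc (Suc l) - 1) + r * r * (c * (2 * r ^ l - 1))" by (simp only: cr)
        also have "\<dots> = 2 * r * (c * (2 * r ^ Suc l - 1))" by (simp add: power2_eq_square algebra_simps)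
        finally show ?thesis using r by simp
      qed
      finally show ?case .
    qed
  qed
  then show ?thesis by (simp add: T_def)
qed

text \<open>Above criticality the roots of \<alpha> p x^2 - x + (1 - p) are complex, of modulus
  \<open>r\<close>. So r^l sin(\<theta> l), cut off at the first zero of the sine, is a nonnegative
  subsolution of the recursion for \<open>\<alpha> ^ k * escape_prob p k l\<close>, and a multiple
  of it stays below for all \<open>k\<close>.\<close>

lemma escape_prob_lower:
  fixes \<alpha> p :: real
  assumes p: "0 < p" "p < 1" and \<alpha>: "0 < \<alpha>" "1 < 4 * \<alpha> * p * (1 - p)"
  shows "\<exists>c>0. \<forall>k. c \<le> \<alpha> ^ k * escape_prob p k 1"
proof -
  define s where "s = sqrt (\<alpha> * p * (1 - p))"
  have ap0: "0 < \<alpha> * p * (1 - p)" using p \<alpha> by simp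
  have s2: "s * s = \<alpha> * p * (1 - p)" using ap0 by (simp add: s_def)
  have s0: "0 < s" using ap0 by (simp add: s_def)
  have "(1/2)\<^sup>2 < \<alpha> * p * (1 - p)" using \<alpha> by (simp add: power2_eq_square)
  then have s1: "1 / 2 < s" unfolding s_def by (rule real_less_rsqrt)
  have "(\<lambda>n. 2 * s * cos (pi / real n)) \<longlonglongrightarrow> 2 * s * cos 0"
    by (intro tendsto_mult tendsto_const tendsto_cos lim_const_over_n)
  then have "eventually (\<lambda>n. 1 < 2 * s * cos (pi / real n)) sequentially"
    by (rule order_tendstoD) (use s1 in simp)
  then obtain N0 where N0: "\<And>n. N0 \<le> n \<Longrightarrow> 1 < 2 * s * cos (pi / real n)" by (auto simp: eventually_sequentially)
  \<comment> \<open>Large enough for \<open>2 * s * cos (pi / real N) > 1\<close>; the 2 ensures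
    \<theta> < pi, hence a positive value at \<open>l = 1\<close>.\<close>
  define N where "N = max N0 2"
  have N: "2 \<le> N" and cosN: "1 < 2 * s * cos (pi / real N)" using N0[of N] by (auto simp: N_def)
  define \<theta> where "\<theta> = pi / real N"
  define r where "r = (1 - p) / s"
  have r0: "0 < r" using p s0 by (simp add: r_def)
  have rs: "\<alpha> * p * r = s" "(1 - p) = r * s" using s0 s2 p by (auto simp: r_def field_simps)
  \<comment> \<open>The sine vanishes at \<open>l = N\<close>, so cutting off beyond does not
    destroy the subsolution: where the cut is felt, the left-hand side is 0.\<close>
  define \<phi> where "\<phi> = (\<lambda>l. if l \<le> N then r ^ l * sin (\<theta> * real l) else 0)"
  have sin0: "0 \<le> sin (\<theta> * real l)" if "l \<le> N" for l
  proof (rule sin_ge_zero)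
    show "\<theta> * real l \<le> pi" using that N pi_gt_zero by (simp add: \<theta>_def field_simps)
  qed (use pi_gt_zero in \<open>simp add: \<theta>_def\<close>)
  have \<phi>0: "0 \<le> \<phi> l" for l using sin0 r0 by (simp add: \<phi>_def)
  have sub: "\<phi> (Suc l) \<le> \<alpha> * p * \<phi> (Suc (Suc l)) + (1 - p) * \<phi> l" for l
  proof (cases "Suc (Suc l) \<le> N")
    case True
    have "\<alpha> * p * \<phi> (Suc (Suc l)) + (1 - p) * \<phi> l
      = r ^ Suc l * s * (sin (\<theta> * real (Suc l) + \<theta>) + sin (\<theta> * real (Suc l) - \<theta>))"
    proof -
      have "\<alpha> * p * \<phi> (Suc (Suc l)) = (\<alpha> * p * r) * r ^ Suc l * sin (\<theta> * real (Suc l) + \<theta>)"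
        using True by (simp add: \<phi>_def algebra_simps)
      moreover have "(1 - p) * \<phi> l = s * r ^ Suc l * sin (\<theta> * real (Suc l) - \<theta>)"
        unfolding rs(2) using True by (simp add: \<phi>_def algebra_simps)
      ultimately show ?thesis unfolding rs(1) by (simp add: algebra_simps)
    qed
    also have "\<dots> = (2 * s * cos \<theta>) * (r ^ Suc l * sin (\<theta> * real (Suc l)))"
    proof -
      have "sin (x + \<theta>) + sin (x - \<theta>) = 2 * cos \<theta> * sin x" for x by (simp add: sin_add sin_diff)
      then show ?thesis by simp
    qed
    also have "\<dots> = (2 * s * cos \<theta>) * \<phi> (Suc l)" using True by (simp add: \<phi>_def)
    also have "1 * \<phi> (Suc l) \<le> \<dots>" using cosN \<phi>0[of "Suc l"] by (intro mult_right_mono) (auto simp: \<theta>_def)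
    finally show ?thesis by simp
  next
    case False
    have "\<phi> (Suc l) = 0"
    proof (cases "Suc l = N")
      case True
      then have "\<theta> * real (Suc l) = pi" using N by (simp add: \<theta>_def)
      then show ?thesis unfolding \<phi>_def by (simp only: sin_pi) simp
    next
      case F: False
      then show ?thesis using False by (simp add: \<phi>_def)
    qed
    then show ?thesis using \<phi>0 p \<alpha> by simp
  qed
  \<comment> \<open>Normalizes \<phi> to at most 1, the value of \<open>escape_prob\<close> at
    \<open>k = 0\<close>.\<close>
  define c where "c = 1 / (1 + (\<Sum>l\<le>N. \<phi> l))"
  have S0: "0 \<le> (\<Sum>l\<le>N. \<phi> l)" by (intro sum_nonneg \<phi>0)
  have c0: "0 < c" using S0 by (simp add: c_def)
  have c1: "c * \<phi> l \<le> 1" for l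
  proof (cases "l \<le> N")
    case True
    then have "\<phi> l \<le> (\<Sum>l\<le>N. \<phi> l)" by (intro member_le_sum \<phi>0) auto
    then show ?thesis using S0 by (simp add: c_def field_simps)
  next
    case False then show ?thesis by (simp add: \<phi>_def)
  qed
  have main: "c * \<phi> l \<le> \<alpha> ^ k * escape_prob p k l" for k l
  proof (induction k arbitrary: l)
    case 0 then show ?case using c1 by simp
  next
    case (Suc k)
    note IH = Suc.IH
    show ?case
    proof (induction l)
      case 0 then show ?case by (simp add: \<phi>_def)
    next
      case (Suc l)
      have "c * \<phi> (Suc l) \<le> c * (\<alpha> * p * \<phi> (Suc (Suc l)) + (1 - p) * \<phi> l)" using sub c0 by simp
      also have "\<dots> = \<alpha> * p * (c * \<phi> (Suc (Suc l))) + (1 - p) * (c * \<phi> l)" by (simp add: algebra_simps)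
      also have "\<dots> \<le> \<alpha> * p * (\<alpha> ^ k * escape_prob p k (Suc (Suc l))) + (1 - p) * (\<alpha> ^ Suc k * escape_prob p (Suc k) l)"
        using IH[of "Suc (Suc l)"] Suc p \<alpha> by (intro add_mono mult_left_mono) auto
      also have "\<dots> = \<alpha> ^ Suc k * escape_prob p (Suc k) (Suc l)" by (simp add: algebra_simps)
      finally show ?case .
    qed
  qed
  have "0 < \<phi> 1"
  proof -
    have "0 < \<theta>" "\<theta> < pi" using N pi_gt_zero by (auto simp: \<theta>_def field_simps)
    then have "0 < sin (\<theta> * 1)" by (simp add: sin_gt_zero)
    then show ?thesis using r0 N by (simp add: \<phi>_def)
  qed
  then show ?thesis using main[of 1] c0 by (intro exI[of _ "c * \<phi> 1"]) simp
qed

section \<open>The critical rate as a root\<close>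

text \<open>\<open>critical_rate D\<close> is the smaller root of (1 + x)^2 = 4 a x. The roots have
  product 1, which places it between 0 and 1.\<close>

lemma critical_rate_identities:
  assumes a: "1 < mean_excess_degree D"
  shows "0 < critical_rate D" "critical_rate D < 1" "(1 + critical_rate D)\<^sup>2 = 4 * mean_excess_degree D * critical_rate D"
proof -
  define a where "a = mean_excess_degree D"
  define s where "s = sqrt (a\<^sup>2 - a)"
  have a1: "1 < a" using assms by (simp add: a_def)
  have "0 \<le> a\<^sup>2 - a" using a1 by (simp add: power2_eq_square)
  then have s2: "s\<^sup>2 = a\<^sup>2 - a" by (simp add: s_def)
  have \<Lambda>: "critical_rate D = 2 * a - 1 - 2 * s" by (simp add: critical_rate_def Let_def a_def s_def)
  have eq: "(1 + critical_rate D)\<^sup>2 = 4 * a * critical_rate D"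
    unfolding \<Lambda> using s2 by (simp add: power2_eq_square algebra_simps)
  then show "(1 + critical_rate D)\<^sup>2 = 4 * mean_excess_degree D * critical_rate D" by (simp add: a_def)
  have "(a - 1)\<^sup>2 < a\<^sup>2 - a" using a1 by (simp add: power2_eq_square algebra_simps)
  then have "a - 1 < s" unfolding s_def by (rule real_less_rsqrt)
  then show "critical_rate D < 1" unfolding \<Lambda> by simp
  have "0 \<le> 4 * a * critical_rate D" unfolding eq[symmetric] by simp
  then have "0 \<le> critical_rate D" using a1 by (simp add: zero_le_mult_iff)
  moreover have "critical_rate D \<noteq> 0" using eq by auto
  ultimately show "0 < critical_rate D" by simp
qed

text \<open>For \<open>lam > 1\<close> the witness is \<open>1 / 2\<close>, since \<open>p * (1 - p)\<close> decreases beyond it.\<close>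

lemma supercritical_p:
  assumes a: "1 < mean_excess_degree D" and lam: "critical_rate D < lam"
  shows "\<exists>p'. 0 < p' \<and> p' < 1 \<and> p' \<le> lam / (1 + lam) \<and> 1 < 4 * mean_excess_degree D * p' * (1 - p')"
proof -
  let ?a = "mean_excess_degree D" and ?\<Lambda> = "critical_rate D"
  note cr = critical_rate_identities[OF a]
  define l where "l = min lam 1"
  have l: "?\<Lambda> < l" "l \<le> 1" "l \<le> lam" "0 < l" using lam cr by (auto simp: l_def)
  \<comment> \<open>Equivalent to \<Lambda> / (1 + \<Lambda>)^2 < l / (1 + l)^2, the monotonicity of
    x / (1 + x)^2 up to 1.\<close>
  have "0 < (l - ?\<Lambda>) * (1 - l * ?\<Lambda>)"
  proof (rule mult_pos_pos)
    have "l * ?\<Lambda> \<le> ?\<Lambda>" using l(2) cr(1) by (simp add: mult_left_le_one_le l(4) less_imp_le)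
    then show "0 < 1 - l * ?\<Lambda>" using cr(2) by linarith
  qed (use l in simp)
  then have "?\<Lambda> * (1 + l)\<^sup>2 < l * (1 + ?\<Lambda>)\<^sup>2" by (simp add: power2_eq_square algebra_simps)
  also have "\<dots> = ?\<Lambda> * (4 * ?a * l)" unfolding cr(3) by simp
  finally have "(1 + l)\<^sup>2 < 4 * ?a * l" using cr(1) by simp
  then have "1 < 4 * ?a * l / (1 + l)\<^sup>2" using l by simp
  also have "\<dots> = 4 * ?a * (l / (1 + l)) * (1 - l / (1 + l))"
    using l by (simp add: field_simps power2_eq_square)
  finally have *: "1 < 4 * ?a * (l / (1 + l)) * (1 - l / (1 + l))" .
  show ?thesis
    by (rule exI[of _ "l / (1 + l)"]) (use l * in \<open>auto simp: field_simps\<close>)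
qed

section \<open>The subcritical phase\<close>

lemma finite_half_edges: "finite (half_edges n d)"
  by (simp add: half_edges_def)

lemma card_half_edges: "card (half_edges n d) = (\<Sum>i=1..n. half_edge_count n d i)"
  by (simp add: half_edges_def)

lemma card_half_edges_at:
  assumes "i \<in> {1..n}" shows "card {h \<in> half_edges n d. fst h = i} = half_edge_count n d i"
proof -
  have "{h \<in> half_edges n d. fst h = i} = Pair i ` {..<half_edge_count n d i}"
    using assms by (auto simp: half_edges_def)
  then show ?thesis by (simp add: card_image inj_on_def)
qed

lemma even_card_half_edges: "1 \<le> n \<Longrightarrow> even (card (half_edges n d))"
  unfolding card_half_edges by (subst sum_half_edge_count) presburger+

lemma perfect_matchings_half_edges:
  assumes "1 \<le> n"
  shows "finite (perfect_matchings (half_edges n d))" "0 < card (perfect_matchings (half_edges n d))"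
    "perfect_matchings (half_edges n d) \<noteq> {}"
proof -
  show f: "finite (perfect_matchings (half_edges n d))" by (rule finite_perfect_matchings[OF finite_half_edges])
  show c: "0 < card (perfect_matchings (half_edges n d))"
    unfolding card_perfect_matchings[OF finite_half_edges] by (rule num_matchings_pos[OF even_card_half_edges[OF assms]])
  show "perfect_matchings (half_edges n d) \<noteq> {}" using c by auto
qed

lemma nn_integral_config_model:
  assumes "1 \<le> n"
  shows "(\<integral>\<^sup>+G. f G \<partial>config_model D n) = (\<integral>\<^sup>+d. (\<Sum>P\<in>perfect_matchings (half_edges n d). f (config_graph n P)) /
     of_nat (card (perfect_matchings (half_edges n d))) \<partial>Pi_pmf {1..n} 0 (\<lambda>_. D))"
  unfolding config_model_def using perfect_matchings_half_edges[OF assms]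
  by (simp add: nn_integral_pmf_of_set ennreal_of_nat_eq_real_of_nat)

lemma average_ennreal:
  assumes "finite S" "0 < card S" "\<And>x. x \<in> S \<Longrightarrow> 0 \<le> f x"
  shows "(\<Sum>x\<in>S. ennreal (f x)) / of_nat (card S) = ennreal ((\<Sum>x\<in>S. f x) / real (card S))"
proof -
  have "(\<Sum>x\<in>S. ennreal (f x)) = ennreal (\<Sum>x\<in>S. f x)" by (rule sum_ennreal) (rule assms(3))
  then show ?thesis using assms
    by (simp add: ennreal_of_nat_eq_real_of_nat divide_ennreal sum_nonneg)
qed

lemma matched_half_edges:
  assumes "P \<in> perfect_matchings (half_edges n d)" "q \<in> P"
  shows "q \<subseteq> half_edges n d" "fst ` q \<subseteq> {1..n}"
proof -
  show "q \<subseteq> half_edges n d" using assms by (auto simp: perfect_matchings_def partition_on_def)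
  then show "fst ` q \<subseteq> {1..n}" by (auto simp: half_edges_def)
qed

lemma finite_multigraph_config_graph:
  assumes "P \<in> perfect_matchings (half_edges n d)" "0 < lam" "1 \<le> n"
  shows "finite_multigraph (config_graph n P) lam"
proof
  have "finite P"
    using assms(1) finite_half_edges[of n d] by (auto simp: perfect_matchings_def partition_on_def intro: finite_UnionD)
  then show "finite (edges (config_graph n P))" by (simp add: config_graph_def)
  fix e assume "e \<in> edges (config_graph n P)"
  then show "ends (config_graph n P) e \<subseteq> verts (config_graph n P)"
    using assms(3) matched_half_edges(2)[OF assms(1)] by (fastforce simp: config_graph_def)
qed (use assms in \<open>simp_all add: config_graph_def\<close>)

text \<open>At the start vertex 1 is the only red one and has gap 1; the leading 1 counts it. The
  sum stops at \<open>n + 1\<close>, the number of vertices including the one encoded as 0.\<close>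

lemma config_graph_expected_le:
  assumes P: "P \<in> perfect_matchings (half_edges n d)" and lam: "0 < lam" and n: "1 \<le> n"
  shows "(\<integral>\<^sup>+\<omega>. of_nat (card (ever_red (config_graph n P) \<omega> init_coloring)) \<partial>clock_space (config_graph n P) lam)
    \<le> ennreal (1 + (\<Sum>j=1..n + 1. real (npaths (config_graph n P) j 1 {2..n}) * escape_prob (lam / (1 + lam)) j 1))"
proof -
  let ?G = "config_graph n P"
  interpret finite_multigraph ?G lam by (rule finite_multigraph_config_graph[OF P lam n])
  have col: "colored ?G init_coloring Blue = {0}" "colored ?G init_coloring Red = {1}" "colored ?G init_coloring White = {2..n}"
    using n by (auto simp: colored_def config_graph_def init_coloring_def)
  have ch: "chased ?G init_coloring (Suc 0) 1"
    by (rule chased_1[of Chaser_Edge _ 0]) (auto simp: config_graph_def init_coloring_def)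
  have ac: "all_chased ?G init_coloring" using ch by (auto simp: all_chased_def col)
  have "gap ?G init_coloring 1 = 1"
  proof (rule antisym)
    show "gap ?G init_coloring 1 \<le> 1" using gap_le[OF ch] by simp
    show "1 \<le> gap ?G init_coloring 1" using chased_pos[OF chased_gap[OF ch]] by simp
  qed
  moreover have "verts ?G - {2..n} = {0, 1}" "card (verts ?G) = n + 1" using n by (auto simp: config_graph_def)
  ultimately have "potential init_coloring - 1 = 1 + (\<Sum>j=1..n + 1. real (npaths ?G j 1 {2..n}) * escape_prob (lam / (1 + lam)) j 1)"
    by (simp add: potential_def col reach_def p_def)
  moreover have "(\<integral>\<^sup>+\<omega>. of_nat (card (ever_red ?G \<omega> init_coloring)) \<partial>clock_space ?G lam) \<le> ennreal (potential init_coloring - 1)"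
    by (rule expected_ever_red_le[OF _ ac, of 0]) (auto simp: config_graph_def init_coloring_def)
  ultimately show ?thesis by simp
qed

lemma average_npaths:
  assumes n: "1 \<le> n" and W: "W \<subseteq> {2..n}"
  shows "(\<Sum>P\<in>perfect_matchings (half_edges n d). real (npaths (config_graph n P) k 1 W)) / real (card (perfect_matchings (half_edges n d)))
    = mean_paths (half_edge_count n d) k (half_edge_count n d 1) (\<Sum>i=1..n. half_edge_count n d i) W"
proof -
  have "finite W" using W finite_subset by blast
  moreover have "card {h \<in> half_edges n d. fst h = w} = half_edge_count n d w" if "w \<in> W" for w
    using that W n by (intro card_half_edges_at) auto
  moreover have "card {h \<in> half_edges n d. fst h = 1} = half_edge_count n d 1" using n by (intro card_half_edges_at) simp
  ultimately have "(\<Sum>P\<in>perfect_matchings (half_edges n d). real (npaths (config_graph n P) k 1 W))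
    = real (num_matchings (card (half_edges n d))) * mean_paths (half_edge_count n d) k (half_edge_count n d 1) (card (half_edges n d)) W"
    using W n by (intro sum_npaths_matchings finite_half_edges even_card_half_edges) auto
  then show ?thesis
    using perfect_matchings_half_edges(2)[OF n, of d]
    by (simp add: card_perfect_matchings[OF finite_half_edges] card_half_edges)
qed

lemma mean_paths_nonneg: "0 \<le> mean_paths d k c L W"
  by (induction d k c L W rule: mean_paths.induct) (auto intro!: sum_nonneg)

context degree_law
begin

text \<open>For \<open>n = 1\<close> there is no white vertex; the general bound assumes that
  vertices 1 and \<open>n\<close> differ.\<close>

lemma expected_mean_paths_le':
  assumes n: "1 \<le> n" and a1: "1 \<le> a"
  shows "(\<integral>\<^sup>+d. ennreal (mean_paths (half_edge_count n d) (Suc k) (half_edge_count n d 1) (\<Sum>i=1..n. half_edge_count n d i) {2..n}) \<partial>degs {1..n})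
    \<le> ennreal (3 * a ^ k) * (\<integral>\<^sup>+k. of_nat k \<partial>D)"
proof (cases "n = 1")
  case True then show ?thesis by simp
next
  case False then show ?thesis using n a1 by (intro expected_mean_paths_le) auto
qed

lemma expected_ever_red_upper:
  assumes n: "1 \<le> n" and a1: "1 \<le> a" and lam: "0 < lam"
  shows "expected_ever_red D lam n \<le> 1 + ennreal (\<Sum>j=1..n + 1. 3 * a ^ (j - 1) * escape_prob (lam / (1 + lam)) j 1) * (\<integral>\<^sup>+k. of_nat k \<partial>D)"
proof -
  let ?e = "\<lambda>j. escape_prob (lam / (1 + lam)) j 1"
  let ?m = "\<lambda>d j. mean_paths (half_edge_count n d) j (half_edge_count n d 1) (\<Sum>i=1..n. half_edge_count n d i) {2..n}"
  have e0: "0 \<le> ?e j" for j using lam by (intro escape_prob_nonneg) auto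
  have "expected_ever_red D lam n \<le> (\<integral>\<^sup>+d. ennreal (1 + (\<Sum>j=1..n + 1. ?m d j * ?e j)) \<partial>degs {1..n})"
    unfolding expected_ever_red_def nn_integral_config_model[OF n]
  proof (rule nn_integral_mono)
    fix d
    let ?PM = "perfect_matchings (half_edges n d)"
    note pm = perfect_matchings_half_edges[OF n, of d]
    let ?x = "\<lambda>P. 1 + (\<Sum>j=1..n + 1. real (npaths (config_graph n P) j 1 {2..n}) * ?e j)"
    have "(\<Sum>P\<in>?PM. \<integral>\<^sup>+\<omega>. of_nat (card (ever_red (config_graph n P) \<omega> init_coloring)) \<partial>clock_space (config_graph n P) lam) / of_nat (card ?PM)
      \<le> (\<Sum>P\<in>?PM. ennreal (?x P)) / of_nat (card ?PM)"
      by (intro divide_right_mono_ennreal sum_mono config_graph_expected_le lam n)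
    also have "\<dots> = ennreal ((\<Sum>P\<in>?PM. ?x P) / real (card ?PM))"
      by (rule average_ennreal[OF pm(1,2)]) (intro add_nonneg_nonneg sum_nonneg mult_nonneg_nonneg e0, auto)
    also have "(\<Sum>P\<in>?PM. ?x P) / real (card ?PM) = 1 + (\<Sum>j=1..n + 1. ?m d j * ?e j)"
    proof -
      have eq: "(\<Sum>P\<in>?PM. ?x P) = real (card ?PM) + (\<Sum>j=1..n + 1. (\<Sum>P\<in>?PM. real (npaths (config_graph n P) j 1 {2..n})) * ?e j)"
        by (simp only: sum.distrib sum.swap[of _ _ ?PM] sum_distrib_right) simp
      have gen: "(z + (\<Sum>j\<in>J. N j * e j)) / z = 1 + (\<Sum>j\<in>J. N j / z * e j)" if "z \<noteq> 0" for z :: real and N e :: "nat \<Rightarrow> real" and J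
        using that by (simp add: add_divide_distrib sum_divide_distrib)
      have nz: "real (card ?PM) \<noteq> 0" using pm(2) by simp
      have "(\<Sum>P\<in>?PM. ?x P) / real (card ?PM) = 1 + (\<Sum>j=1..n + 1. (\<Sum>P\<in>?PM. real (npaths (config_graph n P) j 1 {2..n})) / real (card ?PM) * ?e j)"
        unfolding eq by (rule gen[OF nz])
      then show ?thesis by (simp only: average_npaths[OF n order_refl])
    qed
    finally show "(\<Sum>P\<in>?PM. \<integral>\<^sup>+\<omega>. of_nat (card (ever_red (config_graph n P) \<omega> init_coloring)) \<partial>clock_space (config_graph n P) lam) / of_nat (card ?PM)
      \<le> ennreal (1 + (\<Sum>j=1..n + 1. ?m d j * ?e j))" .
  qed
  also have "\<dots> = (\<integral>\<^sup>+d. 1 + (\<Sum>j=1..n + 1. ennreal (?e j) * ennreal (?m d j)) \<partial>degs {1..n})"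
  proof (rule nn_integral_cong)
    fix d
    have "(\<Sum>j=1..n + 1. ennreal (?e j) * ennreal (?m d j)) = (\<Sum>j=1..n + 1. ennreal (?m d j * ?e j))"
      by (intro sum.cong refl, subst mult.commute, rule ennreal_mult'[OF mean_paths_nonneg, symmetric])
    also have "\<dots> = ennreal (\<Sum>j=1..n + 1. ?m d j * ?e j)"
      by (intro sum_ennreal mult_nonneg_nonneg e0 mean_paths_nonneg)
    finally show "ennreal (1 + (\<Sum>j=1..n + 1. ?m d j * ?e j)) = 1 + (\<Sum>j=1..n + 1. ennreal (?e j) * ennreal (?m d j))"
      by (simp only: ennreal_plus[OF zero_le_one sum_nonneg[OF mult_nonneg_nonneg[OF mean_paths_nonneg e0]]] ennreal_1)
  qed
  also have "\<dots> = 1 + (\<Sum>j=1..n + 1. ennreal (?e j) * (\<integral>\<^sup>+d. ennreal (?m d j) \<partial>degs {1..n}))"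
    by (simp add: nn_integral_add nn_integral_sum nn_integral_cmult)
  also have "\<dots> \<le> 1 + (\<Sum>j=1..n + 1. ennreal (?e j) * (ennreal (3 * a ^ (j - 1)) * (\<integral>\<^sup>+k. of_nat k \<partial>D)))"
  proof (intro add_left_mono sum_mono mult_left_mono)
    fix j assume "j \<in> {1..n + 1}"
    then obtain k where "j = Suc k" by (cases j) auto
    then show "(\<integral>\<^sup>+d. ennreal (?m d j) \<partial>degs {1..n}) \<le> ennreal (3 * a ^ (j - 1)) * (\<integral>\<^sup>+k. of_nat k \<partial>D)"
      using expected_mean_paths_le'[OF n a1, of k] by simp
  qed simp
  also have "(\<Sum>j=1..n + 1. ennreal (?e j) * (ennreal (3 * a ^ (j - 1)) * (\<integral>\<^sup>+k. of_nat k \<partial>D)))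
    = (\<Sum>j=1..n + 1. ennreal (3 * a ^ (j - 1) * ?e j)) * (\<integral>\<^sup>+k. of_nat k \<partial>D)"
    unfolding sum_distrib_right using a(1) e0
    by (intro sum.cong refl) (simp add: ennreal_mult' mult_ac)
  also have "(\<Sum>j=1..n + 1. ennreal (3 * a ^ (j - 1) * ?e j)) = ennreal (\<Sum>j=1..n + 1. 3 * a ^ (j - 1) * ?e j)"
    using a(1) by (intro sum_ennreal mult_nonneg_nonneg e0) auto
  finally show ?thesis .
qed

end

section \<open>Moments of the degree and the explicit constant\<close>

text \<open>The bound of \<mu> by the excess degree plus 1 is nonnegativity of the variance. It
  removes the mean degree from the upper bound, which may depend on the critical rate only.\<close>

lemma degree_moments:
  fixes D :: "nat pmf"
  assumes int: "integrable (measure_pmf D) (\<lambda>k. real k * (real k - 2))"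
    and pos: "0 < measure_pmf.expectation D (\<lambda>k. real k * (real k - 2))"
  defines "\<mu> \<equiv> measure_pmf.expectation D real"
  shows "0 < \<mu>" "1 < mean_excess_degree D" "\<mu> \<le> mean_excess_degree D + 1"
    "integrable (measure_pmf D) real"
    "(\<integral>\<^sup>+k. of_nat k \<partial>D) = ennreal \<mu>" "(\<integral>\<^sup>+k. of_nat (k * (k - 1)) \<partial>D) = ennreal (mean_excess_degree D * \<mu>)"
proof -
  have i2: "integrable (measure_pmf D) (\<lambda>k. (real k)\<^sup>2)"
  proof (rule Bochner_Integration.integrable_bound)
    \<comment> \<open>Dominates k^2: the 4 covers k \<le> 2, and beyond that k^2 \<le> 3 k (k - 2),
      as k (2 k - 6) \<ge> 0.\<close>
    show "integrable (measure_pmf D) (\<lambda>k. 4 + 3 * \<bar>real k * (real k - 2)\<bar>)" using int by auto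
    have "(real k)\<^sup>2 \<le> 4 + 3 * \<bar>real k * (real k - 2)\<bar>" for k
    proof (cases "k \<le> 2")
      case True
      then have "real k * real k \<le> 2 * 2" by (intro mult_mono) auto
      then show ?thesis by (simp add: power2_eq_square)
    next
      case False
      then have "0 \<le> real k * (2 * real k - 6)" by simp
      moreover have "real k * (real k - 2) \<le> \<bar>real k * (real k - 2)\<bar>" by (rule abs_ge_self)
      ultimately show ?thesis by (simp add: power2_eq_square algebra_simps)
    qed
    then show "AE k in measure_pmf D. norm ((real k)\<^sup>2) \<le> norm (4 + 3 * \<bar>real k * (real k - 2)\<bar>)" by simp
  qed simp
  show i1: "integrable (measure_pmf D) real"
  proof (rule Bochner_Integration.integrable_bound[OF i2])
    have "real k \<le> (real k)\<^sup>2" for k by (cases k) (auto simp: power2_eq_square)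
    then show "AE k in measure_pmf D. norm (real k) \<le> norm ((real k)\<^sup>2)" by simp
  qed simp
  define m2 where "m2 = measure_pmf.expectation D (\<lambda>k. (real k)\<^sup>2)"
  have "measure_pmf.expectation D (\<lambda>k. real k * (real k - 2)) = measure_pmf.expectation D (\<lambda>k. (real k)\<^sup>2 - 2 * real k)"
    by (simp add: power2_eq_square algebra_simps)
  also have "\<dots> = m2 - 2 * \<mu>" using i1 i2 by (simp add: m2_def \<mu>_def)
  finally have m2: "2 * \<mu> < m2" using pos by simp
  have mu0: "0 \<le> \<mu>" unfolding \<mu>_def by (rule integral_nonneg_AE) simp
  have "\<mu> \<noteq> 0"
  proof
    assume "\<mu> = 0"
    then have "AE k in measure_pmf D. real k = 0"
      using integral_nonneg_eq_0_iff_AE[OF i1] by (simp add: \<mu>_def)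
    then have "AE k in measure_pmf D. (real k)\<^sup>2 = 0" by eventually_elim simp
    then have "m2 = 0" unfolding m2_def by (rule integral_eq_zero_AE)
    then show False using m2 \<open>\<mu> = 0\<close> by simp
  qed
  then show mu: "0 < \<mu>" using mu0 by simp
  have a: "mean_excess_degree D = m2 / \<mu> - 1" by (simp add: mean_excess_degree_def m2_def \<mu>_def)
  show "1 < mean_excess_degree D" unfolding a using m2 mu by (simp add: field_simps)
  have "0 \<le> measure_pmf.expectation D (\<lambda>k. (real k - \<mu>)\<^sup>2)" by (rule integral_nonneg_AE) simp
  also have "\<dots> = measure_pmf.expectation D (\<lambda>k. (real k)\<^sup>2 - 2 * \<mu> * real k + \<mu>\<^sup>2)"
    by (simp add: power2_eq_square algebra_simps)
  also have "\<dots> = m2 - 2 * \<mu> * \<mu> + \<mu>\<^sup>2" using i1 i2 by (simp add: m2_def \<mu>_def)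
  finally have "\<mu> * \<mu> \<le> m2" by (simp add: power2_eq_square)
  then show "\<mu> \<le> mean_excess_degree D + 1" unfolding a using mu by (simp add: field_simps)
  show "(\<integral>\<^sup>+k. of_nat k \<partial>D) = ennreal \<mu>"
    unfolding \<mu>_def using nn_integral_eq_integral[OF i1] by (simp add: ennreal_of_nat_eq_real_of_nat)
  have kk: "real (k * (k - 1)) = (real k)\<^sup>2 - real k" for k by (cases k) (auto simp: power2_eq_square algebra_simps)
  have "(\<integral>\<^sup>+k. of_nat (k * (k - 1)) \<partial>D) = (\<integral>\<^sup>+k. ennreal ((real k)\<^sup>2 - real k) \<partial>D)"
    by (simp only: ennreal_of_nat_eq_real_of_nat kk)
  also have "\<dots> = ennreal (measure_pmf.expectation D (\<lambda>k. (real k)\<^sup>2 - real k))"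
  proof (rule nn_integral_eq_integral)
    show "AE k in measure_pmf D. 0 \<le> (real k)\<^sup>2 - real k" unfolding kk[symmetric] by simp
  qed (use i1 i2 in simp)
  also have "measure_pmf.expectation D (\<lambda>k. (real k)\<^sup>2 - real k) = m2 - \<mu>" using i1 i2 by (simp add: m2_def \<mu>_def)
  also have "\<dots> = mean_excess_degree D * \<mu>" unfolding a using mu by (simp add: field_simps)
  finally show "(\<integral>\<^sup>+k. of_nat (k * (k - 1)) \<partial>D) = ennreal (mean_excess_degree D * \<mu>)" .
qed

text \<open>\<open>a\<close> is recovered from \<Lambda> by (1 + \<Lambda>)^2 = 4 a \<Lambda>, and
  \<open>r\<close> is \<open>2 * (1 - p)\<close> at the critical rate. The middle factor is the
  bound of \<open>weighted_escape_prob_le\<close> at \<open>l = 1\<close>, \<open>a + 1\<close>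
  bounds the mean degree, and the leading 2 instead of 1 makes the inequality strict.\<close>

definition subcritical_bound :: "real \<Rightarrow> real" where
  "subcritical_bound \<Lambda> = (let a = (1 + \<Lambda>)\<^sup>2 / (4 * \<Lambda>); r = 2 / (1 + \<Lambda>) in 2 + 3 / a * ((2 * r - 1) / (r - 1)\<^sup>2) * (a + 1))"

text \<open>Monotonicity of \<open>escape_prob\<close> in \<open>p\<close> reduces all rates to the
  critical one.\<close>

theorem subcritical:
  assumes int: "integrable (measure_pmf D) (\<lambda>k. real k * (real k - 2))"
    and pos: "0 < measure_pmf.expectation D (\<lambda>k. real k * (real k - 2))"
    and lam: "0 < lam" "lam \<le> critical_rate D"
  shows "(SUP n\<in>{1..}. expected_ever_red D lam n) < ennreal (subcritical_bound (critical_rate D))"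
proof -
  note dm = degree_moments[OF int pos]
  let ?\<Lambda> = "critical_rate D" and ?a = "mean_excess_degree D" and ?\<mu> = "measure_pmf.expectation D real"
  note cr = critical_rate_identities[OF dm(2)]
  interpret degree_law D ?a
    by unfold_locales (use dm in \<open>auto simp: ennreal_mult'\<close>)
  define p where "p = ?\<Lambda> / (1 + ?\<Lambda>)"
  define r where "r = 2 / (1 + ?\<Lambda>)"
  define c where "c = 1 / (r - 1)\<^sup>2"
  have a: "?a = (1 + ?\<Lambda>)\<^sup>2 / (4 * ?\<Lambda>)" unfolding cr(3) using cr(1) by simp
  have p: "0 < p" "p < 1" "1 - p = 1 / (1 + ?\<Lambda>)" using cr by (auto simp: p_def field_simps)
  have crit: "4 * ?a * p * (1 - p) = 1"
    unfolding p(3) unfolding p_def a using cr(1) by (simp add: power2_eq_square)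
  have r: "r = 2 * (1 - p)" "1 < r" using cr unfolding p(3) by (auto simp: r_def)
  have lp: "lam / (1 + lam) \<le> p" using lam cr unfolding p_def by (simp add: field_simps)
  have S: "(\<Sum>j=1..K. 3 * ?a ^ (j - 1) * escape_prob (lam / (1 + lam)) j 1) \<le> 3 / ?a * (c * (2 * r - 1))" for K
  proof -
    have "(\<Sum>j=1..K. 3 * ?a ^ (j - 1) * escape_prob (lam / (1 + lam)) j 1) \<le> (\<Sum>j=1..K. 3 / ?a * (?a ^ j * escape_prob p j 1))"
    proof (rule sum_mono)
      fix j assume "j \<in> {1..K}"
      then obtain k where k: "j = Suc k" by (cases j) auto
      have "escape_prob (lam / (1 + lam)) j 1 \<le> escape_prob p j 1"
        using lam lp p by (intro escape_prob_mono_p) auto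
      then have "3 * ?a ^ (j - 1) * escape_prob (lam / (1 + lam)) j 1 \<le> 3 * ?a ^ (j - 1) * escape_prob p j 1"
        using dm(2) by (intro mult_left_mono) auto
      also have "\<dots> = 3 / ?a * (?a ^ j * escape_prob p j 1)" using dm(2) by (simp add: k)
      finally show "3 * ?a ^ (j - 1) * escape_prob (lam / (1 + lam)) j 1 \<le> 3 / ?a * (?a ^ j * escape_prob p j 1)" .
    qed
    also have "\<dots> = 3 / ?a * (\<Sum>j=1..K. ?a ^ j * escape_prob p j 1)" by (simp only: sum_distrib_left)
    also have "\<dots> \<le> 3 / ?a * (c * (2 * r ^ 1 - 1))"
      using dm(2) by (intro mult_left_mono weighted_escape_prob_le[OF p(1,2) crit r c_def]) simp
    finally show ?thesis by simp
  qed
  have B0: "0 \<le> 3 / ?a * (c * (2 * r - 1))" using dm(2) r by (simp add: c_def)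
  have up: "expected_ever_red D lam n \<le> ennreal (1 + 3 / ?a * (c * (2 * r - 1)) * (?a + 1))" if "1 \<le> n" for n
  proof -
    have "expected_ever_red D lam n \<le> 1 + ennreal (\<Sum>j=1..n + 1. 3 * ?a ^ (j - 1) * escape_prob (lam / (1 + lam)) j 1) * ennreal ?\<mu>"
      using expected_ever_red_upper[OF that _ lam(1)] dm(2,5) by simp
    also have "\<dots> \<le> 1 + ennreal (3 / ?a * (c * (2 * r - 1))) * ennreal (?a + 1)"
      by (intro add_left_mono mult_mono ennreal_leI S dm(3)) auto
    also have "\<dots> = ennreal (1 + 3 / ?a * (c * (2 * r - 1)) * (?a + 1))"
    proof -
      have gen: "1 + ennreal x * ennreal y = ennreal (1 + x * y)" if "0 \<le> x" "0 \<le> y" for x y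
        using that by (simp add: ennreal_mult)
      show ?thesis by (rule gen) (use B0 dm(2) in auto)
    qed
    finally show ?thesis .
  qed
  have "(SUP n\<in>{1..}. expected_ever_red D lam n) \<le> ennreal (1 + 3 / ?a * (c * (2 * r - 1)) * (?a + 1))"
    by (rule SUP_least) (use up in simp)
  also have "\<dots> < ennreal (subcritical_bound ?\<Lambda>)"
  proof (rule ennreal_lessI)
    have "0 \<le> 3 / ?a * (c * (2 * r - 1)) * (?a + 1)" using dm(2) by (intro mult_nonneg_nonneg B0) simp
    moreover have "subcritical_bound ?\<Lambda> = 2 + 3 / ?a * (c * (2 * r - 1)) * (?a + 1)"
      unfolding subcritical_bound_def Let_def a[symmetric] r_def[symmetric] c_def by simp
    ultimately show "0 < subcritical_bound ?\<Lambda>" "1 + 3 / ?a * (c * (2 * r - 1)) * (?a + 1) < subcritical_bound ?\<Lambda>"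
      by linarith+
  qed
  finally show ?thesis .
qed

section \<open>Short cycles near the root\<close>

text \<open>Self-loops at vertices of \<open>X\<close> are included: the half-edges differ, but
  their vertices need not.\<close>

definition closes :: "half_edge set set \<Rightarrow> nat set \<Rightarrow> bool" where
  "closes P X \<longleftrightarrow> (\<exists>h h'. h \<noteq> h' \<and> {h, h'} \<in> P \<and> fst h \<in> X \<and> fst h' \<in> X)"

text \<open>Exploring at most \<open>j\<close> further edges of the matching \<open>P\<close> from \<open>X\<close> can lead to a cycle.\<close>

fun cyclic :: "nat \<Rightarrow> half_edge set set \<Rightarrow> nat set \<Rightarrow> bool" where
  "cyclic 0 P X \<longleftrightarrow> closes P X"
| "cyclic (Suc j) P X \<longleftrightarrow> closes P X \<or>
    (\<exists>h h'. {h, h'} \<in> P \<and> fst h \<in> X \<and> fst h' \<notin> X \<and> cyclic j (P - {{h, h'}}) (insert (fst h') X))"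

lemma cyclic_Suc: "cyclic j P X \<Longrightarrow> cyclic (Suc j) P X"
proof (induction j arbitrary: P X)
  case 0 then show ?case by simp
next
  case (Suc j)
  from Suc.prems consider "closes P X"
    | h h' where "{h, h'} \<in> P" "fst h \<in> X" "fst h' \<notin> X" "cyclic j (P - {{h, h'}}) (insert (fst h') X)"
    unfolding cyclic.simps(2) by blast
  then show ?case
  proof cases
    case 1 then show ?thesis by simp
  next
    case 2
    then show ?thesis using Suc.IH[OF 2(4)] unfolding cyclic.simps(2)[of "Suc j"] by blast
  qed
qed

lemma cyclic_mono: "j \<le> j' \<Longrightarrow> cyclic j P X \<Longrightarrow> cyclic j' P X"
  by (induction j' rule: dec_induct) (auto intro: cyclic_Suc simp del: cyclic.simps)

text \<open>\<open>P'\<close> is the matching without the edges along which \<open>X\<close> was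
  grown, so an exploration that starts at \<open>X\<close> can be preceded by these
  \<open>card X - 1\<close> steps from the root.\<close>

lemma grown_explored:
  assumes "P \<in> perfect_matchings (half_edges n d)" "grown (config_graph n P) 0 1 X"
  shows "\<exists>P'. 0 \<notin> X \<and> (\<forall>q\<in>P. \<not> fst ` q \<subseteq> X \<longrightarrow> q \<in> P') \<and> (\<forall>j. cyclic j P' X \<longrightarrow> cyclic (card X - 1 + j) P {1})"
  using assms(2)
proof (induction rule: grown.induct)
  case grown_root
  then show ?case by (intro exI[of _ P]) auto
next
  case (grown_insert X e u w)
  then obtain P' where P': "0 \<notin> X" "\<forall>q\<in>P. \<not> fst ` q \<subseteq> X \<longrightarrow> q \<in> P'" "\<And>j. cyclic j P' X \<Longrightarrow> cyclic (card X - 1 + j) P {1}" by blast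
  show ?case
  proof (cases "w \<in> X")
    case True
    then have "insert w X = X" by auto
    then show ?thesis using P' by metis
  next
    case False
    have "e \<noteq> Chaser_Edge" using grown_insert.hyps P'(1) by (auto simp: config_graph_def doubleton_eq_iff)
    then obtain q where q: "e = Matched q" "q \<in> P" using grown_insert.hyps(2) by (auto simp: config_graph_def)
    have fq: "fst ` q = {u, w}" using grown_insert.hyps(3) q by (simp add: config_graph_def)
    have "card q = 2" using assms(1) q by (simp add: perfect_matchings_def)
    then obtain h h' where h: "q = {h, h'}" "fst h = u" "fst h' = w"
    proof -
      obtain g g' where g: "q = {g, g'}" using \<open>card q = 2\<close> by (auto simp: card_2_iff)
      then have "fst g = u \<and> fst g' = w \<or> fst g' = u \<and> fst g = w" using fq by (auto simp: doubleton_eq_iff)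
      then show ?thesis using that[of g g'] that[of g' g] g by (auto simp: insert_commute)
    qed
    have "0 < card X" using finite_grown[OF grown_insert.hyps(1)] root_in_grown[OF grown_insert.hyps(1)] by (auto simp: card_gt_0_iff)
    then have cX: "card (insert w X) - 1 = card X - 1 + 1" using False finite_grown[OF grown_insert.hyps(1)] by simp
    show ?thesis
    proof (intro exI[of _ "P' - {q}"] conjI ballI impI allI)
      show "0 \<notin> insert w X" using P'(1) grown_insert.hyps by auto
      fix q' assume "q' \<in> P" "\<not> fst ` q' \<subseteq> insert w X"
      then show "q' \<in> P' - {q}" using P'(2) fq grown_insert.hyps(4) by auto
    next
      fix j assume c: "cyclic j (P' - {q}) (insert w X)"
      have "q \<in> P'" using P'(2) q(2) fq False by auto
      then have "cyclic (Suc j) P' X"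
        unfolding cyclic.simps using c h grown_insert.hyps(4) False by blast
      have eq: "card (insert w X) - 1 + j = card X - 1 + Suc j" using cX by linarith
      show "cyclic (card (insert w X) - 1 + j) P {1}" unfolding eq by (rule P'(3)) fact
    qed
  qed
qed

text \<open>Of two different edges from \<open>X\<close> to \<open>v\<close>, exploring one makes
  the other run inside the explored set.\<close>

lemma not_locally_tree_cyclic:
  assumes P: "P \<in> perfect_matchings (half_edges n d)" and nl: "\<not> locally_tree (config_graph n P) 0 1 J"
  shows "cyclic J P {1}"
proof -
  let ?G = "config_graph n P"
  obtain X v x x' e e' where X: "grown ?G 0 1 X" "card X < J" "v \<notin> X" "v \<noteq> 0" "x \<in> X" "x' \<in> X" "e \<in> edges ?G" "e' \<in> edges ?G"
    "ends ?G e = {x, v}" "ends ?G e' = {x', v}" "e \<noteq> e'"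
    using nl unfolding locally_tree_def by blast
  obtain P' where P': "0 \<notin> X" "\<forall>q\<in>P. \<not> fst ` q \<subseteq> X \<longrightarrow> q \<in> P'" "\<And>j. cyclic j P' X \<Longrightarrow> cyclic (card X - 1 + j) P {1}"
    using grown_explored[OF P X(1)] by blast
  have pair: "\<exists>h h'. f = Matched {h, h'} \<and> {h, h'} \<in> P' \<and> h \<noteq> h' \<and> fst h = y \<and> fst h' = v"
    if f: "f \<in> edges ?G" "ends ?G f = {y, v}" "y \<in> X" for f y
  proof -
    have "f \<noteq> Chaser_Edge" using f X P'(1) by (auto simp: config_graph_def doubleton_eq_iff)
    then obtain q where q: "f = Matched q" "q \<in> P" using f by (auto simp: config_graph_def)
    have fq: "fst ` q = {y, v}" using f q by (simp add: config_graph_def)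
    then have qP': "q \<in> P'" using P'(2) q X(3) by auto
    have "card q = 2" using P q by (simp add: perfect_matchings_def)
    then obtain g g' where g: "q = {g, g'}" "g \<noteq> g'" by (auto simp: card_2_iff)
    then have "fst g = y \<and> fst g' = v \<or> fst g' = y \<and> fst g = v" using fq by (auto simp: doubleton_eq_iff)
    then show ?thesis
    proof
      assume "fst g = y \<and> fst g' = v"
      then show ?thesis using g q(1) qP' by (intro exI[of _ g] exI[of _ g']) simp
    next
      assume "fst g' = y \<and> fst g = v"
      then show ?thesis using g q(1) qP' by (intro exI[of _ g'] exI[of _ g]) (simp add: insert_commute)
    qed
  qed
  obtain h h' where h: "e = Matched {h, h'}" "{h, h'} \<in> P'" "fst h = x" "fst h' = v" using pair[OF X(7,9,5)] by blast
  obtain g g' where g: "e' = Matched {g, g'}" "{g, g'} \<in> P'" "g \<noteq> g'" "fst g = x'" "fst g' = v" using pair[OF X(8,10,6)] by blast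
  have "{g, g'} \<noteq> {h, h'}" using X(11) h g by auto
  then have "closes (P' - {{h, h'}}) (insert v X)"
    unfolding closes_def using g X by (intro exI[of _ g] exI[of _ g']) auto
  then have "cyclic 0 (P' - {{h, h'}}) (insert (fst h') X)" using h(4) by simp
  then have "cyclic (Suc 0) P' X" unfolding cyclic.simps(2) using h(2-4) X(3,5) by blast
  from P'(3)[OF this] have "cyclic (card X - 1 + Suc 0) P {1}" .
  moreover have "card X - 1 + Suc 0 \<le> J" using X(2) by linarith
  ultimately show ?thesis by (rule cyclic_mono[rotated])
qed

section \<open>The probability of a short cycle for given degrees\<close>

definition cyclic_prob :: "nat \<Rightarrow> half_edge set \<Rightarrow> nat set \<Rightarrow> real" where
  "cyclic_prob j H X = real (card {P \<in> perfect_matchings H. cyclic j P X}) / real (card (perfect_matchings H))"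

lemma cyclic_prob_le_1: "finite H \<Longrightarrow> cyclic_prob j H X \<le> 1"
  unfolding cyclic_prob_def by (rule divide_le_eq_1[THEN iffD2])
    (auto intro!: card_mono finite_perfect_matchings simp: not_less)

text \<open>A half-edge has \<open>card H - 1\<close> equally likely partners, and given the partner
  the rest is again a uniform matching.\<close>

lemma edge_prob:
  assumes H: "finite H" "even (card H)" and h: "h \<in> H" "h' \<in> H" "h \<noteq> h'"
  shows "real (card {P \<in> perfect_matchings H. {h, h'} \<in> P \<and> Q P}) / real (card (perfect_matchings H))
    = real (card {P \<in> perfect_matchings (H - {h, h'}). Q (insert {h, h'} P)}) / real (card (perfect_matchings (H - {h, h'}))) / real (card H - 1)"
proof -
  have "card {h, h'} \<le> card H" using h H(1) by (intro card_mono) auto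
  then have c2: "2 \<le> card H" using h by simp
  have c: "card (H - {h, h'}) = card H - 2" using h H(1) by (subst card_Diff_subset) auto
  show ?thesis
    unfolding card_perfect_matchings_edge[OF h] using H
    by (simp add: card_perfect_matchings c num_matchings_rec[OF c2])
qed

text \<open>Union bound over the at most \<open>x * x\<close> ordered pairs of half-edges at
  \<open>X\<close>, and over the first edge explored.\<close>

lemma cyclic_prob_rec:
  assumes H: "finite H" "even (card H)" and x: "card {h \<in> H. fst h \<in> X} \<le> x"
  shows "cyclic_prob 0 H X \<le> real x * real x / real (card H - 1)"
    "cyclic_prob (Suc j) H X \<le> real x * real x / real (card H - 1) +
      (\<Sum>h\<in>{h \<in> H. fst h \<in> X}. \<Sum>h'\<in>{h' \<in> H. fst h' \<notin> X}. cyclic_prob j (H - {h, h'}) (insert (fst h') X) / real (card H - 1))"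
proof -
  let ?PM = "perfect_matchings H" and ?HX = "{h \<in> H. fst h \<in> X}" and ?HY = "{h' \<in> H. fst h' \<notin> X}"
  have fin: "finite ?PM" "finite ?HX" "finite ?HY" using H finite_perfect_matchings by auto
  let ?D = "{z \<in> ?HX \<times> ?HX. fst z \<noteq> snd z}"
  have sub: "P \<in> ?PM \<Longrightarrow> {h, h'} \<in> P \<Longrightarrow> h \<in> H \<and> h' \<in> H" for P h h'
    by (auto simp: perfect_matchings_def partition_on_def)
  have closes: "real (card {P \<in> ?PM. closes P X}) / real (card ?PM) \<le> real x * real x / real (card H - 1)"
  proof -
    have "{P \<in> ?PM. closes P X} \<subseteq> (\<Union>z\<in>?D. {P \<in> ?PM. {fst z, snd z} \<in> P \<and> True})"
      using sub unfolding closes_def by fastforce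
    then have "card {P \<in> ?PM. closes P X} \<le> card (\<Union>z\<in>?D. {P \<in> ?PM. {fst z, snd z} \<in> P \<and> True})"
      using fin by (intro card_mono) auto
    also have "\<dots> \<le> (\<Sum>z\<in>?D. card {P \<in> ?PM. {fst z, snd z} \<in> P \<and> True})"
      by (rule card_UN_le) (use fin in auto)
    finally have "real (card {P \<in> ?PM. closes P X}) \<le> (\<Sum>z\<in>?D. real (card {P \<in> ?PM. {fst z, snd z} \<in> P \<and> True}))"
      using of_nat_mono by fastforce
    then have "real (card {P \<in> ?PM. closes P X}) / real (card ?PM) \<le> (\<Sum>z\<in>?D. real (card {P \<in> ?PM. {fst z, snd z} \<in> P \<and> True})) / real (card ?PM)"
      by (rule divide_right_mono) simp
    also have "\<dots> = (\<Sum>z\<in>?D. real (card {P \<in> ?PM. {fst z, snd z} \<in> P \<and> True}) / real (card ?PM))"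
      by (rule sum_divide_distrib)
    also have "\<dots> \<le> (\<Sum>z\<in>?D. 1 / real (card H - 1))"
    proof (rule sum_mono)
      fix z assume "z \<in> ?D"
      then have z: "fst z \<in> H" "snd z \<in> H" "fst z \<noteq> snd z" by auto
      have "real (card (perfect_matchings (H - {fst z, snd z}))) / real (card (perfect_matchings (H - {fst z, snd z}))) \<le> 1" by simp
      then show "real (card {P \<in> ?PM. {fst z, snd z} \<in> P \<and> True}) / real (card ?PM) \<le> 1 / real (card H - 1)"
        unfolding edge_prob[OF H z] by (intro divide_right_mono) auto
    qed
    also have "\<dots> = real (card ?D) / real (card H - 1)" by simp
    also have "\<dots> \<le> real x * real x / real (card H - 1)"
    proof (rule divide_right_mono)
      have "card ?D \<le> card (?HX \<times> ?HX)" using fin by (intro card_mono) auto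
      also have "\<dots> \<le> x * x" using x by (simp add: card_cartesian_product mult_le_mono)
      finally have "real (card ?D) \<le> real (x * x)" by (rule of_nat_mono)
      then show "real (card ?D) \<le> real x * real x" by simp
    qed simp
    finally show ?thesis .
  qed
  then show "cyclic_prob 0 H X \<le> real x * real x / real (card H - 1)" by (simp add: cyclic_prob_def)
  let ?E = "\<lambda>h h'. {P \<in> ?PM. {h, h'} \<in> P \<and> cyclic j (P - {{h, h'}}) (insert (fst h') X)}"
  have "{P \<in> ?PM. cyclic (Suc j) P X} \<subseteq> {P \<in> ?PM. closes P X} \<union> (\<Union>h\<in>?HX. \<Union>h'\<in>?HY. ?E h h')"
    using sub by (simp only: cyclic.simps) blast
  then have "card {P \<in> ?PM. cyclic (Suc j) P X} \<le> card ({P \<in> ?PM. closes P X} \<union> (\<Union>h\<in>?HX. \<Union>h'\<in>?HY. ?E h h'))"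
    using fin by (intro card_mono) auto
  also have "\<dots> \<le> card {P \<in> ?PM. closes P X} + card (\<Union>h\<in>?HX. \<Union>h'\<in>?HY. ?E h h')" by (rule card_Un_le)
  also have "card (\<Union>h\<in>?HX. \<Union>h'\<in>?HY. ?E h h') \<le> (\<Sum>h\<in>?HX. card (\<Union>h'\<in>?HY. ?E h h'))"
    by (rule card_UN_le) (use fin in auto)
  also have "\<dots> \<le> (\<Sum>h\<in>?HX. \<Sum>h'\<in>?HY. card (?E h h'))"
    by (intro sum_mono card_UN_le) (use fin in auto)
  finally have "real (card {P \<in> ?PM. cyclic (Suc j) P X}) \<le> real (card {P \<in> ?PM. closes P X}) + (\<Sum>h\<in>?HX. \<Sum>h'\<in>?HY. real (card (?E h h')))"
    using of_nat_mono by fastforce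
  then have "cyclic_prob (Suc j) H X \<le> (real (card {P \<in> ?PM. closes P X}) + (\<Sum>h\<in>?HX. \<Sum>h'\<in>?HY. real (card (?E h h')))) / real (card ?PM)"
    unfolding cyclic_prob_def by (rule divide_right_mono) simp
  also have "\<dots> = real (card {P \<in> ?PM. closes P X}) / real (card ?PM) + (\<Sum>h\<in>?HX. \<Sum>h'\<in>?HY. real (card (?E h h')) / real (card ?PM))"
    by (simp add: add_divide_distrib sum_divide_distrib)
  also have "(\<Sum>h\<in>?HX. \<Sum>h'\<in>?HY. real (card (?E h h')) / real (card ?PM))
    = (\<Sum>h\<in>?HX. \<Sum>h'\<in>?HY. cyclic_prob j (H - {h, h'}) (insert (fst h') X) / real (card H - 1))"
  proof (intro sum.cong refl)
    fix h h' assume "h \<in> ?HX" "h' \<in> ?HY"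
    then have h: "h \<in> H" "h' \<in> H" "h \<noteq> h'" by auto
    have eq: "{P \<in> perfect_matchings (H - {h, h'}). cyclic j (insert {h, h'} P - {{h, h'}}) (insert (fst h') X)}
      = {P \<in> perfect_matchings (H - {h, h'}). cyclic j P (insert (fst h') X)}"
    proof -
      have "insert {h, h'} P - {{h, h'}} = P" if "P \<in> perfect_matchings (H - {h, h'})" for P
      proof -
        have "{h, h'} \<notin> P" using that by (auto simp: perfect_matchings_def partition_on_def)
        then show ?thesis by auto
      qed
      then show ?thesis by auto
    qed
    show "real (card (?E h h')) / real (card ?PM) = cyclic_prob j (H - {h, h'}) (insert (fst h') X) / real (card H - 1)"
      unfolding edge_prob[OF H h] eq cyclic_prob_def ..
  qed
  finally show "cyclic_prob (Suc j) H X \<le> real x * real x / real (card H - 1) +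
      (\<Sum>h\<in>?HX. \<Sum>h'\<in>?HY. cyclic_prob j (H - {h, h'}) (insert (fst h') X) / real (card H - 1))"
    using add_right_mono[OF closes] by (rule order_trans)
qed

definition heavy :: "half_edge set \<Rightarrow> nat \<Rightarrow> half_edge set" where
  "heavy H t = {h \<in> H. t < card {g \<in> H. fst g = fst h}}"

text \<open>Few half-edges belong to vertices of large degree, so that the exploration stays bounded; the
  finitely many degree thresholds \<open>thr \<eta>\<close> have to be chosen one after the other.\<close>

lemma cyclic_prob_small:
  fixes thr :: "real \<Rightarrow> nat" and \<epsilon> :: real
  assumes "0 < \<epsilon>"
  shows "\<exists>F L. finite F \<and> card F \<le> j \<and> (\<forall>\<eta>\<in>F. 0 < \<eta>) \<and> 0 < L \<and>
    (\<forall>H0 H X l. finite H0 \<longrightarrow> L \<le> l \<longrightarrow> (\<forall>\<eta>\<in>F. real (card (heavy H0 (thr \<eta>))) \<le> \<eta> * l) \<longrightarrow> H \<subseteq> H0 \<longrightarrow> even (card H) \<longrightarrow>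
      l + 2 * real j + 1 \<le> real (card H) \<longrightarrow> card {h \<in> H. fst h \<in> X} \<le> x \<longrightarrow> cyclic_prob j H X \<le> \<epsilon>)"
  using assms
proof (induction j arbitrary: x \<epsilon>)
  case 0
  show ?case
  proof (intro exI[of _ "{}"] exI[of _ "real x * real x / \<epsilon> + 1"] conjI allI impI)
    show "0 < real x * real x / \<epsilon> + 1" using 0 by (intro add_nonneg_pos) auto
    fix H0 H :: "half_edge set" and X l
    assume H: "finite H0" "real x * real x / \<epsilon> + 1 \<le> l" "H \<subseteq> H0" "even (card H)" "l + 2 * real 0 + 1 \<le> real (card H)" "card {h \<in> H. fst h \<in> X} \<le> x"
    have fH: "finite H" using H finite_subset by blast
    have "0 < l" using H(2) 0 by (smt (verit) divide_nonneg_pos mult_nonneg_nonneg of_nat_0_le_iff)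
    have l: "l \<le> real (card H - 1)" using H(5) \<open>0 < l\<close> by (subst of_nat_diff) auto
    have "cyclic_prob 0 H X \<le> real x * real x / real (card H - 1)" by (rule cyclic_prob_rec(1)[OF fH H(4,6)])
    also have "\<dots> \<le> real x * real x / l" using l \<open>0 < l\<close> by (intro divide_left_mono) auto
    also have "\<dots> \<le> \<epsilon>" using H(2) 0 \<open>0 < l\<close> by (simp add: field_simps)
    finally show "cyclic_prob 0 H X \<le> \<epsilon>" .
  qed auto
next
  case (Suc j)
  \<comment> \<open>Each of the at most \<open>x\<close> half-edges at \<open>X\<close> costs at
    most 2 \<eta>: once for a partner at a vertex of degree above \<open>thr \<eta>\<close>, once
    for the induction hypothesis with \<open>x + thr \<eta>\<close> half-edges. The pairs inside
    \<open>X\<close> take the remaining third of \<epsilon>.\<close>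
  define \<eta> where "\<eta> = \<epsilon> / (3 * (real x + 1))"
  have \<eta>: "0 < \<eta>" using Suc.prems by (simp add: \<eta>_def)
  obtain F L where F: "finite F" "card F \<le> j" "\<forall>\<eta>\<in>F. 0 < \<eta>" "0 < L"
    and IH: "\<And>H0 H X l. finite H0 \<Longrightarrow> L \<le> l \<Longrightarrow> \<forall>\<eta>\<in>F. real (card (heavy H0 (thr \<eta>))) \<le> \<eta> * l \<Longrightarrow> H \<subseteq> H0 \<Longrightarrow> even (card H) \<Longrightarrow>
      l + 2 * real j + 1 \<le> real (card H) \<Longrightarrow> card {h \<in> H. fst h \<in> X} \<le> x + thr \<eta> \<Longrightarrow> cyclic_prob j H X \<le> \<eta>"
    using Suc.IH[OF \<eta>, of "x + thr \<eta>"] by blast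
  define L' where "L' = max L (3 * real x * real x / \<epsilon>)"
  show ?case
  proof (intro exI[of _ "insert \<eta> F"] exI[of _ L'] conjI allI impI)
    show "card (insert \<eta> F) \<le> Suc j" using F by (simp add: card_insert_if)
    fix H0 H :: "half_edge set" and X l
    assume H: "finite H0" "L' \<le> l" "\<forall>\<eta>\<in>insert \<eta> F. real (card (heavy H0 (thr \<eta>))) \<le> \<eta> * l" "H \<subseteq> H0" "even (card H)"
      "l + 2 * real (Suc j) + 1 \<le> real (card H)" "card {h \<in> H. fst h \<in> X} \<le> x"
    let ?HX = "{h \<in> H. fst h \<in> X}" and ?HY = "{h' \<in> H. fst h' \<notin> X}" and ?M = "real (card H - 1)"
    have fH: "finite H" using H finite_subset by blast
    have l0: "0 < l" using H(2) F(4) by (simp add: L'_def)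
    have l: "l \<le> ?M" "0 < ?M" using H(6) l0 by (auto simp: of_nat_diff)
    have first: "real x * real x / ?M \<le> \<epsilon> / 3"
    proof -
      have "real x * real x / ?M \<le> real x * real x / l" using l l0 by (intro divide_left_mono) auto
      also have "\<dots> \<le> \<epsilon> / 3" using H(2) Suc.prems l0 by (simp add: L'_def field_simps)
      finally show ?thesis .
    qed
    have inner: "(\<Sum>h'\<in>?HY. cyclic_prob j (H - {h, h'}) (insert (fst h') X) / ?M) \<le> 2 * \<eta>" if h: "h \<in> ?HX" for h
    proof -
      have pw: "cyclic_prob j (H - {h, h'}) (insert (fst h') X) \<le> \<eta> + (if h' \<in> heavy H0 (thr \<eta>) then 1 else 0)" if h': "h' \<in> ?HY" for h'
      proof (cases "h' \<in> heavy H0 (thr \<eta>)")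
        case True then show ?thesis using cyclic_prob_le_1[of "H - {h, h'}"] fH \<eta> by (smt (verit) finite_Diff)
      next
        case False
        have ne: "h \<noteq> h'" using h h' by auto
        have c: "card (H - {h, h'}) = card H - 2" using h h' ne fH by (subst card_Diff_subset) auto
        have c2: "2 \<le> card H" using H(6) l0 by linarith
        have "cyclic_prob j (H - {h, h'}) (insert (fst h') X) \<le> \<eta>"
        proof (rule IH[OF H(1), of l])
          show "L \<le> l" using H(2) by (simp add: L'_def)
          show "\<forall>\<eta>\<in>F. real (card (heavy H0 (thr \<eta>))) \<le> \<eta> * l" using H(3) by blast
          show "H - {h, h'} \<subseteq> H0" using H(4) by blast
          show "even (card (H - {h, h'}))" using c H(5) by simp
          show "l + 2 * real j + 1 \<le> real (card (H - {h, h'}))" using c c2 H(6) by (simp add: of_nat_diff)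
          have "{g \<in> H - {h, h'}. fst g \<in> insert (fst h') X} \<subseteq> ?HX \<union> {g \<in> H0. fst g = fst h'}" using H(4) by auto
          then have "card {g \<in> H - {h, h'}. fst g \<in> insert (fst h') X} \<le> card (?HX \<union> {g \<in> H0. fst g = fst h'})"
            using fH H(1) by (intro card_mono) auto
          also have "\<dots> \<le> card ?HX + card {g \<in> H0. fst g = fst h'}" by (rule card_Un_le)
          also have "card {g \<in> H0. fst g = fst h'} \<le> thr \<eta>" using False h' H(4) by (auto simp: heavy_def)
          finally show "card {g \<in> H - {h, h'}. fst g \<in> insert (fst h') X} \<le> x + thr \<eta>" using H(7) by simp
        qed
        then show ?thesis using False by simp
      qed
      have "(\<Sum>h'\<in>?HY. cyclic_prob j (H - {h, h'}) (insert (fst h') X)) \<le> (\<Sum>h'\<in>?HY. \<eta> + (if h' \<in> heavy H0 (thr \<eta>) then 1 else 0))"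
        by (intro sum_mono pw)
      also have "\<dots> = real (card ?HY) * \<eta> + real (card (?HY \<inter> heavy H0 (thr \<eta>)))"
        using fH by (simp add: sum.distrib sum.If_cases)
      also have "\<dots> \<le> ?M * \<eta> + \<eta> * l"
      proof (intro add_mono mult_right_mono)
        have "card ?HY \<le> card (H - {h})" using fH h by (intro card_mono) auto
        also have "\<dots> = card H - 1" using fH h by simp
        finally show "real (card ?HY) \<le> ?M" by (rule of_nat_mono)
        have "card (?HY \<inter> heavy H0 (thr \<eta>)) \<le> card (heavy H0 (thr \<eta>))" using H(1) by (intro card_mono) (auto simp: heavy_def)
        then show "real (card (?HY \<inter> heavy H0 (thr \<eta>))) \<le> \<eta> * l" using H(3) by (smt (verit) insertI1 of_nat_mono)
      qed (use \<eta> in simp)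
      also have "\<dots> \<le> 2 * \<eta> * ?M" using l(1) \<eta> by (simp add: mult.commute)
      finally have "(\<Sum>h'\<in>?HY. cyclic_prob j (H - {h, h'}) (insert (fst h') X)) / ?M \<le> 2 * \<eta>" using l(2) by (simp add: divide_le_eq)
      then show ?thesis by (simp add: sum_divide_distrib)
    qed
    have "cyclic_prob (Suc j) H X \<le> real x * real x / ?M + (\<Sum>h\<in>?HX. \<Sum>h'\<in>?HY. cyclic_prob j (H - {h, h'}) (insert (fst h') X) / ?M)"
      by (rule cyclic_prob_rec(2)[OF fH H(5,7)])
    also have "\<dots> \<le> \<epsilon> / 3 + (\<Sum>h\<in>?HX. 2 * \<eta>)" by (intro add_mono first sum_mono inner)
    also have "\<dots> \<le> \<epsilon> / 3 + real x * (2 * \<eta>)" using H(7) \<eta> by (simp add: mult_right_mono)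
    also have "\<dots> \<le> \<epsilon>"
    proof -
      have "real x * \<eta> \<le> \<epsilon> / 3" unfolding \<eta>_def using Suc.prems by (simp add: field_simps)
      then show ?thesis by simp
    qed
    finally show "cyclic_prob (Suc j) H X \<le> \<epsilon>" .
  qed (use F \<eta> in \<open>auto simp: L'_def\<close>)
qed

section \<open>Typical degree sequences\<close>

lemma truncated_mean_small:
  fixes D :: "nat pmf"
  assumes "(\<integral>\<^sup>+k. of_nat k \<partial>D) < \<infinity>" "0 < \<delta>"
  shows "\<exists>t\<ge>1. (\<integral>\<^sup>+k. (if t \<le> k then of_nat k else 0) \<partial>D) \<le> ennreal \<delta>"
proof -
  have "(\<lambda>t. \<integral>\<^sup>+k. (if t \<le> k then of_nat k else 0) \<partial>D) \<longlonglongrightarrow> (\<integral>\<^sup>+k. 0 \<partial>measure_pmf D)"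
  proof (rule nn_integral_dominated_convergence[where w = of_nat])
    have "(\<lambda>t. if t \<le> k then of_nat k else 0 :: ennreal) \<longlonglongrightarrow> 0" for k :: nat
      by (rule tendsto_eventually, rule eventually_mono[OF eventually_gt_at_top[of k]]) simp
    then show "AE k in D. (\<lambda>t. if t \<le> k then of_nat k else 0 :: ennreal) \<longlonglongrightarrow> 0" by simp
  qed (use assms in auto)
  then have "\<forall>\<^sub>F t in sequentially. (\<integral>\<^sup>+k. (if t \<le> k then of_nat k else 0) \<partial>D) < ennreal \<delta>"
    using assms(2) by (intro order_tendstoD(2)) auto
  then obtain N where "\<And>t. N \<le> t \<Longrightarrow> (\<integral>\<^sup>+k. (if t \<le> k then of_nat k else 0) \<partial>D) < ennreal \<delta>"
    by (auto simp: eventually_sequentially)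
  from less_imp_le[OF this[of "max 1 N"]] show ?thesis by (intro exI[of _ "max 1 N"] conjI) auto
qed

text \<open>The generating function at 1/2 is below 1 because \<open>D\<close> is not identically 0.
  It gives a Chernoff bound for small total degree, for which no second moment is required.\<close>

lemma expectation_half_power_less_1:
  fixes D :: "nat pmf"
  assumes "0 < (\<integral>\<^sup>+k. of_nat k \<partial>D)"
  obtains \<rho> where "0 \<le> \<rho>" "\<rho> < 1" "(\<integral>\<^sup>+k. ennreal ((1 / 2) ^ k) \<partial>D) = ennreal \<rho>"
proof
  define \<rho> where "\<rho> = measure_pmf.expectation D (\<lambda>k. (1 / 2 :: real) ^ k)"
  have int: "integrable (measure_pmf D) (\<lambda>k. (1 / 2 :: real) ^ k)"
    by (rule measure_pmf.integrable_const_bound[where B = 1]) (auto simp: power_le_one)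
  show "(\<integral>\<^sup>+k. ennreal ((1 / 2) ^ k) \<partial>D) = ennreal \<rho>"
    unfolding \<rho>_def by (rule nn_integral_eq_integral[OF int]) simp
  show "0 \<le> \<rho>" unfolding \<rho>_def by (rule integral_nonneg_AE) simp
  have "\<exists>k\<in>set_pmf D. k \<noteq> 0"
  proof (rule ccontr)
    assume "\<not> (\<exists>k\<in>set_pmf D. k \<noteq> 0)"
    then have "AE k in D. (of_nat k :: ennreal) = 0" by (auto simp: AE_measure_pmf_iff)
    then have "(\<integral>\<^sup>+k. of_nat k \<partial>D) = 0" by (subst nn_integral_0_iff_AE) auto
    then show False using assms by simp
  qed
  then have pos: "0 < measure_pmf.prob D {1..}" by (auto intro: measure_pmf_posI)
  have "(1 / 2 :: real) ^ k \<le> 1 - indicator {1..} k / 2" for k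
    by (cases k) (auto simp: power_le_one)
  then have "\<rho> \<le> measure_pmf.expectation D (\<lambda>k. 1 - indicator {1..} k / 2)"
    unfolding \<rho>_def by (intro integral_mono int) (auto intro!: measure_pmf.integrable_const_bound[where B = 1] split: split_indicator)
  also have "\<dots> = 1 - measure_pmf.prob D {1..} / 2"
    by (subst Bochner_Integration.integral_diff) (auto intro!: measure_pmf.integrable_const_bound[where B = 1] split: split_indicator)
  finally show "\<rho> < 1" using pos by simp
qed

text \<open>The extra half-edge raises a degree by at most 1, so a heavy vertex has degree at least
  \<open>t \<ge> 1\<close>, and adding 1 at most doubles it.\<close>

lemma card_heavy_le:
  assumes "1 \<le> t"
  shows "card (heavy (half_edges n d) t) \<le> 2 * (\<Sum>v=1..n. if t \<le> d v then d v else 0)"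
proof -
  let ?c = "half_edge_count n d"
  have "heavy (half_edges n d) t = (SIGMA v:{v \<in> {1..n}. t < ?c v}. {..<?c v})"
    using card_half_edges_at[of _ n d] by (auto simp: heavy_def half_edges_def)
  then have "card (heavy (half_edges n d) t) = (\<Sum>v\<in>{v \<in> {1..n}. t < ?c v}. ?c v)" by simp
  also have "\<dots> = (\<Sum>v=1..n. if t < ?c v then ?c v else 0)" by (rule sum.inter_filter) simp
  also have "\<dots> \<le> (\<Sum>v=1..n. 2 * (if t \<le> d v then d v else 0))"
    using assms by (intro sum_mono) (auto simp: half_edge_count_def)
  finally show ?thesis by (simp add: sum_distrib_left)
qed

text \<open>\<open>cyclic_prob_small\<close> applies unless the root has large degree, the total
  degree is below \<open>c * real n\<close>, or for some threshold in \<open>F\<close> too many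
  half-edges are heavy. The first and third exceptions are bounded by truncated means, the second by
  the Chernoff bound.\<close>

theorem cyclic_prob_config_small:
  fixes D :: "nat pmf"
  assumes D: "0 < (\<integral>\<^sup>+k. of_nat k \<partial>D)" "(\<integral>\<^sup>+k. of_nat k \<partial>D) < \<infinity>" and \<delta>: "0 < \<delta>"
  shows "\<exists>n0. \<forall>n\<ge>n0. (\<integral>\<^sup>+d. ennreal (cyclic_prob J (half_edges n d) {1}) \<partial>Pi_pmf {1..n} 0 (\<lambda>_. D)) \<le> ennreal \<delta>"
proof -
  obtain \<rho> where \<rho>: "0 \<le> \<rho>" "\<rho> < 1" "(\<integral>\<^sup>+k. ennreal ((1 / 2) ^ k) \<partial>D) = ennreal \<rho>"
    using expectation_half_power_less_1[OF D(1)] .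
  define s where "s = (1 + \<rho>) / 2"
  have s: "\<rho> < s" "s < 1" "0 < s" using \<rho> by (auto simp: s_def)
  \<comment> \<open>Means 2^c = 1/s, so the Chernoff bound for a total degree below c n is (\<rho> /
    s)^n.\<close>
  define c where "c = ln (1 / s) / ln 2"
  have c: "0 < c" using s by (simp add: c_def)
  \<comment> \<open>At most \<open>J + 3\<close> shares are used: the regular case, the root, the
    total degree, and at most \<open>J\<close> thresholds.\<close>
  define \<delta>' where "\<delta>' = \<delta> / (real J + 4)"
  have \<delta>': "0 < \<delta>'" using \<delta> by (simp add: \<delta>'_def)
  obtain x where x: "1 \<le> x" "(\<integral>\<^sup>+k. (if x \<le> k then of_nat k else 0) \<partial>D) \<le> ennreal \<delta>'"
    using truncated_mean_small[OF D(2) \<delta>'] by blast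
  \<comment> \<open>Chosen so that Markov's inequality at level \<eta> l, with
    \<open>l = c * real n / 2\<close> and the factor 2 of \<open>card_heavy_le\<close>, gives
    exactly one share.\<close>
  define thr where "thr \<eta> = (SOME t. 1 \<le> t \<and> (\<integral>\<^sup>+k. (if t \<le> k then of_nat k else 0) \<partial>D) \<le> ennreal (\<eta> * c * \<delta>' / 4))" for \<eta>
  have thr: "1 \<le> thr \<eta>" "(\<integral>\<^sup>+k. (if thr \<eta> \<le> k then of_nat k else 0) \<partial>D) \<le> ennreal (\<eta> * c * \<delta>' / 4)"
    if "0 < \<eta>" for \<eta>
  proof -
    have "\<exists>t. 1 \<le> t \<and> (\<integral>\<^sup>+k. (if t \<le> k then of_nat k else 0) \<partial>D) \<le> ennreal (\<eta> * c * \<delta>' / 4)"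
      using that c \<delta>' by (intro truncated_mean_small[OF D(2)]) auto
    from someI_ex[OF this] show "1 \<le> thr \<eta>" "(\<integral>\<^sup>+k. (if thr \<eta> \<le> k then of_nat k else 0) \<partial>D) \<le> ennreal (\<eta> * c * \<delta>' / 4)"
      unfolding thr_def by auto
  qed
  from cyclic_prob_small[OF \<delta>', of J thr x]
  obtain F L where F: "finite F" "card F \<le> J" "\<forall>\<eta>\<in>F. 0 < \<eta>" "0 < L"
    and FL: "\<forall>H0 H X l. finite H0 \<longrightarrow> L \<le> l \<longrightarrow> (\<forall>\<eta>\<in>F. real (card (heavy H0 (thr \<eta>))) \<le> \<eta> * l) \<longrightarrow> H \<subseteq> H0 \<longrightarrow> even (card H) \<longrightarrow>
      l + 2 * real J + 1 \<le> real (card H) \<longrightarrow> card {h \<in> H. fst h \<in> X} \<le> x \<longrightarrow> cyclic_prob J H X \<le> \<delta>'"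
    by (elim exE conjE)
  have "(\<lambda>n. (\<rho> / s) ^ n) \<longlonglongrightarrow> 0" using s \<rho> by (intro LIMSEQ_power_zero) auto
  then have "\<forall>\<^sub>F n in sequentially. (\<rho> / s) ^ n < \<delta>'" using \<delta>' by (intro order_tendstoD(2)) auto
  then obtain n1 where n1: "\<And>n. n1 \<le> n \<Longrightarrow> (\<rho> / s) ^ n < \<delta>'" by (auto simp: eventually_sequentially)
  define n0 where "n0 = max (max 2 n1) (nat \<lceil>2 * max L (2 * real J + 1) / c\<rceil>)"
  show ?thesis
  proof (intro exI[of _ n0] allI impI)
    fix n assume n: "n0 \<le> n"
    have n2: "2 \<le> n" "n1 \<le> n" using n by (auto simp: n0_def)
    \<comment> \<open>Half of the lower bound for the number of half-edges; the other half covers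
      those used up by the exploration.\<close>
    define l where "l = c * real n / 2"
    have "2 * max L (2 * real J + 1) / c \<le> real n" using n unfolding n0_def by linarith
    then have m: "2 * max L (2 * real J + 1) \<le> c * real n" using c by (simp add: divide_le_eq mult.commute)
    have l: "L \<le> l" and l': "2 * real J + 1 \<le> l"
      using m unfolding l_def by (simp_all add: max_def split: if_splits)
    have l0: "0 < l" using l F(4) by simp
    let ?E = "\<lambda>f. \<integral>\<^sup>+d. f d \<partial>Pi_pmf {1..n} 0 (\<lambda>_. D)"
    let ?a = "\<lambda>d :: nat \<Rightarrow> nat. if x \<le> d 1 then of_nat (d 1) else 0 :: ennreal"
    let ?b = "\<lambda>d :: nat \<Rightarrow> nat. ennreal ((1 / s) ^ n) * (\<Prod>v=1..n. ennreal ((1 / 2) ^ d v))"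
    let ?g = "\<lambda>\<eta> d. ennreal (2 / (\<eta> * l)) * (\<Sum>v=1..n. if thr \<eta> \<le> d v then of_nat (d v) else 0)"
    have pw: "ennreal (cyclic_prob J (half_edges n d) {1}) \<le> ennreal \<delta>' + ?a d + ?b d + (\<Sum>\<eta>\<in>F. ?g \<eta> d)" for d
    proof -
      let ?H = "half_edges n d"
      have le1: "ennreal (cyclic_prob J ?H {1}) \<le> 1" using cyclic_prob_le_1[OF finite_half_edges] by (simp add: ennreal_le_1)
      consider "x \<le> d 1" | "real (\<Sum>v=1..n. d v) < c * real n" | \<eta> where "\<eta> \<in> F" "\<eta> * l < real (card (heavy ?H (thr \<eta>)))"
        | "d 1 < x" "c * real n \<le> real (\<Sum>v=1..n. d v)" "\<forall>\<eta>\<in>F. real (card (heavy ?H (thr \<eta>))) \<le> \<eta> * l"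
        by (meson not_le)
      note cs = this
      have sums: "A \<le> A + B + C + S" "B \<le> A + B + C + S" "C \<le> A + B + C + S" "S \<le> A + B + C + S" for A B C S :: ennreal
        by (rule add_increasing2[OF zero_le add_increasing2[OF zero_le add_increasing2[OF zero_le order_refl]]]
          add_increasing2[OF zero_le add_increasing2[OF zero_le add_increasing[OF zero_le order_refl]]]
          add_increasing2[OF zero_le add_increasing[OF zero_le order_refl]]
          add_increasing[OF zero_le order_refl])+
      from cs show ?thesis
      proof cases
        case 1
        have "(1 :: ennreal) \<le> of_nat (d 1)" using 1 x(1) by (simp add: ennreal_of_nat_eq_real_of_nat)
        then have "1 \<le> ?a d" using 1 by simp
        then show ?thesis by (intro order_trans[OF le1] order_trans[OF _ sums(2)])
      next
        case 2
        have "real (\<Sum>v=1..n. d v) * ln 2 \<le> real n * ln (1 / s)" using 2 by (simp add: c_def field_simps)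
        then have "ln (2 ^ (\<Sum>v=1..n. d v)) \<le> ln ((1 / s) ^ n)" using s by (simp add: ln_realpow del: of_nat_sum)
        then have "(2 :: real) ^ (\<Sum>v=1..n. d v) \<le> (1 / s) ^ n" using s by (subst (asm) ln_le_cancel_iff) auto
        then have "2 ^ (\<Sum>v=1..n. d v) * (1 / 2 :: real) ^ (\<Sum>v=1..n. d v) \<le> (1 / s) ^ n * (1 / 2) ^ (\<Sum>v=1..n. d v)"
          by (rule mult_right_mono) simp
        then have "1 \<le> (1 / s) ^ n * (1 / 2 :: real) ^ (\<Sum>v=1..n. d v)" by (simp add: power_one_over)
        also have "(1 / 2 :: real) ^ (\<Sum>v=1..n. d v) = (\<Prod>v=1..n. (1 / 2) ^ d v)" by (rule power_sum)
        finally have "ennreal 1 \<le> ennreal ((1 / s) ^ n * (\<Prod>v=1..n. (1 / 2) ^ d v))" by (rule ennreal_leI)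
        also have "\<dots> = ?b d" using s by (simp add: ennreal_mult prod_ennreal prod_nonneg)
        finally have "1 \<le> ?b d" by simp
        then show ?thesis by (intro order_trans[OF le1] order_trans[OF _ sums(3)])
      next
        case 3
        note \<eta> = bspec[OF F(3) 3(1)]
        have "\<eta> * l \<le> real (2 * (\<Sum>v=1..n. if thr \<eta> \<le> d v then d v else 0))"
          using 3(2) card_heavy_le[OF thr(1)[OF \<eta>], of n d] of_nat_mono by (smt (verit))
        then have "1 \<le> 2 / (\<eta> * l) * real (\<Sum>v=1..n. if thr \<eta> \<le> d v then d v else 0)"
          using \<eta> l0 by (simp add: field_simps)
        then have "1 \<le> ennreal (2 / (\<eta> * l)) * of_nat (\<Sum>v=1..n. if thr \<eta> \<le> d v then d v else 0)"
          using \<eta> l0 by (simp add: ennreal_of_nat_eq_real_of_nat ennreal_mult[symmetric] del: of_nat_sum flip: ennreal_1)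
        also have "\<dots> = ?g \<eta> d" by (simp add: if_distrib cong: if_cong)
        also have "\<dots> \<le> (\<Sum>\<eta>\<in>F. ?g \<eta> d)" using 3(1) F(1) by (intro member_le_sum) auto
        finally show ?thesis by (intro order_trans[OF le1] order_trans[OF _ sums(4)])
      next
        case 4
        have "{h \<in> ?H. fst h \<in> {1}} = {h \<in> ?H. fst h = 1}" by auto
        then have "card {h \<in> ?H. fst h \<in> {1}} = half_edge_count n d 1" using card_half_edges_at[of 1 n d] n2 by simp
        also have "\<dots> = d 1" using n2 by (simp add: half_edge_count_def)
        finally have c1: "card {h \<in> ?H. fst h \<in> {1}} \<le> x" using 4(1) by simp
        have "(\<Sum>v=1..n. d v) \<le> card ?H" unfolding card_half_edges by (intro sum_mono) (simp add: half_edge_count_def)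
        then have "c * real n \<le> real (card ?H)" using 4(2) of_nat_mono by (smt (verit))
        then have "l + 2 * real J + 1 \<le> real (card ?H)" using l' by (simp add: l_def)
        then have "cyclic_prob J ?H {1} \<le> \<delta>'"
          using l 4(3) c1 n2 by (intro FL[rule_format, OF finite_half_edges, of l n d]) (auto simp: even_card_half_edges)
        then show ?thesis by (intro order_trans[OF ennreal_leI sums(1)])
      qed
    qed
    have Eb: "?E ?b \<le> ennreal \<delta>'"
    proof -
      have "?E ?b = ennreal ((1 / s) ^ n) * (\<Prod>v=1..n. \<integral>\<^sup>+k. ennreal ((1 / 2) ^ k) \<partial>D)"
        by (subst nn_integral_cmult, simp, subst nn_integral_prod_Pi_pmf[where f = "\<lambda>_ k. ennreal ((1 / 2) ^ k)"]) simp_all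
      also have "\<dots> = ennreal ((\<rho> / s) ^ n)" using s \<rho>
        by (simp add: ennreal_power ennreal_mult[symmetric] power_divide)
      also have "\<dots> \<le> ennreal \<delta>'" using n1[OF n2(2)] by (intro ennreal_leI) simp
      finally show ?thesis .
    qed
    have Eg: "?E (?g \<eta>) \<le> ennreal \<delta>'" if \<eta>: "\<eta> \<in> F" for \<eta>
    proof -
      have \<eta>0: "0 < \<eta>" using bspec[OF F(3) \<eta>] .
      have "?E (?g \<eta>) = ennreal (2 / (\<eta> * l)) * (\<Sum>v=1..n. ?E (\<lambda>d. if thr \<eta> \<le> d v then of_nat (d v) else 0))"
        by (simp add: nn_integral_cmult nn_integral_sum)
      also have "\<dots> = ennreal (2 / (\<eta> * l)) * (\<Sum>v=1..n. \<integral>\<^sup>+k. (if thr \<eta> \<le> k then of_nat k else 0) \<partial>D)"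
        by (intro arg_cong2[where f = "(*)"] sum.cong refl expectation_coordinate[where f = "\<lambda>k. if thr \<eta> \<le> k then of_nat k else 0"]) auto
      also have "\<dots> \<le> ennreal (2 / (\<eta> * l)) * (\<Sum>v=1..n. ennreal (\<eta> * c * \<delta>' / 4))"
        by (intro mult_left_mono sum_mono thr(2) \<eta>0) simp
      also have "\<dots> = ennreal (2 / (\<eta> * l) * (real n * (\<eta> * c * \<delta>' / 4)))"
        using \<eta>0 l0 c \<delta>' by (simp only: sum_constant card_atLeastAtMost ennreal_of_nat_eq_real_of_nat) (subst ennreal_mult, simp, simp, subst ennreal_mult, simp_all)
      also have "2 / (\<eta> * l) * (real n * (\<eta> * c * \<delta>' / 4)) = \<delta>'"
        using \<eta>0 c n2 by (simp add: l_def field_simps)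
      finally show ?thesis .
    qed
    have "?E (\<lambda>d. ennreal (cyclic_prob J (half_edges n d) {1})) \<le> ?E (\<lambda>d. ennreal \<delta>' + ?a d + ?b d + (\<Sum>\<eta>\<in>F. ?g \<eta> d))"
      by (intro nn_integral_mono pw)
    also have "\<dots> = ennreal \<delta>' + ?E ?a + ?E ?b + (\<Sum>\<eta>\<in>F. ?E (?g \<eta>))"
      by (simp add: nn_integral_add nn_integral_sum)
    also have "\<dots> \<le> ennreal \<delta>' + ennreal \<delta>' + ennreal \<delta>' + (\<Sum>\<eta>\<in>F. ennreal \<delta>')"
    proof (intro add_mono order_refl Eb sum_mono Eg)
      show "?E ?a \<le> ennreal \<delta>'"
        using x(2) expectation_coordinate[where I = "{1..n}" and v = 1 and f = "\<lambda>k. if x \<le> k then of_nat k else 0" and z = 0 and D = D] n2 by simp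
    qed
    also have "\<dots> = ennreal (3 * \<delta>' + real (card F) * \<delta>')"
      using \<delta>' by (simp add: ennreal_of_nat_eq_real_of_nat ennreal_mult[symmetric] ennreal_plus[symmetric] algebra_simps del: ennreal_plus)
    also have "\<dots> \<le> ennreal \<delta>"
    proof (rule ennreal_leI)
      have "real (card F) * \<delta>' \<le> real J * \<delta>'" using F(2) \<delta>' by (intro mult_right_mono) auto
      moreover have "real J * \<delta>' + 4 * \<delta>' = \<delta>" unfolding distrib_right[symmetric] by (simp add: \<delta>'_def)
      ultimately show "3 * \<delta>' + real (card F) * \<delta>' \<le> \<delta>" using \<delta>' by linarith
    qed
    finally show "?E (\<lambda>d. ennreal (cyclic_prob J (half_edges n d) {1})) \<le> ennreal \<delta>" .
  qed
qed

section \<open>The expected number of paths from below\<close>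

primrec path_weight :: "(nat \<Rightarrow> nat) \<Rightarrow> nat \<Rightarrow> nat list \<Rightarrow> nat" where
  "path_weight d c [] = 1"
| "path_weight d c (w # ws) = c * d w * path_weight d (d w - 1) ws"

lemma path_weight_snoc: "path_weight d c (ws @ [w]) = c * steps_weight d ws * d w"
  by (induction ws arbitrary: c) (simp_all add: steps_weight_def)

text \<open>All denominators are replaced by one larger number, after which the weight of a path is
  a product over its vertices.\<close>

lemma mean_paths_ge:
  assumes "finite W" "c + sum d W \<le> L" "L \<le> L0" "0 < L0"
  shows "(\<Sum>ws\<in>dlists k W. real (path_weight d c ws)) / real L0 ^ k \<le> mean_paths d k c L W"
  using assms(1-3)
proof (induction k arbitrary: c L W)
  case 0 then show ?case by simp
next
  case (Suc k)
  have "(\<Sum>ws\<in>dlists (Suc k) W. real (path_weight d c ws)) / real L0 ^ Suc k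
    = (\<Sum>w\<in>W. real c * real (d w) / real L0 * ((\<Sum>ws\<in>dlists k (W - {w}). real (path_weight d (d w - 1) ws)) / real L0 ^ k))"
    by (simp add: sum_dlists_Cons[OF Suc.prems(1)] sum_divide_distrib sum_distrib_left mult_ac)
  also have "\<dots> \<le> (\<Sum>w\<in>W. real c * real (d w) / real (L - 1) * mean_paths d k (d w - 1) (L - 2) (W - {w}))"
  proof (rule sum_mono)
    fix w assume w: "w \<in> W"
    show "real c * real (d w) / real L0 * ((\<Sum>ws\<in>dlists k (W - {w}). real (path_weight d (d w - 1) ws)) / real L0 ^ k)
      \<le> real c * real (d w) / real (L - 1) * mean_paths d k (d w - 1) (L - 2) (W - {w})"
    proof (cases "c = 0 \<or> d w = 0")
      case False
      have "sum d W = d w + sum d (W - {w})" using w Suc.prems(1) by (simp add: sum.remove)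
      then have L: "d w - 1 + sum d (W - {w}) \<le> L - 2" "2 \<le> L" using Suc.prems(2) False by linarith+
      show ?thesis
      proof (rule mult_mono)
        show "real c * real (d w) / real L0 \<le> real c * real (d w) / real (L - 1)"
          using L Suc.prems(3) assms(4) by (intro divide_left_mono mult_pos_pos) auto
        show "(\<Sum>ws\<in>dlists k (W - {w}). real (path_weight d (d w - 1) ws)) / real L0 ^ k \<le> mean_paths d k (d w - 1) (L - 2) (W - {w})"
          using L(1) Suc.prems by (intro Suc.IH) auto
      qed (auto intro!: sum_nonneg divide_nonneg_nonneg)
    qed auto
  qed
  finally show ?case by simp
qed

lemma card_dlists_ge:
  assumes "finite W" shows "(card W - k) ^ k \<le> card (dlists k W)"
proof (cases "k \<le> card W")
  case True
  have "(card W - k) ^ k = (\<Prod>i\<in>{card W - k + 1..card W}. card W - k)" using True by simp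
  also have "\<dots> \<le> \<Prod>{card W - k + 1..card W}" by (intro prod_mono) auto
  also have "\<dots> = card (dlists k W)" unfolding dlists_def
    using card_lists_distinct_length_eq[OF assms True] by (simp add: conj_assoc)
  finally show ?thesis .
next
  case False then show ?thesis by (cases k) auto
qed

section \<open>Removing the random denominator\<close>

text \<open>The convex function x^(-k) lies above its tangent at \<open>c\<close>; this follows from
  Bernoulli's inequality for \<open>c / x\<close>.\<close>

lemma inverse_power_tangent:
  fixes x c :: real assumes "0 < x" "0 < c"
  shows "(real k + 1) / c ^ k \<le> 1 / x ^ k + real k * x / c ^ (k + 1)"
proof -
  define z where "z = c / x"
  have z: "0 < z" using assms by (simp add: z_def)
  have "0 \<le> (z - 1)\<^sup>2 / z" using z by simp
  also have "\<dots> = z - 1 - (1 - 1 / z)" using z by (simp add: power2_eq_square field_simps)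
  finally have "real k * (1 - 1 / z) \<le> real k * (z - 1)" by (intro mult_left_mono) auto
  also have "1 + real k * (z - 1) \<le> z ^ k" using Bernoulli_inequality[of "z - 1" k] z by simp
  finally have "(1 + real k * (1 - 1 / z)) / c ^ k \<le> z ^ k / c ^ k" using assms by (intro divide_right_mono) auto
  moreover have "z ^ k / c ^ k = 1 / x ^ k" using assms by (simp add: z_def power_divide)
  moreover have "(1 + real k * (1 - 1 / z)) / c ^ k = (real k + 1) / c ^ k - real k * x / c ^ (k + 1)"
    using assms by (simp add: z_def field_simps)
  ultimately show ?thesis by simp
qed

text \<open>Jensen's inequality for x^(-k) under the law weighted by \<open>Q\<close>, for which the
  mean of \<open>L\<close> is at most \<open>c\<close>.\<close>

lemma expectation_div_power_ge:
  fixes Q L :: "'a \<Rightarrow> nat" and M :: "'a pmf"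
  assumes L: "\<And>x. 0 < L x" and c: "0 < c" and e: "0 \<le> e"
    and Q: "(\<integral>\<^sup>+x. of_nat (Q x) \<partial>M) = ennreal e" and QL: "(\<integral>\<^sup>+x. of_nat (Q x * L x) \<partial>M) \<le> ennreal (e * c)"
  shows "ennreal (e / c ^ k) \<le> (\<integral>\<^sup>+x. ennreal (real (Q x) / real (L x) ^ k) \<partial>M)"
proof -
  let ?X = "\<integral>\<^sup>+x. ennreal (real (Q x) / real (L x) ^ k) \<partial>M"
  have pw: "ennreal ((real k + 1) / c ^ k) * of_nat (Q x) \<le> ennreal (real (Q x) / real (L x) ^ k) + ennreal (real k / c ^ (k + 1)) * of_nat (Q x * L x)" for x
  proof -
    have "(real k + 1) / c ^ k * real (Q x) \<le> (1 / real (L x) ^ k + real k * real (L x) / c ^ (k + 1)) * real (Q x)"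
      using L c by (intro mult_right_mono inverse_power_tangent) auto
    also have "\<dots> = real (Q x) / real (L x) ^ k + real k / c ^ (k + 1) * real (Q x * L x)" by (simp add: field_simps)
    finally show ?thesis using c
      by (simp add: ennreal_of_nat_eq_real_of_nat ennreal_mult[symmetric] ennreal_plus[symmetric] ennreal_leI del: ennreal_plus of_nat_mult)
  qed
  have "ennreal ((real k + 1) / c ^ k) * ennreal e = (\<integral>\<^sup>+x. ennreal ((real k + 1) / c ^ k) * of_nat (Q x) \<partial>M)"
    by (simp add: nn_integral_cmult Q)
  also have "\<dots> \<le> (\<integral>\<^sup>+x. ennreal (real (Q x) / real (L x) ^ k) + ennreal (real k / c ^ (k + 1)) * of_nat (Q x * L x) \<partial>M)"
    by (intro nn_integral_mono pw)
  also have "\<dots> = ?X + ennreal (real k / c ^ (k + 1)) * (\<integral>\<^sup>+x. of_nat (Q x * L x) \<partial>M)"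
    by (simp add: nn_integral_add nn_integral_cmult del: of_nat_mult)
  also have "\<dots> \<le> ?X + ennreal (real k / c ^ (k + 1)) * ennreal (e * c)" by (intro add_left_mono mult_left_mono QL) simp
  also have "\<dots> = ?X + ennreal (real k * e / c ^ k)" using c e by (simp add: ennreal_mult[symmetric] field_simps)
  finally have *: "ennreal (e / c ^ k + real k * e / c ^ k) \<le> ?X + ennreal (real k * e / c ^ k)"
    using c e by (simp add: ennreal_mult[symmetric] field_simps)
  show ?thesis
  proof (cases ?X)
    case (real x)
    then have "ennreal (e / c ^ k + real k * e / c ^ k) \<le> ennreal (x + real k * e / c ^ k)"
      using * c e by (simp add: ennreal_plus)
    then show ?thesis using real c e by (subst (asm) ennreal_le_iff) (auto simp: ennreal_le_iff)
  qed simp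
qed

text \<open>Values of \<open>f\<close> at degrees above \<open>B\<close> are dropped rather than
  capped, since paths through such vertices are not followed.\<close>

definition truncated :: "nat \<Rightarrow> (nat \<Rightarrow> nat) \<Rightarrow> nat \<Rightarrow> nat" where
  "truncated B f k = (if k \<le> B then f k else 0)"

text \<open>\<open>Q\<close> is a product of functions of single degrees: \<open>m\<close> for the
  root and for the last vertex, \<open>b\<close> for each vertex in between. Where \<open>Q\<close>
  does not vanish, the \<open>k + 2\<close> path vertices have total degree at most
  \<open>(k + 2) * B\<close>, and the other degrees are independent of \<open>Q\<close>. Vertex
  \<open>n\<close> is left out because of its extra half-edge.\<close>

lemma expectation_path_weight:
  fixes D :: "nat pmf"
  assumes m: "(\<integral>\<^sup>+k. of_nat (truncated B (\<lambda>k. k) k) \<partial>D) = ennreal m" "0 \<le> m"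
    and b: "(\<integral>\<^sup>+k. of_nat (truncated B (\<lambda>k. k * (k - 1)) k) \<partial>D) = ennreal b" "0 \<le> b"
    and \<mu>: "(\<integral>\<^sup>+k. of_nat k \<partial>D) = ennreal \<mu>" "0 \<le> \<mu>"
    and n: "2 \<le> n" and ws: "ws \<in> dlists (Suc k) {2..n - 1}"
  defines "Q \<equiv> \<lambda>d. if d 1 \<le> B \<and> (\<forall>w\<in>set ws. d w \<le> B) then path_weight d (d 1) ws else 0"
  shows "(\<integral>\<^sup>+d. of_nat (Q d) \<partial>Pi_pmf {1..n} 0 (\<lambda>_. D)) = ennreal (m\<^sup>2 * b ^ k)"
    and "(\<integral>\<^sup>+d. of_nat (Q d * ((\<Sum>i=1..n. d i) + 1)) \<partial>Pi_pmf {1..n} 0 (\<lambda>_. D))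
      \<le> ennreal (m\<^sup>2 * b ^ k * (real n * \<mu> + real ((k + 2) * B + 1)))"
proof -
  let ?E = "\<lambda>f. \<integral>\<^sup>+d. f d \<partial>Pi_pmf {1..n} 0 (\<lambda>_. D)"
  obtain xs x where xs: "ws = xs @ [x]" "length xs = k" using ws by (auto simp: dlists_def length_Suc_conv_rev)
  have d: "distinct xs" "x \<notin> set xs" "set xs \<subseteq> {2..n - 1}" "x \<in> {2..n - 1}" using ws xs by (auto simp: dlists_def)
  define S where "S = insert 1 (set ws)"
  have d': "1 \<notin> insert x (set xs)" using d(3,4) by auto
  have S: "S \<subseteq> {1..n}" using d(3,4) n by (fastforce simp: S_def xs)
  have "S = insert 1 (insert x (set xs))" by (auto simp: S_def xs)
  then have S': "finite S" "card S = k + 2" using d(2) d' distinct_card[OF d(1)] xs(2) by (simp_all add: card_insert_if)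
  define f where "f = (\<lambda>v. if v = 1 \<or> v = x then truncated B (\<lambda>k. k) else if v \<in> set xs then truncated B (\<lambda>k. k * (k - 1)) else (\<lambda>_. 1))"
  have Q: "Q d = (\<Prod>v=1..n. f v (d v))" for d
  proof -
    have "(\<Prod>v=1..n. f v (d v)) = (\<Prod>v\<in>S. f v (d v))"
      using S by (intro prod.mono_neutral_right) (auto simp: S_def f_def xs)
    also have "S = insert 1 (insert x (set xs))" by (auto simp: S_def xs)
    also have "(\<Prod>v\<in>insert 1 (insert x (set xs)). f v (d v)) = truncated B (\<lambda>k. k) (d 1) * (truncated B (\<lambda>k. k) (d x) * (\<Prod>v\<in>set xs. truncated B (\<lambda>k. k * (k - 1)) (d v)))"
    proof -
      have "(\<Prod>v\<in>set xs. f v (d v)) = (\<Prod>v\<in>set xs. truncated B (\<lambda>k. k * (k - 1)) (d v))"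
        using d by (intro prod.cong refl) (auto simp: f_def)
      with d' show ?thesis using d(2) by (simp add: f_def)
    qed
    also have "\<dots> = Q d"
    proof (cases "d 1 \<le> B \<and> (\<forall>w\<in>set ws. d w \<le> B)")
      case True
      then have "(\<Prod>v\<in>set xs. truncated B (\<lambda>k. k * (k - 1)) (d v)) = steps_weight d xs"
        unfolding steps_weight_eq_prod[OF d(1)] using xs by (intro prod.cong refl) (auto simp: truncated_def)
      then show ?thesis using True xs by (simp add: Q_def path_weight_snoc truncated_def)
    next
      case False
      then consider "B < d 1" | "B < d x" | w where "w \<in> set xs" "B < d w" using xs by force
      then have "truncated B (\<lambda>k. k) (d 1) * (truncated B (\<lambda>k. k) (d x) * (\<Prod>v\<in>set xs. truncated B (\<lambda>k. k * (k - 1)) (d v))) = 0"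
      proof cases
        case 3 then show ?thesis by (auto simp: truncated_def intro!: bexI[of _ w])
      qed (auto simp: truncated_def)
      moreover have "Q d = 0" unfolding Q_def by (rule if_not_P) (rule False)
      ultimately show ?thesis by simp
    qed
    finally show ?thesis by simp
  qed
  have "?E (\<lambda>d. of_nat (Q d)) = ?E (\<lambda>d. \<Prod>v=1..n. of_nat (f v (d v)))" unfolding Q by simp
  also have "\<dots> = (\<Prod>v=1..n. \<integral>\<^sup>+k. of_nat (f v k) \<partial>D)" by (rule nn_integral_prod_Pi_pmf[where f = "\<lambda>v k. of_nat (f v k)"]) simp
  also have "\<dots> = (\<Prod>v\<in>S. \<integral>\<^sup>+k. of_nat (f v k) \<partial>D)"
    using S by (intro prod.mono_neutral_right) (auto simp: S_def f_def xs)
  also have "S = insert 1 (insert x (set xs))" by (auto simp: S_def xs)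
  also have "(\<Prod>v\<in>insert 1 (insert x (set xs)). \<integral>\<^sup>+k. of_nat (f v k) \<partial>D) = ennreal m * (ennreal m * (\<Prod>v\<in>set xs. ennreal b))"
  proof -
    have "(\<Prod>v\<in>set xs. \<integral>\<^sup>+k. of_nat (f v k) \<partial>D) = (\<Prod>v\<in>set xs. ennreal b)"
      using d b(1) by (intro prod.cong refl) (auto simp: f_def)
    with d' show ?thesis using d(2) m(1) by (simp add: f_def)
  qed
  also have "\<dots> = ennreal (m\<^sup>2 * b ^ k)"
    using m b d xs by (simp add: ennreal_mult ennreal_power distinct_card power2_eq_square mult_ac)
  finally show EQ: "?E (\<lambda>d. of_nat (Q d)) = ennreal (m\<^sup>2 * b ^ k)" .
  have off: "?E (\<lambda>d. of_nat (Q d * d v)) = ennreal (m\<^sup>2 * b ^ k) * ennreal \<mu>" if v: "v \<in> {1..n} - S" for v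
  proof -
    have Qv: "Q (d(v := y)) = Q d" for d y
    proof -
      have "f v y = f v (d v)" using v by (auto simp: f_def S_def xs)
      then show ?thesis unfolding Q by (intro prod.cong refl) auto
    qed
    have "?E (\<lambda>d. of_nat (Q d * d v)) = ?E (\<lambda>d. \<integral>\<^sup>+y. of_nat (Q d) * of_nat y \<partial>D)"
      by (subst Pi_pmf_resample[of _ v]) (use v in \<open>simp_all add: Qv\<close>)
    also have "\<dots> = ?E (\<lambda>d. of_nat (Q d)) * ennreal \<mu>"
      by (simp add: nn_integral_cmult nn_integral_multc \<mu>)
    finally show ?thesis by (simp only: EQ)
  qed
  have "Q d * ((\<Sum>i=1..n. d i) + 1) \<le> Q d * ((k + 2) * B + 1) + (\<Sum>v\<in>{1..n} - S. Q d * d v)" for d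
  proof (cases "Q d = 0")
    case False
    then have "\<And>v. v \<in> S \<Longrightarrow> d v \<le> B" by (auto simp: Q_def S_def split: if_splits)
    then have "sum d S \<le> (k + 2) * B" using sum_bounded_above[of S d B] S'(2) by simp
    moreover have "(\<Sum>i=1..n. d i) = sum d ({1..n} - S) + sum d S" using S S' by (intro sum.subset_diff) auto
    ultimately have "(\<Sum>i=1..n. d i) + 1 \<le> (k + 2) * B + 1 + sum d ({1..n} - S)" by simp
    then have "Q d * ((\<Sum>i=1..n. d i) + 1) \<le> Q d * ((k + 2) * B + 1 + sum d ({1..n} - S))" by (rule mult_left_mono) simp
    then show ?thesis by (simp add: distrib_left sum_distrib_left)
  qed simp
  then have "?E (\<lambda>d. of_nat (Q d * ((\<Sum>i=1..n. d i) + 1))) \<le> ?E (\<lambda>d. of_nat (Q d) * of_nat ((k + 2) * B + 1) + (\<Sum>v\<in>{1..n} - S. of_nat (Q d * d v)))"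
    by (intro nn_integral_mono) (simp only: of_nat_mult[symmetric] of_nat_sum[symmetric] of_nat_add[symmetric] of_nat_le_iff)
  also have "\<dots> = ennreal (m\<^sup>2 * b ^ k) * of_nat ((k + 2) * B + 1) + (\<Sum>v\<in>{1..n} - S. ennreal (m\<^sup>2 * b ^ k) * ennreal \<mu>)"
    by (subst nn_integral_add, simp, simp, subst nn_integral_multc, simp, subst nn_integral_sum, simp)
       (simp only: EQ off cong: sum.cong)
  also have "\<dots> \<le> ennreal (m\<^sup>2 * b ^ k) * of_nat ((k + 2) * B + 1) + (\<Sum>v=1..n. ennreal (m\<^sup>2 * b ^ k) * ennreal \<mu>)"
    by (intro add_left_mono sum_mono2) auto
  also have "\<dots> = ennreal (m\<^sup>2 * b ^ k * (real n * \<mu> + real ((k + 2) * B + 1)))"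
    using b(2) \<mu>(2)
    by (simp add: ennreal_of_nat_eq_real_of_nat ennreal_mult[symmetric] ennreal_plus[symmetric] algebra_simps del: ennreal_plus of_nat_add of_nat_mult of_nat_Suc)
  finally show "?E (\<lambda>d. of_nat (Q d * ((\<Sum>i=1..n. d i) + 1))) \<le> ennreal (m\<^sup>2 * b ^ k * (real n * \<mu> + real ((k + 2) * B + 1)))" .
qed

text \<open>Jensen's inequality is applied to each vertex sequence, with the total degree plus 1 as
  a bound for the number of half-edges; the power of \<open>n - 2 - Suc k\<close> is a lower bound
  for the number of sequences.\<close>

theorem expected_mean_paths_ge:
  fixes D :: "nat pmf"
  assumes m: "(\<integral>\<^sup>+k. of_nat (truncated B (\<lambda>k. k) k) \<partial>D) = ennreal m" "0 \<le> m"
    and b: "(\<integral>\<^sup>+k. of_nat (truncated B (\<lambda>k. k * (k - 1)) k) \<partial>D) = ennreal b" "0 \<le> b"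
    and \<mu>: "(\<integral>\<^sup>+k. of_nat k \<partial>D) = ennreal \<mu>" "0 \<le> \<mu>"
    and n: "2 \<le> n"
  shows "ennreal (real ((n - 2 - Suc k) ^ Suc k) * (m\<^sup>2 * b ^ k) / (real n * \<mu> + real ((k + 2) * B + 1)) ^ Suc k)
    \<le> (\<integral>\<^sup>+d. (if d 1 \<le> B then ennreal (mean_paths (half_edge_count n d) (Suc k) (half_edge_count n d 1)
        (\<Sum>i=1..n. half_edge_count n d i) {v \<in> {2..n - 1}. d v \<le> B}) else 0) \<partial>Pi_pmf {1..n} 0 (\<lambda>_. D))"
proof -
  let ?E = "\<lambda>f. \<integral>\<^sup>+d. f d \<partial>Pi_pmf {1..n} 0 (\<lambda>_. D)"
  let ?W = "{2..n - 1}" and ?c = "real n * \<mu> + real ((k + 2) * B + 1)"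
  let ?L = "\<lambda>d :: nat \<Rightarrow> nat. (\<Sum>i=1..n. d i) + 1"
  define Q where "Q = (\<lambda>ws d :: nat \<Rightarrow> nat. if d 1 \<le> B \<and> (\<forall>w\<in>set ws. d w \<le> B) then path_weight d (d 1) ws else 0)"
  have c: "0 < ?c" using \<mu>(2) by (intro add_nonneg_pos mult_nonneg_nonneg) (simp_all del: of_nat_add of_nat_mult)
  have "real (card (dlists (Suc k) ?W)) * (m\<^sup>2 * b ^ k / ?c ^ Suc k) \<ge> real ((n - 2 - Suc k) ^ Suc k) * (m\<^sup>2 * b ^ k / ?c ^ Suc k)"
  proof (rule mult_right_mono)
    have "card ?W = n - 2" using n by simp
    then show "real ((n - 2 - Suc k) ^ Suc k) \<le> real (card (dlists (Suc k) ?W))"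
      using card_dlists_ge[of ?W "Suc k"] by (intro of_nat_mono) simp
    show "0 \<le> m\<^sup>2 * b ^ k / ?c ^ Suc k" using b(2) c by (intro divide_nonneg_nonneg) auto
  qed
  then have "ennreal (real ((n - 2 - Suc k) ^ Suc k) * (m\<^sup>2 * b ^ k) / ?c ^ Suc k) \<le> ennreal (real (card (dlists (Suc k) ?W)) * (m\<^sup>2 * b ^ k / ?c ^ Suc k))"
    by (intro ennreal_leI) simp
  also have "\<dots> = (\<Sum>ws\<in>dlists (Suc k) ?W. ennreal (m\<^sup>2 * b ^ k / ?c ^ Suc k))"
    by (simp only: sum_constant ennreal_of_nat_eq_real_of_nat ennreal_mult'[OF of_nat_0_le_iff])
  also have "\<dots> \<le> (\<Sum>ws\<in>dlists (Suc k) ?W. ?E (\<lambda>d. ennreal (real (Q ws d) / real (?L d) ^ Suc k)))"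
  proof (rule sum_mono)
    fix ws assume ws: "ws \<in> dlists (Suc k) ?W"
    note e = expectation_path_weight[OF m b \<mu> n ws, folded Q_def]
    have Qws: "Q ws = (\<lambda>d. if d 1 \<le> B \<and> (\<forall>w\<in>set ws. d w \<le> B) then path_weight d (d 1) ws else 0)" by (simp add: Q_def)
    show "ennreal (m\<^sup>2 * b ^ k / ?c ^ Suc k) \<le> ?E (\<lambda>d. ennreal (real (Q ws d) / real (?L d) ^ Suc k))"
      using expectation_path_weight[OF m b \<mu> n ws] c b(2) unfolding Qws
      by (intro expectation_div_power_ge) auto
  qed
  also have "\<dots> = ?E (\<lambda>d. \<Sum>ws\<in>dlists (Suc k) ?W. ennreal (real (Q ws d) / real (?L d) ^ Suc k))"
    by (rule nn_integral_sum[symmetric]) simp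
  also have "\<dots> \<le> ?E (\<lambda>d. if d 1 \<le> B then ennreal (mean_paths (half_edge_count n d) (Suc k) (half_edge_count n d 1)
        (\<Sum>i=1..n. half_edge_count n d i) {v \<in> ?W. d v \<le> B}) else 0)"
  proof (rule nn_integral_mono)
    fix d :: "nat \<Rightarrow> nat"
    let ?h = "half_edge_count n d" and ?WB = "{v \<in> ?W. d v \<le> B}"
    show "(\<Sum>ws\<in>dlists (Suc k) ?W. ennreal (real (Q ws d) / real (?L d) ^ Suc k))
      \<le> (if d 1 \<le> B then ennreal (mean_paths ?h (Suc k) (?h 1) (\<Sum>i=1..n. ?h i) ?WB) else 0)"
    proof (cases "d 1 \<le> B")
      case True
      have pwh: "path_weight ?h j ws = path_weight d j ws" if "set ws \<subseteq> ?W" for j ws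
        using that n by (induction ws arbitrary: j) (auto simp: half_edge_count_def)
      have "(\<Sum>ws\<in>dlists (Suc k) ?W. ennreal (real (Q ws d) / real (?L d) ^ Suc k))
        = ennreal ((\<Sum>ws\<in>dlists (Suc k) ?W. real (Q ws d)) / real (?L d) ^ Suc k)"
        by (subst sum_ennreal) (simp_all only: sum_divide_distrib divide_nonneg_nonneg of_nat_0_le_iff zero_le_power)
      also have "(\<Sum>ws\<in>dlists (Suc k) ?W. real (Q ws d)) = (\<Sum>ws\<in>dlists (Suc k) ?WB. real (path_weight ?h (?h 1) ws))"
      proof (rule sum.mono_neutral_cong_right)
        show "\<forall>ws\<in>dlists (Suc k) ?W - dlists (Suc k) ?WB. real (Q ws d) = 0"
          by (auto simp: dlists_def Q_def)
        show "real (Q ws d) = real (path_weight ?h (?h 1) ws)" if ws: "ws \<in> dlists (Suc k) ?WB" for ws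
        proof -
          have "set ws \<subseteq> ?W" "\<forall>w\<in>set ws. d w \<le> B" using ws by (auto simp: dlists_def)
          moreover have "?h 1 = d 1" using n by (simp add: half_edge_count_def)
          ultimately show ?thesis using True pwh by (simp add: Q_def)
        qed
      qed (simp_all add: finite_dlists, auto simp: dlists_def)
      also have "ennreal ((\<Sum>ws\<in>dlists (Suc k) ?WB. real (path_weight ?h (?h 1) ws)) / real (?L d) ^ Suc k)
        \<le> ennreal (mean_paths ?h (Suc k) (?h 1) (\<Sum>i=1..n. ?h i) ?WB)"
      proof (intro ennreal_leI mean_paths_ge)
        have "?h 1 + sum ?h ?WB = sum ?h (insert 1 ?WB)" by simp
        also have "\<dots> \<le> (\<Sum>i=1..n. ?h i)" using n by (intro sum_mono2) auto
        finally show "?h 1 + sum ?h ?WB \<le> (\<Sum>i=1..n. ?h i)" .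
        show "(\<Sum>i=1..n. ?h i) \<le> ?L d" using n by (subst sum_half_edge_count) auto
      qed auto
      finally show ?thesis using True by simp
    next
      case False
      then show ?thesis by (simp add: Q_def)
    qed
  qed
  finally show ?thesis .
qed

section \<open>The supercritical phase\<close>

text \<open>A half-edge has only one partner, so hops from \<open>u\<close> inject into the
  half-edges at \<open>u\<close>.\<close>

lemma card_hops_config_le:
  assumes P: "P \<in> perfect_matchings H" and H: "finite H" and u: "u \<notin> W" "0 \<notin> W" "u \<noteq> 0"
  shows "finite (hops (config_graph n P) u W)" "card (hops (config_graph n P) u W) \<le> card {h \<in> H. fst h = u}"
proof -
  let ?S = "{(h, h'). h \<in> H \<and> h' \<in> H \<and> fst h = u \<and> fst h' \<in> W \<and> {h, h'} \<in> P}"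
  note bij = hops_config_graph[OF P u, of n]
  have "?S \<subseteq> H \<times> H" by auto
  then have fS: "finite ?S" by (rule finite_subset) (simp add: H)
  then show "finite (hops (config_graph n P) u W)" using bij_betw_finite[OF bij] by simp
  have inj: "inj_on fst ?S"
  proof (rule inj_onI)
    fix x y assume xy: "x \<in> ?S" "y \<in> ?S" "fst x = fst y"
    obtain h g g' where s: "x = (h, g)" "y = (h, g')" using xy(3) by (cases x, cases y) auto
    then have "g \<in> H - {h} \<and> {h, g} \<in> P" "g' \<in> H - {h} \<and> {h, g'} \<in> P" "h \<in> H" using xy u by auto
    then have "g = g'" using perfect_matching_partner[OF P] by blast
    then show "x = y" using s by simp
  qed
  have "card (hops (config_graph n P) u W) = card ?S" using bij_betw_same_card[OF bij] by simp
  also have "\<dots> \<le> card {h \<in> H. fst h = u}" using H by (intro card_inj_on_le[OF inj]) auto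
  finally show "card (hops (config_graph n P) u W) \<le> card {h \<in> H. fst h = u}" .
qed

lemma npaths_config_le:
  assumes P: "P \<in> perfect_matchings H" and H: "finite H" and u: "u \<notin> W" "0 \<notin> W" "u \<noteq> 0"
    and B: "\<And>v. v \<in> insert u W \<Longrightarrow> card {h \<in> H. fst h = v} \<le> B"
  shows "npaths (config_graph n P) k u W \<le> B ^ k"
  using u B
proof (induction k arbitrary: u W)
  case 0 then show ?case by simp
next
  case (Suc k)
  note hops = card_hops_config_le[OF P H Suc.prems(1-3), of n]
  have "npaths (config_graph n P) (Suc k) u W \<le> (\<Sum>(e, w)\<in>hops (config_graph n P) u W. B ^ k)"
    unfolding npaths.simps
  proof (rule sum_mono)
    fix x assume x: "x \<in> hops (config_graph n P) u W"
    obtain e w where x': "x = (e, w)" by (cases x)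
    have w: "w \<in> W" using x x' by (simp add: hops_def)
    have "npaths (config_graph n P) k w (W - {w}) \<le> B ^ k"
      using w Suc.prems by (intro Suc.IH) (auto intro: ccontr)
    then show "(case x of (e, w) \<Rightarrow> npaths (config_graph n P) k w (W - {w})) \<le> (case x of (e, w) \<Rightarrow> B ^ k)" by (simp add: x')
  qed
  also have "\<dots> = card (hops (config_graph n P) u W) * B ^ k" by simp
  also have "\<dots> \<le> B * B ^ k" using hops(2) Suc.prems(4)[of u] by (intro mult_right_mono) auto
  finally show ?case by simp
qed

text \<open>If the exploration meets no cycle, the bound for trees applies to all paths into
  \<open>W\<close>. Otherwise the left-hand side is at most the added error term, since bounded
  degrees allow at most \<open>B ^ k\<close> paths.\<close>

lemma config_graph_expected_ge:
  assumes P: "P \<in> perfect_matchings (half_edges n d)" and lam: "0 < lam" and n: "2 \<le> n"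
    and d1: "d 1 \<le> B" and W: "W \<subseteq> {v \<in> {2..n - 1}. d v \<le> B}"
    and J: "2 * B ^ k + k + 3 < J" "2 * k < J"
  shows "ennreal (real (npaths (config_graph n P) k 1 W) * escape_prob (lam / (1 + lam)) k 1)
    \<le> (\<integral>\<^sup>+\<omega>. of_nat (card (ever_red (config_graph n P) \<omega> init_coloring)) \<partial>clock_space (config_graph n P) lam)
      + ennreal (if cyclic J P {1} then real (B ^ k) * escape_prob (lam / (1 + lam)) k 1 else 0)"
proof -
  let ?G = "config_graph n P" and ?e = "escape_prob (lam / (1 + lam)) k 1"
  have e0: "0 \<le> ?e" using lam by (intro escape_prob_nonneg) auto
  have W': "finite W" "0 \<notin> W" "1 \<notin> W" using W by (auto intro: finite_subset[OF W])
  have deg: "card {h \<in> half_edges n d. fst h = v} \<le> B" if "v \<in> insert 1 W" for v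
  proof -
    have v: "v \<in> {1..n}" "v \<noteq> n" "d v \<le> B" using that W d1 n by auto
    then show ?thesis by (subst card_half_edges_at) (auto simp: half_edge_count_def)
  qed
  have np: "npaths ?G k 1 W \<le> B ^ k"
    using W' deg by (intro npaths_config_le[OF P finite_half_edges]) auto
  show ?thesis
  proof (cases "cyclic J P {1}")
    case True
    have "real (npaths ?G k 1 W) * ?e \<le> real (B ^ k) * ?e" using np e0 by (intro mult_right_mono of_nat_mono)
    then show ?thesis using True by (simp add: ennreal_leI add_increasing)
  next
    case False
    then have lt: "locally_tree ?G 0 1 J" using not_locally_tree_cyclic[OF P] by blast
    interpret fm: finite_multigraph ?G lam using n by (intro finite_multigraph_config_graph[OF P lam]) simp
    have fc: "finite (paths ?G k 1 W)" "card (paths ?G k 1 W) = npaths ?G k 1 W"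
      using finite_card_paths[OF fm.finite_edges W'(1)] by auto
    interpret chase_tree ?G lam 0 1 Chaser_Edge J k "paths ?G k 1 W"
    proof
      show "e = Chaser_Edge" if e: "e \<in> edges ?G" "0 \<in> ends ?G e" for e
      proof (rule ccontr)
        assume "e \<noteq> Chaser_Edge"
        then obtain q where "e = Matched q" "q \<in> P" using e by (auto simp: config_graph_def)
        then show False using matched_half_edges(2)[OF P, of q] e by (auto simp: config_graph_def)
      qed
      show "locally_tree ?G 0 1 J" by (rule lt)
      show "finite (paths ?G k 1 W)" by (rule fc)
      show "valid_path ?G 1 q \<and> distinct (1 # map snd q) \<and> 0 \<notin> snd ` set q \<and> length q = k" if "q \<in> paths ?G k 1 W" for q
      proof -
        note q = paths_valid[OF that]
        then have "1 \<notin> snd ` set q" "0 \<notin> snd ` set q" using W' by blast+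
        then show ?thesis using q by simp
      qed
      show "2 * card (paths ?G k 1 W) + k + 3 < J" "2 * k < J" using J np fc(2) by auto
    qed (use n in \<open>auto simp: config_graph_def\<close>)
    have "ennreal (real (card (paths ?G k 1 W)) * escape_prob fm.p k 1) \<le> (\<integral>\<^sup>+\<omega>. of_nat (card (ever_red ?G \<omega> init_coloring)) \<partial>clock_space ?G lam)"
      by (rule expected_ever_red_ge_paths) (auto simp: init_coloring_def)
    then show ?thesis using False unfolding fc(2) fm.p_def by simp
  qed
qed

lemma expected_ever_red_ge_mean_paths:
  assumes lam: "0 < lam" and n: "2 \<le> n" and J: "2 * B ^ k + k + 3 < J" "2 * k < J"
  shows "(\<integral>\<^sup>+d. (if d 1 \<le> B then ennreal (mean_paths (half_edge_count n d) k (half_edge_count n d 1)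
        (\<Sum>i=1..n. half_edge_count n d i) {v \<in> {2..n - 1}. d v \<le> B}) else 0) \<partial>Pi_pmf {1..n} 0 (\<lambda>_. D)) * ennreal (escape_prob (lam / (1 + lam)) k 1)
    \<le> expected_ever_red D lam n + ennreal (real (B ^ k)) * (\<integral>\<^sup>+d. ennreal (cyclic_prob J (half_edges n d) {1}) \<partial>Pi_pmf {1..n} 0 (\<lambda>_. D))"
proof -
  let ?e = "escape_prob (lam / (1 + lam)) k 1"
  have e: "0 \<le> ?e" "?e \<le> 1" using lam by (auto intro!: escape_prob_nonneg escape_prob_le_1)
  have n1: "1 \<le> n" using n by simp
  let ?E = "\<lambda>f. \<integral>\<^sup>+d. f d \<partial>Pi_pmf {1..n} 0 (\<lambda>_. D)"
  let ?m = "\<lambda>d. mean_paths (half_edge_count n d) k (half_edge_count n d 1) (\<Sum>i=1..n. half_edge_count n d i) {v \<in> {2..n - 1}. d v \<le> B}"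
  let ?I = "\<lambda>P. \<integral>\<^sup>+\<omega>. of_nat (card (ever_red (config_graph n P) \<omega> init_coloring)) \<partial>clock_space (config_graph n P) lam"
  let ?A = "\<lambda>d. (\<Sum>P\<in>perfect_matchings (half_edges n d). ?I P) / of_nat (card (perfect_matchings (half_edges n d)))"
  have pw: "(if d 1 \<le> B then ennreal (?m d) else 0) * ennreal ?e \<le> ?A d + ennreal (real (B ^ k)) * ennreal (cyclic_prob J (half_edges n d) {1})" for d
  proof (cases "d 1 \<le> B")
    case True
    let ?PM = "perfect_matchings (half_edges n d)" and ?W = "{v \<in> {2..n - 1}. d v \<le> B}"
    note pm = perfect_matchings_half_edges[OF n1, of d]
    let ?N = "\<lambda>P. real (npaths (config_graph n P) k 1 ?W)" and ?b = "\<lambda>P. if cyclic J P {1} then real (B ^ k) * ?e else 0"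
    have "ennreal (?m d) * ennreal ?e = ennreal ((\<Sum>P\<in>?PM. ?N P * ?e) / real (card ?PM))"
    proof -
      have "?m d = (\<Sum>P\<in>?PM. ?N P) / real (card ?PM)" by (rule average_npaths[OF n1, symmetric]) auto
      then have "(\<Sum>P\<in>?PM. ?N P * ?e) / real (card ?PM) = ?m d * ?e" by (simp add: sum_distrib_right)
      then show ?thesis using e by (simp only: ennreal_mult[OF mean_paths_nonneg e(1)])
    qed
    also have "\<dots> = (\<Sum>P\<in>?PM. ennreal (?N P * ?e)) / of_nat (card ?PM)"
      by (rule average_ennreal[OF pm(1,2), symmetric]) (use e in simp)
    also have "\<dots> \<le> (\<Sum>P\<in>?PM. ?I P + ennreal (?b P)) / of_nat (card ?PM)"
      by (intro divide_right_mono_ennreal sum_mono config_graph_expected_ge[where d = d, OF _ lam n True order_refl J])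
    also have "\<dots> = ?A d + (\<Sum>P\<in>?PM. ennreal (?b P)) / of_nat (card ?PM)"
      by (simp only: sum.distrib add_divide_distrib_ennreal)
    also have "(\<Sum>P\<in>?PM. ennreal (?b P)) / of_nat (card ?PM) = ennreal ((\<Sum>P\<in>?PM. ?b P) / real (card ?PM))"
      by (rule average_ennreal[OF pm(1,2)]) (use e in simp)
    also have "(\<Sum>P\<in>?PM. ?b P) / real (card ?PM) = real (B ^ k) * ?e * cyclic_prob J (half_edges n d) {1}"
      using pm(1) by (simp add: cyclic_prob_def sum.inter_filter[symmetric])
    also have "\<dots> \<le> real (B ^ k) * cyclic_prob J (half_edges n d) {1}"
      using e by (intro mult_right_mono mult_left_le) (auto simp: cyclic_prob_def)
    also have "ennreal (real (B ^ k) * cyclic_prob J (half_edges n d) {1}) = ennreal (real (B ^ k)) * ennreal (cyclic_prob J (half_edges n d) {1})"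
      by (rule ennreal_mult') simp
    finally show ?thesis using True by (simp add: ennreal_leI add_left_mono)
  qed simp
  have "?E (\<lambda>d. if d 1 \<le> B then ennreal (?m d) else 0) * ennreal ?e = ?E (\<lambda>d. (if d 1 \<le> B then ennreal (?m d) else 0) * ennreal ?e)"
    by (rule nn_integral_multc[symmetric]) simp
  also have "\<dots> \<le> ?E (\<lambda>d. ?A d + ennreal (real (B ^ k)) * ennreal (cyclic_prob J (half_edges n d) {1}))"
    by (intro nn_integral_mono pw)
  also have "\<dots> = ?E ?A + ennreal (real (B ^ k)) * ?E (\<lambda>d. ennreal (cyclic_prob J (half_edges n d) {1}))"
    by (subst nn_integral_add, simp, simp, subst nn_integral_cmult) simp_all
  also have "?E ?A = expected_ever_red D lam n"
    unfolding expected_ever_red_def nn_integral_config_model[OF n1] ..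
  finally show ?thesis .
qed

section \<open>Choice of the parameters and the limit\<close>

text \<open>Monotone convergence; the integral of \<open>f\<close> may be infinite, which reduces
  both second-moment regimes to bounded degrees.\<close>

lemma truncated_limit:
  fixes D :: "nat pmf"
  assumes "x < (\<integral>\<^sup>+k. of_nat (f k) \<partial>D)"
  shows "\<exists>B. x < (\<integral>\<^sup>+k. of_nat (truncated B f k) \<partial>D)"
proof -
  have "(\<integral>\<^sup>+k. of_nat (f k) \<partial>D) = (\<integral>\<^sup>+k. (SUP B. of_nat (truncated B f k)) \<partial>D)"
  proof (rule nn_integral_cong)
    fix k
    show "(of_nat (f k) :: ennreal) = (SUP B. of_nat (truncated B f k))"
    proof (rule antisym)
      show "(of_nat (f k) :: ennreal) \<le> (SUP B. of_nat (truncated B f k))"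
        by (rule SUP_upper2[of k]) (auto simp: truncated_def)
      show "(SUP B. of_nat (truncated B f k)) \<le> (of_nat (f k) :: ennreal)"
        by (rule SUP_least) (auto simp: truncated_def)
    qed
  qed
  also have "\<dots> = (SUP B. \<integral>\<^sup>+k. of_nat (truncated B f k) \<partial>D)"
    by (rule nn_integral_monotone_convergence_SUP) (auto simp: incseq_def le_fun_def truncated_def)
  finally show ?thesis using assms by (simp add: less_SUP_iff)
qed

text \<open>For fixed \<open>k\<close> and large \<open>n\<close>, the expected number of followed
  paths is at least a constant times (b / \<mu>')^k, and the escape probability is at least a
  constant divided by \<alpha>^k; the product grows like \<open>r ^ k\<close>. Given
  \<open>x\<close>, the length \<open>k\<close> is fixed before the tolerance for cycles, and
  \<open>n\<close> comes last.\<close>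

theorem supercritical:
  fixes D :: "nat pmf"
  assumes \<mu>: "(\<integral>\<^sup>+k. of_nat k \<partial>D) = ennreal \<mu>" "0 < \<mu>" and lam: "0 < lam"
    and \<alpha>: "0 < \<alpha>" "ennreal (\<alpha> * \<mu>) < (\<integral>\<^sup>+k. of_nat (k * (k - 1)) \<partial>D)"
    and p: "0 < p" "p < 1" "p \<le> lam / (1 + lam)" "1 < 4 * \<alpha> * p * (1 - p)"
  shows "(\<lambda>n. expected_ever_red D lam n) \<longlonglongrightarrow> \<infinity>"
proof -
  obtain B where B: "ennreal (\<alpha> * \<mu>) < (\<integral>\<^sup>+k. of_nat (truncated B (\<lambda>k. k * (k - 1)) k) \<partial>D)"
    using truncated_limit[OF \<alpha>(2)] by blast
  let ?T1 = "\<integral>\<^sup>+k. of_nat (truncated B (\<lambda>k. k) k) \<partial>D" and ?T2 = "\<integral>\<^sup>+k. of_nat (truncated B (\<lambda>k. k * (k - 1)) k) \<partial>D"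
  have T1: "?T1 \<le> ennreal \<mu>" unfolding \<mu>(1)[symmetric] by (intro nn_integral_mono) (auto simp: truncated_def)
  have "truncated B (\<lambda>k. k * (k - 1)) k \<le> B * truncated B (\<lambda>k. k) k" for k
    by (simp add: truncated_def mult.commute mult_le_mono)
  then have "?T2 \<le> (\<integral>\<^sup>+k. of_nat B * of_nat (truncated B (\<lambda>k. k) k) \<partial>D)"
    by (intro nn_integral_mono) (simp only: of_nat_mult[symmetric] of_nat_le_iff)
  then have T2: "?T2 \<le> of_nat B * ?T1" by (simp add: nn_integral_cmult)
  obtain m where m: "?T1 = ennreal m" "0 \<le> m" using T1 by (cases ?T1) (auto simp: top_unique)
  have "of_nat B * ?T1 < \<top>" unfolding m(1) by (simp add: ennreal_mult_less_top of_nat_less_top)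
  then obtain b where b: "?T2 = ennreal b" "0 \<le> b" using T2 by (cases ?T2) (auto simp: top_unique)
  have ab: "\<alpha> * \<mu> < b" using B b \<alpha>(1) \<mu>(2) by (simp add: ennreal_less_iff)
  have m0: "0 < m"
  proof (rule ccontr)
    assume "\<not> 0 < m"
    then have "?T2 = 0" using T2 m by simp
    then show False using B by simp
  qed
  \<comment> \<open>Lies strictly between \<mu> and b / \<alpha>: above \<mu> to absorb lower-order
    terms in \<open>n\<close>, below b / \<alpha> so that \<open>r > 1\<close>.\<close>
  define \<mu>' where "\<mu>' = (\<mu> + b / \<alpha>) / 2"
  have "\<mu> < b / \<alpha>" using ab \<alpha>(1) by (simp add: field_simps)
  then have lt: "\<mu> < \<mu>' \<and> \<mu>' < b / \<alpha> \<and> 0 < \<mu>'" using \<mu>(2) unfolding \<mu>'_def by argo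
  note \<mu>' = conjunct1[OF lt] conjunct1[OF conjunct2[OF lt]] conjunct2[OF conjunct2[OF lt]]
  obtain c where c: "0 < c" "\<And>k. c \<le> \<alpha> ^ k * escape_prob p k 1"
    using escape_prob_lower[OF p(1,2) \<alpha>(1) p(4)] by blast
  define r where "r = b / (\<alpha> * \<mu>')"
  have r: "1 < r" using \<mu>' \<alpha>(1) by (simp add: r_def field_simps)
  show ?thesis unfolding infinity_ennreal_def tendsto_top_iff_ennreal
  proof (intro allI impI)
    fix x :: real assume x: "0 \<le> x"
    \<comment> \<open>Of the surplus 2, one unit pays for short cycles and the other makes the final
      inequality strict.\<close>
    obtain k where k: "(x + 2) / (c * m\<^sup>2 / (\<alpha> * \<mu>')) < r ^ k" using real_arch_pow[OF r] by blast
    have k': "x + 2 \<le> c / \<alpha> ^ Suc k * (m\<^sup>2 * b ^ k / \<mu>' ^ Suc k)"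
    proof -
      have "x + 2 < r ^ k * (c * m\<^sup>2 / (\<alpha> * \<mu>'))" using k c(1) m0 \<alpha>(1) \<mu>' by (subst (asm) pos_divide_less_eq) auto
      also have "\<dots> = c / \<alpha> ^ Suc k * (m\<^sup>2 * b ^ k / \<mu>' ^ Suc k)" by (simp add: r_def power_divide power_mult_distrib mult_ac)
      finally show ?thesis by simp
    qed
    let ?e = "escape_prob (lam / (1 + lam)) (Suc k) 1"
    have "c / \<alpha> ^ Suc k \<le> escape_prob p (Suc k) 1"
      using c(2)[of "Suc k"] \<alpha>(1) by (subst pos_divide_le_eq) (auto simp: mult.commute simp del: escape_prob.simps power_Suc)
    also have "\<dots> \<le> ?e" using p lam by (intro escape_prob_mono_p) auto
    finally have e: "c / \<alpha> ^ Suc k \<le> ?e" .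
    have e0: "0 \<le> ?e" using lam by (intro escape_prob_nonneg) auto
    define J where "J = 2 * B ^ Suc k + 2 * Suc k + 4"
    define C where "C = real ((k + 2) * B + 1)"
    have D: "0 < (\<integral>\<^sup>+k. of_nat k \<partial>D)" "(\<integral>\<^sup>+k. of_nat k \<partial>D) < \<infinity>" using \<mu> by auto
    define \<delta> where "\<delta> = 1 / (real (B ^ Suc k) + 1)"
    have \<delta>: "0 < \<delta>" "real (B ^ Suc k) * \<delta> \<le> 1" by (auto simp: \<delta>_def add_nonneg_pos divide_le_eq_1 simp del: of_nat_power)
    obtain n0 where n0: "\<And>n. n0 \<le> n \<Longrightarrow> (\<integral>\<^sup>+d. ennreal (cyclic_prob J (half_edges n d) {1}) \<partial>Pi_pmf {1..n} 0 (\<lambda>_. D)) \<le> ennreal \<delta>"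
      using cyclic_prob_config_small[OF D \<delta>(1), of J] by blast
    \<comment> \<open>From \<open>n1\<close> on, \<open>real (n - 2 - Suc k) * \<mu>'\<close> is at
      least \<open>real n * \<mu> + C\<close>.\<close>
    define n1 where "n1 = max (max n0 (3 + k)) (nat \<lceil>(C + real (3 + k) * \<mu>') / (\<mu>' - \<mu>)\<rceil>)"
    have "ennreal x < expected_ever_red D lam n" if n: "n1 \<le> n" for n
    proof -
      have n': "n0 \<le> n" "2 \<le> n" "3 + k \<le> n" using n by (auto simp: n1_def)
      have "(C + real (3 + k) * \<mu>') / (\<mu>' - \<mu>) \<le> real n" using n unfolding n1_def by linarith
      then have "C + real (3 + k) * \<mu>' \<le> real n * (\<mu>' - \<mu>)" using \<mu>'(1) by (simp add: divide_le_eq del: of_nat_add)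
      moreover have nr: "real (n - 2 - Suc k) = real n - real (3 + k)" using n'(3) by (simp add: of_nat_diff)
      ultimately have "real n * \<mu> + C \<le> real (n - 2 - Suc k) * \<mu>'" by (simp add: algebra_simps)
      then have "(real n * \<mu> + C) ^ Suc k \<le> (real (n - 2 - Suc k) * \<mu>') ^ Suc k"
        using \<mu>(2) by (intro power_mono) (auto simp: C_def simp del: of_nat_add of_nat_mult of_nat_Suc)
      moreover have C0: "0 < real n * \<mu> + C" using \<mu>(2) by (auto simp: C_def intro!: add_nonneg_pos simp del: of_nat_add of_nat_mult of_nat_Suc)
      moreover have "1 / z \<le> u / y" if "y \<le> u * z" "0 < y" "0 < z" for u y z :: real using that by (simp add: field_simps)
      ultimately have "1 / \<mu>' ^ Suc k \<le> real ((n - 2 - Suc k) ^ Suc k) / (real n * \<mu> + C) ^ Suc k"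
        using \<mu>'(3) by (simp only: power_mult_distrib of_nat_power zero_less_power)
      then have "m\<^sup>2 * b ^ k / \<mu>' ^ Suc k \<le> real ((n - 2 - Suc k) ^ Suc k) * (m\<^sup>2 * b ^ k) / (real n * \<mu> + C) ^ Suc k"
        using mult_right_mono[of "1 / \<mu>' ^ Suc k" "real ((n - 2 - Suc k) ^ Suc k) / (real n * \<mu> + C) ^ Suc k" "m\<^sup>2 * b ^ k"] b(2)
        by (simp only: times_divide_eq_left mult_1 mult_nonneg_nonneg zero_le_power zero_le_power2)
      then have "c / \<alpha> ^ Suc k * (m\<^sup>2 * b ^ k / \<mu>' ^ Suc k) \<le> ?e * (real ((n - 2 - Suc k) ^ Suc k) * (m\<^sup>2 * b ^ k) / (real n * \<mu> + C) ^ Suc k)"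
        (is "_ \<le> ?e * ?R")
        using e e0 c(1) \<alpha>(1) b(2) \<mu>'(3) by (intro mult_mono) (auto simp del: escape_prob.simps)
      with k' have "ennreal (x + 2) \<le> ennreal (?e * ?R)" by (intro ennreal_leI) linarith
      also have "\<dots> = ennreal ?R * ennreal ?e"
        by (subst mult.commute) (rule ennreal_mult''[OF e0])
      also have "\<dots> \<le> (\<integral>\<^sup>+d. (if d 1 \<le> B then ennreal (mean_paths (half_edge_count n d) (Suc k) (half_edge_count n d 1)
          (\<Sum>i=1..n. half_edge_count n d i) {v \<in> {2..n - 1}. d v \<le> B}) else 0) \<partial>Pi_pmf {1..n} 0 (\<lambda>_. D)) * ennreal ?e"
        unfolding C_def using \<mu> by (intro mult_right_mono expected_mean_paths_ge m b n'(2)) auto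
      also have "\<dots> \<le> expected_ever_red D lam n + ennreal (real (B ^ Suc k)) * (\<integral>\<^sup>+d. ennreal (cyclic_prob J (half_edges n d) {1}) \<partial>Pi_pmf {1..n} 0 (\<lambda>_. D))"
        by (rule expected_ever_red_ge_mean_paths[OF lam n'(2)]) (auto simp: J_def)
      also have "\<dots> \<le> expected_ever_red D lam n + ennreal (real (B ^ Suc k)) * ennreal \<delta>"
        by (intro add_left_mono mult_left_mono n0 n'(1)) simp
      also have "ennreal (real (B ^ Suc k)) * ennreal \<delta> = ennreal (real (B ^ Suc k) * \<delta>)" by (rule ennreal_mult'[symmetric]) simp
      also have "\<dots> \<le> ennreal 1" by (rule ennreal_leI) (rule \<delta>)
      finally have le: "ennreal (x + 2) \<le> expected_ever_red D lam n + ennreal 1" by (simp add: add_left_mono)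
      show ?thesis
      proof (cases "expected_ever_red D lam n")
        case (real y)
        then have "ennreal (x + 2) \<le> ennreal (y + 1)" using le by (simp add: ennreal_plus)
        then have "x + 2 \<le> y + 1" using real by (subst (asm) ennreal_le_iff) auto
        then show ?thesis using real x by (simp add: ennreal_less_iff)
      qed simp
    qed
    then show "\<forall>\<^sub>F n in sequentially. ennreal x < expected_ever_red D lam n" by (auto simp: eventually_sequentially)
  qed
qed

theorem supercritical_finite_variance:
  assumes int: "integrable (measure_pmf D) (\<lambda>k. real k * (real k - 2))"
    and pos: "0 < measure_pmf.expectation D (\<lambda>k. real k * (real k - 2))"
    and lam: "0 < lam" "critical_rate D < lam"
  shows "(\<lambda>n. expected_ever_red D lam n) \<longlonglongrightarrow> \<infinity>"
proof -
  note dm = degree_moments[OF int pos]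
  let ?a = "mean_excess_degree D"
  obtain p where p: "0 < p" "p < 1" "p \<le> lam / (1 + lam)" "1 < 4 * ?a * p * (1 - p)"
    using supercritical_p[OF dm(2) lam(2)] by blast
  define q where "q = 4 * p * (1 - p)"
  have q: "0 < q" using p by (simp add: q_def)
  have "1 / q < ?a" using p(4) q by (simp add: q_def field_simps)
  \<comment> \<open>Below the excess degree, yet large enough that
    \<open>4 * \<alpha> * p * (1 - p)\<close> still exceeds 1.\<close>
  then obtain \<alpha> where \<alpha>: "1 / q < \<alpha>" "\<alpha> < ?a" using dense by blast
  have \<alpha>0: "0 < \<alpha>" using \<alpha>(1) q by (meson divide_pos_pos less_trans zero_less_one)
  have "ennreal (\<alpha> * measure_pmf.expectation D real) < (\<integral>\<^sup>+k. of_nat (k * (k - 1)) \<partial>D)"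
    unfolding dm(6) using dm(1) \<alpha>(2) \<alpha>0 by (intro ennreal_lessI mult_strict_right_mono mult_pos_pos) auto
  moreover have "1 < 4 * \<alpha> * p * (1 - p)" using \<alpha>(1) q by (simp add: q_def field_simps)
  ultimately show ?thesis by (rule supercritical[OF dm(5,1) lam(1) \<alpha>0 _ p(1-3)])
qed

theorem supercritical_infinite_variance:
  fixes D :: "nat pmf"
  assumes m2: "(\<integral>\<^sup>+k. ennreal ((real k)\<^sup>2) \<partial>D) = \<infinity>" and m1: "(\<integral>\<^sup>+k. ennreal (real k) \<partial>D) < \<infinity>" and lam: "0 < lam"
  shows "(\<lambda>n. expected_ever_red D lam n) \<longlonglongrightarrow> \<infinity>"
proof -
  let ?m = "\<integral>\<^sup>+k. ennreal (real k) \<partial>D" and ?b = "\<integral>\<^sup>+k. of_nat (k * (k - 1)) \<partial>D"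
  obtain \<mu> where \<mu>: "?m = ennreal \<mu>" "0 \<le> \<mu>" using m1 by (cases ?m) auto
  have "ennreal ((real k)\<^sup>2) = of_nat (k * (k - 1)) + ennreal (real k)" for k
  proof -
    have "(real k)\<^sup>2 = real (k * (k - 1)) + real k" by (cases k) (simp_all add: power2_eq_square algebra_simps)
    then show ?thesis by (simp add: ennreal_of_nat_eq_real_of_nat del: of_nat_mult)
  qed
  then have "?b + ?m = \<infinity>" using m2 by (simp add: nn_integral_add)
  then have b: "?b = \<infinity>" using m1 by (auto simp: ennreal_add_eq_top)
  have "\<mu> \<noteq> 0"
  proof
    assume "\<mu> = 0"
    then have "?m = 0" using \<mu>(1) by simp
    then have "AE k in D. ennreal (real k) = 0" by (subst (asm) nn_integral_0_iff_AE) auto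
    then have "AE k in D. ennreal ((real k)\<^sup>2) = 0" by eventually_elim simp
    then have "(\<integral>\<^sup>+k. ennreal ((real k)\<^sup>2) \<partial>D) = 0" by (subst nn_integral_0_iff_AE) auto
    then show False using m2 by simp
  qed
  then have \<mu>0: "0 < \<mu>" using \<mu>(2) by simp
  define p where "p = min (lam / (1 + lam)) (1 / 2)"
  have p: "0 < p" "p < 1" "p \<le> lam / (1 + lam)" using lam by (auto simp: p_def)
  \<comment> \<open>Makes \<open>4 * \<alpha> * p * (1 - p)\<close> equal to 2; any \<alpha> is
    admissible, as E[D(D-1)] is infinite.\<close>
  define \<alpha> where "\<alpha> = 1 / (2 * p * (1 - p))"
  have \<alpha>: "0 < \<alpha>" "1 < 4 * \<alpha> * p * (1 - p)" using p by (auto simp: \<alpha>_def)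
  show ?thesis
    by (rule supercritical[OF _ \<mu>0 lam \<alpha>(1) _ p \<alpha>(2)]) (use \<mu> b in \<open>simp_all add: ennreal_of_nat_eq_real_of_nat\<close>)
qed

theorem theorem1p3:
  shows "(\<exists>C :: real \<Rightarrow> real. \<forall>(D :: nat pmf) (lam :: real).
            integrable (measure_pmf D) (\<lambda>k. real k * (real k - 2)) \<and>
            0 < measure_pmf.expectation D (\<lambda>k. real k * (real k - 2)) \<and>
            0 < lam \<and> lam \<le> critical_rate D \<longrightarrow>
            (SUP n\<in>{1..}. expected_ever_red D lam n) < ennreal (C (critical_rate D))) \<and>
         (\<forall>(D :: nat pmf) (lam :: real).
            integrable (measure_pmf D) (\<lambda>k. real k * (real k - 2)) \<and>
            0 < measure_pmf.expectation D (\<lambda>k. real k * (real k - 2)) \<and>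
            0 < lam \<and> critical_rate D < lam \<longrightarrow>
            (\<lambda>n. expected_ever_red D lam n) \<longlonglongrightarrow> \<infinity>) \<and>
         (\<forall>(D :: nat pmf) (lam :: real).
            (\<integral>\<^sup>+k. ennreal ((real k)\<^sup>2) \<partial>measure_pmf D) = \<infinity> \<and>
            (\<integral>\<^sup>+k. ennreal (real k) \<partial>measure_pmf D) < \<infinity> \<and>
            0 < lam \<longrightarrow>
            (\<lambda>n. expected_ever_red D lam n) \<longlonglongrightarrow> \<infinity>)"
proof (intro conjI exI[of _ subcritical_bound] allI impI; elim conjE)
qed (rule subcritical supercritical_finite_variance supercritical_infinite_variance; assumption)+

end
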